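(* Let $\{X_t\}_{t\ge 0}$ be the OU-superprocess starting from $\nu\in\mathcal{M}_F(\mathbb{R}^d)$. Assume $\alpha>2\mu$ and let $f\in\mathcal{C}(\mathbb{R}^d)$. Then, conditionally on the set of non-extinction $Ext^c$, there is the convergence in distribution, as $t\to+\infty$, $$\left(e^{-\alpha t}|X_t|,\ \frac{|X_t|-e^{\alpha t}V_\infty}{\sqrt{|X_t|}},\ \frac{\langle X_t,f\rangle-|X_t|\langle f,\varphi\rangle}{\exp((\alpha-\mu)t)}\right)\to^d\big(\tilde V_\infty,\,G,\,\langle\mathrm{grad} f,\varphi\rangle\circ\tilde H_\infty\big),$$ where $G\sim\mathcal{N}(0,\tfrac{2\beta}{\alpha})$, the variables $\tilde H_\infty,\tilde V_\infty$ are respectively $H_\infty,V_\infty$ conditioned on $Ext^c$, and $(\tilde V_\infty,\tilde H_\infty)$ and $G$ are independent. Moreover, $$\left(e^{-\alpha t}|X_t|,\ \frac{\langle X_t,f\rangle-|X_t|\langle f,\varphi\rangle}{\exp((\alpha-\mu)t)}\right)\to\big(V_\infty,\ \langle\mathrm{grad} f,\varphi\rangle\circ H_\infty\big)\quad\text{in probability, as }t\to+\infty.$$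
   Context: Fix $d\ge1$, $\sigma>0$, $\mu>0$, $\alpha>0$, $\beta>0$. $\{\mathcal{P}_t\}_{t\ge0}$ is the semigroup of the Ornstein-Uhlenbeck process on $\mathbb{R}^d$ with generator $L=\frac12\sigma^2\Delta-\mu x\circ\nabla$ ($\circ$ is the standard scalar product), and $\varphi(x)=(\mu/(\pi\sigma^2))^{d/2}\exp(-\frac{\mu}{\sigma^2}\|x\|^2)$ denotes both its invariant density and the corresponding probability measure. $\mathcal{M}_F(\mathbb{R}^d)$ is the set of finite compactly supported measures on $\mathbb{R}^d$. For a measure $\nu$ and a function $f$, $\langle f,\nu\rangle=\langle\nu,f\rangle:=\int f\,d\nu$ and $|\nu|:=\langle 1,\nu\rangle$; for functions $f$, $\langle f,\varphi\rangle=\langle\varphi,f\rangle=\int f\varphi\,dx$. $\mathcal{C}(\mathbb{R}^d)$ is the space of continuous $f:\mathbb{R}^d\to\mathbb{R}$ for which there is $n$ with $|f(x)|/\|x\|^n\to0$ as $\|x\|\to+\infty$. The vector $\langle\mathrm{grad} f,\varphi\rangle\in\mathbb{R}^d$ is understood in the weak sense, $\langle\mathrm{grad} f,\varphi\rangle:=-\int_{\mathbb{R}^d}f(x)\,\mathrm{grad}\,\varphi(x)\,dx$. The OU-superprocess $\{X_t\}_{t\ge0}$ with branching mechanism $\psi(\lambda)=-\alpha\lambda+\beta\lambda^2$ started from $\nu$ (law $\mathbb{P}_\nu$) is the finite-measure-valued Markov process (realized with right-continuous paths) with $X_0=\nu$ such that for all bounded positive measurable $f$, $-\log\mathbb{E}_\nu(e^{-\langle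 f,X_t\rangle})=\int u_f(x,t)\,\nu(dx)$, where $u_f$ is the unique non-negative solution of $u_f(x,t)=\mathcal{P}_tf(x)-\int_0^t\mathcal{P}_s[\psi(u_f(\cdot,t-s))](x)\,ds$. $Ext:=\{\lim_{t\to+\infty}|X_t|=0\}$ is the extinction event and $Ext^c$ its complement. $V_t:=e^{-\alpha t}|X_t|$ is a positive martingale and $V_\infty:=\lim_{t\to+\infty}V_t$ is its a.s. and $L^2$ limit. $H_t:=e^{-(\alpha-\mu)t}\int_{\mathbb{R}^d}x\,X_t(dx)$ is an $\mathbb{R}^d$-valued martingale which for $\alpha>2\mu$ is $L^2$-bounded, and $H_\infty:=\lim_{t\to+\infty}H_t$ is its a.s. and $L^2$ limit. "Conditionally on $Ext^c$" means under $\mathbb{P}_\nu(\cdot\mid Ext^c)$ (and $(\tilde V_\infty,\tilde H_\infty)$ has the joint law of $(V_\infty,H_\infty)$ under this measure). $\mathcal{N}(0,s)$ denotes the centered normal law with variance $s$. *)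

theory Defs
  imports "HOL-Probability.Probability"
begin

subsection \<open>The Ornstein-Uhlenbeck semigroup\<close>

definition gradient :: "(real^'n \<Rightarrow> real) \<Rightarrow> real^'n \<Rightarrow> real^'n" where
  "gradient f x = (\<chi> i. frechet_derivative f (at x) (axis i 1))"

definition laplacian :: "(real^'n \<Rightarrow> real) \<Rightarrow> real^'n \<Rightarrow> real" where
  "laplacian f x = (\<Sum>i\<in>UNIV. gradient (\<lambda>y. gradient f y $ i) x $ i)"

definition ou_generator :: "real \<Rightarrow> real \<Rightarrow> (real^'n \<Rightarrow> real) \<Rightarrow> real^'n \<Rightarrow> real" where
  "ou_generator \<sigma> \<mu> f x = 1/2 * \<sigma>\<^sup>2 * laplacian f x - \<mu> * (x \<bullet> gradient f x)"

definition ou_density :: "real \<Rightarrow> real \<Rightarrow> real^'n \<Rightarrow> real" where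
  "ou_density \<sigma> \<mu> x =
     (\<mu> / (pi * \<sigma>\<^sup>2)) powr (real CARD('n) / 2) * exp (- (\<mu> / \<sigma>\<^sup>2) * (norm x)\<^sup>2)"

definition ou_measure :: "real \<Rightarrow> real \<Rightarrow> (real^'n) measure" where
  "ou_measure \<sigma> \<mu> = density lborel (\<lambda>x. ennreal (ou_density \<sigma> \<mu> x))"

text \<open>Mehler's formula: started from \<open>x\<close>, the Ornstein-Uhlenbeck process is at time \<open>t\<close> distributed
  as \<open>exp (- \<mu> t) x + sqrt (1 - exp (- 2 \<mu> t)) Y\<close> with \<open>Y\<close> distributed according to the invariant law.
  See \<open>ou_semigroup_add\<close>, \<open>ou_semigroup_invariant\<close> and \<open>ou_semigroup_generator\<close> below for the semigroup
  property, the invariance of \<^const>\<open>ou_measure\<close> and the identification of the generator with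
  \<^const>\<open>ou_generator\<close>.\<close>

definition ou_semigroup ::
    "real \<Rightarrow> real \<Rightarrow> real \<Rightarrow> (real^'n \<Rightarrow> real) \<Rightarrow> real^'n \<Rightarrow> real" where
  "ou_semigroup \<sigma> \<mu> t f x =
     (\<integral>y. f (exp (- \<mu> * t) *\<^sub>R x + sqrt (1 - exp (- 2 * \<mu> * t)) *\<^sub>R y) \<partial>ou_measure \<sigma> \<mu>)"

lemma sets_ou_measure [simp, measurable_cong]: "sets (ou_measure \<sigma> \<mu>) = sets borel"
  by (simp add: ou_measure_def)

lemma space_ou_measure [simp]: "space (ou_measure \<sigma> \<mu>) = UNIV"
  by (simp add: ou_measure_def)

lemma ou_density_nonneg [simp]: "0 \<le> ou_density \<sigma> \<mu> x"
  by (simp add: ou_density_def)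

lemma borel_measurable_ou_density [measurable]: "ou_density \<sigma> \<mu> \<in> borel_measurable borel"
  unfolding ou_density_def by measurable

lemma ou_density_prod:
  fixes x :: "real^'n"
  assumes "\<mu> > 0" "\<sigma> > 0"
  shows "ou_density \<sigma> \<mu> x = (\<Prod>b\<in>Basis. normal_density 0 (\<sigma> / sqrt (2 * \<mu>)) (x \<bullet> b))"
proof -
  define K where "K = (\<mu> / (pi * \<sigma>\<^sup>2)) powr (1/2)"
  define k where "k = \<mu> / \<sigma>\<^sup>2"
  have c: "normal_density 0 (\<sigma> / sqrt (2 * \<mu>)) y = K * exp (- k * y\<^sup>2)" for y
  proof -
    have sq: "(\<sigma> / sqrt (2 * \<mu>))\<^sup>2 = \<sigma>\<^sup>2 / (2 * \<mu>)" using assms by (simp add: power_divide)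
    have 1: "2 * pi * (\<sigma>\<^sup>2 / (2 * \<mu>)) = inverse (\<mu> / (pi * \<sigma>\<^sup>2))"
      using assms by (simp add: divide_simps)
    have 2: "- (y - 0)\<^sup>2 / (2 * (\<sigma>\<^sup>2 / (2 * \<mu>))) = - k * y\<^sup>2"
      using assms by (simp add: k_def divide_simps)
    have "1 / sqrt (inverse (\<mu> / (pi * \<sigma>\<^sup>2))) = K"
      using assms unfolding real_sqrt_inverse by (simp only: K_def powr_half_sqrt divide_inverse inverse_inverse_eq) (simp add: powr_half_sqrt)
    then show ?thesis unfolding normal_density_def sq 1 2 by simp
  qed
  have n: "(norm x)\<^sup>2 = (\<Sum>b\<in>Basis. (x \<bullet> b)\<^sup>2)"
    by (simp only: power2_norm_eq_inner euclidean_inner[of x x], simp only: power2_eq_square)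
  have K: "K ^ CARD('n) = (\<mu> / (pi * \<sigma>\<^sup>2)) powr (real CARD('n) / 2)"
  proof -
    have "K > 0" using assms by (simp add: K_def)
    then have "K ^ CARD('n) = K powr real CARD('n)" by (simp only: powr_realpow)
    then show ?thesis by (simp only: K_def powr_powr) simp
  qed
  have "(\<Prod>b\<in>(Basis::(real^'n) set). normal_density 0 (\<sigma> / sqrt (2 * \<mu>)) (x \<bullet> b))
      = K ^ CARD('n) * exp (\<Sum>b\<in>Basis. - k * (x \<bullet> b)\<^sup>2)"
    by (simp add: c prod.distrib exp_sum)
  also have "(\<Sum>b\<in>Basis. - k * (x \<bullet> b)\<^sup>2) = - k * (norm x)\<^sup>2"
    unfolding n by (rule sum_distrib_left [symmetric])
  also have "K ^ CARD('n) * exp (- k * (norm x)\<^sup>2) = ou_density \<sigma> \<mu> x"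
    unfolding K ou_density_def k_def ..
  finally show ?thesis by simp
qed

lemma prob_space_ou_measure:
  assumes "\<mu> > 0" "\<sigma> > 0"
  shows "prob_space (ou_measure \<sigma> \<mu> :: (real^'n) measure)"
proof
  let ?sd = "\<sigma> / sqrt (2 * \<mu>)"
  have sd: "?sd > 0" using assms by simp
  have "emeasure (ou_measure \<sigma> \<mu>) (space (ou_measure \<sigma> \<mu> :: (real^'n) measure))
      = (\<integral>\<^sup>+x. (\<Prod>b\<in>(Basis::(real^'n) set). ennreal (normal_density 0 ?sd (x \<bullet> b))) \<partial>lborel)"
    by (simp add: ou_measure_def emeasure_density ou_density_prod[OF assms] prod_ennreal)
  also have "\<dots> = (\<Prod>b\<in>(Basis::(real^'n) set). (\<integral>\<^sup>+x. ennreal (normal_density 0 ?sd x) \<partial>lborel))"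
    by (rule nn_integral_lborel_prod[where f="\<lambda>b x. ennreal (normal_density 0 ?sd x)"]) auto
  also have "(\<integral>\<^sup>+x. ennreal (normal_density 0 ?sd x) \<partial>lborel) = 1"
    using sd by (subst nn_integral_eq_integral) auto
  finally show "emeasure (ou_measure \<sigma> \<mu>) (space (ou_measure \<sigma> \<mu> :: (real^'n) measure)) = 1"
    by simp
qed

lemma ou_semigroup_0:
  fixes f :: "real^'n \<Rightarrow> real"
  assumes "\<mu> > 0" "\<sigma> > 0"
  shows "ou_semigroup \<sigma> \<mu> 0 f x = f x"
proof -
  interpret prob_space "ou_measure \<sigma> \<mu> :: (real^'n) measure"
    using assms by (rule prob_space_ou_measure)
  show ?thesis using prob_space by (simp add: ou_semigroup_def)
qed

lemma nn_integral_lborel_affine: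
  fixes f :: "'a::euclidean_space \<Rightarrow> ennreal"
  assumes [measurable]: "f \<in> borel_measurable borel" and "c \<noteq> 0"
  shows "(\<integral>\<^sup>+x. f x \<partial>lborel) = ennreal (\<bar>c\<bar> ^ DIM('a)) * (\<integral>\<^sup>+x. f (t + c *\<^sub>R x) \<partial>lborel)"
  by (subst lborel_affine[OF assms(2), of t])
     (simp add: nn_integral_density nn_integral_distr nn_integral_cmult)

lemma ou_density_rotate:
  fixes y w :: "real^'n"
  assumes "a\<^sup>2 + b\<^sup>2 = 1" "b \<noteq> 0"
  shows "ou_density \<sigma> \<mu> y * ou_density \<sigma> \<mu> ((w - a *\<^sub>R y) /\<^sub>R b)
       = ou_density \<sigma> \<mu> w * ou_density \<sigma> \<mu> ((y - a *\<^sub>R w) /\<^sub>R b)"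
proof -
  have sq: "(norm (v /\<^sub>R b))\<^sup>2 = (v \<bullet> v) / b\<^sup>2" for v :: "real^'n"
    by (simp add: power_mult_distrib power2_norm_eq_inner [symmetric] power_inverse field_simps)
  have "(norm y)\<^sup>2 + (norm ((w - a *\<^sub>R y) /\<^sub>R b))\<^sup>2 = (norm w)\<^sup>2 + (norm ((y - a *\<^sub>R w) /\<^sub>R b))\<^sup>2"
  proof -
    have "b\<^sup>2 * (y \<bullet> y) + (w - a *\<^sub>R y) \<bullet> (w - a *\<^sub>R y) = b\<^sup>2 * (w \<bullet> w) + (y - a *\<^sub>R w) \<bullet> (y - a *\<^sub>R w)"
    proof -
      have "(a\<^sup>2 + b\<^sup>2) * (y \<bullet> y) + w \<bullet> w = (a\<^sup>2 + b\<^sup>2) * (w \<bullet> w) + y \<bullet> y"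
        using assms(1) by simp
      then show ?thesis
        by (simp add: inner_diff_left inner_diff_right inner_commute power2_eq_square algebra_simps)
    qed
    then have "(b\<^sup>2 * (y \<bullet> y) + (w - a *\<^sub>R y) \<bullet> (w - a *\<^sub>R y)) / b\<^sup>2
             = (b\<^sup>2 * (w \<bullet> w) + (y - a *\<^sub>R w) \<bullet> (y - a *\<^sub>R w)) / b\<^sup>2" by simp
    then show ?thesis
      using assms(2) by (simp only: sq) (simp add: power2_norm_eq_inner add_divide_distrib)
  qed
  then have "exp (- (\<mu> / \<sigma>\<^sup>2) * ((norm y)\<^sup>2 + (norm ((w - a *\<^sub>R y) /\<^sub>R b))\<^sup>2))
           = exp (- (\<mu> / \<sigma>\<^sup>2) * ((norm w)\<^sup>2 + (norm ((y - a *\<^sub>R w) /\<^sub>R b))\<^sup>2))"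
    by (rule arg_cong)
  then show ?thesis
    unfolding distrib_left exp_add
    by (simp only: ou_density_def mult.assoc mult.left_commute[of "exp _" "_ powr _"])
qed

lemma ou_measure_rotate:
  fixes a b :: real
  assumes "\<mu> > 0" "\<sigma> > 0" and ab: "a\<^sup>2 + b\<^sup>2 = 1"
  shows "distr (ou_measure \<sigma> \<mu> \<Otimes>\<^sub>M ou_measure \<sigma> \<mu>) borel (\<lambda>(y, z). a *\<^sub>R y + b *\<^sub>R z)
       = (ou_measure \<sigma> \<mu> :: (real^'n) measure)"
proof (cases "b = 0")
  interpret G: prob_space "ou_measure \<sigma> \<mu> :: (real^'n) measure"
    using assms(1,2) by (rule prob_space_ou_measure)
  interpret GG: pair_prob_space "ou_measure \<sigma> \<mu> :: (real^'n) measure" "ou_measure \<sigma> \<mu> :: (real^'n) measure" ..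
  let ?p = "ou_density \<sigma> \<mu> :: real^'n \<Rightarrow> real"
  let ?G = "ou_measure \<sigma> \<mu> :: (real^'n) measure"
  case False
  show ?thesis
  proof (rule measure_eqI)
    fix A assume "A \<in> sets (distr (?G \<Otimes>\<^sub>M ?G) borel (\<lambda>(y, z). a *\<^sub>R y + b *\<^sub>R z))"
    then have [measurable]: "A \<in> sets borel" by simp
    have one: "(\<integral>\<^sup>+y. ennreal (?p y) \<partial>lborel) = 1"
      using G.emeasure_space_1 by (simp add: ou_measure_def emeasure_density)
    have inner: "(\<integral>\<^sup>+z. ennreal (?p z) * indicator A (a *\<^sub>R y + b *\<^sub>R z) \<partial>lborel)
        = (\<integral>\<^sup>+w. ennreal (1 / \<bar>b\<bar> ^ CARD('n)) * ennreal (?p ((w - a *\<^sub>R y) /\<^sub>R b)) * indicator A w \<partial>lborel)" for y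
    proof -
      have "(\<integral>\<^sup>+w. ennreal (1 / \<bar>b\<bar> ^ CARD('n)) * ennreal (?p ((w - a *\<^sub>R y) /\<^sub>R b)) * indicator A w \<partial>lborel)
         = ennreal (\<bar>b\<bar> ^ CARD('n)) * (\<integral>\<^sup>+z. ennreal (1 / \<bar>b\<bar> ^ CARD('n)) * (ennreal (?p z) * indicator A (a *\<^sub>R y + b *\<^sub>R z)) \<partial>lborel)"
        using False
        by (subst nn_integral_lborel_affine[where c=b and t="a *\<^sub>R y"]) (simp_all add: mult.assoc)
      also have "\<dots> = (ennreal (\<bar>b\<bar> ^ CARD('n)) * ennreal (1 / \<bar>b\<bar> ^ CARD('n))) * (\<integral>\<^sup>+z. ennreal (?p z) * indicator A (a *\<^sub>R y + b *\<^sub>R z) \<partial>lborel)"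
        by (subst nn_integral_cmult) (auto simp: mult.assoc)
      also have "ennreal (\<bar>b\<bar> ^ CARD('n)) * ennreal (1 / \<bar>b\<bar> ^ CARD('n)) = 1"
        using False by (subst ennreal_mult [symmetric]) auto
      finally show ?thesis by simp
    qed
    have outer: "(\<integral>\<^sup>+y. ennreal (1 / \<bar>b\<bar> ^ CARD('n)) * ennreal (?p ((y - a *\<^sub>R w) /\<^sub>R b)) \<partial>lborel) = 1" for w
    proof -
      have "(\<integral>\<^sup>+y. ennreal (1 / \<bar>b\<bar> ^ CARD('n)) * ennreal (?p ((y - a *\<^sub>R w) /\<^sub>R b)) \<partial>lborel)
          = ennreal (\<bar>b\<bar> ^ CARD('n)) * (\<integral>\<^sup>+z. ennreal (1 / \<bar>b\<bar> ^ CARD('n)) * ennreal (?p z) \<partial>lborel)"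
        using False by (subst nn_integral_lborel_affine[where c=b and t="a *\<^sub>R w"]) simp_all
      also have "\<dots> = ennreal (\<bar>b\<bar> ^ CARD('n)) * ennreal (1 / \<bar>b\<bar> ^ CARD('n))"
        by (subst nn_integral_cmult) (auto simp: one)
      also have "\<dots> = 1"
        using False by (subst ennreal_mult [symmetric]) auto
      finally show ?thesis .
    qed
    have "emeasure (distr (?G \<Otimes>\<^sub>M ?G) borel (\<lambda>(y, z). a *\<^sub>R y + b *\<^sub>R z)) A
        = (\<integral>\<^sup>+x. indicator A (case x of (y, z) \<Rightarrow> a *\<^sub>R y + b *\<^sub>R z) \<partial>(?G \<Otimes>\<^sub>M ?G))"
      by (subst nn_integral_indicator [symmetric], simp, subst nn_integral_distr) simp_all
    also have "\<dots> = (\<integral>\<^sup>+y. \<integral>\<^sup>+z. indicator A (a *\<^sub>R y + b *\<^sub>R z) \<partial>?G \<partial>?G)"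
      by (subst G.nn_integral_fst [symmetric]) auto
    also have "\<dots> = (\<integral>\<^sup>+y. ennreal (?p y) * (\<integral>\<^sup>+z. ennreal (?p z) * indicator A (a *\<^sub>R y + b *\<^sub>R z) \<partial>lborel) \<partial>lborel)"
      by (simp add: ou_measure_def nn_integral_density)
    also have "\<dots> = (\<integral>\<^sup>+y. \<integral>\<^sup>+w. ennreal (?p y) * (ennreal (1 / \<bar>b\<bar> ^ CARD('n)) * ennreal (?p ((w - a *\<^sub>R y) /\<^sub>R b)) * indicator A w) \<partial>lborel \<partial>lborel)"
      by (subst nn_integral_cmult) (auto simp: inner)
    also have "\<dots> = (\<integral>\<^sup>+w. \<integral>\<^sup>+y. ennreal (?p y) * (ennreal (1 / \<bar>b\<bar> ^ CARD('n)) * ennreal (?p ((w - a *\<^sub>R y) /\<^sub>R b)) * indicator A w) \<partial>lborel \<partial>lborel)"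
      by (rule lborel_pair.Fubini') simp
    also have "\<dots> = (\<integral>\<^sup>+w. \<integral>\<^sup>+y. (ennreal (?p w) * indicator A w) * (ennreal (1 / \<bar>b\<bar> ^ CARD('n)) * ennreal (?p ((y - a *\<^sub>R w) /\<^sub>R b))) \<partial>lborel \<partial>lborel)"
    proof (intro nn_integral_cong)
      fix w y :: "real^'n"
      have "ennreal (?p y) * ennreal (?p ((w - a *\<^sub>R y) /\<^sub>R b)) = ennreal (?p w) * ennreal (?p ((y - a *\<^sub>R w) /\<^sub>R b))"
        using ou_density_rotate[OF ab False, of \<sigma> \<mu> y w] by (simp add: ennreal_mult [symmetric])
      from arg_cong[OF this, of "\<lambda>v. v * (ennreal (1 / \<bar>b\<bar> ^ CARD('n)) * indicator A w)"]
      show "ennreal (?p y) * (ennreal (1 / \<bar>b\<bar> ^ CARD('n)) * ennreal (?p ((w - a *\<^sub>R y) /\<^sub>R b)) * indicator A w)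
        = (ennreal (?p w) * indicator A w) * (ennreal (1 / \<bar>b\<bar> ^ CARD('n)) * ennreal (?p ((y - a *\<^sub>R w) /\<^sub>R b)))"
        by (simp only: ac_simps)
    qed
    also have "\<dots> = (\<integral>\<^sup>+w. ennreal (?p w) * indicator A w \<partial>lborel)"
      by (subst nn_integral_cmult) (auto simp: outer)
    also have "\<dots> = emeasure ?G A"
      by (simp add: ou_measure_def emeasure_density)
    finally show "emeasure (distr (?G \<Otimes>\<^sub>M ?G) borel (\<lambda>(y, z). a *\<^sub>R y + b *\<^sub>R z)) A = emeasure ?G A" .
  qed simp
next
  interpret G: prob_space "ou_measure \<sigma> \<mu> :: (real^'n) measure"
    using assms(1,2) by (rule prob_space_ou_measure)
  let ?p = "ou_density \<sigma> \<mu> :: real^'n \<Rightarrow> real"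
  let ?G = "ou_measure \<sigma> \<mu> :: (real^'n) measure"
  case True
  with ab have a: "a = 1 \<or> a = -1" by (simp add: power2_eq_1_iff)
  show ?thesis
  proof (rule measure_eqI)
    fix A assume "A \<in> sets (distr (?G \<Otimes>\<^sub>M ?G) borel (\<lambda>(y, z). a *\<^sub>R y + b *\<^sub>R z))"
    then have [measurable]: "A \<in> sets borel" by simp
    have "emeasure (distr (?G \<Otimes>\<^sub>M ?G) borel (\<lambda>(y, z). a *\<^sub>R y + b *\<^sub>R z)) A
        = (\<integral>\<^sup>+x. indicator A (case x of (y, z) \<Rightarrow> a *\<^sub>R y + b *\<^sub>R z) \<partial>(?G \<Otimes>\<^sub>M ?G))"
      by (subst nn_integral_indicator [symmetric], simp, subst nn_integral_distr) simp_all
    also have "\<dots> = (\<integral>\<^sup>+y. \<integral>\<^sup>+z. indicator A (a *\<^sub>R y + b *\<^sub>R z) \<partial>?G \<partial>?G)"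
      by (subst G.nn_integral_fst [symmetric]) auto
    also have "\<dots> = (\<integral>\<^sup>+y. indicator A (a *\<^sub>R y) \<partial>?G)"
      using G.emeasure_space_1 by (simp add: True)
    also have "\<dots> = (\<integral>\<^sup>+y. ennreal (?p y) * indicator A (a *\<^sub>R y) \<partial>lborel)"
      by (simp add: ou_measure_def nn_integral_density)
    also have "\<dots> = (\<integral>\<^sup>+y. ennreal (?p y) * indicator A y \<partial>lborel)"
      using a nn_integral_lborel_affine[of "\<lambda>y. ennreal (?p y) * indicator A y" a 0]
      by (auto simp: ou_density_def)
    also have "\<dots> = emeasure ?G A"
      by (simp add: ou_measure_def emeasure_density)
    finally show "emeasure (distr (?G \<Otimes>\<^sub>M ?G) borel (\<lambda>(y, z). a *\<^sub>R y + b *\<^sub>R z)) A = emeasure ?G A" .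
  qed simp
qed

lemma integral_ou_measure_rotate:
  fixes f :: "real^'n \<Rightarrow> real"
  assumes "\<mu> > 0" "\<sigma> > 0" and ab: "a\<^sup>2 + b\<^sup>2 = 1"
    and [measurable]: "f \<in> borel_measurable borel" and bd: "\<And>x. \<bar>f x\<bar> \<le> B"
  shows "(\<integral>y. (\<integral>z. f (a *\<^sub>R y + b *\<^sub>R z) \<partial>ou_measure \<sigma> \<mu>) \<partial>ou_measure \<sigma> \<mu>) = (\<integral>y. f y \<partial>ou_measure \<sigma> \<mu>)"
proof -
  let ?G = "ou_measure \<sigma> \<mu> :: (real^'n) measure"
  interpret G: prob_space ?G using assms(1,2) by (rule prob_space_ou_measure)
  interpret GG: pair_prob_space ?G ?G ..
  have "(\<integral>y. f y \<partial>?G) = (\<integral>x. f (case x of (y, z) \<Rightarrow> a *\<^sub>R y + b *\<^sub>R z) \<partial>(?G \<Otimes>\<^sub>M ?G))"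
    by (subst ou_measure_rotate[OF assms(1-3), symmetric], subst integral_distr) auto
  also have "\<dots> = (\<integral>y. (\<integral>z. f (a *\<^sub>R y + b *\<^sub>R z) \<partial>?G) \<partial>?G)"
  proof -
    have "integrable (?G \<Otimes>\<^sub>M ?G) (\<lambda>(y, z). f (a *\<^sub>R y + b *\<^sub>R z))"
      by (rule GG.integrable_const_bound[where B=B]) (auto simp: bd)
    from GG.integral_fst'[OF this] show ?thesis by (simp add: case_prod_unfold)
  qed
  finally show ?thesis by simp
qed

lemma ou_semigroup_invariant:
  fixes f :: "real^'n \<Rightarrow> real"
  assumes "\<mu> > 0" "\<sigma> > 0" "t \<ge> 0"
    and "f \<in> borel_measurable borel" "\<And>x. \<bar>f x\<bar> \<le> B"
  shows "(\<integral>x. ou_semigroup \<sigma> \<mu> t f x \<partial>ou_measure \<sigma> \<mu>) = (\<integral>x. f x \<partial>ou_measure \<sigma> \<mu>)"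
proof -
  have "(exp (- \<mu> * t))\<^sup>2 + (sqrt (1 - exp (- 2 * \<mu> * t)))\<^sup>2 = 1"
    using assms by (simp add: exp_double [symmetric] mult.assoc)
  then show ?thesis
    unfolding ou_semigroup_def using assms by (intro integral_ou_measure_rotate[where B=B]) auto
qed

lemma ou_semigroup_add:
  fixes f :: "real^'n \<Rightarrow> real"
  assumes "\<mu> > 0" "\<sigma> > 0" "s \<ge> 0" "t \<ge> 0"
    and [measurable]: "f \<in> borel_measurable borel" and bd: "\<And>x. \<bar>f x\<bar> \<le> B"
  shows "ou_semigroup \<sigma> \<mu> s (ou_semigroup \<sigma> \<mu> t f) x = ou_semigroup \<sigma> \<mu> (s + t) f x"
proof -
  define c where "c u = sqrt (1 - exp (- 2 * \<mu> * u))" for u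
  have nn: "1 - exp (- 2 * \<mu> * u) \<ge> 0" if "u \<ge> 0" for u using that assms(1) by simp
  have c2: "(c u)\<^sup>2 = 1 - exp (- 2 * \<mu> * u)" if "u \<ge> 0" for u
    unfolding c_def using nn[OF that] by simp
  have e: "exp (- \<mu> * t) *\<^sub>R (exp (- \<mu> * s) *\<^sub>R x + c s *\<^sub>R y) + c t *\<^sub>R z
      = exp (- \<mu> * (s + t)) *\<^sub>R x + ((exp (- \<mu> * t) * c s) *\<^sub>R y + c t *\<^sub>R z)" for y z :: "real^'n"
    by (simp add: algebra_simps exp_add [symmetric])
  show ?thesis
  proof (cases "c (s + t) = 0")
    case True
    then have "1 - exp (- 2 * \<mu> * (s + t)) = 0" by (simp add: c_def)
    then have "s + t = 0" using assms(1) by simp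
    then have "s = 0" "t = 0" using assms by auto
    then show ?thesis using assms by (simp add: ou_semigroup_0)
  next
    case False
    define a where "a = exp (- \<mu> * t) * c s / c (s + t)"
    define b where "b = c t / c (s + t)"
    have "(exp (- \<mu> * t) * c s)\<^sup>2 + (c t)\<^sup>2 = (c (s + t))\<^sup>2"
      using assms by (simp add: c2 power_mult_distrib exp_double [symmetric] algebra_simps exp_add [symmetric])
    then have ab: "a\<^sup>2 + b\<^sup>2 = 1"
      using False unfolding a_def b_def power_divide add_divide_distrib [symmetric] by simp
    have "ou_semigroup \<sigma> \<mu> s (ou_semigroup \<sigma> \<mu> t f) x
       = (\<integral>y. (\<integral>z. f (exp (- \<mu> * (s + t)) *\<^sub>R x + c (s + t) *\<^sub>R (a *\<^sub>R y + b *\<^sub>R z)) \<partial>ou_measure \<sigma> \<mu>) \<partial>ou_measure \<sigma> \<mu>)"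
      using False unfolding ou_semigroup_def c_def [symmetric] e a_def b_def
      by (simp add: scaleR_add_right)
    also have "\<dots> = (\<integral>y. f (exp (- \<mu> * (s + t)) *\<^sub>R x + c (s + t) *\<^sub>R y) \<partial>ou_measure \<sigma> \<mu>)"
      by (rule integral_ou_measure_rotate[OF assms(1,2) ab, where B=B]) (auto simp: bd)
    finally show ?thesis unfolding ou_semigroup_def c_def .
  qed
qed


lemma ou_measure_coordinate_moment:
  fixes i :: "'n::finite"
  assumes "\<mu> > 0" "\<sigma> > 0"
  shows "integrable (ou_measure \<sigma> \<mu>) (\<lambda>y::real^'n. (y $ i)\<^sup>2)" (is ?A)
    and "(\<integral>y. (y $ i)\<^sup>2 \<partial>(ou_measure \<sigma> \<mu> :: (real^'n) measure)) = \<sigma>\<^sup>2 / (2 * \<mu>)" (is ?B)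
proof -
  let ?sd = "\<sigma> / sqrt (2 * \<mu>)"
  let ?e = "axis i 1 :: real^'n"
  have sd: "?sd > 0" using assms by simp
  let ?g = "\<lambda>(b::real^'n) x. ennreal ((if b = ?e then x\<^sup>2 else 1) * normal_density 0 ?sd x)"
  have sm: "has_bochner_integral lborel (\<lambda>x. x\<^sup>2 * normal_density 0 ?sd x) (?sd\<^sup>2)"
    using normal_moment_even[OF sd, of 0 1] by (simp add: fact_numeral mult.commute)
  have one: "(\<integral>\<^sup>+x. ennreal (normal_density 0 ?sd x) \<partial>lborel) = 1"
    using sd by (subst nn_integral_eq_integral) auto
  have two: "(\<integral>\<^sup>+x. ennreal (x\<^sup>2 * normal_density 0 ?sd x) \<partial>lborel) = ennreal (?sd\<^sup>2)"
    using sm by (subst nn_integral_eq_integral) (auto simp: has_bochner_integral_iff)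
  have "(\<integral>\<^sup>+y. ennreal ((y $ i)\<^sup>2) \<partial>(ou_measure \<sigma> \<mu> :: (real^'n) measure))
      = (\<integral>\<^sup>+y. ennreal ((y \<bullet> ?e)\<^sup>2 * ou_density \<sigma> \<mu> y) \<partial>lborel)"
    by (simp add: ou_measure_def nn_integral_density inner_axis ennreal_mult [symmetric] mult.commute)
  also have "\<dots> = (\<integral>\<^sup>+y. (\<Prod>b\<in>(Basis::(real^'n) set). ?g b (y \<bullet> b)) \<partial>lborel)"
  proof (intro nn_integral_cong)
    fix y :: "real^'n"
    have "(\<Prod>b\<in>(Basis::(real^'n) set). (if b = ?e then (y \<bullet> b)\<^sup>2 else 1)) = (y \<bullet> ?e)\<^sup>2"
      by (subst prod.delta) (auto simp: axis_in_Basis_iff)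
    then show "ennreal ((y \<bullet> ?e)\<^sup>2 * ou_density \<sigma> \<mu> y) = (\<Prod>b\<in>(Basis::(real^'n) set). ?g b (y \<bullet> b))"
      by (simp add: prod_ennreal prod.distrib ou_density_prod[OF assms])
  qed
  also have "\<dots> = (\<Prod>b\<in>(Basis::(real^'n) set). (\<integral>\<^sup>+x. ?g b x \<partial>lborel))"
    by (rule nn_integral_lborel_prod) auto
  also have "\<dots> = (\<Prod>b\<in>(Basis::(real^'n) set). if b = ?e then ennreal (?sd\<^sup>2) else 1)"
    by (intro prod.cong refl) (auto simp: one two)
  also have "\<dots> = ennreal (\<sigma>\<^sup>2 / (2 * \<mu>))"
    using assms by (subst prod.delta) (auto simp: axis_in_Basis_iff power_divide)
  finally have "has_bochner_integral (ou_measure \<sigma> \<mu>) (\<lambda>y::real^'n. (y $ i)\<^sup>2) (\<sigma>\<^sup>2 / (2 * \<mu>))"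
    using assms by (intro has_bochner_integral_nn_integral) auto
  then show ?A ?B by (auto simp: has_bochner_integral_iff)
qed

lemma ou_measure_reflect:
  fixes c :: "real^'n \<Rightarrow> real" and f :: "real^'n \<Rightarrow> real"
  assumes c: "\<And>b. b \<in> Basis \<Longrightarrow> \<bar>c b\<bar> = 1" and [measurable]: "f \<in> borel_measurable borel"
  shows "(\<integral>y. f (\<Sum>b\<in>Basis. (c b * (y \<bullet> b)) *\<^sub>R b) \<partial>ou_measure \<sigma> \<mu>) = (\<integral>y. f y \<partial>ou_measure \<sigma> \<mu>)"
proof -
  let ?T = "\<lambda>y::real^'n. (\<Sum>b\<in>Basis. (c b * (y \<bullet> b)) *\<^sub>R b)"
  have c0: "c b \<noteq> 0" if "b \<in> Basis" for b using c[OF that] by auto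
  have l: "distr lborel borel ?T = (lborel :: (real^'n) measure)"
    using lborel_affine_euclidean[where c=c and t=0, OF c0] by (simp add: c density_1)
  have sq: "(norm z)\<^sup>2 = (\<Sum>b\<in>Basis. (z \<bullet> b)\<^sup>2)" for z :: "real^'n"
    by (simp only: power2_norm_eq_inner euclidean_inner[of z z], simp only: power2_eq_square)
  have Tb: "(?T y \<bullet> b)\<^sup>2 = (y \<bullet> b)\<^sup>2" if b: "b \<in> Basis" for y b
  proof -
    have "?T y \<bullet> b = c b * (y \<bullet> b)" by (rule inner_sum_left_Basis[OF b])
    then have "\<bar>?T y \<bullet> b\<bar> = \<bar>y \<bullet> b\<bar>" by (simp only: abs_mult c[OF b] mult_1)
    then show ?thesis by (simp only: power2_eq_iff abs_eq_iff)
  qed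
  have norm_T: "(norm (?T y))\<^sup>2 = (norm y)\<^sup>2" for y
    unfolding sq by (intro sum.cong refl Tb)
  have "(\<integral>y. f y \<partial>ou_measure \<sigma> \<mu>) = (\<integral>y. ou_density \<sigma> \<mu> y * f y \<partial>lborel)"
    by (simp add: ou_measure_def integral_density)
  also have "\<dots> = (\<integral>y. ou_density \<sigma> \<mu> (?T y) * f (?T y) \<partial>lborel)"
    by (subst l [symmetric], rule integral_distr) measurable
  also have "\<dots> = (\<integral>y. ou_density \<sigma> \<mu> y * f (?T y) \<partial>lborel)"
    unfolding ou_density_def norm_T ..
  also have "\<dots> = (\<integral>y. f (?T y) \<partial>ou_measure \<sigma> \<mu>)"
    by (simp add: ou_measure_def integral_density)
  finally show ?thesis by simp
qed

lemma ou_measure_moments: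
  fixes i j :: "'n::finite"
  assumes "\<mu> > 0" "\<sigma> > 0"
  shows "integrable (ou_measure \<sigma> \<mu>) (\<lambda>y::real^'n. (norm y)\<^sup>2)"
    and "integrable (ou_measure \<sigma> \<mu>) (\<lambda>y::real^'n. y $ i * y $ j)"
    and "(\<integral>y. y $ i * y $ j \<partial>(ou_measure \<sigma> \<mu> :: (real^'n) measure)) = (if i = j then \<sigma>\<^sup>2 / (2 * \<mu>) else 0)"
    and "integrable (ou_measure \<sigma> \<mu>) (\<lambda>y::real^'n. y $ i)"
    and "(\<integral>y. y $ i \<partial>(ou_measure \<sigma> \<mu> :: (real^'n) measure)) = 0"
proof -
  let ?G = "ou_measure \<sigma> \<mu> :: (real^'n) measure"
  interpret G: prob_space ?G using assms by (rule prob_space_ou_measure)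
  note m = ou_measure_coordinate_moment[where 'n='n, OF assms]
  have "(\<lambda>y::real^'n. (norm y)\<^sup>2) = (\<lambda>y. \<Sum>i\<in>UNIV. (y $ i)\<^sup>2)"
    by (intro ext) (simp only: power2_norm_eq_inner inner_vec_def, simp add: power2_eq_square)
  then show "integrable ?G (\<lambda>y. (norm y)\<^sup>2)"
    using m by simp
  show "integrable ?G (\<lambda>y. y $ i * y $ j)"
  proof (rule Bochner_Integration.integrable_bound)
    show "integrable ?G (\<lambda>y. (y $ i)\<^sup>2 + (y $ j)\<^sup>2)" using m by simp
    show "AE y in ?G. norm (y $ i * y $ j) \<le> norm ((y $ i)\<^sup>2 + (y $ j)\<^sup>2)"
    proof (intro always_eventually allI)
      fix y :: "real^'n"
      have "2 * (\<bar>y $ i\<bar> * \<bar>y $ j\<bar>) \<le> (y $ i)\<^sup>2 + (y $ j)\<^sup>2"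
        using sum_squares_bound[of "\<bar>y $ i\<bar>" "\<bar>y $ j\<bar>"] by simp
      moreover have "0 \<le> \<bar>y $ i\<bar> * \<bar>y $ j\<bar>" by simp
      ultimately have "\<bar>y $ i\<bar> * \<bar>y $ j\<bar> \<le> (y $ i)\<^sup>2 + (y $ j)\<^sup>2" by linarith
      then show "norm (y $ i * y $ j) \<le> norm ((y $ i)\<^sup>2 + (y $ j)\<^sup>2)"
        by (simp add: abs_mult)
    qed
  qed measurable
  show "integrable ?G (\<lambda>y. y $ i)"
  proof (rule Bochner_Integration.integrable_bound)
    show "integrable ?G (\<lambda>y. 1 + (y $ i)\<^sup>2)" using m by simp
    show "AE y in ?G. norm (y $ i) \<le> norm (1 + (y $ i)\<^sup>2)"
    proof (intro always_eventually allI)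
      fix y :: "real^'n"
      have "2 * \<bar>y $ i\<bar> \<le> 1 + (y $ i)\<^sup>2"
        using sum_squares_bound[of 1 "\<bar>y $ i\<bar>"] by simp
      then show "norm (y $ i) \<le> norm (1 + (y $ i)\<^sup>2)" by simp
    qed
  qed measurable
  have flip: "(\<Sum>b\<in>Basis. ((if b \<in> B then -1 else 1) * (y \<bullet> b)) *\<^sub>R b) $ k
      = (if axis k 1 \<in> B then - (y $ k) else y $ k)" for B :: "(real^'n) set" and y :: "real^'n" and k
  proof -
    have "(\<Sum>b\<in>Basis. ((if b \<in> B then -1 else 1) * (y \<bullet> b)) *\<^sub>R b) \<bullet> axis k 1
      = (if axis k 1 \<in> B then -1 else 1) * (y \<bullet> axis k 1)"
      by (subst inner_sum_left_Basis) (auto simp: axis_in_Basis_iff)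
    then show ?thesis by (simp add: inner_axis split: if_splits)
  qed
  have "(\<integral>y. - (y $ i) \<partial>?G) = (\<integral>y. y $ i \<partial>?G)"
    using ou_measure_reflect[of "\<lambda>b. if b \<in> UNIV then -1 else 1" "\<lambda>y. y $ i" \<sigma> \<mu>]
    unfolding flip by simp
  then show "(\<integral>y. y $ i \<partial>?G) = 0" by simp
  show "(\<integral>y. y $ i * y $ j \<partial>?G) = (if i = j then \<sigma>\<^sup>2 / (2 * \<mu>) else 0)"
  proof (cases "i = j")
    case True
    then show ?thesis using m by (simp add: power2_eq_square [symmetric])
  next
    case False
    have "(\<integral>y. - (y $ i * y $ j) \<partial>?G) = (\<integral>y. y $ i * y $ j \<partial>?G)"
      using ou_measure_reflect[of "\<lambda>b. if b \<in> {axis i 1} then -1 else 1" "\<lambda>y. y $ i * y $ j" \<sigma> \<mu>] False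
      unfolding flip by (simp add: axis_eq_axis)
    with False show ?thesis by simp
  qed
qed

lemma second_order_remainder:
  fixes f :: "real^'n \<Rightarrow> real"
  assumes f: "\<And>y. (f has_derivative (\<lambda>v. g y \<bullet> v)) (at y)"
    and g: "(g has_derivative D) (at x)" and "\<epsilon> > 0"
  shows "\<exists>\<delta>>0. \<forall>h. norm h < \<delta> \<longrightarrow> \<bar>f (x + h) - f x - g x \<bullet> h - 1/2 * (h \<bullet> D h)\<bar> \<le> \<epsilon> * (norm h)\<^sup>2"
proof -
  from g \<open>\<epsilon> > 0\<close> obtain \<delta> where d: "\<delta> > 0"
    and D: "\<And>y. norm (y - x) < \<delta> \<Longrightarrow> norm (g y - g x - D (y - x)) \<le> \<epsilon> * norm (y - x)"
    unfolding has_derivative_at_alt by blast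
  have lin: "bounded_linear D" using g by (rule has_derivative_bounded_linear)
  show ?thesis
  proof (intro exI conjI allI impI)
    fix h :: "real^'n" assume h: "norm h < \<delta>"
    define k where "k s = f (x + s *\<^sub>R h) - s * (g x \<bullet> h) - s\<^sup>2 / 2 * (h \<bullet> D h)" for s
    have k: "(k has_real_derivative (g (x + s *\<^sub>R h) \<bullet> h - g x \<bullet> h - s * (h \<bullet> D h))) (at s)" for s
    proof -
      have "((\<lambda>s. x + s *\<^sub>R h) has_derivative (\<lambda>r. r *\<^sub>R h)) (at s)"
        by (auto intro!: derivative_eq_intros)
      then have "((\<lambda>s. f (x + s *\<^sub>R h)) has_derivative (\<lambda>r. g (x + s *\<^sub>R h) \<bullet> (r *\<^sub>R h))) (at s)"
        by (rule has_derivative_compose[OF _ f])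
      then have 1: "((\<lambda>s. f (x + s *\<^sub>R h)) has_real_derivative (g (x + s *\<^sub>R h) \<bullet> h)) (at s)"
        unfolding has_field_derivative_def by (simp add: mult_commute_abs)
      show ?thesis
        unfolding k_def by (auto intro!: derivative_eq_intros 1)
    qed
    obtain s where s: "0 < s" "s < 1" and "k 1 - k 0 = (1 - 0) * (g (x + s *\<^sub>R h) \<bullet> h - g x \<bullet> h - s * (h \<bullet> D h))"
      using MVT2[of 0 1 k, OF _ k] by auto
    then have "f (x + h) - f x - g x \<bullet> h - 1/2 * (h \<bullet> D h) = (g (x + s *\<^sub>R h) - g x - D (s *\<^sub>R h)) \<bullet> h"
      by (simp add: k_def inner_diff_left inner_diff_right linear_simps[OF lin] inner_commute)
    also have "\<bar>\<dots>\<bar> \<le> norm (g (x + s *\<^sub>R h) - g x - D (s *\<^sub>R h)) * norm h"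
      by (rule Cauchy_Schwarz_ineq2)
    also have "\<dots> \<le> (\<epsilon> * norm h) * norm h"
    proof (rule mult_right_mono)
      have le: "norm (s *\<^sub>R h) \<le> norm h" using s by (simp add: mult_left_le_one_le)
      then have "norm (g (x + s *\<^sub>R h) - g x - D (s *\<^sub>R h)) \<le> \<epsilon> * norm (s *\<^sub>R h)"
        using D[of "x + s *\<^sub>R h"] h by simp
      also have "\<dots> \<le> \<epsilon> * norm h" using le \<open>\<epsilon> > 0\<close> by simp
      finally show "norm (g (x + s *\<^sub>R h) - g x - D (s *\<^sub>R h)) \<le> \<epsilon> * norm h" .
    qed simp
    finally show "\<bar>f (x + h) - f x - g x \<bullet> h - 1/2 * (h \<bullet> D h)\<bar> \<le> \<epsilon> * (norm h)\<^sup>2"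
      by (simp add: power2_eq_square mult.assoc)
  qed (rule d)
qed


lemma linear_axis_expansion:
  fixes l :: "real^'n \<Rightarrow> 'b::real_vector"
  assumes l: "linear l"
  shows "l y = (\<Sum>i\<in>UNIV. y $ i *\<^sub>R l (axis i 1))"
proof -
  have "l y = l (\<Sum>i\<in>UNIV. y $ i *\<^sub>R axis i 1)"
    using basis_expansion[of y] by (simp add: scalar_mult_eq_scaleR)
  also have "\<dots> = (\<Sum>i\<in>UNIV. l (y $ i *\<^sub>R axis i 1))" by (rule linear_sum[OF l])
  finally show ?thesis by (simp add: linear_cmul[OF l])
qed

lemma ou_measure_linear:
  fixes l :: "real^'n \<Rightarrow> real"
  assumes "\<mu> > 0" "\<sigma> > 0" and l: "linear l"
  shows "integrable (ou_measure \<sigma> \<mu>) l" and "(\<integral>y. l y \<partial>ou_measure \<sigma> \<mu>) = 0"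
proof -
  have "l y = (\<Sum>i\<in>UNIV. y $ i * l (axis i 1))" for y
    using linear_axis_expansion[OF l, of y] by simp
  then have e: "l = (\<lambda>y. \<Sum>i\<in>UNIV. y $ i * l (axis i 1))" by (rule ext)
  show "integrable (ou_measure \<sigma> \<mu>) l"
    by (subst e) (auto intro!: ou_measure_moments assms)
  show "(\<integral>y. l y \<partial>ou_measure \<sigma> \<mu>) = 0"
    by (subst e) (simp add: ou_measure_moments[OF assms(1,2)])
qed

lemma ou_measure_quadratic:
  fixes D :: "real^'n \<Rightarrow> real^'n"
  assumes "\<mu> > 0" "\<sigma> > 0" and D: "linear D"
  shows "integrable (ou_measure \<sigma> \<mu>) (\<lambda>y. y \<bullet> D y)"
    and "(\<integral>y. y \<bullet> D y \<partial>ou_measure \<sigma> \<mu>) = \<sigma>\<^sup>2 / (2 * \<mu>) * (\<Sum>i\<in>UNIV. D (axis i 1) $ i)"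
proof -
  have "y \<bullet> D y = (\<Sum>i\<in>UNIV. \<Sum>j\<in>UNIV. y $ i * y $ j * D (axis j 1) $ i)" for y
  proof -
    have "D y = (\<Sum>j\<in>UNIV. y $ j *\<^sub>R D (axis j 1))"
      using linear_axis_expansion[OF D, of y] by simp
    then show ?thesis by (simp add: inner_vec_def sum_distrib_left mult.assoc)
  qed
  then have e: "(\<lambda>y. y \<bullet> D y) = (\<lambda>y. \<Sum>i\<in>UNIV. \<Sum>j\<in>UNIV. y $ i * y $ j * D (axis j 1) $ i)" by (rule ext)
  note m = ou_measure_moments[OF assms(1,2)]
  show "integrable (ou_measure \<sigma> \<mu>) (\<lambda>y. y \<bullet> D y)"
    by (subst e) (auto intro!: m Bochner_Integration.integrable_sum)
  have "(\<integral>y. y \<bullet> D y \<partial>ou_measure \<sigma> \<mu>)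
      = (\<Sum>i\<in>UNIV. \<Sum>j\<in>UNIV. (if i = j then \<sigma>\<^sup>2 / (2 * \<mu>) else 0) * D (axis j 1) $ i)"
    unfolding e by (simp add: m)
  also have "\<dots> = (\<Sum>i\<in>UNIV. \<sigma>\<^sup>2 / (2 * \<mu>) * D (axis i 1) $ i)"
    by (simp add: if_distrib[of "\<lambda>c. c * _"] cong: if_cong)
  finally show "(\<integral>y. y \<bullet> D y \<partial>ou_measure \<sigma> \<mu>) = \<sigma>\<^sup>2 / (2 * \<mu>) * (\<Sum>i\<in>UNIV. D (axis i 1) $ i)"
    by (simp add: sum_distrib_left)
qed

lemma second_order_remainder_bound:
  fixes f :: "real^'n \<Rightarrow> real"
  assumes f: "\<And>y. (f has_derivative (\<lambda>v. g y \<bullet> v)) (at y)"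
    and g: "(g has_derivative D) (at x)" and B: "\<And>y. \<bar>f y\<bar> \<le> B"
  shows "\<exists>C. \<forall>h. \<bar>f (x + h) - f x - g x \<bullet> h - 1/2 * (h \<bullet> D h)\<bar> \<le> C * (norm h)\<^sup>2"
proof -
  obtain \<delta> where d: "\<delta> > 0"
    and D: "\<And>h. norm h < \<delta> \<Longrightarrow> \<bar>f (x + h) - f x - g x \<bullet> h - 1/2 * (h \<bullet> D h)\<bar> \<le> 1 * (norm h)\<^sup>2"
    using second_order_remainder[OF f g, of 1] by auto
  have lin: "bounded_linear D" using g by (rule has_derivative_bounded_linear)
  obtain K where K: "\<And>h. norm (D h) \<le> norm h * K" using bounded_linear.bounded[OF lin] by auto
  have B0: "B \<ge> 0" using B[of x] by linarith
  have K0: "\<bar>h \<bullet> D h\<bar> \<le> \<bar>K\<bar> * (norm h)\<^sup>2" for h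
  proof -
    have "\<bar>h \<bullet> D h\<bar> \<le> norm h * norm (D h)" by (rule Cauchy_Schwarz_ineq2)
    also have "\<dots> \<le> norm h * (norm h * \<bar>K\<bar>)"
      by (intro mult_left_mono order_trans[OF K]) auto
    finally show ?thesis by (simp add: power2_eq_square mult_ac)
  qed
  show ?thesis
  proof (intro exI allI)
    fix h :: "real^'n"
    let ?q = "\<bar>f (x + h) - f x - g x \<bullet> h - 1/2 * (h \<bullet> D h)\<bar>"
    let ?C = "1 + 2 * B / \<delta>\<^sup>2 + norm (g x) / \<delta> + \<bar>K\<bar>"
    have nn: "0 \<le> 2 * B / \<delta>\<^sup>2 * (norm h)\<^sup>2" "0 \<le> norm (g x) / \<delta> * (norm h)\<^sup>2" "0 \<le> \<bar>K\<bar> * (norm h)\<^sup>2"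
      using B0 d by auto
    have e: "?C * (norm h)\<^sup>2 = (norm h)\<^sup>2 + 2 * B / \<delta>\<^sup>2 * (norm h)\<^sup>2 + norm (g x) / \<delta> * (norm h)\<^sup>2 + \<bar>K\<bar> * (norm h)\<^sup>2"
      by (simp add: algebra_simps)
    show "?q \<le> ?C * (norm h)\<^sup>2"
    proof (cases "norm h < \<delta>")
      case True
      from D[OF this] nn show ?thesis unfolding e by linarith
    next
      case False
      have "2 * B * 1 \<le> 2 * B * ((norm h)\<^sup>2 / \<delta>\<^sup>2)"
        using False d B0 by (intro mult_left_mono) (auto simp: power_mono)
      then have 1: "\<bar>f (x + h) - f x\<bar> \<le> 2 * B / \<delta>\<^sup>2 * (norm h)\<^sup>2"
        using B[of "x + h"] B[of x] by simp
      have "norm (g x) * norm h * 1 \<le> norm (g x) * norm h * (norm h / \<delta>)"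
        using False d by (intro mult_left_mono) auto
      then have 2: "\<bar>g x \<bullet> h\<bar> \<le> norm (g x) / \<delta> * (norm h)\<^sup>2"
        using Cauchy_Schwarz_ineq2[of "g x" h] by (simp add: power2_eq_square mult_ac)
      show ?thesis using 1 2 K0[of h] nn zero_le_power2[of "norm h"] unfolding e by linarith
    qed
  qed
qed

lemma ou_semigroup_remainder:
  fixes q :: "real^'n \<Rightarrow> real" and x :: "real^'n"
  assumes pos: "\<mu> > 0" "\<sigma> > 0"
    and [measurable]: "q \<in> borel_measurable borel"
    and C: "\<And>h. \<bar>q h\<bar> \<le> C * (norm h)\<^sup>2"
    and small: "\<And>\<epsilon>. \<epsilon> > 0 \<Longrightarrow> \<exists>\<delta>>0. \<forall>h. norm h < \<delta> \<longrightarrow> \<bar>q h\<bar> \<le> \<epsilon> * (norm h)\<^sup>2"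
  defines "h \<equiv> \<lambda>t y. (exp (- \<mu> * t) - 1) *\<^sub>R x + sqrt (1 - exp (- 2 * \<mu> * t)) *\<^sub>R y"
  shows "\<And>t. t > 0 \<Longrightarrow> integrable (ou_measure \<sigma> \<mu>) (\<lambda>y. q (h t y))"
    and "((\<lambda>t. (\<integral>y. q (h t y) \<partial>ou_measure \<sigma> \<mu>) / t) \<longlongrightarrow> 0) (at_right 0)"
proof -
  let ?G = "ou_measure \<sigma> \<mu> :: (real^'n) measure"
  interpret G: prob_space ?G using pos by (rule prob_space_ou_measure)
  have [measurable]: "h t \<in> borel_measurable borel" for t unfolding h_def by measurable
  define W where "W y = 2 * \<mu> * (norm x)\<^sup>2 + 4 * \<mu> * (norm y)\<^sup>2" for y :: "real^'n"
  have W: "integrable ?G W" unfolding W_def using ou_measure_moments(1)[OF pos] by auto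
  have W0: "W y \<ge> 0" for y unfolding W_def using pos by auto
  have hW: "(norm (h t y))\<^sup>2 \<le> t * W y" if t: "t > 0" for t y
  proof -
    have e1: "1 - exp (- \<mu> * t) \<le> \<mu> * t" using exp_ge_add_one_self[of "- \<mu> * t"] by simp
    have e2: "1 - exp (- 2 * \<mu> * t) \<le> 2 * \<mu> * t" using exp_ge_add_one_self[of "- 2 * \<mu> * t"] by simp
    have e3: "0 \<le> 1 - exp (- \<mu> * t)" "1 - exp (- \<mu> * t) \<le> 1" "0 \<le> 1 - exp (- 2 * \<mu> * t)" using t pos by auto
    let ?a = "(exp (- \<mu> * t) - 1) *\<^sub>R x" and ?b = "sqrt (1 - exp (- 2 * \<mu> * t)) *\<^sub>R y"
    have "(norm (?a + ?b))\<^sup>2 \<le> (norm ?a + norm ?b)\<^sup>2" by (intro power_mono norm_triangle_ineq) auto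
    also have "\<dots> \<le> 2 * (norm ?a)\<^sup>2 + 2 * (norm ?b)\<^sup>2"
      using sum_squares_bound[of "norm ?a" "norm ?b"] by (simp add: power2_sum)
    also have "(norm ?a)\<^sup>2 = (1 - exp (- \<mu> * t))\<^sup>2 * (norm x)\<^sup>2"
      by (simp add: power_mult_distrib power2_commute)
    also have "(norm ?b)\<^sup>2 = (1 - exp (- 2 * \<mu> * t)) * (norm y)\<^sup>2"
      using e3 by (simp add: power_mult_distrib)
    finally have "(norm (h t y))\<^sup>2 \<le> 2 * ((1 - exp (- \<mu> * t))\<^sup>2 * (norm x)\<^sup>2) + 2 * ((1 - exp (- 2 * \<mu> * t)) * (norm y)\<^sup>2)"
      unfolding h_def .
    also have "(1 - exp (- \<mu> * t))\<^sup>2 \<le> \<mu> * t"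
    proof -
      have "(1 - exp (- \<mu> * t))\<^sup>2 \<le> 1 - exp (- \<mu> * t)"
        using e3 unfolding power2_eq_square by (simp add: mult_left_le)
      with e1 show ?thesis by linarith
    qed
    finally have "(norm (h t y))\<^sup>2 \<le> 2 * ((\<mu> * t) * (norm x)\<^sup>2) + 2 * ((1 - exp (- 2 * \<mu> * t)) * (norm y)\<^sup>2)"
      by (simp add: mult_right_mono)
    also have "\<dots> \<le> 2 * ((\<mu> * t) * (norm x)\<^sup>2) + 2 * ((2 * \<mu> * t) * (norm y)\<^sup>2)"
      using e2 by (intro add_left_mono mult_left_mono mult_right_mono) auto
    finally show ?thesis by (simp add: W_def algebra_simps)
  qed
  have C0: "C \<ge> 0"
  proof (rule ccontr)
    assume "\<not> C \<ge> 0"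
    then have "C * (norm (axis undefined 1 :: real^'n))\<^sup>2 < 0" by (simp add: norm_axis_1)
    with C[of "axis undefined 1"] show False by linarith
  qed
  have qW: "\<bar>q (h t y)\<bar> \<le> t * (C * W y)" if "t > 0" for t y
  proof -
    have "\<bar>q (h t y)\<bar> \<le> C * (t * W y)" using C[of "h t y"] hW[OF that, of y] C0 by (meson mult_left_mono order_trans)
    then show ?thesis by (simp add: mult_ac)
  qed
  show "integrable ?G (\<lambda>y. q (h t y))" if "t > 0" for t
  proof (rule Bochner_Integration.integrable_bound)
    show "integrable ?G (\<lambda>y. t * (C * W y))" using W by auto
    show "AE y in ?G. norm (q (h t y)) \<le> norm (t * (C * W y))"
      using qW[OF that] C0 W0 that by (intro always_eventually allI) (simp add: abs_mult)
  qed measurable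
  show "((\<lambda>t. (\<integral>y. q (h t y) \<partial>?G) / t) \<longlongrightarrow> 0) (at_right 0)"
    unfolding tendsto_at_iff_sequentially
  proof (intro allI impI)
    fix T :: "nat \<Rightarrow> real" assume T: "\<forall>i. T i \<in> {0<..} - {0}" and T0: "T \<longlonglongrightarrow> 0"
    then have Tpos: "T i > 0" for i by auto
    have "(\<lambda>i. \<integral>y. q (h (T i) y) / T i \<partial>?G) \<longlonglongrightarrow> (\<integral>y. 0 \<partial>?G)"
    proof (rule integral_dominated_convergence)
      show "integrable ?G (\<lambda>y. C * W y)" using W by auto
      show "AE y in ?G. norm (q (h (T i) y) / T i) \<le> C * W y" for i
        using qW[OF Tpos, of i] Tpos[of i] by (intro always_eventually allI) (simp add: field_simps)
      show "AE y in ?G. (\<lambda>i. q (h (T i) y) / T i) \<longlonglongrightarrow> 0"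
      proof (intro always_eventually allI)
        fix y :: "real^'n"
        have h0: "(\<lambda>i. h (T i) y) \<longlonglongrightarrow> 0"
        proof -
          have "(\<lambda>i. h (T i) y) \<longlonglongrightarrow> (exp (- \<mu> * 0) - 1) *\<^sub>R x + sqrt (1 - exp (- 2 * \<mu> * 0)) *\<^sub>R y"
            unfolding h_def by (intro tendsto_intros T0)
          then show ?thesis by simp
        qed
        show "(\<lambda>i. q (h (T i) y) / T i) \<longlonglongrightarrow> 0"
        proof (rule tendstoI)
          fix r :: real assume r: "r > 0"
          define \<epsilon> where "\<epsilon> = r / (2 * (W y + 1))"
          have eps: "\<epsilon> > 0" unfolding \<epsilon>_def using r W0[of y] by simp
          have eW: "\<epsilon> * W y < r"
          proof -
            have "\<epsilon> * W y \<le> \<epsilon> * (W y + 1)" using eps by simp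
            also have "\<epsilon> * (W y + 1) = r / 2" unfolding \<epsilon>_def using W0[of y] by (simp add: field_simps)
            finally show ?thesis using r by linarith
          qed
          from small[OF eps] obtain \<delta> where "\<delta> > 0" and \<delta>: "\<And>k. norm k < \<delta> \<Longrightarrow> \<bar>q k\<bar> \<le> \<epsilon> * (norm k)\<^sup>2" by blast
          from tendstoD[OF h0 \<open>\<delta> > 0\<close>] show "\<forall>\<^sub>F i in sequentially. dist (q (h (T i) y) / T i) 0 < r"
          proof (rule eventually_mono)
            fix i assume "dist (h (T i) y) 0 < \<delta>"
            then have "\<bar>q (h (T i) y)\<bar> \<le> \<epsilon> * (norm (h (T i) y))\<^sup>2" using \<delta> by simp
            also have "\<dots> \<le> \<epsilon> * (T i * W y)" using hW[OF Tpos[of i], of y] eps by simp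
            finally have "\<bar>q (h (T i) y)\<bar> / T i \<le> \<epsilon> * W y" using Tpos[of i] by (simp add: field_simps)
            with eW show "dist (q (h (T i) y) / T i) 0 < r" using Tpos[of i] by simp
          qed
        qed
      qed
    qed measurable
    then show "((\<lambda>t. (\<integral>y. q (h t y) \<partial>?G) / t) \<circ> T) \<longlonglongrightarrow> 0" by (simp add: o_def)
  qed
qed

lemma ou_semigroup_generator:
  fixes f :: "real^'n \<Rightarrow> real"
  assumes pos: "\<mu> > 0" "\<sigma> > 0"
    and df: "\<And>y. f differentiable (at y)" and dg: "gradient f differentiable (at x)"
    and bd: "bounded (range f)"
  shows "((\<lambda>t. (ou_semigroup \<sigma> \<mu> t f x - f x) / t) \<longlongrightarrow> ou_generator \<sigma> \<mu> f x) (at_right 0)"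
proof -
  let ?G = "ou_measure \<sigma> \<mu> :: (real^'n) measure"
  interpret G: prob_space ?G using pos by (rule prob_space_ou_measure)
  define g where "g = gradient f"
  define D where "D = frechet_derivative (gradient f) (at x)"
  have f': "(f has_derivative (\<lambda>v. g y \<bullet> v)) (at y)" for y
  proof -
    let ?l = "frechet_derivative f (at y)"
    have d: "(f has_derivative ?l) (at y)" using df frechet_derivative_works by blast
    then have l: "linear ?l" by (rule has_derivative_linear)
    have "?l v = g y \<bullet> v" for v
    proof -
      have "?l v = (\<Sum>i\<in>UNIV. v $ i * ?l (axis i 1))"
        using linear_axis_expansion[OF l, of v] by simp
      then show ?thesis by (simp add: g_def gradient_def inner_vec_def mult.commute)
    qed
    then have "?l = (\<lambda>v. g y \<bullet> v)" by (rule ext)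
    with d show ?thesis by simp
  qed
  have g': "(g has_derivative D) (at x)"
    unfolding g_def D_def using dg frechet_derivative_works by blast
  have D: "linear D" using g' by (rule has_derivative_linear)
  have lap: "laplacian f x = (\<Sum>i\<in>UNIV. D (axis i 1) $ i)"
  proof -
    have "gradient (\<lambda>y. gradient f y $ i) x $ i = D (axis i 1) $ i" for i
    proof -
      have "((\<lambda>y. g y $ i) has_derivative (\<lambda>v. D v $ i)) (at x)"
        using bounded_linear.has_derivative[OF bounded_linear_vec_nth g'] .
      from frechet_derivative_at[OF this]
      have "frechet_derivative (\<lambda>y. gradient f y $ i) (at x) = (\<lambda>v. D v $ i)" by (simp add: g_def)
      then show ?thesis by (simp add: gradient_def[of "\<lambda>y. gradient f y $ i"])
    qed
    then show ?thesis by (simp add: laplacian_def)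
  qed
  have [measurable]: "f \<in> borel_measurable borel"
    by (intro borel_measurable_continuous_onI continuous_at_imp_continuous_on ballI differentiable_imp_continuous_within df)
  have [measurable]: "D \<in> borel_measurable borel"
    using D by (intro borel_measurable_continuous_onI linear_continuous_on) (simp add: linear_linear)
  obtain B where B: "\<And>y. \<bar>f y\<bar> \<le> B" using bd by (auto simp: bounded_iff)
  define q where "q h = f (x + h) - f x - g x \<bullet> h - 1/2 * (h \<bullet> D h)" for h
  obtain C where C: "\<And>h. \<bar>q h\<bar> \<le> C * (norm h)\<^sup>2"
    using second_order_remainder_bound[OF f' g' B] unfolding q_def by blast
  have small: "\<exists>\<delta>>0. \<forall>h. norm h < \<delta> \<longrightarrow> \<bar>q h\<bar> \<le> \<epsilon> * (norm h)\<^sup>2" if "\<epsilon> > 0" for \<epsilon>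
    using second_order_remainder[OF f' g' that] unfolding q_def .
  have [measurable]: "q \<in> borel_measurable borel" unfolding q_def by measurable
  define e where "e t = exp (- \<mu> * t)" for t
  define s where "s t = sqrt (1 - exp (- 2 * \<mu> * t))" for t
  define h where "h t y = (e t - 1) *\<^sub>R x + s t *\<^sub>R y" for t and y :: "real^'n"
  have qi: "integrable ?G (\<lambda>y. q (h t y))" if "t > 0" for t
    using ou_semigroup_remainder(1)[OF pos _ C small that, of x] unfolding h_def e_def s_def by simp
  have q0: "((\<lambda>t. (\<integral>y. q (h t y) \<partial>?G) / t) \<longlongrightarrow> 0) (at_right 0)"
    using ou_semigroup_remainder(2)[OF pos _ C small, of x] unfolding h_def e_def s_def by simp
  have main: "ou_semigroup \<sigma> \<mu> t f x - f x = (e t - 1) * (g x \<bullet> x)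
      + 1/2 * ((e t - 1)\<^sup>2 * (x \<bullet> D x) + (s t)\<^sup>2 * (\<sigma>\<^sup>2 / (2 * \<mu>) * laplacian f x))
      + (\<integral>y. q (h t y) \<partial>?G)" if t: "t > 0" for t
  proof -
    have lin1: "linear (\<lambda>y. g x \<bullet> y)" "linear (\<lambda>y. x \<bullet> D y + y \<bullet> D x)"
      using D by (auto intro!: linearI simp: linear_add linear_cmul inner_add_left inner_add_right algebra_simps)
    note i1 = ou_measure_linear[OF pos lin1(1)] and i2 = ou_measure_linear[OF pos lin1(2)]
      and i3 = ou_measure_quadratic[OF pos D]
    have decomp: "a - b = c1 + c2 + d + (a - b - (c1 + c2) - d)" for a b c1 c2 d :: real by simp
    have dec: "f (e t *\<^sub>R x + s t *\<^sub>R y) - f x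
       = (e t - 1) * (g x \<bullet> x) + s t * (g x \<bullet> y)
         + 1/2 * ((e t - 1)\<^sup>2 * (x \<bullet> D x) + ((e t - 1) * s t) * (x \<bullet> D y + y \<bullet> D x) + (s t)\<^sup>2 * (y \<bullet> D y))
         + q (h t y)" for y
    proof -
      have x: "x + h t y = e t *\<^sub>R x + s t *\<^sub>R y" by (simp add: h_def algebra_simps)
      have gh: "g x \<bullet> h t y = (e t - 1) * (g x \<bullet> x) + s t * (g x \<bullet> y)" by (simp add: h_def inner_add_right)
      have "D (h t y) = (e t - 1) *\<^sub>R D x + s t *\<^sub>R D y" unfolding h_def by (simp only: linear_add[OF D] linear_cmul[OF D])
      then have "h t y \<bullet> D (h t y) = ((e t - 1) *\<^sub>R x + s t *\<^sub>R y) \<bullet> ((e t - 1) *\<^sub>R D x + s t *\<^sub>R D y)" by (simp add: h_def)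
      also have "\<dots> = (e t - 1)\<^sup>2 * (x \<bullet> D x) + ((e t - 1) * s t) * (x \<bullet> D y + y \<bullet> D x) + (s t)\<^sup>2 * (y \<bullet> D y)"
        by (simp add: inner_add_left inner_add_right power2_eq_square distrib_left mult_ac)
      finally have hD: "h t y \<bullet> D (h t y) = (e t - 1)\<^sup>2 * (x \<bullet> D x) + ((e t - 1) * s t) * (x \<bullet> D y + y \<bullet> D x) + (s t)\<^sup>2 * (y \<bullet> D y)" .
      show ?thesis unfolding q_def x gh hD by (rule decomp)
    qed
    have "ou_semigroup \<sigma> \<mu> t f x - f x = (\<integral>y. f (e t *\<^sub>R x + s t *\<^sub>R y) - f x \<partial>?G)"
    proof -
      have "integrable ?G (\<lambda>y. f (e t *\<^sub>R x + s t *\<^sub>R y))"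
        by (rule G.integrable_const_bound[where B=B]) (auto simp: B)
      then show ?thesis using G.prob_space by (simp add: ou_semigroup_def e_def s_def)
    qed
    also have "\<dots> = (e t - 1) * (g x \<bullet> x)
      + 1/2 * ((e t - 1)\<^sup>2 * (x \<bullet> D x) + (s t)\<^sup>2 * (\<integral>y. y \<bullet> D y \<partial>?G))
      + (\<integral>y. q (h t y) \<partial>?G)"
    proof -
      have 1: "has_bochner_integral ?G (\<lambda>y. (e t - 1) * (g x \<bullet> x)) ((e t - 1) * (g x \<bullet> x))"
        using G.prob_space by (simp add: has_bochner_integral_iff)
      have 2: "has_bochner_integral ?G (\<lambda>y. (e t - 1)\<^sup>2 * (x \<bullet> D x)) ((e t - 1)\<^sup>2 * (x \<bullet> D x))"
        using G.prob_space by (simp add: has_bochner_integral_iff)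
      have 3: "has_bochner_integral ?G (\<lambda>y. s t * (g x \<bullet> y)) (s t * 0)"
        by (intro has_bochner_integral_mult_right) (rule has_bochner_integral_iff[THEN iffD2, OF conjI[OF i1]])
      have 4: "has_bochner_integral ?G (\<lambda>y. ((e t - 1) * s t) * (x \<bullet> D y + y \<bullet> D x)) (((e t - 1) * s t) * 0)"
        by (intro has_bochner_integral_mult_right) (rule has_bochner_integral_iff[THEN iffD2, OF conjI[OF i2]])
      have 5: "has_bochner_integral ?G (\<lambda>y. (s t)\<^sup>2 * (y \<bullet> D y)) ((s t)\<^sup>2 * (\<integral>y. y \<bullet> D y \<partial>?G))"
        by (intro has_bochner_integral_mult_right) (rule has_bochner_integral_iff[THEN iffD2, OF conjI[OF i3(1) refl]])
      have 6: "has_bochner_integral ?G (\<lambda>y. q (h t y)) (\<integral>y. q (h t y) \<partial>?G)"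
        using qi[OF t] by (simp add: has_bochner_integral_iff)
      have "has_bochner_integral ?G (\<lambda>y. f (e t *\<^sub>R x + s t *\<^sub>R y) - f x)
        ((e t - 1) * (g x \<bullet> x) + s t * 0
         + 1/2 * ((e t - 1)\<^sup>2 * (x \<bullet> D x) + ((e t - 1) * s t) * 0 + (s t)\<^sup>2 * (\<integral>y. y \<bullet> D y \<partial>?G))
         + (\<integral>y. q (h t y) \<partial>?G))"
        unfolding dec by (intro has_bochner_integral_add has_bochner_integral_mult_right 1 2 3 4 5 6)
      from has_bochner_integral_integral_eq[OF this] show ?thesis by simp
    qed
    finally show ?thesis by (simp add: i3(2) lap)
  qed
  have s2: "(s t)\<^sup>2 = 1 - exp (- 2 * \<mu> * t)" if "t > 0" for t
    unfolding s_def using that pos by simp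
  have le: "((\<lambda>t. (e t - 1) / t) \<longlongrightarrow> - \<mu>) (at_right 0)"
  proof -
    have "(e has_real_derivative - \<mu>) (at 0)" unfolding e_def by (auto intro!: derivative_eq_intros)
    then have "((\<lambda>t. (e t - 1) / t) \<longlongrightarrow> - \<mu>) (at 0)" by (simp add: DERIV_def e_def)
    then show ?thesis by (rule tendsto_within_subset) auto
  qed
  have ls: "((\<lambda>t. (1 - exp (- 2 * \<mu> * t)) / t) \<longlongrightarrow> 2 * \<mu>) (at_right 0)"
  proof -
    have "((\<lambda>t. 1 - exp (- 2 * \<mu> * t)) has_real_derivative 2 * \<mu>) (at 0)" by (auto intro!: derivative_eq_intros)
    then have "((\<lambda>t. (1 - exp (- 2 * \<mu> * t)) / t) \<longlongrightarrow> 2 * \<mu>) (at 0)" by (simp add: DERIV_def)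
    then show ?thesis by (rule tendsto_within_subset) auto
  qed
  have e0: "((\<lambda>t. e t - 1) \<longlongrightarrow> 0) (at_right 0)"
  proof -
    have "((\<lambda>t. e t - 1) \<longlongrightarrow> exp (- \<mu> * 0) - 1) (at_right 0)" unfolding e_def by (intro tendsto_intros)
    then show ?thesis by simp
  qed
  have split: "a / t * b + 1/2 * (a / t * a * c + r / t * d) + k / t = (a * b + 1/2 * (a\<^sup>2 * c + r * d) + k) / t"
    if "t \<noteq> 0" for a b c d r k t :: real
    using that by (simp add: field_simps power2_eq_square)
  have "((\<lambda>t. (e t - 1) / t * (g x \<bullet> x)
      + 1/2 * ((e t - 1) / t * (e t - 1) * (x \<bullet> D x) + (1 - exp (- 2 * \<mu> * t)) / t * (\<sigma>\<^sup>2 / (2 * \<mu>) * laplacian f x))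
      + (\<integral>y. q (h t y) \<partial>?G) / t)
    \<longlongrightarrow> - \<mu> * (g x \<bullet> x) + 1/2 * (- \<mu> * 0 * (x \<bullet> D x) + 2 * \<mu> * (\<sigma>\<^sup>2 / (2 * \<mu>) * laplacian f x)) + 0) (at_right 0)"
    by (intro tendsto_intros le ls e0 q0)
  also have "- \<mu> * (g x \<bullet> x) + 1/2 * (- \<mu> * 0 * (x \<bullet> D x) + 2 * \<mu> * (\<sigma>\<^sup>2 / (2 * \<mu>) * laplacian f x)) + 0 = ou_generator \<sigma> \<mu> f x"
    using pos by (simp add: ou_generator_def g_def inner_commute)
  finally show ?thesis
  proof (rule Lim_transform_eventually)
    show "\<forall>\<^sub>F t in at_right 0. (e t - 1) / t * (g x \<bullet> x)
      + 1/2 * ((e t - 1) / t * (e t - 1) * (x \<bullet> D x) + (1 - exp (- 2 * \<mu> * t)) / t * (\<sigma>\<^sup>2 / (2 * \<mu>) * laplacian f x))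
      + (\<integral>y. q (h t y) \<partial>?G) / t = (ou_semigroup \<sigma> \<mu> t f x - f x) / t"
    proof (rule eventually_at_right_less[THEN eventually_mono])
      fix t :: real assume t: "0 < t"
      show "(e t - 1) / t * (g x \<bullet> x)
      + 1/2 * ((e t - 1) / t * (e t - 1) * (x \<bullet> D x) + (1 - exp (- 2 * \<mu> * t)) / t * (\<sigma>\<^sup>2 / (2 * \<mu>) * laplacian f x))
      + (\<integral>y. q (h t y) \<partial>?G) / t = (ou_semigroup \<sigma> \<mu> t f x - f x) / t"
        unfolding main[OF t] s2[OF t] using t by (intro split) simp
    qed
  qed
qed


subsection \<open>Test functions and weak gradients\<close>

definition poly_growth_functions :: "(real^'n \<Rightarrow> real) set" where
  "poly_growth_functions =
     {f. continuous_on UNIV f \<and> (\<exists>n::nat. ((\<lambda>x. \<bar>f x\<bar> / norm x ^ n) \<longlongrightarrow> 0) at_infinity)}"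

definition ou_mean_gradient :: "real \<Rightarrow> real \<Rightarrow> (real^'n \<Rightarrow> real) \<Rightarrow> real^'n" where
  "ou_mean_gradient \<sigma> \<mu> f = - (\<integral>x. f x *\<^sub>R gradient (ou_density \<sigma> \<mu>) x \<partial>lborel)"


subsection \<open>Spaces of finite measures\<close>

text \<open>The measurable space of all finite measures on \<open>K\<close>, with the \<open>\<sigma>\<close>-algebra generated by the
  evaluations; the analogue of \<^const>\<open>subprob_algebra\<close> without the bound on the total mass.\<close>

definition finite_measure_algebra :: "'a measure \<Rightarrow> 'a measure measure" where
  "finite_measure_algebra K =
     (SUP A \<in> sets K. vimage_algebra {M. finite_measure M \<and> sets M = sets K} (\<lambda>M. emeasure M A) borel)"

lemma space_finite_measure_algebra:
  "space (finite_measure_algebra K) = {M. finite_measure M \<and> sets M = sets K}"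
  by (auto simp add: finite_measure_algebra_def space_Sup_eq_UN)

definition compactly_supported_measures :: "('a::topological_space) measure set" where
  "compactly_supported_measures =
     {\<nu> \<in> space (finite_measure_algebra borel). \<exists>K. compact K \<and> emeasure \<nu> (- K) = 0}"


subsection \<open>The superprocess\<close>

definition branching_mechanism :: "real \<Rightarrow> real \<Rightarrow> real \<Rightarrow> real" where
  "branching_mechanism \<alpha> \<beta> l = - \<alpha> * l + \<beta> * l\<^sup>2"

text \<open>The integral equation of the log-Laplace functional. Local boundedness in time is automatic
  for a non-negative solution, as \<open>\<psi> \<ge> - \<alpha>\<^sup>2 / (4 \<beta>)\<close>; it is required here
  because the integral of a non-integrable function is \<open>0\<close> by convention.\<close>

definition log_laplace_solution ::
    "real \<Rightarrow> real \<Rightarrow> real \<Rightarrow> real \<Rightarrow> (real^'n \<Rightarrow> real) \<Rightarrow> (real^'n \<Rightarrow> real \<Rightarrow> real) \<Rightarrow> bool" where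
  "log_laplace_solution \<sigma> \<mu> \<alpha> \<beta> f u \<longleftrightarrow>
     (\<lambda>(x, t). u x t) \<in> borel_measurable borel \<and>
     (\<forall>x. \<forall>t\<ge>0. 0 \<le> u x t) \<and>
     (\<forall>T\<ge>0. \<exists>B. \<forall>x. \<forall>t\<in>{0..T}. u x t \<le> B) \<and>
     (\<forall>x. \<forall>t\<ge>0. u x t = ou_semigroup \<sigma> \<mu> t f x -
        (\<integral>s\<in>{0..t}. ou_semigroup \<sigma> \<mu> s (\<lambda>y. branching_mechanism \<alpha> \<beta> (u y (t - s))) x \<partial>lborel))"

text \<open>\<open>Q t \<eta>\<close> is the law at time \<open>t\<close> of the superprocess started from \<open>\<eta>\<close>.\<close>

definition ou_superprocess_kernel ::
    "real \<Rightarrow> real \<Rightarrow> real \<Rightarrow> real \<Rightarrow>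
     (real \<Rightarrow> (real^'n) measure \<Rightarrow> (real^'n) measure measure) \<Rightarrow> bool" where
  "ou_superprocess_kernel \<sigma> \<mu> \<alpha> \<beta> Q \<longleftrightarrow>
     (\<forall>t\<ge>0. Q t \<in> finite_measure_algebra borel \<rightarrow>\<^sub>M prob_algebra (finite_measure_algebra borel)) \<and>
     (\<forall>f. f \<in> borel_measurable borel \<and> (\<forall>x. 0 \<le> f x) \<and> bounded (range f) \<longrightarrow>
        (\<exists>u. log_laplace_solution \<sigma> \<mu> \<alpha> \<beta> f u \<and>
             (\<forall>t\<ge>0. \<forall>\<eta>\<in>space (finite_measure_algebra borel).
                - ln (\<integral>\<xi>. exp (- (\<integral>x. f x \<partial>\<xi>)) \<partial>Q t \<eta>) = (\<integral>x. u x t \<partial>\<eta>))))"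

definition natural_filtration ::
    "'w measure \<Rightarrow> 's measure \<Rightarrow> (real \<Rightarrow> 'w \<Rightarrow> 's) \<Rightarrow> real \<Rightarrow> 'w measure" where
  "natural_filtration M S X t =
     sigma (space M) (\<Union>s\<in>{0..t}. {X s -` A \<inter> space M | A. A \<in> sets S})"

definition markov_process ::
    "'w measure \<Rightarrow> 's measure \<Rightarrow> (real \<Rightarrow> 's \<Rightarrow> 's measure) \<Rightarrow> (real \<Rightarrow> 'w \<Rightarrow> 's) \<Rightarrow> bool" where
  "markov_process M S Q X \<longleftrightarrow>
     (\<forall>t\<ge>0. X t \<in> M \<rightarrow>\<^sub>M S) \<and>
     (\<forall>s\<ge>0. \<forall>t\<ge>0. \<forall>A\<in>sets S. AE \<omega> in M.
        real_cond_exp M (natural_filtration M S X s) (indicator (X (s + t) -` A \<inter> space M)) \<omega> =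
        measure (Q t (X s \<omega>)) A)"

definition ou_superprocess ::
    "real \<Rightarrow> real \<Rightarrow> real \<Rightarrow> real \<Rightarrow> (real^'n) measure \<Rightarrow> 'w measure \<Rightarrow>
     (real \<Rightarrow> 'w \<Rightarrow> (real^'n) measure) \<Rightarrow> bool" where
  "ou_superprocess \<sigma> \<mu> \<alpha> \<beta> \<nu> M X \<longleftrightarrow>
     prob_space M \<and>
     (\<exists>Q. ou_superprocess_kernel \<sigma> \<mu> \<alpha> \<beta> Q \<and>
          markov_process M (finite_measure_algebra borel) Q X) \<and>
     (AE \<omega> in M. X 0 \<omega> = \<nu>) \<and>
     (\<forall>\<omega>\<in>space M. \<forall>g::real^'n \<Rightarrow> real. continuous_on UNIV g \<and> bounded (range g) \<longrightarrow>
        (\<forall>t\<ge>0. ((\<lambda>s. \<integral>x. g x \<partial>X s \<omega>) \<longlongrightarrow> (\<integral>x. g x \<partial>X t \<omega>)) (at_right t)))"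

abbreviation total_mass :: "'a measure \<Rightarrow> real" where
  "total_mass \<nu> \<equiv> measure \<nu> (space \<nu>)"

definition non_extinction :: "'w measure \<Rightarrow> (real \<Rightarrow> 'w \<Rightarrow> 'a measure) \<Rightarrow> 'w set" where
  "non_extinction M X = space M - {\<omega>\<in>space M. ((\<lambda>t. total_mass (X t \<omega>)) \<longlongrightarrow> 0) at_top}"


subsection \<open>Modes of convergence\<close>

definition tendsto_in_distribution ::
    "'w measure \<Rightarrow> ('i \<Rightarrow> 'w \<Rightarrow> 'a::topological_space) \<Rightarrow> 'v measure \<Rightarrow> ('v \<Rightarrow> 'a) \<Rightarrow> 'i filter \<Rightarrow> bool"
  where
  "tendsto_in_distribution M Y N Z F \<longleftrightarrow>
     (\<forall>g::'a \<Rightarrow> real. continuous_on UNIV g \<and> bounded (range g) \<longrightarrow>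
        ((\<lambda>i. \<integral>\<omega>. g (Y i \<omega>) \<partial>M) \<longlongrightarrow> (\<integral>\<omega>. g (Z \<omega>) \<partial>N)) F)"

definition tendsto_in_probability ::
    "'w measure \<Rightarrow> ('i \<Rightarrow> 'w \<Rightarrow> 'a::metric_space) \<Rightarrow> ('w \<Rightarrow> 'a) \<Rightarrow> 'i filter \<Rightarrow> bool" where
  "tendsto_in_probability M Y Z F \<longleftrightarrow>
     (\<forall>\<epsilon>>0. ((\<lambda>i. measure M {\<omega>\<in>space M. dist (Y i \<omega>) (Z \<omega>) > \<epsilon>}) \<longlongrightarrow> 0) F)"

text \<open>Independence of two random variables of different types, which
  \<^const>\<open>prob_space.indep_var\<close> does not admit.\<close>

definition (in prob_space) indep_rv ::
    "'b measure \<Rightarrow> ('a \<Rightarrow> 'b) \<Rightarrow> 'c measure \<Rightarrow> ('a \<Rightarrow> 'c) \<Rightarrow> bool" where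
  "indep_rv S X T Y \<longleftrightarrow> random_variable S X \<and> random_variable T Y \<and>
     indep_set {X -` A \<inter> space M | A. A \<in> sets S} {Y -` B \<inter> space M | B. B \<in> sets T}"

end

theory Submission
  imports Defs "HOL-Complex_Analysis.Complex_Analysis"
begin

text \<open>
  For the third component, subtract from \<open>f\<close> its mean and its linear part \<open>c \<circ> x\<close>, where
  \<open>c = \<langle>grad f, \<phi>\<rangle>\<close>. The remainder \<open>g\<close> is orthogonal to \<open>1\<close> and to the coordinates, so \<open>\<P>\<^sub>t g\<close> decays
  like \<open>exp (- 2 \<mu> t)\<close>, and the second moment formula of the superprocess shows that
  \<open>exp (- (\<alpha> - \<mu>) t) \<langle>X\<^sub>t, g\<rangle>\<close> tends to \<open>0\<close> in \<open>L\<^sup>2\<close>. What is left of the component is \<open>c \<circ> H\<^sub>t\<close>.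

  For the second component, put \<open>\<kappa> = \<beta> / \<alpha>\<close>. The log-Laplace equation is explicit for constants, and with the Markov
  property it gives \<open>E (exp (- l exp (\<alpha> t) V\<^sub>\<infinity>) | X\<^sub>t) = exp (- |X\<^sub>t| l / (1 + \<kappa> l))\<close> for \<open>l \<ge> 0\<close>, hence for complex \<open>l\<close> with
  \<open>Re l \<ge> 0\<close>. Taking \<open>l = i \<theta> / sqrt |X\<^sub>t|\<close>, the characteristic function of the fluctuation given \<open>X\<^sub>t\<close> is
  \<open>exp (- \<kappa> \<theta>\<^sup>2 / (1 + i \<kappa> \<theta> / sqrt |X\<^sub>t|))\<close>, which converges to the Gaussian one on non-extinction, where
  \<open>|X\<^sub>t| \<rightarrow> \<infinity>\<close>. As this limit does not depend on \<open>X\<^sub>t\<close>, the fluctuation is asymptotically independent of the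
  other two components, which are functions of \<open>X\<^sub>t\<close>.
\<close>

section \<open>Decay of the Ornstein-Uhlenbeck semigroup\<close>

text \<open>The superprocess is known only through Laplace functionals of bounded nonnegative
  functions, each given by some solution of the integral equation. Moments are extracted from that
  equation: Gronwall bounds, valid for any solution, expand \<open>u\<close> for the datum \<theta>
  f up to an error of order \<theta>^3, and second differences at \<theta> = 0 turn this into second
  moments. Unbounded functions enter by truncation, controlled by the weights
  \<open>exp (a * norm x)\<close>: they dominate polynomials, are preserved by the semigroup
  uniformly in time, and are integrable for a compactly supported start.

  The condition \<alpha> > 2 \<mu> acts in one place: branching noise of order
  \<open>exp (\<alpha> * t)\<close> must be beaten by
  \<open>exp (2 * (\<alpha> - \<mu>) * t)\<close>.

  Non-extinction is not determined by \<open>X t\<close>, so conditioning on it does not pass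
  through the Markov property. It is replaced by survival up to time t; the error vanishes because
  extinction and \<open>V_inf = 0\<close> agree almost surely. As L2 decay gives almost sure limits
  along subsequences only, the final limits rest on the subsequence principle.\<close>

lemma integrable_ou_exp_norm:
  assumes "\<mu> > 0" "\<sigma> > 0"
  shows "integrable (ou_measure \<sigma> \<mu>) (\<lambda>y::real^'n. exp (a * norm y))"
proof -
  define k where "k = \<mu> / \<sigma>\<^sup>2"
  have k: "k > 0" using assms by (simp add: k_def)
  let ?G = "ou_measure \<sigma> \<mu> :: (real^'n) measure"
  let ?p = "ou_density \<sigma> \<mu> :: real^'n \<Rightarrow> real"
  interpret prob_space ?G using assms by (rule prob_space_ou_measure)
  \<comment> \<open>Completing the square: with r = norm y, a r - (3 k / 4) r^2 is at most a^2 / (3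
    k). The remaining quarter of the Gaussian exponent is the density at half the argument.\<close>
  define C where "C = exp (a\<^sup>2 / (3 * k))"
  have le: "?p y * exp (a * norm y) \<le> C * ?p (y /\<^sub>R 2)" for y
  proof -
    have "0 \<le> (a - (3 * k / 2) * norm y)\<^sup>2 / (3 * k)" using k by simp
    also have "\<dots> = a\<^sup>2 / (3 * k) - a * norm y + 3 * k / 4 * (norm y)\<^sup>2"
      using k by (simp add: power2_diff divide_simps) (simp add: power2_eq_square algebra_simps)
    finally have "a * norm y - k * (norm y)\<^sup>2 \<le> a\<^sup>2 / (3 * k) - k * (norm (y /\<^sub>R 2))\<^sup>2"
      by (simp add: power2_eq_square field_simps)
    then have "exp (a * norm y - k * (norm y)\<^sup>2) \<le> exp (a\<^sup>2 / (3 * k) - k * (norm (y /\<^sub>R 2))\<^sup>2)" by simp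
    then have "exp (a * norm y) * exp (- k * (norm y)\<^sup>2) \<le> C * exp (- k * (norm (y /\<^sub>R 2))\<^sup>2)"
      unfolding C_def by (simp add: mult_exp_exp)
    from mult_left_mono[OF this, of "(\<mu> / (pi * \<sigma>\<^sup>2)) powr (real CARD('n) / 2)"]
    show ?thesis by (simp add: ou_density_def k_def mult_ac)
  qed
  have one: "(\<integral>\<^sup>+y. ennreal (?p y) \<partial>lborel) = 1"
    using emeasure_space_1 by (simp add: ou_measure_def emeasure_density)
  have "(\<integral>\<^sup>+y. ennreal (exp (a * norm y)) \<partial>?G) = (\<integral>\<^sup>+y. ennreal (?p y * exp (a * norm y)) \<partial>lborel)"
    by (simp add: ou_measure_def nn_integral_density ennreal_mult)
  also have "\<dots> \<le> (\<integral>\<^sup>+y. ennreal C * ennreal (?p (y /\<^sub>R 2)) \<partial>lborel)"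
    using le by (intro nn_integral_mono) (simp add: C_def ennreal_mult [symmetric])
  also have "\<dots> = ennreal C * (\<integral>\<^sup>+y. ennreal (?p (y /\<^sub>R 2)) \<partial>lborel)"
    by (rule nn_integral_cmult) measurable
  also have "\<dots> = ennreal C * ennreal (2 ^ CARD('n))"
    by (subst nn_integral_lborel_affine[where c=2 and t=0]) (simp_all add: one)
  also have "\<dots> < \<infinity>" by (simp add: ennreal_mult_less_top)
  finally show ?thesis by (intro integrableI_nonneg) auto
qed

text \<open>The value depends on the dimension, which no real argument mentions; the type argument
  \<open>'n itself\<close> carries it.\<close>

definition ou_exp_moment :: "real \<Rightarrow> real \<Rightarrow> 'n::finite itself \<Rightarrow> real \<Rightarrow> real" where
  "ou_exp_moment \<sigma> \<mu> (_ :: 'n itself) a = (\<integral>y. exp (a * norm y) \<partial>(ou_measure \<sigma> \<mu> :: (real^'n) measure))"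

lemma ou_exp_bound:
  fixes F :: "real^'n \<Rightarrow> real"
  assumes "\<mu> > 0" "\<sigma> > 0" "F \<in> borel_measurable borel" "\<And>y. \<bar>F y\<bar> \<le> C * exp (a * norm y)"
  shows "integrable (ou_measure \<sigma> \<mu>) F"
    and "\<bar>\<integral>y. F y \<partial>ou_measure \<sigma> \<mu>\<bar> \<le> C * ou_exp_moment \<sigma> \<mu> TYPE('n) a"
proof -
  have i: "integrable (ou_measure \<sigma> \<mu>) (\<lambda>y::real^'n. C * exp (a * norm y))"
    by (intro integrable_mult_right integrable_ou_exp_norm assms)
  have C: "C \<ge> 0" using assms(4)[of 0] by simp
  show I: "integrable (ou_measure \<sigma> \<mu>) F"
    by (rule Bochner_Integration.integrable_bound[OF i]) (use assms C in \<open>auto simp: abs_mult\<close>)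
  have "\<bar>\<integral>y. F y \<partial>ou_measure \<sigma> \<mu>\<bar> \<le> (\<integral>y. \<bar>F y\<bar> \<partial>ou_measure \<sigma> \<mu>)" by (rule integral_abs_bound)
  also have "\<dots> \<le> (\<integral>y. C * exp (a * norm y) \<partial>(ou_measure \<sigma> \<mu> :: (real^'n) measure))"
    using I i assms by (intro integral_mono) auto
  finally show "\<bar>\<integral>y. F y \<partial>ou_measure \<sigma> \<mu>\<bar> \<le> C * ou_exp_moment \<sigma> \<mu> TYPE('n) a"
    by (simp add: ou_exp_moment_def)
qed

lemma ou_exp_moment_ge_1:
  assumes "\<mu> > 0" "\<sigma> > 0" "a \<ge> 0"
  shows "ou_exp_moment \<sigma> \<mu> TYPE('n::finite) a \<ge> 1"
proof -
  interpret prob_space "ou_measure \<sigma> \<mu> :: (real^'n) measure" using assms(1,2) by (rule prob_space_ou_measure)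
  have "(\<integral>y. 1 \<partial>(ou_measure \<sigma> \<mu> :: (real^'n) measure)) \<le> (\<integral>y. exp (a * norm y) \<partial>(ou_measure \<sigma> \<mu> :: (real^'n) measure))"
    using assms(3) by (intro integral_mono integrable_ou_exp_norm assms(1,2)) auto
  then show ?thesis using prob_space by (simp add: ou_exp_moment_def)
qed

lemma norm_ou_flow_le:
  fixes x y :: "real^'n"
  assumes "\<mu> > 0" "t \<ge> 0"
  shows "norm (exp (- \<mu> * t) *\<^sub>R x + sqrt (1 - exp (- 2 * \<mu> * t)) *\<^sub>R y) \<le> norm x + norm y"
proof -
  have "norm (exp (- \<mu> * t) *\<^sub>R x + sqrt (1 - exp (- 2 * \<mu> * t)) *\<^sub>R y)
     \<le> exp (- \<mu> * t) * norm x + sqrt (1 - exp (- 2 * \<mu> * t)) * norm y"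
    using norm_triangle_ineq[of "exp (- \<mu> * t) *\<^sub>R x" "sqrt (1 - exp (- 2 * \<mu> * t)) *\<^sub>R y"] assms by simp
  also have "\<dots> \<le> 1 * norm x + 1 * norm y"
    using assms by (intro add_mono mult_right_mono) auto
  finally show ?thesis by simp
qed

text \<open>The flow coefficients are at most one, so \<open>norm_ou_flow_le\<close> and the
  multiplicativity of exp separate x from y. The constant is independent of t: functions dominated
  by \<open>exp (a * norm y)\<close> stay so under the semigroup, uniformly in time.\<close>

lemma ou_semigroup_exp_bound:
  fixes F :: "real^'n \<Rightarrow> real"
  assumes "\<mu> > 0" "\<sigma> > 0" "t \<ge> 0" "a \<ge> 0"
    and [measurable]: "F \<in> borel_measurable borel" and F: "\<And>y. \<bar>F y\<bar> \<le> C * exp (a * norm y)"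
  shows "integrable (ou_measure \<sigma> \<mu>) (\<lambda>y. F (exp (- \<mu> * t) *\<^sub>R x + sqrt (1 - exp (- 2 * \<mu> * t)) *\<^sub>R y))"
    and "\<bar>ou_semigroup \<sigma> \<mu> t F x\<bar> \<le> C * ou_exp_moment \<sigma> \<mu> TYPE('n) a * exp (a * norm x)"
proof -
  have C: "C \<ge> 0" using F[of 0] by simp
  have b: "\<bar>F (exp (- \<mu> * t) *\<^sub>R x + sqrt (1 - exp (- 2 * \<mu> * t)) *\<^sub>R y)\<bar> \<le> (C * exp (a * norm x)) * exp (a * norm y)" for y
  proof -
    have "exp (a * norm (exp (- \<mu> * t) *\<^sub>R x + sqrt (1 - exp (- 2 * \<mu> * t)) *\<^sub>R y)) \<le> exp (a * (norm x + norm y))"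
      using norm_ou_flow_le[OF assms(1,3), of x y] assms(4) by (simp add: mult_left_mono)
    from order_trans[OF F mult_left_mono[OF this C]] show ?thesis
      by (simp add: distrib_left exp_add mult_ac)
  qed
  show "integrable (ou_measure \<sigma> \<mu>) (\<lambda>y. F (exp (- \<mu> * t) *\<^sub>R x + sqrt (1 - exp (- 2 * \<mu> * t)) *\<^sub>R y))"
    by (rule ou_exp_bound(1)[OF assms(1,2) _ b]) measurable
  have "\<bar>ou_semigroup \<sigma> \<mu> t F x\<bar> \<le> (C * exp (a * norm x)) * ou_exp_moment \<sigma> \<mu> TYPE('n) a"
    unfolding ou_semigroup_def by (rule ou_exp_bound(2)[OF assms(1,2) _ b]) measurable
  then show "\<bar>ou_semigroup \<sigma> \<mu> t F x\<bar> \<le> C * ou_exp_moment \<sigma> \<mu> TYPE('n) a * exp (a * norm x)"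
    by (simp add: mult_ac)
qed

section \<open>Change of variables in Gaussian integrals\<close>

lemma integral_lborel_affine:
  fixes f :: "'a::euclidean_space \<Rightarrow> real"
  assumes [measurable]: "f \<in> borel_measurable borel" and "c \<noteq> 0"
  shows "(\<integral>x. f x \<partial>lborel) = \<bar>c\<bar> ^ DIM('a) * (\<integral>x. f (t + c *\<^sub>R x) \<partial>lborel)"
  by (subst lborel_affine[OF assms(2), of t])
     (simp add: integral_density integral_distr)

text \<open>\<open>exp (\<delta> w)\<close> is the density of the rescaled Gaussian law with respect
  to the original one. The change of variables moves the dependence on \<tau> from \<open>h\<close>,
  which is merely measurable, into an explicit smooth factor. It serves for \<tau> =
  \<open>exp (- 2 * \<mu> * u)\<close>.\<close>

lemma ou_measure_scale:
  fixes h :: "real^'n \<Rightarrow> real"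
  assumes "\<mu> > 0" "\<sigma> > 0" and [measurable]: "h \<in> borel_measurable borel" and \<tau>: "0 \<le> \<tau>" "\<tau> < 1"
  defines "\<delta> \<equiv> \<lambda>w. - (real CARD('n) / 2) * ln (1 - \<tau>) - \<mu> / \<sigma>\<^sup>2 * (norm w)\<^sup>2 * (\<tau> / (1 - \<tau>))"
  shows "(\<integral>y. h (sqrt (1 - \<tau>) *\<^sub>R y) \<partial>ou_measure \<sigma> \<mu>) = (\<integral>w. h w * exp (\<delta> w) \<partial>ou_measure \<sigma> \<mu>)"
proof -
  define c where "c = sqrt (1 - \<tau>)"
  have c: "c > 0" "c \<noteq> 0" "c\<^sup>2 = 1 - \<tau>" using \<tau> by (auto simp: c_def)
  have e: "ou_density \<sigma> \<mu> (w /\<^sub>R c) = c ^ CARD('n) * (ou_density \<sigma> \<mu> w * exp (\<delta> w))" for w :: "real^'n"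
  proof -
    have "c ^ CARD('n) = exp (real CARD('n) * ln c)" using c by (simp add: exp_of_nat_mult)
    also have "ln c = ln (1 - \<tau>) / 2" using \<tau> by (simp add: c_def ln_sqrt)
    finally have cn: "c ^ CARD('n) = exp (real CARD('n) / 2 * ln (1 - \<tau>))" by simp
    have "- (\<mu> / \<sigma>\<^sup>2) * (norm (w /\<^sub>R c))\<^sup>2 = - (\<mu> / \<sigma>\<^sup>2) * (norm w)\<^sup>2 / (1 - \<tau>)"
    proof -
      have "norm (w /\<^sub>R c) = norm w / c" using c by (simp add: divide_inverse)
      then have "(norm (w /\<^sub>R c))\<^sup>2 = (norm w)\<^sup>2 / (1 - \<tau>)" using c by (simp add: power_divide)
      then show ?thesis by simp
    qed
    also have "1 / (1 - \<tau>) = 1 + \<tau> / (1 - \<tau>)" using \<tau> by (simp add: field_simps)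
    then have "- (\<mu> / \<sigma>\<^sup>2) * (norm w)\<^sup>2 / (1 - \<tau>) = - (\<mu> / \<sigma>\<^sup>2) * (norm w)\<^sup>2 * (1 + \<tau> / (1 - \<tau>))"
      by (metis times_divide_eq_right mult.right_neutral)
    also have "\<dots> = real CARD('n) / 2 * ln (1 - \<tau>) + (- (\<mu> / \<sigma>\<^sup>2) * (norm w)\<^sup>2 + \<delta> w)"
      by (simp add: \<delta>_def distrib_left)
    finally have "- (\<mu> / \<sigma>\<^sup>2) * (norm (w /\<^sub>R c))\<^sup>2 = real CARD('n) / 2 * ln (1 - \<tau>) + (- (\<mu> / \<sigma>\<^sup>2) * (norm w)\<^sup>2 + \<delta> w)" .
    then show ?thesis unfolding ou_density_def cn by (simp only: exp_add mult_ac)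
  qed
  have "(\<integral>y. h (c *\<^sub>R y) \<partial>ou_measure \<sigma> \<mu>) = (\<integral>y. ou_density \<sigma> \<mu> y * h (c *\<^sub>R y) \<partial>lborel)"
    by (simp add: ou_measure_def integral_density)
  also have "\<dots> = \<bar>inverse c\<bar> ^ CARD('n) * (\<integral>w. ou_density \<sigma> \<mu> (w /\<^sub>R c) * h w \<partial>lborel)"
    using c by (subst integral_lborel_affine[where c="inverse c" and t=0]) simp_all
  also have "\<dots> = (\<integral>w. \<bar>inverse c\<bar> ^ CARD('n) * (ou_density \<sigma> \<mu> (w /\<^sub>R c) * h w) \<partial>lborel)" by simp
  also have "\<dots> = (\<integral>w. ou_density \<sigma> \<mu> w * (h w * exp (\<delta> w)) \<partial>lborel)"
    unfolding e using c by (simp add: power_inverse mult_ac)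
  also have "\<dots> = (\<integral>w. h w * exp (\<delta> w) \<partial>ou_measure \<sigma> \<mu>)"
    by (simp add: ou_measure_def integral_density \<delta>_def)
  finally show ?thesis by (simp add: c_def)
qed

text \<open>The Cameron-Martin formula: \<open>exp (\<theta> y)\<close> is the density of the law
  translated by \<open>v\<close>. Integrability is transferred separately, since an equality of
  Bochner integrals says nothing about it.\<close>

lemma ou_measure_shift:
  fixes G :: "real^'n \<Rightarrow> real" and v :: "real^'n"
  assumes "\<mu> > 0" "\<sigma> > 0" and [measurable]: "G \<in> borel_measurable borel"
  defines "\<theta> \<equiv> \<lambda>y. \<mu> / \<sigma>\<^sup>2 * (2 * (v \<bullet> y) - (norm v)\<^sup>2)"
  shows "(\<integral>y. G (y + v) \<partial>ou_measure \<sigma> \<mu>) = (\<integral>y. G y * exp (\<theta> y) \<partial>ou_measure \<sigma> \<mu>)"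
    and "integrable (ou_measure \<sigma> \<mu>) (\<lambda>y. G (y + v)) \<longleftrightarrow> integrable (ou_measure \<sigma> \<mu>) (\<lambda>y. G y * exp (\<theta> y))"
proof -
  have "(norm (y - v))\<^sup>2 = (norm y)\<^sup>2 - (2 * (v \<bullet> y) - (norm v)\<^sup>2)" for y
    by (simp add: power2_norm_eq_inner inner_diff_left inner_diff_right inner_commute)
  then have "- (\<mu> / \<sigma>\<^sup>2) * (norm (y - v))\<^sup>2 = - (\<mu> / \<sigma>\<^sup>2) * (norm y)\<^sup>2 + \<theta> y" for y
    by (simp add: \<theta>_def right_diff_distrib)
  then have e: "ou_density \<sigma> \<mu> (y - v) = ou_density \<sigma> \<mu> y * exp (\<theta> y)" for y
    by (simp only: ou_density_def exp_add mult_ac)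
  have l: "lborel = distr lborel borel (\<lambda>x. v + x)" using lborel_distr_plus[of v] by simp
  have [measurable]: "\<theta> \<in> borel_measurable borel" unfolding \<theta>_def by measurable
  have "(\<integral>y. G y * exp (\<theta> y) \<partial>ou_measure \<sigma> \<mu>) = (\<integral>y. ou_density \<sigma> \<mu> (y - v) * G y \<partial>lborel)"
    by (simp add: ou_measure_def integral_density e mult_ac)
  also have "\<dots> = (\<integral>y. ou_density \<sigma> \<mu> y * G (v + y) \<partial>lborel)"
    by (subst l, subst integral_distr) auto
  also have "\<dots> = (\<integral>y. G (y + v) \<partial>ou_measure \<sigma> \<mu>)"
    by (simp add: ou_measure_def integral_density add.commute)
  finally show "(\<integral>y. G (y + v) \<partial>ou_measure \<sigma> \<mu>) = (\<integral>y. G y * exp (\<theta> y) \<partial>ou_measure \<sigma> \<mu>)" ..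
  have "integrable (ou_measure \<sigma> \<mu>) (\<lambda>y. G y * exp (\<theta> y)) \<longleftrightarrow> integrable lborel (\<lambda>y. ou_density \<sigma> \<mu> (y - v) * G y)"
    by (simp add: ou_measure_def integrable_density e mult_ac)
  also have "\<dots> \<longleftrightarrow> integrable lborel (\<lambda>y. ou_density \<sigma> \<mu> y * G (v + y))"
    by (subst l, subst integrable_distr_eq) auto
  also have "\<dots> \<longleftrightarrow> integrable (ou_measure \<sigma> \<mu>) (\<lambda>y. G (y + v))"
    by (simp add: ou_measure_def integrable_density add.commute)
  finally show "integrable (ou_measure \<sigma> \<mu>) (\<lambda>y. G (y + v)) \<longleftrightarrow> integrable (ou_measure \<sigma> \<mu>) (\<lambda>y. G y * exp (\<theta> y))" ..
qed

lemma exp_minus_one_bound: "\<bar>exp x - 1\<bar> \<le> \<bar>x\<bar> * (1 + exp x)" for x :: real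
proof -
  have 1: "1 + x \<le> exp x" "1 - x \<le> exp (- x)" using exp_ge_add_one_self[of x] exp_ge_add_one_self[of "- x"] by auto
  have "(1 - x) * exp x \<le> exp (- x) * exp x" using 1(2) by (intro mult_right_mono) auto
  then have 2: "exp x - 1 \<le> x * exp x" by (simp add: exp_minus algebra_simps)
  show ?thesis
  proof (cases "x \<ge> 0")
    case True then show ?thesis using 1 2 by (simp add: distrib_left)
  next
    case False
    then have "\<bar>exp x - 1\<bar> = 1 - exp x" "\<bar>x\<bar> * (1 + exp x) = - x + (- x) * exp x" "0 \<le> (- x) * exp x"
      by (auto simp: distrib_left mult_nonpos_nonneg)
    then show ?thesis using 1(1) by linarith
  qed
qed

text \<open>The shape \<open>1 + exp x\<close> covers both signs and fits the use with x =
  \<open>\<theta> y\<close>: the part with the exponential is turned by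
  \<open>ou_measure_shift\<close> into an integral of a translated function, so that only the square
  of \<open>\<theta>\<close> remains to be bounded.\<close>

lemma exp_second_order_bound: "\<bar>exp x - 1 - x\<bar> \<le> x\<^sup>2 * (1 + exp x)" for x :: real
proof -
  have 1: "1 + x \<le> exp x" "1 - x \<le> exp (- x)" using exp_ge_add_one_self[of x] exp_ge_add_one_self[of "- x"] by auto
  have "(1 - x) * exp x \<le> exp (- x) * exp x" using 1(2) by (intro mult_right_mono) auto
  then have "exp x - 1 - x \<le> x * (exp x - 1)" by (simp add: exp_minus algebra_simps)
  also have "\<dots> \<le> \<bar>x\<bar> * \<bar>exp x - 1\<bar>" by (metis abs_ge_self abs_mult)
  also have "\<dots> \<le> \<bar>x\<bar> * (\<bar>x\<bar> * (1 + exp x))" by (intro mult_left_mono exp_minus_one_bound) auto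
  finally have "exp x - 1 - x \<le> x\<^sup>2 * (1 + exp x)" by (simp add: power2_eq_square mult.assoc [symmetric])
  moreover have "0 \<le> x\<^sup>2 * (1 + exp x)" by (intro mult_nonneg_nonneg add_nonneg_nonneg) auto
  ultimately show ?thesis using 1(1) by linarith
qed

lemma square_le_2_exp: "x\<^sup>2 \<le> 2 * exp x" if "x \<ge> 0" for x :: real
  using exp_lower_Taylor_quadratic[OF that] that by simp

text \<open>The error is the integral of \<open>h w * (exp (\<delta> w) - 1)\<close>, where
  \<open>\<delta>\<close> is \<tau> times at most quadratic growth; raising the exponent from a to a
  + 1 absorbs that growth. \<open>D\<close> is uniform in \<open>h\<close> and \<open>C\<close>
  because a later instance is \<open>g w * (x \<bullet> w)\<close>, whose constant depends on
  x.\<close>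

lemma ou_measure_scale_estimate:
  assumes "\<mu> > 0" "\<sigma> > 0" "a \<ge> 0"
  shows "\<exists>D\<ge>0. \<forall>(h :: real^'n \<Rightarrow> real) C \<tau>. h \<in> borel_measurable borel \<longrightarrow> (\<forall>y. \<bar>h y\<bar> \<le> C * exp (a * norm y)) \<longrightarrow>
     0 \<le> \<tau> \<longrightarrow> \<tau> \<le> 1/2 \<longrightarrow>
     \<bar>(\<integral>y. h (sqrt (1 - \<tau>) *\<^sub>R y) \<partial>ou_measure \<sigma> \<mu>) - (\<integral>y. h y \<partial>ou_measure \<sigma> \<mu>)\<bar> \<le> D * C * \<tau>"
proof -
  let ?G = "ou_measure \<sigma> \<mu> :: (real^'n) measure"
  define k where "k = \<mu> / \<sigma>\<^sup>2"
  have k: "k > 0" using assms by (simp add: k_def)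
  define d where "d = real CARD('n)"
  have d: "d \<ge> 0" by (simp add: d_def)
  define D where "D = (d + 4 * k) * (1 + exp d) * ou_exp_moment \<sigma> \<mu> TYPE('n) (a + 1)"
  show ?thesis
  proof (intro exI conjI allI impI)
    show "D \<ge> 0" using d k ou_exp_moment_ge_1[where 'n='n, OF assms(1,2), of "a + 1"] assms(3) by (simp add: D_def)
    fix h :: "real^'n \<Rightarrow> real" and C \<tau> :: real
    assume [measurable]: "h \<in> borel_measurable borel" and h: "\<forall>y. \<bar>h y\<bar> \<le> C * exp (a * norm y)"
      and \<tau>: "0 \<le> \<tau>" "\<tau> \<le> 1/2"
    have C: "C \<ge> 0" using h[rule_format, of 0] by simp
    define \<delta> where "\<delta> w = - (real CARD('n) / 2) * ln (1 - \<tau>) - \<mu> / \<sigma>\<^sup>2 * (norm w)\<^sup>2 * (\<tau> / (1 - \<tau>))" for w :: "real^'n"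
    have [measurable]: "\<delta> \<in> borel_measurable borel" unfolding \<delta>_def by measurable
    have r: "0 \<le> \<tau> / (1 - \<tau>)" "\<tau> / (1 - \<tau>) \<le> 2 * \<tau>"
    proof -
      have "\<tau> * 1 \<le> \<tau> * (2 * (1 - \<tau>))" using \<tau> by (intro mult_left_mono) auto
      then show "\<tau> / (1 - \<tau>) \<le> 2 * \<tau>" using \<tau> by (simp add: divide_simps) (simp add: algebra_simps)
    qed (use \<tau> in auto)
    have ln: "0 \<le> - ln (1 - \<tau>)" "- ln (1 - \<tau>) \<le> 2 * \<tau>"
    proof -
      have "- ln (1 - \<tau>) = ln (inverse (1 - \<tau>))" using \<tau> by (simp add: ln_inverse)
      also have "\<dots> \<le> inverse (1 - \<tau>) - 1" using \<tau> by (intro ln_le_minus_one) auto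
      also have "\<dots> = \<tau> / (1 - \<tau>)" using \<tau> by (simp add: field_simps)
      finally show "- ln (1 - \<tau>) \<le> 2 * \<tau>" using r by linarith
    qed (use \<tau> in auto)
    have \<delta>e: "\<delta> w = d / 2 * (- ln (1 - \<tau>)) - k * (norm w)\<^sup>2 * (\<tau> / (1 - \<tau>))" for w
      by (simp add: \<delta>_def d_def k_def)
    have a1: "0 \<le> d / 2 * (- ln (1 - \<tau>))" "d / 2 * (- ln (1 - \<tau>)) \<le> d * \<tau>"
      using ln d mult_left_mono[OF ln(2), of "d/2"] by (auto simp: mult_nonneg_nonpos)
    have a2: "0 \<le> k * (norm w)\<^sup>2 * (\<tau> / (1 - \<tau>))" "k * (norm w)\<^sup>2 * (\<tau> / (1 - \<tau>)) \<le> 4 * k * \<tau> * exp (norm w)" for w :: "real^'n"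
    proof -
      show "0 \<le> k * (norm w)\<^sup>2 * (\<tau> / (1 - \<tau>))" using k r(1) by (intro mult_nonneg_nonneg) auto
      have "k * (norm w)\<^sup>2 * (\<tau> / (1 - \<tau>)) \<le> k * (2 * exp (norm w)) * (2 * \<tau>)"
        using k r by (intro mult_mono square_le_2_exp) auto
      then show "k * (norm w)\<^sup>2 * (\<tau> / (1 - \<tau>)) \<le> 4 * k * \<tau> * exp (norm w)" by (simp add: mult_ac)
    qed
    have \<delta>1: "\<bar>\<delta> w\<bar> \<le> (d + 4 * k) * \<tau> * exp (norm w)" for w
    proof -
      have "d * \<tau> * 1 \<le> d * \<tau> * exp (norm w)" using d \<tau> by (intro mult_left_mono) auto
      then show ?thesis using a1 a2[of w] unfolding \<delta>e by (simp add: distrib_right abs_le_iff)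
    qed
    \<comment> \<open>An upper bound independent of w controls \<open>exp (\<delta> w)\<close>; it
      exists because the quadratic term enters with a minus sign.\<close>
    have \<delta>2: "\<delta> w \<le> d" for w
    proof -
      have "d * \<tau> \<le> d * 1" using d \<tau> by (intro mult_left_mono) auto
      then show ?thesis using a1 a2[of w] unfolding \<delta>e by linarith
    qed
    have b: "\<bar>h w * (exp (\<delta> w) - 1)\<bar> \<le> (C * (d + 4 * k) * (1 + exp d) * \<tau>) * exp ((a + 1) * norm w)" for w
    proof -
      have "\<bar>exp (\<delta> w) - 1\<bar> \<le> \<bar>\<delta> w\<bar> * (1 + exp (\<delta> w))" by (rule exp_minus_one_bound)
      also have "\<dots> \<le> ((d + 4 * k) * \<tau> * exp (norm w)) * (1 + exp d)"
        using \<delta>1 \<delta>2 d k \<tau> by (intro mult_mono) auto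
      finally have "\<bar>h w\<bar> * \<bar>exp (\<delta> w) - 1\<bar> \<le> (C * exp (a * norm w)) * (((d + 4 * k) * \<tau> * exp (norm w)) * (1 + exp d))"
        using h C by (intro mult_mono) auto
      then show ?thesis unfolding abs_mult by (simp add: algebra_simps exp_add)
    qed
    have i1: "integrable ?G (\<lambda>w. h w * (exp (\<delta> w) - 1))"
      by (rule ou_exp_bound(1)[OF assms(1,2) _ b]) measurable
    have i2: "integrable ?G h" by (rule ou_exp_bound(1)[OF assms(1,2) _ h[rule_format]]) measurable
    have "(\<integral>y. h (sqrt (1 - \<tau>) *\<^sub>R y) \<partial>?G) = (\<integral>w. h w * exp (\<delta> w) \<partial>?G)"
      unfolding \<delta>_def by (rule ou_measure_scale[OF assms(1,2)]) (use \<tau> in auto)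
    also have "\<dots> = (\<integral>w. h w * (exp (\<delta> w) - 1) + h w \<partial>?G)"
      by (intro Bochner_Integration.integral_cong refl) (simp add: algebra_simps)
    also have "\<dots> = (\<integral>w. h w * (exp (\<delta> w) - 1) \<partial>?G) + (\<integral>w. h w \<partial>?G)"
      by (rule Bochner_Integration.integral_add[OF i1 i2])
    finally have "\<bar>(\<integral>y. h (sqrt (1 - \<tau>) *\<^sub>R y) \<partial>?G) - (\<integral>y. h y \<partial>?G)\<bar> = \<bar>\<integral>w. h w * (exp (\<delta> w) - 1) \<partial>?G\<bar>" by simp
    also have "\<dots> \<le> (C * (d + 4 * k) * (1 + exp d) * \<tau>) * ou_exp_moment \<sigma> \<mu> TYPE('n) (a + 1)"
      by (rule ou_exp_bound(2)[OF assms(1,2) _ b]) measurable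
    finally show "\<bar>(\<integral>y. h (sqrt (1 - \<tau>) *\<^sub>R y) \<partial>?G) - (\<integral>y. h y \<partial>?G)\<bar> \<le> D * C * \<tau>"
      by (simp add: D_def mult_ac)
  qed
qed

lemma inner_le_exp: "\<bar>x \<bullet> y\<bar> \<le> exp (norm x) * exp (norm y)" for x y :: "'a::real_inner"
proof -
  have l: "r \<le> exp r" for r :: real using exp_ge_add_one_self[of r] by linarith
  have "\<bar>x \<bullet> y\<bar> \<le> norm x * norm y" by (rule Cauchy_Schwarz_ineq2)
  also have "\<dots> \<le> exp (norm x) * exp (norm y)" by (intro mult_mono l) auto
  finally show ?thesis .
qed

text \<open>The hypotheses say that \<open>g\<close> is orthogonal to the Hermite polynomials of degree at most one;
  writing \<open>\<P>\<^sub>u g (x)\<close> as a Gaussian integral of a shifted and rescaled \<open>g\<close>, they cancel the terms of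
  order \<open>0\<close> and \<open>1\<close> in \<open>exp (- \<mu> u)\<close>.\<close>

lemma ou_semigroup_decay:
  fixes g :: "real^'n \<Rightarrow> real"
  assumes pos: "\<mu> > 0" "\<sigma> > 0" and a: "a \<ge> 0"
    and [measurable]: "g \<in> borel_measurable borel" and g: "\<And>y. \<bar>g y\<bar> \<le> C * exp (a * norm y)"
    and g0: "(\<integral>y. g y \<partial>ou_measure \<sigma> \<mu>) = 0" and g1: "\<And>x. (\<integral>y. g y * (x \<bullet> y) \<partial>ou_measure \<sigma> \<mu>) = 0"
  shows "\<exists>D\<ge>0. \<forall>u\<ge>0. \<forall>x. \<bar>ou_semigroup \<sigma> \<mu> u g x\<bar> \<le> D * exp (- 2 * \<mu> * u) * exp ((a + 2) * norm x)"
proof -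
  let ?G = "ou_measure \<sigma> \<mu> :: (real^'n) measure"
  let ?E = "ou_exp_moment \<sigma> \<mu> TYPE('n)"
  define k where "k = \<mu> / \<sigma>\<^sup>2"
  have k: "k > 0" using pos by (simp add: k_def)
  have C: "C \<ge> 0" using g[of 0] by simp
  have E: "?E b \<ge> 0" if "b \<ge> 0" for b using ou_exp_moment_ge_1[where 'n='n, OF pos that] by simp
  obtain D1 where D1: "D1 \<ge> 0" and D1b: "\<And>(h :: real^'n \<Rightarrow> real) C \<tau>. h \<in> borel_measurable borel \<Longrightarrow> (\<forall>y. \<bar>h y\<bar> \<le> C * exp (a * norm y)) \<Longrightarrow>
     0 \<le> \<tau> \<Longrightarrow> \<tau> \<le> 1/2 \<Longrightarrow>
     \<bar>(\<integral>y. h (sqrt (1 - \<tau>) *\<^sub>R y) \<partial>?G) - (\<integral>y. h y \<partial>?G)\<bar> \<le> D1 * C * \<tau>"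
    using ou_measure_scale_estimate[where 'n='n, OF pos a] by blast
  have "a + 1 \<ge> 0" using a by simp
  from ou_measure_scale_estimate[where 'n='n, OF pos this]
  obtain D2 where D2: "D2 \<ge> 0" and D2b: "\<And>(h :: real^'n \<Rightarrow> real) C \<tau>. h \<in> borel_measurable borel \<Longrightarrow> (\<forall>y. \<bar>h y\<bar> \<le> C * exp ((a + 1) * norm y)) \<Longrightarrow>
     0 \<le> \<tau> \<Longrightarrow> \<tau> \<le> 1/2 \<Longrightarrow>
     \<bar>(\<integral>y. h (sqrt (1 - \<tau>) *\<^sub>R y) \<partial>?G) - (\<integral>y. h y \<partial>?G)\<bar> \<le> D2 * C * \<tau>"
    by blast
  \<comment> \<open>One summand for each of \<open>T1\<close> to \<open>T4\<close> below: scaling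
    error of the mean, scaling error of the first moments, quadratic part of
    \<open>\<theta>\<close>, Taylor remainder.\<close>
  define B where "B = D1 * C + 4 * k * D2 * C + 4 * k * C * ?E a + 64 * k\<^sup>2 * C * ?E (a + 2)"
  have B: "B \<ge> 0" using D1 D2 C k E a by (simp add: B_def)
  have main: "\<bar>ou_semigroup \<sigma> \<mu> u g x\<bar> \<le> B * exp (- 2 * \<mu> * u) * exp ((a + 2) * norm x)"
    if u: "u \<ge> 0" and small: "exp (- 2 * \<mu> * u) \<le> 1/2" for u x
  proof -
    define \<tau> where "\<tau> = exp (- 2 * \<mu> * u)"
    define c where "c = sqrt (1 - \<tau>)"
    define e where "e = exp (- \<mu> * u)"
    \<comment> \<open>The Mehler argument e x + c y equals c (y + \<eta> x): a translation by
      \<open>v\<close> followed by a scaling. As \<tau> is at most 1/2, c stays away from 0 and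
      \<eta>^2 is of order \<tau>.\<close>
    define \<eta> where "\<eta> = e / c"
    have \<tau>: "0 < \<tau>" "\<tau> \<le> 1/2" using small by (auto simp: \<tau>_def)
    have e2: "e\<^sup>2 = \<tau>" by (simp add: e_def \<tau>_def exp_double [symmetric] mult.assoc)
    have c: "c > 0" "c \<le> 1" "1/2 \<le> c" "c\<^sup>2 = 1 - \<tau>"
    proof -
      have "sqrt (1/4) \<le> c" unfolding c_def using \<tau> by (intro real_sqrt_le_mono) auto
      then show "1/2 \<le> c" by (simp add: real_sqrt_divide)
    qed (use \<tau> in \<open>auto simp: c_def\<close>)
    have \<eta>2: "\<eta>\<^sup>2 \<le> 2 * \<tau>"
    proof -
      have "\<tau> * 1 \<le> \<tau> * (2 * (1 - \<tau>))" using \<tau> by (intro mult_left_mono) auto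
      then show ?thesis using \<tau> unfolding \<eta>_def power_divide c e2 by (simp add: divide_simps)
    qed
    have \<eta>: "0 \<le> \<eta>" "\<eta> \<le> 1"
    proof -
      show "0 \<le> \<eta>" using c by (simp add: \<eta>_def e_def)
      have "\<eta>\<^sup>2 \<le> 1\<^sup>2" using \<eta>2 \<tau> by simp
      then show "\<eta> \<le> 1" by (rule power2_le_imp_le) simp
    qed
    define v where "v = \<eta> *\<^sub>R x"
    define G where "G y = g (c *\<^sub>R y)" for y
    define \<theta> where "\<theta> y = k * (2 * (v \<bullet> y) - (norm v)\<^sup>2)" for y
    have [measurable]: "G \<in> borel_measurable borel" "\<theta> \<in> borel_measurable borel" unfolding G_def \<theta>_def by measurable
    have Pu: "ou_semigroup \<sigma> \<mu> u g x = (\<integral>y. G (y + v) \<partial>?G)"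
    proof -
      have "c *\<^sub>R (y + v) = e *\<^sub>R x + c *\<^sub>R y" for y using c by (simp add: v_def \<eta>_def scaleR_add_right)
      then show ?thesis unfolding ou_semigroup_def G_def by (simp add: e_def c_def \<tau>_def)
    qed
    have Gb: "\<bar>G y\<bar> \<le> C * exp (a * norm y)" for y
    proof -
      have "a * (c * norm y) \<le> a * norm y" using a c by (intro mult_left_mono) (auto simp: mult_left_le_one_le)
      then show ?thesis using order_trans[OF g[of "c *\<^sub>R y"]] C c unfolding G_def by (simp add: mult_left_mono)
    qed
    have x2: "(norm x)\<^sup>2 \<le> 2 * exp (norm x)" by (rule square_le_2_exp) simp
    have v2: "(norm v)\<^sup>2 \<le> \<eta> * (2 * exp (norm x))"
    proof -
      have "(norm v)\<^sup>2 = (\<eta> * \<eta>) * (norm x)\<^sup>2" by (simp add: v_def power2_eq_square)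
      also have "\<dots> \<le> (\<eta> * 1) * (2 * exp (norm x))" using \<eta> x2 by (intro mult_mono) auto
      finally show ?thesis by simp
    qed
    have lin: "\<bar>2 * (v \<bullet> y)\<bar> + (norm v)\<^sup>2 \<le> 4 * \<eta> * exp (norm x) * exp (norm y)" for y
    proof -
      have "\<bar>2 * (v \<bullet> y)\<bar> \<le> 2 * \<eta> * (exp (norm x) * exp (norm y))"
        using \<eta> inner_le_exp[of x y] by (simp add: v_def abs_mult mult_left_mono)
      moreover have "\<eta> * (2 * exp (norm x)) * 1 \<le> \<eta> * (2 * exp (norm x)) * exp (norm y)"
        using \<eta> by (intro mult_left_mono) auto
      ultimately show ?thesis using v2 by (simp add: mult_ac)
    qed
    have kb: "k * (\<bar>2 * (v \<bullet> y)\<bar> + (norm v)\<^sup>2) \<le> 4 * k * \<eta> * exp (norm x) * exp (norm y)" for y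
      using mult_left_mono[OF lin[of y], of k] k by (simp only: mult_ac)
    have \<theta>1: "\<bar>\<theta> y\<bar> \<le> 4 * k * \<eta> * exp (norm x) * exp (norm y)" for y
    proof -
      have "\<bar>\<theta> y\<bar> = k * \<bar>2 * (v \<bullet> y) - (norm v)\<^sup>2\<bar>" using k by (simp add: \<theta>_def abs_mult)
      also have "\<dots> \<le> k * (\<bar>2 * (v \<bullet> y)\<bar> + (norm v)\<^sup>2)"
        using k zero_le_power2[of "norm v"] by (intro mult_left_mono) linarith+
      finally show ?thesis using kb by (rule order_trans)
    qed
    have \<theta>2: "\<bar>\<theta> (y + v)\<bar> \<le> 4 * k * \<eta> * exp (norm x) * exp (norm y)" for y
    proof -
      have "\<theta> (y + v) = k * (2 * (v \<bullet> y) + (norm v)\<^sup>2)" by (simp add: \<theta>_def inner_add_right power2_norm_eq_inner)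
      then have "\<bar>\<theta> (y + v)\<bar> = k * \<bar>2 * (v \<bullet> y) + (norm v)\<^sup>2\<bar>" using k by (simp add: abs_mult)
      also have "\<dots> \<le> k * (\<bar>2 * (v \<bullet> y)\<bar> + (norm v)\<^sup>2)"
        using k zero_le_power2[of "norm v"] by (intro mult_left_mono) linarith+
      finally show ?thesis using kb by (rule order_trans)
    qed
    \<comment> \<open>Two factors \<eta> make one factor \<tau>: 32 = 16 * 2 by
      \<open>\<eta>2\<close>.\<close>
    have sq: "z\<^sup>2 \<le> 32 * k\<^sup>2 * \<tau> * exp (2 * norm x) * exp (2 * norm y)" if "\<bar>z\<bar> \<le> 4 * k * \<eta> * exp (norm x) * exp (norm y)" for z and y :: "real^'n"
    proof -
      have "z\<^sup>2 \<le> (4 * k * \<eta> * exp (norm x) * exp (norm y))\<^sup>2" using that by (metis abs_ge_zero power2_abs power_mono)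
      also have "\<dots> = 16 * k\<^sup>2 * exp (2 * norm x) * exp (2 * norm y) * \<eta>\<^sup>2"
        by (simp add: power_mult_distrib exp_double)
      also have "\<dots> \<le> 16 * k\<^sup>2 * exp (2 * norm x) * exp (2 * norm y) * (2 * \<tau>)" using \<eta>2 by (intro mult_left_mono) auto
      finally show ?thesis by (simp add: mult_ac)
    qed
    define K where "K = 32 * k\<^sup>2 * C * \<tau> * exp ((a + 2) * norm x)"
    have K: "K \<ge> 0" using C \<tau> by (simp add: K_def)
    have ex: "exp (b * norm x) \<le> exp ((a + 2) * norm x)" if "b \<le> a + 2" for b
      using that by (simp add: mult_right_mono)
    have q1: "\<bar>\<bar>G y\<bar> * (\<theta> y)\<^sup>2\<bar> \<le> K * exp ((a + 2) * norm y)" for y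
    proof -
      have "\<bar>G y\<bar> * (\<theta> y)\<^sup>2 \<le> (C * exp (a * norm y)) * (32 * k\<^sup>2 * \<tau> * exp (2 * norm x) * exp (2 * norm y))"
        using Gb sq[OF \<theta>1] C by (intro mult_mono) auto
      also have "\<dots> = (32 * k\<^sup>2 * C * \<tau> * exp (2 * norm x)) * exp ((a + 2) * norm y)"
        by (simp add: algebra_simps exp_add)
      also have "\<dots> \<le> K * exp ((a + 2) * norm y)" unfolding K_def using C \<tau> ex[of 2] a
        by (intro mult_right_mono mult_left_mono) auto
      finally show ?thesis by simp
    qed
    have q2: "\<bar>\<bar>G (y + v)\<bar> * (\<theta> (y + v))\<^sup>2\<bar> \<le> K * exp ((a + 2) * norm y)" for y
    proof -
      have "norm (y + v) \<le> norm y + norm x"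
        using norm_triangle_ineq[of y v] \<eta> mult_left_le_one_le[of "norm x" \<eta>] by (simp add: v_def)
      then have "exp (a * norm (y + v)) \<le> exp (a * norm x) * exp (a * norm y)"
        using mult_left_mono[of "norm (y + v)" "norm y + norm x" a] a by (simp add: mult_exp_exp distrib_left)
      with Gb[of "y + v"] C have "\<bar>G (y + v)\<bar> \<le> C * (exp (a * norm x) * exp (a * norm y))"
        by (meson mult_left_mono order_trans)
      then have "\<bar>G (y + v)\<bar> * (\<theta> (y + v))\<^sup>2 \<le> (C * (exp (a * norm x) * exp (a * norm y))) * (32 * k\<^sup>2 * \<tau> * exp (2 * norm x) * exp (2 * norm y))"
        using sq[OF \<theta>2] C by (intro mult_mono) auto
      also have "\<dots> = K * exp ((a + 2) * norm y)"
        by (simp add: K_def algebra_simps exp_add)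
      finally show ?thesis by simp
    qed
    have i0: "integrable ?G G" by (rule ou_exp_bound(1)[OF pos _ Gb]) measurable
    have Gxb: "\<bar>G y * (x \<bullet> y)\<bar> \<le> (C * exp (norm x)) * exp ((a + 1) * norm y)" for y
    proof -
      have "\<bar>G y\<bar> * \<bar>x \<bullet> y\<bar> \<le> (C * exp (a * norm y)) * (exp (norm x) * exp (norm y))"
        using Gb inner_le_exp C by (intro mult_mono) auto
      then show ?thesis by (simp add: abs_mult algebra_simps exp_add)
    qed
    have ix: "integrable ?G (\<lambda>y. G y * (x \<bullet> y))" by (rule ou_exp_bound(1)[OF pos _ Gxb]) measurable
    have G\<theta>: "G y * \<theta> y = 2 * k * \<eta> * (G y * (x \<bullet> y)) - k * (norm v)\<^sup>2 * G y" for y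
      by (simp add: \<theta>_def v_def algebra_simps)
    have i1: "integrable ?G (\<lambda>y. G y * \<theta> y)" unfolding G\<theta> using i0 ix by simp
    have j1: "integrable ?G (\<lambda>y. \<bar>G y\<bar> * (\<theta> y)\<^sup>2)" by (rule ou_exp_bound(1)[OF pos _ q1]) measurable
    have j2': "integrable ?G (\<lambda>y. \<bar>G (y + v)\<bar> * (\<theta> (y + v))\<^sup>2)" by (rule ou_exp_bound(1)[OF pos _ q2]) measurable
    have s: "(\<integral>y. H (y + v) \<partial>?G) = (\<integral>y. H y * exp (\<theta> y) \<partial>?G)"
      "integrable ?G (\<lambda>y. H (y + v)) \<longleftrightarrow> integrable ?G (\<lambda>y. H y * exp (\<theta> y))" if "H \<in> borel_measurable borel" for H
      using ou_measure_shift[OF pos that, of v] unfolding \<theta>_def k_def by auto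
    have j2: "integrable ?G (\<lambda>y. \<bar>G y\<bar> * (\<theta> y)\<^sup>2 * exp (\<theta> y))"
      using j2' by (subst (asm) s(2)[of "\<lambda>y. \<bar>G y\<bar> * (\<theta> y)\<^sup>2"]) auto
    have rb: "\<bar>G y * (exp (\<theta> y) - 1 - \<theta> y)\<bar> \<le> \<bar>G y\<bar> * (\<theta> y)\<^sup>2 + \<bar>G y\<bar> * (\<theta> y)\<^sup>2 * exp (\<theta> y)" for y
      using mult_left_mono[OF exp_second_order_bound[of "\<theta> y"], of "\<bar>G y\<bar>"] unfolding abs_mult by (simp add: algebra_simps)
    have i3: "integrable ?G (\<lambda>y. G y * (exp (\<theta> y) - 1 - \<theta> y))"
      by (rule Bochner_Integration.integrable_bound[OF Bochner_Integration.integrable_add[OF j1 j2]])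
         (auto intro!: always_eventually order_trans[OF rb])
    have "ou_semigroup \<sigma> \<mu> u g x = (\<integral>y. G y * exp (\<theta> y) \<partial>?G)"
      unfolding Pu by (rule s(1)) measurable
    \<comment> \<open>Taylor splitting of \<open>exp (\<theta> y)\<close>. The first two terms only
      involve integrals of \<open>G\<close> against 1 and against a linear function; by
      \<open>g0\<close> and \<open>g1\<close> these vanish up to the scaling error. The last term is
      quadratic in \<open>\<theta>\<close>.\<close>
    also have "\<dots> = (\<integral>y. G y + G y * \<theta> y + G y * (exp (\<theta> y) - 1 - \<theta> y) \<partial>?G)"
      by (intro Bochner_Integration.integral_cong refl) (simp add: algebra_simps)
    also have "\<dots> = (\<integral>y. G y \<partial>?G) + (\<integral>y. G y * \<theta> y \<partial>?G) + (\<integral>y. G y * (exp (\<theta> y) - 1 - \<theta> y) \<partial>?G)"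
      using i0 i1 i3 by simp
    also have "(\<integral>y. G y * \<theta> y \<partial>?G) = 2 * k * \<eta> * (\<integral>y. G y * (x \<bullet> y) \<partial>?G) - k * (norm v)\<^sup>2 * (\<integral>y. G y \<partial>?G)"
      unfolding G\<theta> using i0 ix by simp
    finally have eq: "ou_semigroup \<sigma> \<mu> u g x = (\<integral>y. G y \<partial>?G) + (2 * k * \<eta> * (\<integral>y. G y * (x \<bullet> y) \<partial>?G) - k * (norm v)\<^sup>2 * (\<integral>y. G y \<partial>?G)) +
        (\<integral>y. G y * (exp (\<theta> y) - 1 - \<theta> y) \<partial>?G)" .
    have "\<bar>p + (q - r) + s\<bar> \<le> \<bar>p\<bar> + \<bar>q\<bar> + \<bar>r\<bar> + \<bar>s\<bar>" for p q r s :: real by linarith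
    from this[of "\<integral>y. G y \<partial>?G" "2 * k * \<eta> * (\<integral>y. G y * (x \<bullet> y) \<partial>?G)" "k * (norm v)\<^sup>2 * (\<integral>y. G y \<partial>?G)"]
    have split: "\<bar>ou_semigroup \<sigma> \<mu> u g x\<bar> \<le> \<bar>\<integral>y. G y \<partial>?G\<bar> + \<bar>2 * k * \<eta>\<bar> * \<bar>\<integral>y. G y * (x \<bullet> y) \<partial>?G\<bar>
       + \<bar>k * (norm v)\<^sup>2\<bar> * \<bar>\<integral>y. G y \<partial>?G\<bar> + \<bar>\<integral>y. G y * (exp (\<theta> y) - 1 - \<theta> y) \<partial>?G\<bar>"
      unfolding eq abs_mult[symmetric] .
    have "\<bar>2 * k * \<eta>\<bar> = 2 * k * \<eta>" "\<bar>k * (norm v)\<^sup>2\<bar> = k * (norm v)\<^sup>2"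
      using k \<eta> by (auto simp: abs_mult)
    note split = split[unfolded this]
    have e1: "exp (norm x) \<le> exp ((a + 2) * norm x)" using ex[of 1] a by simp
    have e0: "1 \<le> exp ((a + 2) * norm x)" using a by simp
    let ?X = "exp ((a + 2) * norm x)"
    have T1: "\<bar>\<integral>y. G y \<partial>?G\<bar> \<le> D1 * C * \<tau> * ?X"
    proof -
      have "\<bar>\<integral>y. G y \<partial>?G\<bar> \<le> D1 * C * \<tau> * 1"
        using D1b[of g C \<tau>] g \<tau> unfolding g0 G_def c_def by simp
      also have "\<dots> \<le> D1 * C * \<tau> * ?X" using D1 C \<tau> e0 by (intro mult_left_mono) auto
      finally show ?thesis .
    qed
    have T2: "2 * k * \<eta> * \<bar>\<integral>y. G y * (x \<bullet> y) \<partial>?G\<bar> \<le> 4 * k * D2 * C * \<tau> * ?X"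
    proof -
      \<comment> \<open>The scaling estimate concerns \<open>h (c *\<^sub>R y)\<close>, which is c
        times \<open>G y * (x \<bullet> y)\<close>; dividing by c, at least 1/2, costs a factor
        2.\<close>
      define h where "h w = g w * (x \<bullet> w)" for w
      have hb: "\<bar>h y\<bar> \<le> (C * exp (norm x)) * exp ((a + 1) * norm y)" for y
      proof -
        have "\<bar>g y\<bar> * \<bar>x \<bullet> y\<bar> \<le> (C * exp (a * norm y)) * (exp (norm x) * exp (norm y))"
          using g inner_le_exp C by (intro mult_mono) auto
        then show ?thesis by (simp add: h_def abs_mult algebra_simps exp_add)
      qed
      have [measurable]: "h \<in> borel_measurable borel" unfolding h_def by measurable
      have "\<bar>\<integral>y. h (c *\<^sub>R y) \<partial>?G\<bar> \<le> D2 * (C * exp (norm x)) * \<tau>"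
        using D2b[of h "C * exp (norm x)" \<tau>] hb \<tau> g1[of x] unfolding h_def c_def by simp
      moreover have "(\<integral>y. h (c *\<^sub>R y) \<partial>?G) = c * (\<integral>y. G y * (x \<bullet> y) \<partial>?G)"
        by (subst integral_mult_right_zero [symmetric]) (simp add: h_def G_def mult_ac)
      ultimately have "c * \<bar>\<integral>y. G y * (x \<bullet> y) \<partial>?G\<bar> \<le> D2 * (C * exp (norm x)) * \<tau>" using c by (simp add: abs_mult)
      moreover have "1/2 * \<bar>\<integral>y. G y * (x \<bullet> y) \<partial>?G\<bar> \<le> c * \<bar>\<integral>y. G y * (x \<bullet> y) \<partial>?G\<bar>"
        using c by (intro mult_right_mono) auto
      ultimately have I: "\<bar>\<integral>y. G y * (x \<bullet> y) \<partial>?G\<bar> \<le> 2 * (D2 * (C * exp (norm x)) * \<tau>)" by linarith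
      have "2 * k * \<eta> * \<bar>\<integral>y. G y * (x \<bullet> y) \<partial>?G\<bar> \<le> 2 * k * 1 * (2 * (D2 * (C * exp (norm x)) * \<tau>))"
        using I \<eta> k by (intro mult_mono) auto
      also have "\<dots> = 4 * k * D2 * C * \<tau> * exp (norm x)" by (simp add: mult_ac)
      also have "\<dots> \<le> 4 * k * D2 * C * \<tau> * ?X" using D2 C \<tau> k e1 by (intro mult_left_mono) auto
      finally show ?thesis .
    qed
    \<comment> \<open>\<open>(norm v)\<^sup>2\<close> carries \<eta>^2 and is thus already of order
      \<tau>, so a crude bound on the mean of \<open>G\<close> will do.\<close>
    have T3: "k * (norm v)\<^sup>2 * \<bar>\<integral>y. G y \<partial>?G\<bar> \<le> 4 * k * C * ?E a * \<tau> * ?X"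
    proof -
      have I: "\<bar>\<integral>y. G y \<partial>?G\<bar> \<le> C * ?E a" by (rule ou_exp_bound(2)[OF pos _ Gb]) measurable
      have "(norm v)\<^sup>2 \<le> (2 * \<tau>) * (2 * exp (norm x))"
      proof -
        have "(norm v)\<^sup>2 = \<eta>\<^sup>2 * (norm x)\<^sup>2" by (simp add: v_def power_mult_distrib)
        also have "\<dots> \<le> (2 * \<tau>) * (2 * exp (norm x))" using x2 \<eta>2 \<tau> by (intro mult_mono) auto
        finally show ?thesis .
      qed
      then have "k * (norm v)\<^sup>2 * \<bar>\<integral>y. G y \<partial>?G\<bar> \<le> k * ((2 * \<tau>) * (2 * exp (norm x))) * (C * ?E a)"
        using I k \<tau> by (intro mult_mono) auto
      also have "\<dots> = 4 * k * C * ?E a * \<tau> * exp (norm x)" by (simp add: mult_ac)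
      also have "\<dots> \<le> 4 * k * C * ?E a * \<tau> * ?X" using C k E[OF a] \<tau> e1 by (intro mult_left_mono) auto
      finally show ?thesis .
    qed
    have T4: "\<bar>\<integral>y. G y * (exp (\<theta> y) - 1 - \<theta> y) \<partial>?G\<bar> \<le> 64 * k\<^sup>2 * C * ?E (a + 2) * \<tau> * ?X"
    proof -
      have "\<bar>\<integral>y. G y * (exp (\<theta> y) - 1 - \<theta> y) \<partial>?G\<bar> \<le> (\<integral>y. \<bar>G y * (exp (\<theta> y) - 1 - \<theta> y)\<bar> \<partial>?G)" by (rule integral_abs_bound)
      also have "\<dots> \<le> (\<integral>y. \<bar>G y\<bar> * (\<theta> y)\<^sup>2 + \<bar>G y\<bar> * (\<theta> y)\<^sup>2 * exp (\<theta> y) \<partial>?G)"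
        using i3 j1 j2 rb by (intro integral_mono) auto
      also have "\<dots> = (\<integral>y. \<bar>G y\<bar> * (\<theta> y)\<^sup>2 \<partial>?G) + (\<integral>y. \<bar>G y\<bar> * (\<theta> y)\<^sup>2 * exp (\<theta> y) \<partial>?G)"
        using j1 j2 by simp
      \<comment> \<open>Undoing the Cameron-Martin shift removes the exponential of
        \<open>\<theta>\<close>.\<close>
      also have "(\<integral>y. \<bar>G y\<bar> * (\<theta> y)\<^sup>2 * exp (\<theta> y) \<partial>?G) = (\<integral>y. \<bar>G (y + v)\<bar> * (\<theta> (y + v))\<^sup>2 \<partial>?G)"
        by (rule s(1) [symmetric]) measurable
      also have "(\<integral>y. \<bar>G y\<bar> * (\<theta> y)\<^sup>2 \<partial>?G) + \<dots> \<le> K * ?E (a + 2) + K * ?E (a + 2)"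
      proof (rule add_mono)
        have "\<bar>\<integral>y. \<bar>G y\<bar> * (\<theta> y)\<^sup>2 \<partial>?G\<bar> \<le> K * ?E (a + 2)" by (rule ou_exp_bound(2)[OF pos _ q1]) measurable
        then show "(\<integral>y. \<bar>G y\<bar> * (\<theta> y)\<^sup>2 \<partial>?G) \<le> K * ?E (a + 2)" by linarith
        have "\<bar>\<integral>y. \<bar>G (y + v)\<bar> * (\<theta> (y + v))\<^sup>2 \<partial>?G\<bar> \<le> K * ?E (a + 2)" by (rule ou_exp_bound(2)[OF pos _ q2]) measurable
        then show "(\<integral>y. \<bar>G (y + v)\<bar> * (\<theta> (y + v))\<^sup>2 \<partial>?G) \<le> K * ?E (a + 2)" by linarith
      qed
      also have "\<dots> = 64 * k\<^sup>2 * C * ?E (a + 2) * \<tau> * ?X" by (simp add: K_def mult_ac)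
      finally show ?thesis .
    qed
    have "\<bar>ou_semigroup \<sigma> \<mu> u g x\<bar> \<le> D1 * C * \<tau> * ?X + 4 * k * D2 * C * \<tau> * ?X + 4 * k * C * ?E a * \<tau> * ?X + 64 * k\<^sup>2 * C * ?E (a + 2) * \<tau> * ?X"
      using split T1 T2 T3 T4 by linarith
    also have "\<dots> = B * \<tau> * ?X" by (simp add: B_def algebra_simps)
    finally show ?thesis by (simp add: \<tau>_def)
  qed
  show ?thesis
  proof (intro exI conjI allI impI)
    show "B + 2 * C * ?E a \<ge> 0" using B C E[OF a] by simp
    fix u :: real and x :: "real^'n" assume u: "u \<ge> 0"
    let ?X = "exp ((a + 2) * norm x)"
    show "\<bar>ou_semigroup \<sigma> \<mu> u g x\<bar> \<le> (B + 2 * C * ?E a) * exp (- 2 * \<mu> * u) * ?X"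
    proof (cases "exp (- 2 * \<mu> * u) \<le> 1/2")
      case True
      have "0 \<le> 2 * C * ?E a * exp (- 2 * \<mu> * u) * ?X" using C E[OF a] by simp
      with main[OF u True, of x] show ?thesis by (simp add: distrib_right)
    next
      case False
      \<comment> \<open>In this range of u nothing has decayed yet: 1 < 2
        \<open>exp (- 2 * \<mu> * u)\<close>, so the time-independent bound is enough up to a factor
        2.\<close>
      have "\<bar>ou_semigroup \<sigma> \<mu> u g x\<bar> \<le> C * ?E a * exp (a * norm x)"
        by (rule ou_semigroup_exp_bound(2)[OF pos u a _ g]) measurable
      also have "\<dots> = (C * ?E a) * (1 * exp (a * norm x))" by simp
      also have "\<dots> \<le> (C * ?E a) * ((2 * exp (- 2 * \<mu> * u)) * ?X)"
        using False C E[OF a] by (intro mult_left_mono mult_mono) (auto simp: mult_right_mono)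
      finally have "\<bar>ou_semigroup \<sigma> \<mu> u g x\<bar> \<le> 2 * C * ?E a * exp (- 2 * \<mu> * u) * ?X" by (simp add: mult_ac)
      moreover have "0 \<le> B * exp (- 2 * \<mu> * u) * ?X" using B by simp
      ultimately show ?thesis by (simp add: distrib_right)
    qed
  qed
qed

section \<open>Measurability on the space of finite measures\<close>

lemma measurable_emeasure_finite_measure_algebra[measurable]:
  "A \<in> sets K \<Longrightarrow> (\<lambda>M. emeasure M A) \<in> borel_measurable (finite_measure_algebra K)"
  by (auto intro!: measurable_Sup1 measurable_vimage_algebra1 simp: finite_measure_algebra_def)

text \<open>Induction over nonnegative measurable functions; the indicators are the base case, since
  evaluations generate the \<sigma>-algebra.\<close>

lemma nn_integral_measurable_finite_measure_algebra[measurable]: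
  assumes f: "f \<in> borel_measurable N"
  shows "(\<lambda>M. integral\<^sup>N M f) \<in> borel_measurable (finite_measure_algebra N)" (is "_ \<in> ?B")
  using f
proof induct
  case (cong f g)
  moreover have "(\<lambda>M'. \<integral>\<^sup>+M''. f M'' \<partial>M') \<in> ?B \<longleftrightarrow> (\<lambda>M'. \<integral>\<^sup>+M''. g M'' \<partial>M') \<in> ?B"
    by (intro measurable_cong nn_integral_cong cong)
       (auto simp: space_finite_measure_algebra dest!: sets_eq_imp_space_eq)
  ultimately show ?case by simp
next
  case (set B)
  then have "(\<lambda>M'. \<integral>\<^sup>+M''. indicator B M'' \<partial>M') \<in> ?B \<longleftrightarrow> (\<lambda>M'. emeasure M' B) \<in> ?B"
    by (intro measurable_cong nn_integral_indicator) (simp add: space_finite_measure_algebra)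
  with set show ?case by simp
next
  case (mult f c)
  then have "(\<lambda>M'. \<integral>\<^sup>+M''. c * f M'' \<partial>M') \<in> ?B \<longleftrightarrow> (\<lambda>M'. c * \<integral>\<^sup>+M''. f M'' \<partial>M') \<in> ?B"
    by (intro measurable_cong nn_integral_cmult) (auto simp add: space_finite_measure_algebra)
  with mult show ?case by simp
next
  case (add f g)
  then have "(\<lambda>M'. \<integral>\<^sup>+M''. f M'' + g M'' \<partial>M') \<in> ?B \<longleftrightarrow> (\<lambda>M'. (\<integral>\<^sup>+M''. f M'' \<partial>M') + (\<integral>\<^sup>+M''. g M'' \<partial>M')) \<in> ?B"
    by (intro measurable_cong nn_integral_add) (auto simp add: space_finite_measure_algebra)
  with add show ?case by (simp add: ac_simps)
next
  case (seq F)
  then have "(\<lambda>M'. \<integral>\<^sup>+M''. (SUP i. F i) M'' \<partial>M') \<in> ?B \<longleftrightarrow> (\<lambda>M'. SUP i. (\<integral>\<^sup>+M''. F i M'' \<partial>M')) \<in> ?B"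
    unfolding SUP_apply
    by (intro measurable_cong nn_integral_monotone_convergence_SUP) (auto simp add: space_finite_measure_algebra)
  with seq show ?case by (simp add: ac_simps)
qed

lemma integral_measurable_finite_measure_algebra[measurable]:
  fixes f :: "'a \<Rightarrow> real"
  assumes [measurable]: "f \<in> borel_measurable N"
  shows "(\<lambda>M. integral\<^sup>L M f) \<in> borel_measurable (finite_measure_algebra N)"
proof -
  \<comment> \<open>The Bochner integral of a non-integrable function is 0. The test on
    \<open>\<bar>f x\<bar>\<close> reproduces this default, so that the formula holds at every
    measure of the space.\<close>
  let ?g = "\<lambda>M. if (\<integral>\<^sup>+x. ennreal \<bar>f x\<bar> \<partial>M) < \<infinity> then enn2real (\<integral>\<^sup>+x. ennreal (f x) \<partial>M) - enn2real (\<integral>\<^sup>+x. ennreal (- f x) \<partial>M) else 0"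
  have "integral\<^sup>L M f = ?g M" if "M \<in> space (finite_measure_algebra N)" for M
  proof -
    have "sets M = sets N" using that by (simp add: space_finite_measure_algebra)
    then have [measurable_cong]: "sets M = sets N" .
    have "integrable M f \<longleftrightarrow> (\<integral>\<^sup>+x. ennreal \<bar>f x\<bar> \<partial>M) < \<infinity>" by (simp add: integrable_iff_bounded)
    then show ?thesis using real_lebesgue_integral_def[of M f] not_integrable_integral_eq[of M f] by auto
  qed
  then have "(\<lambda>M. integral\<^sup>L M f) \<in> borel_measurable (finite_measure_algebra N) \<longleftrightarrow> ?g \<in> borel_measurable (finite_measure_algebra N)"
    by (rule measurable_cong)
  also have "\<dots>" by measurable
  finally show ?thesis .
qed

lemma measurable_total_mass[measurable]: "total_mass \<in> borel_measurable (finite_measure_algebra N)"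
proof -
  have "total_mass M = enn2real (emeasure M (space N))" if "M \<in> space (finite_measure_algebra N)" for M
    using that by (auto simp: space_finite_measure_algebra measure_def dest: sets_eq_imp_space_eq)
  then have "total_mass \<in> borel_measurable (finite_measure_algebra N) \<longleftrightarrow> (\<lambda>M. enn2real (emeasure M (space N))) \<in> borel_measurable (finite_measure_algebra N)"
    by (rule measurable_cong)
  also have "\<dots>" by measurable
  finally show ?thesis .
qed

section \<open>Duhamel integrals\<close>

text \<open>Time, function and point may all vary with the parameter \<open>a\<close>: in a Duhamel
  integral the function under the semigroup at time s is itself \<open>F y (t - s)\<close>.\<close>

lemma measurable_ou_semigroup:
  fixes H :: "'a \<Rightarrow> real^'n \<Rightarrow> real" and x :: "'a \<Rightarrow> real^'n" and s :: "'a \<Rightarrow> real"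
  assumes "\<mu> > 0" "\<sigma> > 0"
    and [measurable]: "(\<lambda>(a, y). H a y) \<in> borel_measurable (N \<Otimes>\<^sub>M borel)" "x \<in> borel_measurable N" "s \<in> borel_measurable N"
  shows "(\<lambda>a. ou_semigroup \<sigma> \<mu> (s a) (H a) (x a)) \<in> borel_measurable N"
proof -
  interpret prob_space "ou_measure \<sigma> \<mu> :: (real^'n) measure" using assms(1,2) by (rule prob_space_ou_measure)
  have "(\<lambda>p. (case p of (a, y) \<Rightarrow> H a y)) \<circ> (\<lambda>(a, y). (a, exp (- \<mu> * s a) *\<^sub>R x a + sqrt (1 - exp (- 2 * \<mu> * s a)) *\<^sub>R y))
     \<in> borel_measurable (N \<Otimes>\<^sub>M ou_measure \<sigma> \<mu>)"
    by (rule measurable_comp[of _ _ "N \<Otimes>\<^sub>M borel"]) measurable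
  then have [measurable]: "(\<lambda>(a, y). H a (exp (- \<mu> * s a) *\<^sub>R x a + sqrt (1 - exp (- 2 * \<mu> * s a)) *\<^sub>R y)) \<in> borel_measurable (N \<Otimes>\<^sub>M ou_measure \<sigma> \<mu>)"
    by (simp add: comp_def case_prod_unfold)
  show ?thesis unfolding ou_semigroup_def by measurable
qed

lemma ou_semigroup_const:
  assumes "\<mu> > 0" "\<sigma> > 0"
  shows "ou_semigroup \<sigma> \<mu> t (\<lambda>_. c) (x :: real^'n) = c"
proof -
  interpret prob_space "ou_measure \<sigma> \<mu> :: (real^'n) measure" using assms by (rule prob_space_ou_measure)
  show ?thesis using prob_space by (simp add: ou_semigroup_def)
qed

lemma ou_semigroup_bounded_integrable:
  fixes F :: "real^'n \<Rightarrow> real"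
  assumes "\<mu> > 0" "\<sigma> > 0"
    and [measurable]: "F \<in> borel_measurable borel" and F: "\<And>y. \<bar>F y\<bar> \<le> B"
  shows "integrable (ou_measure \<sigma> \<mu>) (\<lambda>y. F (exp (- \<mu> * t) *\<^sub>R x + sqrt (1 - exp (- 2 * \<mu> * t)) *\<^sub>R y))"
proof -
  interpret prob_space "ou_measure \<sigma> \<mu> :: (real^'n) measure" using assms(1,2) by (rule prob_space_ou_measure)
  show ?thesis by (rule integrable_const_bound[where B=B]) (auto simp: F)
qed

lemma ou_semigroup_abs_le:
  fixes F :: "real^'n \<Rightarrow> real"
  assumes "\<mu> > 0" "\<sigma> > 0"
    and [measurable]: "F \<in> borel_measurable borel" and F: "\<And>y. \<bar>F y\<bar> \<le> B"
  shows "\<bar>ou_semigroup \<sigma> \<mu> t F x\<bar> \<le> B"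
proof -
  interpret prob_space "ou_measure \<sigma> \<mu> :: (real^'n) measure" using assms(1,2) by (rule prob_space_ou_measure)
  have "\<bar>ou_semigroup \<sigma> \<mu> t F x\<bar> \<le> (\<integral>y. \<bar>F (exp (- \<mu> * t) *\<^sub>R x + sqrt (1 - exp (- 2 * \<mu> * t)) *\<^sub>R y)\<bar> \<partial>ou_measure \<sigma> \<mu>)"
    unfolding ou_semigroup_def by (rule integral_abs_bound)
  also have "\<dots> \<le> (\<integral>y. B \<partial>(ou_measure \<sigma> \<mu> :: (real^'n) measure))"
    using ou_semigroup_bounded_integrable[OF assms] by (intro integral_mono) (auto simp: F)
  finally show ?thesis using prob_space by simp
qed

lemma ou_semigroup_lincomb:
  fixes F G :: "real^'n \<Rightarrow> real"
  assumes "\<mu> > 0" "\<sigma> > 0"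
    and "F \<in> borel_measurable borel" "\<And>y. \<bar>F y\<bar> \<le> B"
    and "G \<in> borel_measurable borel" "\<And>y. \<bar>G y\<bar> \<le> B'"
  shows "ou_semigroup \<sigma> \<mu> t (\<lambda>y. a * F y + b * G y) x = a * ou_semigroup \<sigma> \<mu> t F x + b * ou_semigroup \<sigma> \<mu> t G x"
  using ou_semigroup_bounded_integrable[OF assms(1-4), of t x] ou_semigroup_bounded_integrable[OF assms(1,2,5,6), of t x]
  by (simp add: ou_semigroup_def)

text \<open>The mild-form integral of a source \<open>F\<close>. For \<rho> = 0 it is the integral
  of the log-Laplace equation; for \<rho> = \<alpha> the linear growth term has been absorbed into
  the semigroup.\<close>

definition ou_duhamel :: "real \<Rightarrow> real \<Rightarrow> real \<Rightarrow> (real^'n \<Rightarrow> real \<Rightarrow> real) \<Rightarrow> real^'n \<Rightarrow> real \<Rightarrow> real" where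
  "ou_duhamel \<sigma> \<mu> \<rho> F x t = (\<integral>s\<in>{0..t}. exp (\<rho> * s) * ou_semigroup \<sigma> \<mu> s (\<lambda>y. F y (t - s)) x \<partial>lborel)"

lemma ou_duhamel_measurable_integrand:
  fixes F :: "real^'n \<Rightarrow> real \<Rightarrow> real"
  assumes "\<mu> > 0" "\<sigma> > 0" and [measurable]: "(\<lambda>(y, r). F y r) \<in> borel_measurable borel"
  shows "(\<lambda>(s, x, t). ou_semigroup \<sigma> \<mu> s (\<lambda>y. F y (t - s)) x) \<in> borel_measurable (borel \<Otimes>\<^sub>M borel \<Otimes>\<^sub>M borel)"
proof -
  have m: "(\<lambda>(y, r). F y r) \<in> borel_measurable (borel \<Otimes>\<^sub>M borel)" unfolding borel_prod by measurable
  have "(\<lambda>(y, r). F y r) \<circ> (\<lambda>(p, y). (y, snd (snd p) - fst p)) \<in> borel_measurable ((borel \<Otimes>\<^sub>M borel \<Otimes>\<^sub>M borel) \<Otimes>\<^sub>M borel)"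
    by (rule measurable_comp[OF _ m]) measurable
  then have "(\<lambda>(p, y). (\<lambda>p y. F y (snd (snd p) - fst p)) p y) \<in> borel_measurable (((borel :: real measure) \<Otimes>\<^sub>M (borel :: (real^'n) measure) \<Otimes>\<^sub>M borel) \<Otimes>\<^sub>M borel)"
    by (simp add: comp_def case_prod_unfold)
  from measurable_ou_semigroup[OF assms(1,2) this, of "\<lambda>p. fst (snd p)" fst]
  show ?thesis by (simp add: case_prod_unfold)
qed

context
  fixes \<sigma> \<mu> :: real
  assumes pos: "\<mu> > 0" "\<sigma> > 0"
begin

lemma measurable_ou_duhamel:
  fixes F :: "real^'n \<Rightarrow> real \<Rightarrow> real"
  assumes "(\<lambda>(y, r). F y r) \<in> borel_measurable borel"
  shows "(\<lambda>(x, t). ou_duhamel \<sigma> \<mu> \<rho> F x t) \<in> borel_measurable borel"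
proof -
  have [measurable]: "(\<lambda>(s, x, t). ou_semigroup \<sigma> \<mu> s (\<lambda>y. F y (t - s)) x) \<in> borel_measurable (borel \<Otimes>\<^sub>M borel \<Otimes>\<^sub>M borel)"
    by (rule ou_duhamel_measurable_integrand[OF pos assms])
  have "(\<lambda>p. (snd p, fst (fst p), snd (fst p))) \<in> ((borel :: (real^'n) measure) \<Otimes>\<^sub>M (borel :: real measure)) \<Otimes>\<^sub>M lborel \<rightarrow>\<^sub>M borel \<Otimes>\<^sub>M borel \<Otimes>\<^sub>M borel"
    by measurable
  from measurable_compose[OF this ou_duhamel_measurable_integrand[OF pos assms]]
  have [measurable]: "(\<lambda>p. ou_semigroup \<sigma> \<mu> (snd p) (\<lambda>y. F y (snd (fst p) - snd p)) (fst (fst p))) \<in> borel_measurable ((borel \<Otimes>\<^sub>M borel) \<Otimes>\<^sub>M lborel)"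
    by (simp only: prod.case)
  have [measurable]: "Measurable.pred ((borel \<Otimes>\<^sub>M borel) \<Otimes>\<^sub>M lborel) (\<lambda>p. snd p \<in> {0..snd (fst p) :: real})"
    by simp
  have "(\<lambda>p. \<integral>s. indicator {0..snd p} s * (exp (\<rho> * s) * ou_semigroup \<sigma> \<mu> s (\<lambda>y. F y (snd p - s)) (fst p)) \<partial>lborel) \<in> borel_measurable (borel \<Otimes>\<^sub>M borel)"
    unfolding indicator_def by (rule lborel.borel_measurable_lebesgue_integral) (simp add: case_prod_unfold)
  then show ?thesis by (simp add: ou_duhamel_def set_lebesgue_integral_def borel_prod case_prod_unfold)
qed

lemma ou_duhamel_integrand_measurable:
  fixes F :: "real^'n \<Rightarrow> real \<Rightarrow> real"
  assumes "(\<lambda>(y, r). F y r) \<in> borel_measurable borel"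
  shows "(\<lambda>s. ou_semigroup \<sigma> \<mu> s (\<lambda>y. F y (t - s)) x) \<in> borel_measurable borel"
proof -
  have "(\<lambda>(s, x, t). ou_semigroup \<sigma> \<mu> s (\<lambda>y. F y (t - s)) x) \<circ> (\<lambda>s. (s, x, t)) \<in> borel_measurable borel"
    by (rule measurable_comp[OF _ ou_duhamel_measurable_integrand[OF pos assms]]) measurable
  then show ?thesis by (simp add: comp_def)
qed

lemma ou_slice_measurable:
  fixes F :: "real^'n \<Rightarrow> real \<Rightarrow> real"
  assumes "(\<lambda>(y, r). F y r) \<in> borel_measurable borel"
  shows "(\<lambda>y. F y r) \<in> borel_measurable borel"
proof -
  have m: "(\<lambda>(y, r). F y r) \<in> borel_measurable (borel \<Otimes>\<^sub>M borel)" using assms unfolding borel_prod .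
  have "(\<lambda>(y, r). F y r) \<circ> (\<lambda>y. (y, r)) \<in> borel_measurable borel" by (rule measurable_comp[OF _ m]) measurable
  then show ?thesis by (simp add: comp_def)
qed

lemma ou_duhamel_integrable:
  fixes F :: "real^'n \<Rightarrow> real \<Rightarrow> real"
  assumes m: "(\<lambda>(y, r). F y r) \<in> borel_measurable borel" and B: "\<And>y r. r \<in> {0..t} \<Longrightarrow> \<bar>F y r\<bar> \<le> B"
  shows "set_integrable lborel {0..t} (\<lambda>s. exp (\<rho> * s) * ou_semigroup \<sigma> \<mu> s (\<lambda>y. F y (t - s)) x)"
proof (rule set_integrable_bound)
  show "set_integrable lborel {0..t} (\<lambda>s. exp (\<rho> * s) * B)"
    by (rule borel_integrable_atLeastAtMost') (intro continuous_intros)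
  show "set_borel_measurable lborel {0..t} (\<lambda>s. exp (\<rho> * s) * ou_semigroup \<sigma> \<mu> s (\<lambda>y. F y (t - s)) x)"
    unfolding set_borel_measurable_def using ou_duhamel_integrand_measurable[OF m, of t x] by measurable
  have "\<bar>ou_semigroup \<sigma> \<mu> s (\<lambda>y. F y (t - s)) x\<bar> \<le> B" if "s \<in> {0..t}" for s
    by (rule ou_semigroup_abs_le[OF pos ou_slice_measurable[OF m]]) (use B that in auto)
  moreover have "B \<ge> 0" if "s \<in> {0..t}" for s using B[of s 0] that by auto
  ultimately show "AE s in lborel. s \<in> {0..t} \<longrightarrow> norm (exp (\<rho> * s) * ou_semigroup \<sigma> \<mu> s (\<lambda>y. F y (t - s)) x) \<le> norm (exp (\<rho> * s) * B)"
    by (intro always_eventually) (auto simp: abs_mult)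
qed

text \<open>The bound may vary in time because the Gronwall iteration inserts an exponential for
  \<open>b\<close>.\<close>

lemma ou_duhamel_abs_le:
  fixes F :: "real^'n \<Rightarrow> real \<Rightarrow> real"
  assumes m: "(\<lambda>(y, r). F y r) \<in> borel_measurable borel" and B: "\<And>y r. r \<in> {0..t} \<Longrightarrow> \<bar>F y r\<bar> \<le> b r"
    and b: "continuous_on {0..t} b"
  shows "\<bar>ou_duhamel \<sigma> \<mu> \<rho> F x t\<bar> \<le> (\<integral>s\<in>{0..t}. exp (\<rho> * s) * b (t - s) \<partial>lborel)"
proof -
  obtain B' where B': "\<And>r. r \<in> {0..t} \<Longrightarrow> \<bar>b r\<bar> \<le> B'"
    using compact_imp_bounded[OF compact_continuous_image[OF b compact_Icc]] by (auto simp: bounded_iff simp del: atLeastAtMost_iff)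
  have i: "set_integrable lborel {0..t} (\<lambda>s. exp (\<rho> * s) * ou_semigroup \<sigma> \<mu> s (\<lambda>y. F y (t - s)) x)"
    by (rule ou_duhamel_integrable[OF m, where B=B']) (use B B' in \<open>meson order_trans abs_ge_self\<close>)
  have "norm (ou_duhamel \<sigma> \<mu> \<rho> F x t) \<le> (\<integral>s\<in>{0..t}. norm (exp (\<rho> * s) * ou_semigroup \<sigma> \<mu> s (\<lambda>y. F y (t - s)) x) \<partial>lborel)"
    unfolding ou_duhamel_def by (rule set_integral_norm_bound[OF i])
  also have "\<dots> \<le> (\<integral>s\<in>{0..t}. exp (\<rho> * s) * b (t - s) \<partial>lborel)"
  proof (rule set_integral_mono)
    show "set_integrable lborel {0..t} (\<lambda>s. exp (\<rho> * s) * b (t - s))"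
      by (rule borel_integrable_atLeastAtMost') (intro continuous_intros continuous_on_compose2[OF b], auto)
    show "set_integrable lborel {0..t} (\<lambda>s. norm (exp (\<rho> * s) * ou_semigroup \<sigma> \<mu> s (\<lambda>y. F y (t - s)) x))"
      by (rule set_integrable_norm[OF i])
    fix s assume "s \<in> {0..t}"
    then have "\<bar>ou_semigroup \<sigma> \<mu> s (\<lambda>y. F y (t - s)) x\<bar> \<le> b (t - s)"
      by (intro ou_semigroup_abs_le[OF pos ou_slice_measurable[OF m]] B) auto
    then show "norm (exp (\<rho> * s) * ou_semigroup \<sigma> \<mu> s (\<lambda>y. F y (t - s)) x) \<le> exp (\<rho> * s) * b (t - s)"
      by (simp add: abs_mult)
  qed
  finally show ?thesis by simp
qed

lemma ou_duhamel_lincomb: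
  fixes F G :: "real^'n \<Rightarrow> real \<Rightarrow> real"
  assumes F: "(\<lambda>(y, r). F y r) \<in> borel_measurable borel" "\<And>y r. r \<in> {0..t} \<Longrightarrow> \<bar>F y r\<bar> \<le> B"
    and G: "(\<lambda>(y, r). G y r) \<in> borel_measurable borel" "\<And>y r. r \<in> {0..t} \<Longrightarrow> \<bar>G y r\<bar> \<le> B'"
  shows "ou_duhamel \<sigma> \<mu> \<rho> (\<lambda>y r. a * F y r + b * G y r) x t = a * ou_duhamel \<sigma> \<mu> \<rho> F x t + b * ou_duhamel \<sigma> \<mu> \<rho> G x t"
proof -
  note i = ou_duhamel_integrable[OF F, of t \<rho> x] ou_duhamel_integrable[OF G, of t \<rho> x]
  have "ou_duhamel \<sigma> \<mu> \<rho> (\<lambda>y r. a * F y r + b * G y r) x t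
    = (\<integral>s\<in>{0..t}. a * (exp (\<rho> * s) * ou_semigroup \<sigma> \<mu> s (\<lambda>y. F y (t - s)) x) + b * (exp (\<rho> * s) * ou_semigroup \<sigma> \<mu> s (\<lambda>y. G y (t - s)) x) \<partial>lborel)"
    unfolding ou_duhamel_def
  proof (intro set_lebesgue_integral_cong allI impI)
    fix s assume s: "s \<in> {0..t}"
    have "ou_semigroup \<sigma> \<mu> s (\<lambda>y. a * F y (t - s) + b * G y (t - s)) x = a * ou_semigroup \<sigma> \<mu> s (\<lambda>y. F y (t - s)) x + b * ou_semigroup \<sigma> \<mu> s (\<lambda>y. G y (t - s)) x"
      by (rule ou_semigroup_lincomb[OF pos ou_slice_measurable[OF F(1)] _ ou_slice_measurable[OF G(1)], where B=B and B'=B'])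
         (use s F(2) G(2) in auto)
    then show "exp (\<rho> * s) * ou_semigroup \<sigma> \<mu> s (\<lambda>y. a * F y (t - s) + b * G y (t - s)) x
      = a * (exp (\<rho> * s) * ou_semigroup \<sigma> \<mu> s (\<lambda>y. F y (t - s)) x) + b * (exp (\<rho> * s) * ou_semigroup \<sigma> \<mu> s (\<lambda>y. G y (t - s)) x)"
      by (simp add: algebra_simps)
  qed simp
  also have "\<dots> = a * ou_duhamel \<sigma> \<mu> \<rho> F x t + b * ou_duhamel \<sigma> \<mu> \<rho> G x t"
    unfolding ou_duhamel_def
    by (subst set_integral_add) (use i in \<open>auto simp: set_integrable_mult_right\<close>)
  finally show ?thesis .
qed

lemma ou_duhamel_cong:
  assumes "\<And>y r. r \<in> {0..t} \<Longrightarrow> F y r = G y r"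
  shows "ou_duhamel \<sigma> \<mu> \<rho> F x t = ou_duhamel \<sigma> \<mu> \<rho> G x t"
  unfolding ou_duhamel_def
proof (intro set_lebesgue_integral_cong allI impI)
  fix s assume "s \<in> {0..t}"
  then have "(\<lambda>y. F y (t - s)) = (\<lambda>y. G y (t - s))" using assms by auto
  then show "exp (\<rho> * s) * ou_semigroup \<sigma> \<mu> s (\<lambda>y. F y (t - s)) x = exp (\<rho> * s) * ou_semigroup \<sigma> \<mu> s (\<lambda>y. G y (t - s)) x"
    by simp
qed simp

end

context
  fixes \<sigma> \<mu> :: real
  assumes pos: "\<mu> > 0" "\<sigma> > 0"
begin

lemma ou_semigroup_nonneg:
  fixes F :: "real^'n \<Rightarrow> real"
  assumes "\<And>y. 0 \<le> F y"
  shows "0 \<le> ou_semigroup \<sigma> \<mu> t F x"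
  unfolding ou_semigroup_def by (intro integral_nonneg_AE) (simp add: assms)

lemma ou_duhamel_nonneg:
  fixes F :: "real^'n \<Rightarrow> real \<Rightarrow> real"
  assumes "\<And>y r. r \<in> {0..t} \<Longrightarrow> 0 \<le> F y r"
  shows "0 \<le> ou_duhamel \<sigma> \<mu> \<rho> F x t"
  unfolding ou_duhamel_def set_lebesgue_integral_def
  by (rule Bochner_Integration.integral_nonneg)
     (use assms in \<open>auto simp: indicator_def intro!: mult_nonneg_nonneg ou_semigroup_nonneg\<close>)

text \<open>The functions \<open>\<bar>F\<bar> + F\<close> and \<open>\<bar>F\<bar> - F\<close> are
  nonnegative, hence so are their Duhamel integrals; linearity does the rest.\<close>

lemma ou_duhamel_abs:
  fixes F :: "real^'n \<Rightarrow> real \<Rightarrow> real"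
  assumes F: "(\<lambda>(y, r). F y r) \<in> borel_measurable borel" "\<And>y r. r \<in> {0..t} \<Longrightarrow> \<bar>F y r\<bar> \<le> B"
  shows "\<bar>ou_duhamel \<sigma> \<mu> \<rho> F x t\<bar> \<le> ou_duhamel \<sigma> \<mu> \<rho> (\<lambda>y r. \<bar>F y r\<bar>) x t"
proof -
  have m: "(\<lambda>(y, r). \<bar>F y r\<bar>) \<in> borel_measurable borel"
    using borel_measurable_abs[OF F(1)] by (simp add: case_prod_unfold)
  have b: "\<And>y r. r \<in> {0..t} \<Longrightarrow> \<bar>\<bar>F y r\<bar>\<bar> \<le> B" using F(2) by simp
  have p: "0 \<le> ou_duhamel \<sigma> \<mu> \<rho> (\<lambda>y r. 1 * \<bar>F y r\<bar> + c * F y r) x t" if "\<bar>c\<bar> = 1" for c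
    by (rule ou_duhamel_nonneg) (use that in \<open>auto simp: abs_if split: if_splits\<close>)
  show ?thesis
  proof -
    have e: "ou_duhamel \<sigma> \<mu> \<rho> (\<lambda>y r. 1 * \<bar>F y r\<bar> + c * F y r) x t = 1 * ou_duhamel \<sigma> \<mu> \<rho> (\<lambda>y r. \<bar>F y r\<bar>) x t + c * ou_duhamel \<sigma> \<mu> \<rho> F x t" for c
      by (rule ou_duhamel_lincomb[OF pos m b F])
    show ?thesis using p[of 1] p[of "-1"] unfolding e by simp
  qed
qed

lemma set_integral_const_Icc:
  "0 \<le> t \<Longrightarrow> (\<integral>s\<in>{0..t}. c \<partial>lborel) = c * (t :: real)" for c :: real
  by (simp add: set_lebesgue_integral_def)

lemma ou_duhamel_const_bound:
  fixes F :: "real^'n \<Rightarrow> real \<Rightarrow> real"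
  assumes F: "(\<lambda>(y, r). F y r) \<in> borel_measurable borel" "\<And>y r. r \<in> {0..t} \<Longrightarrow> \<bar>F y r\<bar> \<le> B"
    and "0 \<le> t"
  shows "\<bar>ou_duhamel \<sigma> \<mu> 0 F x t\<bar> \<le> B * t"
proof -
  have "\<bar>ou_duhamel \<sigma> \<mu> 0 F x t\<bar> \<le> (\<integral>s\<in>{0..t}. exp (0 * s) * B \<partial>lborel)"
    by (rule ou_duhamel_abs_le[OF pos F]) auto
  then show ?thesis using set_integral_const_Icc[OF assms(3), of B] by simp
qed

lemma set_integral_exp_reflected:
  fixes c t :: real
  assumes "c \<noteq> 0" "0 \<le> t"
  shows "(\<integral>s\<in>{0..t}. exp (c * (t - s)) \<partial>lborel) = (exp (c * t) - 1) / c"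
proof -
  have "(\<integral>s. indicator {0..t} s *\<^sub>R exp (c * (t - s)) \<partial>lborel) = (- exp (c * (t - t)) / c) - (- exp (c * (t - 0)) / c)"
  proof (rule integral_FTC_atLeastAtMost[OF assms(2)])
    fix x assume "0 \<le> x" "x \<le> t"
    show "((\<lambda>s. - exp (c * (t - s)) / c) has_vector_derivative exp (c * (t - x))) (at x within {0..t})"
      using assms(1) unfolding has_real_derivative_iff_has_vector_derivative [symmetric]
      by (auto intro!: derivative_eq_intros)
  qed (intro continuous_intros)
  then show ?thesis using assms(1) by (simp add: set_lebesgue_integral_def diff_divide_distrib)
qed

lemma set_integral_exp_Icc:
  fixes c t :: real
  assumes "c \<noteq> 0" "0 \<le> t"
  shows "(\<integral>s\<in>{0..t}. exp (c * s) \<partial>lborel) = (exp (c * t) - 1) / c"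
proof -
  have "(\<integral>s. indicator {0..t} s *\<^sub>R exp (c * s) \<partial>lborel) = (exp (c * t) / c) - (exp (c * 0) / c)"
  proof (rule integral_FTC_atLeastAtMost[OF assms(2)])
    fix x assume "0 \<le> x" "x \<le> t"
    show "((\<lambda>s. exp (c * s) / c) has_vector_derivative exp (c * x)) (at x within {0..t})"
      using assms(1) unfolding has_real_derivative_iff_has_vector_derivative [symmetric]
      by (auto intro!: derivative_eq_intros)
  qed (intro continuous_intros)
  then show ?thesis by (simp add: set_lebesgue_integral_def diff_divide_distrib)
qed

text \<open>A bound K exp (2 L r) on w is improved by the hypothesis to (C + K / 2) exp (2 L t):
  measured against the rate 2 L, the Duhamel term is a contraction by 1/2. Iteration from the crude
  bound \<open>B\<close> leads to the fixed point K = 2 C, so \<open>B\<close> leaves no trace. That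
  the result is proportional to \<open>C\<close> is what later produces powers of \<theta>.\<close>

lemma ou_gronwall:
  fixes w :: "real^'n \<Rightarrow> real \<Rightarrow> real"
  assumes w: "(\<lambda>(y, r). w y r) \<in> borel_measurable borel" "\<And>y r. r \<in> {0..T} \<Longrightarrow> \<bar>w y r\<bar> \<le> B"
    and L: "L > 0" and C: "C \<ge> 0"
    and le: "\<And>x t. t \<in> {0..T} \<Longrightarrow> \<bar>w x t\<bar> \<le> C + L * ou_duhamel \<sigma> \<mu> 0 (\<lambda>y r. \<bar>w y r\<bar>) x t"
    and t: "t \<in> {0..T}"
  shows "\<bar>w x t\<bar> \<le> 2 * C * exp (2 * L * T)"
proof -
  have m: "(\<lambda>(y, r). \<bar>w y r\<bar>) \<in> borel_measurable borel"
    using borel_measurable_abs[OF w(1)] by (simp add: case_prod_unfold)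
  have B: "B \<ge> 0" using w(2)[OF t, of 0] by simp
  have step: "\<bar>w x t\<bar> \<le> (C + K / 2) * exp (2 * L * t)"
    if K: "\<And>y r. r \<in> {0..T} \<Longrightarrow> \<bar>w y r\<bar> \<le> K * exp (2 * L * r)" and K0: "K \<ge> 0" and t: "t \<in> {0..T}" for K x t
  proof -
    have "\<bar>ou_duhamel \<sigma> \<mu> 0 (\<lambda>y r. \<bar>w y r\<bar>) x t\<bar> \<le> (\<integral>s\<in>{0..t}. exp (0 * s) * (K * exp (2 * L * (t - s))) \<partial>lborel)"
      by (rule ou_duhamel_abs_le[OF pos m]) (use K t in \<open>auto intro!: continuous_intros\<close>)
    also have "\<dots> = K * ((exp (2 * L * t) - 1) / (2 * L))"
      using set_integral_exp_reflected[of "2 * L" t] L t by simp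
    finally have "L * ou_duhamel \<sigma> \<mu> 0 (\<lambda>y r. \<bar>w y r\<bar>) x t \<le> L * (K * ((exp (2 * L * t) - 1) / (2 * L)))"
      using L by (intro mult_left_mono) auto
    also have "\<dots> = K / 2 * (exp (2 * L * t) - 1)" using L by simp
    also have "\<dots> \<le> K / 2 * exp (2 * L * t)" using K0 by (intro mult_left_mono) auto
    finally have "\<bar>w x t\<bar> \<le> C * 1 + K / 2 * exp (2 * L * t)" using le[OF t, of x] by simp
    also have "\<dots> \<le> C * exp (2 * L * t) + K / 2 * exp (2 * L * t)"
      using C L t by (intro add_right_mono mult_left_mono) auto
    finally show ?thesis by (simp add: distrib_right)
  qed
  \<comment> \<open>The recursion K to C + K / 2 sends 2 C + B / 2^n to 2 C + B / 2^(n+1).\<close>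
  have n: "\<bar>w x t\<bar> \<le> (2 * C + B / 2 ^ n) * exp (2 * L * t)" if "t \<in> {0..T}" for n x t
    using that
  proof (induction n arbitrary: x t)
    case 0
    have "B * 1 \<le> (2 * C + B) * exp (2 * L * t)" using B C L 0 by (intro mult_mono) auto
    then show ?case using w(2)[OF 0, of x] by simp
  next
    case (Suc n)
    have "\<bar>w x t\<bar> \<le> (C + (2 * C + B / 2 ^ n) / 2) * exp (2 * L * t)"
      by (rule step) (use Suc B C in auto)
    then show ?case by (simp add: add_divide_distrib mult.commute)
  qed
  have "(\<lambda>n. (2 * C + B / 2 ^ n) * exp (2 * L * t)) \<longlonglongrightarrow> (2 * C + B * 0) * exp (2 * L * t)"
    unfolding divide_inverse power_inverse [symmetric]
    by (intro tendsto_intros LIMSEQ_realpow_zero) auto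
  then have "\<bar>w x t\<bar> \<le> (2 * C + B * 0) * exp (2 * L * t)"
    by (rule LIMSEQ_le_const) (use n[OF t, of x] in auto)
  also have "\<dots> \<le> 2 * C * exp (2 * L * T)" using C L t by (auto intro!: mult_left_mono)
  finally show ?thesis .
qed

lemma integrable_lborel_box:
  fixes h :: "real \<times> real \<Rightarrow> real"
  assumes [measurable]: "h \<in> borel_measurable (lborel \<Otimes>\<^sub>M lborel)"
    and "\<And>p. \<bar>h p\<bar> \<le> C * indicator ({0..t} \<times> {0..t}) p"
  shows "integrable (lborel \<Otimes>\<^sub>M lborel) h"
proof (rule Bochner_Integration.integrable_bound)
  have "emeasure (lborel \<Otimes>\<^sub>M lborel) ({0..t} \<times> {0..t}) = emeasure lborel {0..t} * emeasure lborel {0..t}"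
    by (rule lborel.emeasure_pair_measure_Times) auto
  also have "\<dots> < \<infinity>" by (simp add: emeasure_lborel_Icc_eq ennreal_mult_less_top)
  finally have "integrable (lborel \<Otimes>\<^sub>M lborel) (indicator ({0..t} \<times> {0..t}) :: _ \<Rightarrow> real)"
    by (intro integrable_real_indicator) auto
  then show "integrable (lborel \<Otimes>\<^sub>M lborel) (\<lambda>p. C * indicator ({0..t} \<times> {0..t}) p)" by simp
  show "AE p in lborel \<Otimes>\<^sub>M lborel. norm (h p) \<le> norm (C * indicator ({0..t} \<times> {0..t}) p)"
    using assms(2) by (intro always_eventually allI) (metis abs_ge_self order_trans real_norm_def)
qed measurable

text \<open>Fubini on the triangle s + v \<le> t in the variables \<tau> = s + v and v; for fixed
  \<tau> the exponential is integrated over v between 0 and \<tau>.\<close>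

lemma triangle_integral_convolution:
  fixes J :: "real \<Rightarrow> real"
  assumes [measurable]: "J \<in> borel_measurable borel" and J: "\<And>\<tau>. \<tau> \<in> {0..t} \<Longrightarrow> \<bar>J \<tau>\<bar> \<le> B"
    and \<rho>: "\<rho> > 0" and t: "t \<ge> 0"
  shows "(\<integral>s\<in>{0..t}. (\<integral>v\<in>{0..t - s}. exp (\<rho> * v) * J (s + v) \<partial>lborel) \<partial>lborel)
       = (\<integral>\<tau>\<in>{0..t}. J \<tau> * ((exp (\<rho> * \<tau>) - 1) / \<rho>) \<partial>lborel)"
proof -
  define h where "h s v = (if 0 \<le> s \<and> 0 \<le> v \<and> s + v \<le> t then exp (\<rho> * v) * J (s + v) else 0)" for s v
  have B: "B \<ge> 0" using J[of 0] t by auto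
  have [measurable]: "(\<lambda>(s, v). h s v) \<in> borel_measurable (lborel \<Otimes>\<^sub>M lborel)" unfolding h_def by measurable
  have i1: "integrable (lborel \<Otimes>\<^sub>M lborel) (\<lambda>(s, v). h s v)"
  proof (rule integrable_lborel_box[where C="exp (\<rho> * t) * B" and t=t])
    fix p :: "real \<times> real"
    obtain s v where p: "p = (s, v)" by (cases p)
    show "\<bar>case p of (s, v) \<Rightarrow> h s v\<bar> \<le> exp (\<rho> * t) * B * indicator ({0..t} \<times> {0..t}) p"
    proof (cases "0 \<le> s \<and> 0 \<le> v \<and> s + v \<le> t")
      case True
      have "exp (\<rho> * v) * \<bar>J (s + v)\<bar> \<le> exp (\<rho> * t) * B" using True \<rho> J[of "s + v"] by (intro mult_mono) auto
      then show ?thesis using True by (simp add: p h_def abs_mult)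
    qed (use B in \<open>auto simp: p h_def\<close>)
  qed measurable
  have i2: "integrable (lborel \<Otimes>\<^sub>M lborel) (\<lambda>(\<tau>, v). h (\<tau> - v) v)"
  proof (rule integrable_lborel_box[where C="exp (\<rho> * t) * B" and t=t])
    fix p :: "real \<times> real"
    obtain s v where p: "p = (s, v)" by (cases p)
    show "\<bar>case p of (s, v) \<Rightarrow> h (s - v) v\<bar> \<le> exp (\<rho> * t) * B * indicator ({0..t} \<times> {0..t}) p"
    proof (cases "0 \<le> s - v \<and> 0 \<le> v \<and> s \<le> t")
      case True
      have "exp (\<rho> * v) * \<bar>J s\<bar> \<le> exp (\<rho> * t) * B" using True \<rho> J[of s] by (intro mult_mono) auto
      then show ?thesis using True by (simp add: p h_def abs_mult)
    qed (use B in \<open>auto simp: p h_def\<close>)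
  next
    show "(\<lambda>(\<tau>, v). h (\<tau> - v) v) \<in> borel_measurable (lborel \<Otimes>\<^sub>M lborel)" unfolding h_def by measurable
  qed
  have "(\<integral>s\<in>{0..t}. (\<integral>v\<in>{0..t - s}. exp (\<rho> * v) * J (s + v) \<partial>lborel) \<partial>lborel) = (\<integral>s. (\<integral>v. h s v \<partial>lborel) \<partial>lborel)"
    unfolding set_lebesgue_integral_def
  proof (intro Bochner_Integration.integral_cong refl)
    fix s :: real
    have "indicator {0..t} s *\<^sub>R (\<integral>v. indicator {0..t - s} v *\<^sub>R (exp (\<rho> * v) * J (s + v)) \<partial>lborel)
      = (\<integral>v. indicator {0..t} s *\<^sub>R (indicator {0..t - s} v *\<^sub>R (exp (\<rho> * v) * J (s + v))) \<partial>lborel)" by simp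
    also have "\<dots> = (\<integral>v. h s v \<partial>lborel)"
      by (intro Bochner_Integration.integral_cong refl) (auto simp: h_def indicator_def)
    finally show "indicator {0..t} s *\<^sub>R (\<integral>v. indicator {0..t - s} v *\<^sub>R (exp (\<rho> * v) * J (s + v)) \<partial>lborel) = (\<integral>v. h s v \<partial>lborel)" .
  qed
  also have "\<dots> = (\<integral>v. (\<integral>s. h s v \<partial>lborel) \<partial>lborel)"
    by (rule lborel_pair.Fubini_integral[OF i1, symmetric])
  also have "\<dots> = (\<integral>v. (\<integral>\<tau>. h (\<tau> - v) v \<partial>lborel) \<partial>lborel)"
  proof (rule Bochner_Integration.integral_cong[OF refl])
    fix v :: real
    show "(\<integral>s. h s v \<partial>lborel) = (\<integral>\<tau>. h (\<tau> - v) v \<partial>lborel)"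
      using lborel_integral_real_affine[of 1 "\<lambda>s. h s v" "- v"] by (simp add: add.commute)
  qed
  also have "\<dots> = (\<integral>\<tau>. (\<integral>v. h (\<tau> - v) v \<partial>lborel) \<partial>lborel)"
    by (rule lborel_pair.Fubini_integral[OF i2])
  also have "\<dots> = (\<integral>\<tau>\<in>{0..t}. J \<tau> * ((exp (\<rho> * \<tau>) - 1) / \<rho>) \<partial>lborel)"
    unfolding set_lebesgue_integral_def
  proof (intro Bochner_Integration.integral_cong refl)
    fix \<tau> :: real
    show "(\<integral>v. h (\<tau> - v) v \<partial>lborel) = indicator {0..t} \<tau> *\<^sub>R (J \<tau> * ((exp (\<rho> * \<tau>) - 1) / \<rho>))"
    proof (cases "\<tau> \<in> {0..t}")
      case True
      have "(\<integral>v. h (\<tau> - v) v \<partial>lborel) = (\<integral>v. J \<tau> * (indicator {0..\<tau>} v *\<^sub>R exp (\<rho> * v)) \<partial>lborel)"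
        using True by (intro Bochner_Integration.integral_cong refl) (auto simp: h_def indicator_def)
      also have "\<dots> = J \<tau> * ((exp (\<rho> * \<tau>) - 1) / \<rho>)"
        using set_integral_exp_Icc[of \<rho> \<tau>] True \<rho> by (simp add: set_lebesgue_integral_def)
      finally show ?thesis using True by simp
    next
      case False
      then have "(\<integral>v. h (\<tau> - v) v \<partial>lborel) = (\<integral>v. 0 \<partial>(lborel :: real measure))"
        by (intro Bochner_Integration.integral_cong refl) (auto simp: h_def)
      with False show ?thesis by simp
    qed
  qed
  finally show ?thesis .
qed

text \<open>A resolvent identity: the \<rho>-weighted integral of \<open>N\<close> solves the linear
  equation with growth rate \<rho> and source \<open>N\<close>. For \<rho> = \<alpha> it identifies
  the second-order coefficient of the log-Laplace equation.\<close>

lemma ou_duhamel_resolvent: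
  fixes N :: "real^'n \<Rightarrow> real \<Rightarrow> real"
  assumes N: "(\<lambda>(y, r). N y r) \<in> borel_measurable borel" "\<And>y r. r \<in> {0..t} \<Longrightarrow> \<bar>N y r\<bar> \<le> B"
    and \<rho>: "\<rho> > 0" and t: "t \<ge> 0"
  shows "ou_duhamel \<sigma> \<mu> \<rho> N x t = \<rho> * ou_duhamel \<sigma> \<mu> 0 (ou_duhamel \<sigma> \<mu> \<rho> N) x t + ou_duhamel \<sigma> \<mu> 0 N x t"
proof -
  let ?G = "ou_measure \<sigma> \<mu> :: (real^'n) measure"
  interpret G: prob_space ?G using pos by (rule prob_space_ou_measure)
  interpret pair_sigma_finite ?G "lborel :: real measure" ..
  have B: "B \<ge> 0" using N(2)[of 0 0] t by auto
  define J where "J \<tau> = ou_semigroup \<sigma> \<mu> \<tau> (\<lambda>y. N y (t - \<tau>)) x" for \<tau>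
  have Jm: "J \<in> borel_measurable borel"
    unfolding J_def by (rule ou_duhamel_integrand_measurable[OF pos N(1)])
  have Jb: "\<bar>J \<tau>\<bar> \<le> B" if "\<tau> \<in> {0..t}" for \<tau>
    unfolding J_def by (rule ou_semigroup_abs_le[OF pos ou_slice_measurable[OF pos N(1)]]) (use N(2) that in auto)
  \<comment> \<open>Fubini moves the semigroup at time s under the time integral, and the semigroup
    law merges s with v. The source is taken at t - s - v, which depends on s + v alone, so all is
    expressed by \<open>J (s + v)\<close>.\<close>
  have inner: "ou_semigroup \<sigma> \<mu> s (\<lambda>y. ou_duhamel \<sigma> \<mu> \<rho> N y (t - s)) x = (\<integral>v\<in>{0..t - s}. exp (\<rho> * v) * J (s + v) \<partial>lborel)"
    if s: "s \<in> {0..t}" for s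
  proof -
    let ?z = "\<lambda>y. exp (- \<mu> * s) *\<^sub>R x + sqrt (1 - exp (- 2 * \<mu> * s)) *\<^sub>R y"
    define k where "k y v = indicator {0..t - s} v * (exp (\<rho> * v) * ou_semigroup \<sigma> \<mu> v (\<lambda>y. N y (t - s - v)) (?z y))" for y v
    have "(\<lambda>p. (snd p, ?z (fst p), t - s)) \<in> ?G \<Otimes>\<^sub>M lborel \<rightarrow>\<^sub>M borel \<Otimes>\<^sub>M borel \<Otimes>\<^sub>M borel" by measurable
    from measurable_compose[OF this ou_duhamel_measurable_integrand[OF pos N(1)]]
    have [measurable]: "(\<lambda>p. ou_semigroup \<sigma> \<mu> (snd p) (\<lambda>y. N y (t - s - snd p)) (?z (fst p))) \<in> borel_measurable (?G \<Otimes>\<^sub>M lborel)"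
      by (simp only: prod.case)
    have km: "(\<lambda>(y, v). k y v) \<in> borel_measurable (?G \<Otimes>\<^sub>M lborel)"
      unfolding k_def case_prod_unfold by measurable
    have Pb: "\<bar>ou_semigroup \<sigma> \<mu> v (\<lambda>y. N y (t - s - v)) z\<bar> \<le> B" if "v \<in> {0..t - s}" for v z
      by (rule ou_semigroup_abs_le[OF pos ou_slice_measurable[OF pos N(1)]]) (use N(2) that s in auto)
    have "integrable (?G \<Otimes>\<^sub>M lborel) (\<lambda>(y, v). k y v)"
    proof (rule Bochner_Integration.integrable_bound)
      have "emeasure (?G \<Otimes>\<^sub>M lborel) (UNIV \<times> {0..t - s}) = emeasure ?G UNIV * emeasure lborel {0..t - s}"
        by (rule lborel.emeasure_pair_measure_Times) auto
      also have "\<dots> < \<infinity>" using G.emeasure_space_1 by (simp add: emeasure_lborel_Icc_eq ennreal_mult_less_top)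
      finally have "integrable (?G \<Otimes>\<^sub>M lborel) (indicator (UNIV \<times> {0..t - s}) :: _ \<Rightarrow> real)"
        by (intro integrable_real_indicator) auto
      then show "integrable (?G \<Otimes>\<^sub>M lborel) (\<lambda>p. (exp (\<rho> * t) * B) * indicator (UNIV \<times> {0..t - s}) p)" by simp
      show "AE p in ?G \<Otimes>\<^sub>M lborel. norm (case p of (y, v) \<Rightarrow> k y v) \<le> norm ((exp (\<rho> * t) * B) * indicator (UNIV \<times> {0..t - s}) p)"
      proof (intro always_eventually allI)
        fix p :: "(real^'n) \<times> real"
        obtain y v where p: "p = (y, v)" by (cases p)
        show "norm (case p of (y, v) \<Rightarrow> k y v) \<le> norm ((exp (\<rho> * t) * B) * indicator (UNIV \<times> {0..t - s}) p)"
        proof (cases "v \<in> {0..t - s}")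
          case True
          have "exp (\<rho> * v) * \<bar>ou_semigroup \<sigma> \<mu> v (\<lambda>y. N y (t - s - v)) (?z y)\<bar> \<le> exp (\<rho> * t) * B"
            using True \<rho> s Pb[OF True] by (intro mult_mono) auto
          then show ?thesis using True B by (simp add: p k_def abs_mult)
        qed (auto simp: p k_def)
      qed
    qed (rule km)
    note swap = Fubini_integral[OF this]
    have "ou_semigroup \<sigma> \<mu> s (\<lambda>y. ou_duhamel \<sigma> \<mu> \<rho> N y (t - s)) x = (\<integral>y. (\<integral>v. k y v \<partial>lborel) \<partial>?G)"
      unfolding ou_semigroup_def[of \<sigma> \<mu> s] ou_duhamel_def set_lebesgue_integral_def k_def by simp
    also have "\<dots> = (\<integral>v. (\<integral>y. k y v \<partial>?G) \<partial>lborel)" by (rule swap[symmetric])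
    also have "\<dots> = (\<integral>v\<in>{0..t - s}. exp (\<rho> * v) * J (s + v) \<partial>lborel)"
      unfolding set_lebesgue_integral_def
    proof (intro Bochner_Integration.integral_cong refl)
      fix v :: real
      show "(\<integral>y. k y v \<partial>?G) = indicator {0..t - s} v *\<^sub>R (exp (\<rho> * v) * J (s + v))"
      proof (cases "v \<in> {0..t - s}")
        case True
        have "(\<integral>y. k y v \<partial>?G) = exp (\<rho> * v) * ou_semigroup \<sigma> \<mu> s (ou_semigroup \<sigma> \<mu> v (\<lambda>y. N y (t - s - v))) x"
          using True by (simp add: k_def ou_semigroup_def[of \<sigma> \<mu> s])
        also have "ou_semigroup \<sigma> \<mu> s (ou_semigroup \<sigma> \<mu> v (\<lambda>y. N y (t - s - v))) x = J (s + v)"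
          unfolding J_def diff_diff_eq
          by (rule ou_semigroup_add[OF pos _ _ ou_slice_measurable[OF pos N(1)], where B=B]) (use N(2) True s in auto)
        finally show ?thesis using True by simp
      qed (simp add: k_def)
    qed
    finally show ?thesis .
  qed
  have "ou_duhamel \<sigma> \<mu> 0 (ou_duhamel \<sigma> \<mu> \<rho> N) x t
     = (\<integral>s\<in>{0..t}. (\<integral>v\<in>{0..t - s}. exp (\<rho> * v) * J (s + v) \<partial>lborel) \<partial>lborel)"
    unfolding ou_duhamel_def[of \<sigma> \<mu> 0] by (intro set_lebesgue_integral_cong allI impI) (simp_all add: inner)
  also have "\<dots> = (\<integral>\<tau>\<in>{0..t}. J \<tau> * ((exp (\<rho> * \<tau>) - 1) / \<rho>) \<partial>lborel)"
    by (rule triangle_integral_convolution[OF Jm Jb \<rho> t])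
  finally have "\<rho> * ou_duhamel \<sigma> \<mu> 0 (ou_duhamel \<sigma> \<mu> \<rho> N) x t = (\<integral>\<tau>\<in>{0..t}. \<rho> * (J \<tau> * ((exp (\<rho> * \<tau>) - 1) / \<rho>)) \<partial>lborel)"
    by simp
  also have "\<dots> = (\<integral>\<tau>\<in>{0..t}. exp (\<rho> * \<tau>) * J \<tau> - exp (0 * \<tau>) * J \<tau> \<partial>lborel)"
    using \<rho> by (intro set_lebesgue_integral_cong) (auto simp: field_simps)
  also have "\<dots> = ou_duhamel \<sigma> \<mu> \<rho> N x t - ou_duhamel \<sigma> \<mu> 0 N x t"
    unfolding ou_duhamel_def J_def
    by (rule set_integral_diff(2)) (rule ou_duhamel_integrable[OF pos N], assumption)+
  finally show ?thesis by simp
qed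

end

section \<open>The log-Laplace equation\<close>

lemma log_laplace_solution_bounded:
  assumes "log_laplace_solution \<sigma> \<mu> \<alpha> \<beta> f u" "T \<ge> 0"
  obtains B where "\<And>y r. r \<in> {0..T} \<Longrightarrow> u y r \<le> B"
proof -
  have "\<forall>T\<ge>0. \<exists>B. \<forall>x. \<forall>t\<in>{0..T}. u x t \<le> B"
    using assms(1) unfolding log_laplace_solution_def by (elim conjE)
  with assms(2) obtain B where "\<forall>x. \<forall>t\<in>{0..T}. u x t \<le> B" by auto
  with that show ?thesis by metis
qed

context
  fixes \<sigma> \<mu> \<alpha> \<beta> :: real
  assumes pos: "\<mu> > 0" "\<sigma> > 0" and abpos: "\<alpha> > 0" "\<beta> > 0"
begin

lemma case_prod_borel_arith:
  fixes F G :: "'a::topological_space \<Rightarrow> 'b::topological_space \<Rightarrow> real"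
  assumes "(\<lambda>(y, r). F y r) \<in> borel_measurable borel" "(\<lambda>(y, r). G y r) \<in> borel_measurable borel"
  shows "(\<lambda>(y, r). a * F y r + b * G y r) \<in> borel_measurable borel"
    and "(\<lambda>(y, r). F y r * G y r) \<in> borel_measurable borel"
    and "(\<lambda>(y, r). (F y r)\<^sup>2) \<in> borel_measurable borel"
proof -
  have [measurable]: "(\<lambda>p. F (fst p) (snd p)) \<in> borel_measurable borel" "(\<lambda>p. G (fst p) (snd p)) \<in> borel_measurable borel"
    using assms by (simp_all add: case_prod_unfold)
  show "(\<lambda>(y, r). a * F y r + b * G y r) \<in> borel_measurable borel"
    and "(\<lambda>(y, r). F y r * G y r) \<in> borel_measurable borel"
    and "(\<lambda>(y, r). (F y r)\<^sup>2) \<in> borel_measurable borel"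
    unfolding case_prod_unfold by measurable
qed

text \<open>The coefficient of \<theta> in the solution with datum \<theta> f; its integral over the
  starting measure is the mean of the linear functional of \<open>f\<close>.\<close>

definition mean_flow :: "(real^'n \<Rightarrow> real) \<Rightarrow> real^'n \<Rightarrow> real \<Rightarrow> real" where
  "mean_flow f x t = exp (\<alpha> * t) * ou_semigroup \<sigma> \<mu> t f x"

text \<open>Up to the factor - \<beta>, the coefficient of \<theta>^2 in the solution with datum
  \<theta> f. Times 2 \<beta> and integrated over the starting measure it is the variance: the mean
  mass at each time s contributes the squared mean over the remaining time t - s.\<close>

definition covariance_flow :: "(real^'n \<Rightarrow> real) \<Rightarrow> real^'n \<Rightarrow> real \<Rightarrow> real" where
  "covariance_flow f = ou_duhamel \<sigma> \<mu> \<alpha> (\<lambda>y r. (mean_flow f y r)\<^sup>2)"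

lemma measurable_mean_flow:
  fixes f :: "real^'n \<Rightarrow> real"
  assumes [measurable]: "f \<in> borel_measurable borel"
  shows "(\<lambda>(x, t). mean_flow f x t) \<in> borel_measurable borel"
proof -
  have [measurable]: "(\<lambda>p. ou_semigroup \<sigma> \<mu> (snd p) f (fst p)) \<in> borel_measurable ((borel :: (real^'n) measure) \<Otimes>\<^sub>M borel)"
    by (rule measurable_ou_semigroup[OF pos]) measurable
  have "(\<lambda>p. exp (\<alpha> * snd p) * ou_semigroup \<sigma> \<mu> (snd p) f (fst p)) \<in> borel_measurable (borel \<Otimes>\<^sub>M borel)" by measurable
  then show ?thesis by (simp add: mean_flow_def borel_prod case_prod_unfold)
qed

lemma mean_flow_abs_le:
  fixes f :: "real^'n \<Rightarrow> real"
  assumes [measurable]: "f \<in> borel_measurable borel" and f: "\<And>y. \<bar>f y\<bar> \<le> b" and "t \<le> T"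
  shows "\<bar>mean_flow f x t\<bar> \<le> b * exp (\<alpha> * T)"
proof -
  have "\<bar>mean_flow f x t\<bar> = exp (\<alpha> * t) * \<bar>ou_semigroup \<sigma> \<mu> t f x\<bar>" by (simp add: mean_flow_def abs_mult)
  also have "\<dots> \<le> exp (\<alpha> * T) * b"
    by (intro mult_mono ou_semigroup_abs_le[OF pos]) (use f assms(3) abpos in auto)
  finally show ?thesis by (simp add: mult.commute)
qed

lemma mean_flow_eq:
  fixes f :: "real^'n \<Rightarrow> real"
  assumes f: "f \<in> borel_measurable borel" "\<And>y. \<bar>f y\<bar> \<le> b" and t: "0 \<le> t"
  shows "mean_flow f x t = ou_semigroup \<sigma> \<mu> t f x + \<alpha> * ou_duhamel \<sigma> \<mu> 0 (mean_flow f) x t"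
proof -
  have "ou_duhamel \<sigma> \<mu> 0 (mean_flow f) x t = (\<integral>s\<in>{0..t}. exp (\<alpha> * (t - s)) * ou_semigroup \<sigma> \<mu> t f x \<partial>lborel)"
    unfolding ou_duhamel_def
  proof (intro set_lebesgue_integral_cong allI impI)
    fix s assume s: "s \<in> {0..t}"
    have "ou_semigroup \<sigma> \<mu> s (\<lambda>y. mean_flow f y (t - s)) x = exp (\<alpha> * (t - s)) * ou_semigroup \<sigma> \<mu> s (ou_semigroup \<sigma> \<mu> (t - s) f) x"
      unfolding mean_flow_def by (simp add: ou_semigroup_def[of \<sigma> \<mu> s])
    also have "ou_semigroup \<sigma> \<mu> s (ou_semigroup \<sigma> \<mu> (t - s) f) x = ou_semigroup \<sigma> \<mu> t f x"
      using ou_semigroup_add[OF pos _ _ f(1) f(2), of s "t - s" x] s by simp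
    finally show "exp (0 * s) * ou_semigroup \<sigma> \<mu> s (\<lambda>y. mean_flow f y (t - s)) x = exp (\<alpha> * (t - s)) * ou_semigroup \<sigma> \<mu> t f x" by simp
  qed simp
  also have "\<dots> = (\<integral>s\<in>{0..t}. exp (\<alpha> * (t - s)) \<partial>lborel) * ou_semigroup \<sigma> \<mu> t f x" by simp
  also have "(\<integral>s\<in>{0..t}. exp (\<alpha> * (t - s)) \<partial>lborel) = (exp (\<alpha> * t) - 1) / \<alpha>"
    using abpos t by (intro set_integral_exp_reflected) auto
  finally show ?thesis using abpos unfolding mean_flow_def[of f x t] by (simp add: field_simps)
qed

text \<open>Separating the linear from the quadratic part of the branching mechanism needs
  integrability of both, which the local bound in \<open>log_laplace_solution\<close>
  provides.\<close>

lemma log_laplace_duhamel: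
  fixes f :: "real^'n \<Rightarrow> real"
  assumes u: "log_laplace_solution \<sigma> \<mu> \<alpha> \<beta> f u" and t: "t \<ge> 0"
  shows "u x t = ou_semigroup \<sigma> \<mu> t f x + \<alpha> * ou_duhamel \<sigma> \<mu> 0 u x t - \<beta> * ou_duhamel \<sigma> \<mu> 0 (\<lambda>y r. (u y r)\<^sup>2) x t"
proof -
  have um: "(\<lambda>(y, r). u y r) \<in> borel_measurable borel" and u0: "\<And>y r. r \<ge> 0 \<Longrightarrow> 0 \<le> u y r"
    using u by (auto simp: log_laplace_solution_def)
  obtain B where B: "\<And>y r. r \<in> {0..t} \<Longrightarrow> u y r \<le> B" by (rule log_laplace_solution_bounded[OF u t]) blast
  have ub: "\<bar>u y r\<bar> \<le> B" if "r \<in> {0..t}" for y r using B[OF that] u0[of r y] that by auto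
  have ub2: "\<bar>(u y r)\<^sup>2\<bar> \<le> B\<^sup>2" if "r \<in> {0..t}" for y r
    using power_mono[OF ub[OF that], of y 2] by simp
  have "u x t = ou_semigroup \<sigma> \<mu> t f x - ou_duhamel \<sigma> \<mu> 0 (\<lambda>y r. branching_mechanism \<alpha> \<beta> (u y r)) x t"
    using u t by (simp add: log_laplace_solution_def ou_duhamel_def)
  also have "(\<lambda>y r. branching_mechanism \<alpha> \<beta> (u y r)) = (\<lambda>y r. (- \<alpha>) * u y r + \<beta> * (u y r)\<^sup>2)"
    by (simp add: branching_mechanism_def fun_eq_iff)
  also have "ou_duhamel \<sigma> \<mu> 0 (\<lambda>y r. (- \<alpha>) * u y r + \<beta> * (u y r)\<^sup>2) x t
     = (- \<alpha>) * ou_duhamel \<sigma> \<mu> 0 u x t + \<beta> * ou_duhamel \<sigma> \<mu> 0 (\<lambda>y r. (u y r)\<^sup>2) x t"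
    by (rule ou_duhamel_lincomb[OF pos um ub case_prod_borel_arith(3)[OF um um] ub2])
  finally show ?thesis by simp
qed

text \<open>Three rounds of \<open>ou_gronwall\<close>, each gaining a power of \<theta>: for
  \<open>u\<close>, for its distance from the linear term, and for its distance from the quadratic
  approximation. The constant is chosen before \<theta> and \<open>u\<close>, so it serves every
  solution.\<close>

lemma log_laplace_expansion:
  fixes f :: "real^'n \<Rightarrow> real"
  assumes f: "f \<in> borel_measurable borel" "\<And>y. 0 \<le> f y" "\<And>y. f y \<le> b" and T: "T \<ge> 0"
  shows "\<exists>c. \<forall>\<theta>\<ge>0. \<forall>u. log_laplace_solution \<sigma> \<mu> \<alpha> \<beta> (\<lambda>x. \<theta> * f x) u \<longrightarrow>
     (\<forall>x. \<bar>u x T - (\<theta> * mean_flow f x T - \<beta> * \<theta>\<^sup>2 * covariance_flow f x T)\<bar> \<le> c * \<theta> ^ 3)"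
proof -
  define m where "m = mean_flow f"
  define r where "r = covariance_flow f"
  define E where "E = exp (2 * \<alpha> * T)"
  \<comment> \<open>\<open>c0\<close> bounds the mean flow; \<open>c1\<close>, \<open>c2\<close>,
    \<open>c3\<close> come out of the three rounds: \<open>u\<close> is at most \<theta> c1,
    \<open>w\<close> at most \<theta>^2 c2, \<open>v\<close> at most \<theta>^3 c3 in absolute
    value. \<open>E\<close> is the Gronwall factor.\<close>
  define c0 where "c0 = b * exp (\<alpha> * T)"
  define c1 where "c1 = 2 * b * E"
  define c2 where "c2 = 2 * (\<beta> * (c1\<^sup>2 * T)) * E"
  define c3 where "c3 = 2 * (\<beta> * (c2 * (c1 + c0) * T)) * E"
  have fb: "\<And>y. \<bar>f y\<bar> \<le> b" using f by auto
  have b: "b \<ge> 0" using f(2,3)[of 0] by linarith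
  have nn: "c0 \<ge> 0" "c1 \<ge> 0" "c2 \<ge> 0" using b T abpos by (auto simp: c0_def c1_def c2_def E_def)
  have mm: "(\<lambda>(y, r). m y r) \<in> borel_measurable borel" unfolding m_def by (rule measurable_mean_flow[OF f(1)])
  have mb: "\<bar>m y s\<bar> \<le> c0" if "s \<in> {0..T}" for y s
    unfolding m_def c0_def by (rule mean_flow_abs_le[OF f(1) fb]) (use that in auto)
  have m2m: "(\<lambda>(y, r). (m y r)\<^sup>2) \<in> borel_measurable borel" by (rule case_prod_borel_arith(3)[OF mm mm])
  have m2b: "\<bar>(m y s)\<^sup>2\<bar> \<le> c0\<^sup>2" if "s \<in> {0..T}" for y s using power_mono[OF mb[OF that], of y 2] by simp
  have r_def': "r = ou_duhamel \<sigma> \<mu> \<alpha> (\<lambda>y r. (m y r)\<^sup>2)" by (simp add: r_def covariance_flow_def m_def)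
  have rm: "(\<lambda>(y, s). r y s) \<in> borel_measurable borel" unfolding r_def' by (rule measurable_ou_duhamel[OF pos m2m])
  obtain R where R: "\<And>y s. s \<in> {0..T} \<Longrightarrow> \<bar>r y s\<bar> \<le> R"
  proof -
    have "\<bar>r y s\<bar> \<le> T * (exp (\<alpha> * T) * c0\<^sup>2)" if s: "s \<in> {0..T}" for y s
    proof -
      have "\<bar>r y s\<bar> \<le> (\<integral>v\<in>{0..s}. exp (\<alpha> * v) * c0\<^sup>2 \<partial>lborel)"
        unfolding r_def' by (rule ou_duhamel_abs_le[OF pos m2m m2b]) (use s in auto)
      also have "\<dots> \<le> (\<integral>v\<in>{0..s}. exp (\<alpha> * T) * c0\<^sup>2 \<partial>lborel)"
        using abpos s by (intro set_integral_mono borel_integrable_atLeastAtMost' continuous_intros mult_right_mono) auto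
      also have "\<dots> = (exp (\<alpha> * T) * c0\<^sup>2) * s" using s set_integral_const_Icc[of \<mu> \<sigma> s] pos by simp
      also have "\<dots> \<le> (exp (\<alpha> * T) * c0\<^sup>2) * T" using s by (intro mult_left_mono) auto
      finally show ?thesis by (simp add: mult_ac)
    qed
    then show ?thesis by (rule that)
  qed
  show ?thesis
  proof (intro exI allI impI)
    fix \<theta> u x assume \<theta>: "0 \<le> (\<theta> :: real)" and u: "log_laplace_solution \<sigma> \<mu> \<alpha> \<beta> (\<lambda>x. \<theta> * f x) u"
    have um: "(\<lambda>(y, r). u y r) \<in> borel_measurable borel" and u0: "\<And>y r. r \<ge> 0 \<Longrightarrow> 0 \<le> u y r"
      using u by (auto simp: log_laplace_solution_def)
    obtain B where B: "\<And>y r. r \<in> {0..T} \<Longrightarrow> u y r \<le> B" by (rule log_laplace_solution_bounded[OF u T]) blast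
    have ub: "\<bar>u y r\<bar> \<le> B" if "r \<in> {0..T}" for y r using B[OF that] u0[of r y] that by auto
    have Pf: "ou_semigroup \<sigma> \<mu> t (\<lambda>x. \<theta> * f x) y = \<theta> * ou_semigroup \<sigma> \<mu> t f y" for t y by (simp add: ou_semigroup_def)
    note ueq = log_laplace_duhamel[OF u, unfolded Pf]
    have u1: "\<bar>u y t\<bar> \<le> \<theta> * c1" if t: "t \<in> {0..T}" for y t
    proof -
      have "\<bar>u y t\<bar> \<le> 2 * (\<theta> * b) * exp (2 * \<alpha> * T)"
      proof (rule ou_gronwall[OF pos um ub abpos(1) _ _ t])
        show "0 \<le> \<theta> * b" using \<theta> b by simp
        fix y t assume t: "t \<in> {0..T}"
        \<comment> \<open>The quadratic term enters with a minus sign; dropping it leaves a linear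
          inequality, and a bound proportional to \<theta> that is free of the unknown
          \<open>B\<close>.\<close>
        have "0 \<le> ou_duhamel \<sigma> \<mu> 0 (\<lambda>y r. (u y r)\<^sup>2) y t" by (rule ou_duhamel_nonneg[OF pos]) simp
        then have n: "0 \<le> \<beta> * ou_duhamel \<sigma> \<mu> 0 (\<lambda>y r. (u y r)\<^sup>2) y t" using abpos by simp
        have "ou_semigroup \<sigma> \<mu> t f y \<le> b" using ou_semigroup_abs_le[OF pos f(1) fb, of t y] by simp
        then have "\<theta> * ou_semigroup \<sigma> \<mu> t f y \<le> \<theta> * b" using \<theta> by (rule mult_left_mono)
        then have "u y t \<le> \<theta> * b + \<alpha> * ou_duhamel \<sigma> \<mu> 0 u y t" using ueq[of t y] n t by simp
        also have "ou_duhamel \<sigma> \<mu> 0 u y t = ou_duhamel \<sigma> \<mu> 0 (\<lambda>y r. \<bar>u y r\<bar>) y t"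
          using u0 by (intro ou_duhamel_cong[OF pos]) auto
        finally show "\<bar>u y t\<bar> \<le> \<theta> * b + \<alpha> * ou_duhamel \<sigma> \<mu> 0 (\<lambda>y r. \<bar>u y r\<bar>) y t"
          using u0[of t y] t by auto
      qed auto
      then show ?thesis by (simp add: c1_def E_def mult_ac)
    qed
    have u2m: "(\<lambda>(y, r). (u y r)\<^sup>2) \<in> borel_measurable borel" by (rule case_prod_borel_arith(3)[OF um um])
    have u2b: "\<bar>(u y t)\<^sup>2\<bar> \<le> \<theta>\<^sup>2 * c1\<^sup>2" if "t \<in> {0..T}" for y t
      using power_mono[OF u1[OF that], of y 2] by (simp add: power_mult_distrib)
    define w where "w y t = \<theta> * m y t + (-1) * u y t" for y t
    have wm: "(\<lambda>(y, r). w y r) \<in> borel_measurable borel" unfolding w_def by (rule case_prod_borel_arith(1)[OF mm um])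
    have wb: "\<bar>w y t\<bar> \<le> \<theta> * c0 + \<theta> * c1" if "t \<in> {0..T}" for y t
    proof -
      have "\<bar>w y t\<bar> \<le> \<bar>\<theta> * m y t\<bar> + \<bar>u y t\<bar>" unfolding w_def by linarith
      also have "\<dots> \<le> \<theta> * c0 + \<theta> * c1" using mb[OF that] u1[OF that] \<theta> by (intro add_mono) (auto simp: abs_mult mult_left_mono)
      finally show ?thesis .
    qed
    have weq: "w y t = \<alpha> * ou_duhamel \<sigma> \<mu> 0 w y t + \<beta> * ou_duhamel \<sigma> \<mu> 0 (\<lambda>y r. (u y r)\<^sup>2) y t" if t: "t \<in> {0..T}" for y t
    proof -
      have "ou_duhamel \<sigma> \<mu> 0 w y t = \<theta> * ou_duhamel \<sigma> \<mu> 0 m y t + (-1) * ou_duhamel \<sigma> \<mu> 0 u y t"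
        unfolding w_def by (rule ou_duhamel_lincomb[OF pos mm mb um ub]) (use t in auto)
      moreover have "m y t = ou_semigroup \<sigma> \<mu> t f y + \<alpha> * ou_duhamel \<sigma> \<mu> 0 m y t"
        unfolding m_def by (rule mean_flow_eq[OF f(1) fb]) (use t in auto)
      moreover have "u y t = \<theta> * ou_semigroup \<sigma> \<mu> t f y + \<alpha> * ou_duhamel \<sigma> \<mu> 0 u y t - \<beta> * ou_duhamel \<sigma> \<mu> 0 (\<lambda>y r. (u y r)\<^sup>2) y t"
        by (rule ueq) (use t in auto)
      moreover have "\<theta> * a + (-1) * b = \<alpha> * (\<theta> * p + (-1) * q') + \<beta> * s"
        if "a = P + \<alpha> * p" "b = \<theta> * P + \<alpha> * q' - \<beta> * s" for a b p q' s P :: real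
        unfolding that by (simp add: algebra_simps)
      ultimately show ?thesis unfolding w_def[of y t] by metis
    qed
    have w1: "\<bar>w y t\<bar> \<le> \<theta>\<^sup>2 * c2" if t: "t \<in> {0..T}" for y t
    proof -
      have "\<bar>w y t\<bar> \<le> 2 * (\<beta> * (\<theta>\<^sup>2 * c1\<^sup>2 * T)) * exp (2 * \<alpha> * T)"
      proof (rule ou_gronwall[OF pos wm wb abpos(1) _ _ t])
        show "0 \<le> \<beta> * (\<theta>\<^sup>2 * c1\<^sup>2 * T)" using abpos T by simp
        fix y t assume t: "t \<in> {0..T}"
        have "\<bar>ou_duhamel \<sigma> \<mu> 0 w y t\<bar> \<le> ou_duhamel \<sigma> \<mu> 0 (\<lambda>y r. \<bar>w y r\<bar>) y t"
          by (rule ou_duhamel_abs[OF pos wm wb]) (use t in auto)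
        then have 1: "\<alpha> * \<bar>ou_duhamel \<sigma> \<mu> 0 w y t\<bar> \<le> \<alpha> * ou_duhamel \<sigma> \<mu> 0 (\<lambda>y r. \<bar>w y r\<bar>) y t" using abpos by simp
        have "\<bar>ou_duhamel \<sigma> \<mu> 0 (\<lambda>y r. (u y r)\<^sup>2) y t\<bar> \<le> \<theta>\<^sup>2 * c1\<^sup>2 * t"
          by (rule ou_duhamel_const_bound[OF pos u2m u2b]) (use t in auto)
        also have "\<dots> \<le> \<theta>\<^sup>2 * c1\<^sup>2 * T" using t by (intro mult_left_mono) auto
        finally have 2: "\<beta> * \<bar>ou_duhamel \<sigma> \<mu> 0 (\<lambda>y r. (u y r)\<^sup>2) y t\<bar> \<le> \<beta> * (\<theta>\<^sup>2 * c1\<^sup>2 * T)" using abpos by simp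
        have "\<bar>w y t\<bar> \<le> \<alpha> * \<bar>ou_duhamel \<sigma> \<mu> 0 w y t\<bar> + \<beta> * \<bar>ou_duhamel \<sigma> \<mu> 0 (\<lambda>y r. (u y r)\<^sup>2) y t\<bar>"
          unfolding weq[OF t, of y] using abpos by (intro order_trans[OF abs_triangle_ineq]) (simp add: abs_mult)
        then show "\<bar>w y t\<bar> \<le> \<beta> * (\<theta>\<^sup>2 * c1\<^sup>2 * T) + \<alpha> * ou_duhamel \<sigma> \<mu> 0 (\<lambda>y r. \<bar>w y r\<bar>) y t" using 1 2 by linarith
      qed auto
      then show ?thesis by (simp add: c2_def E_def mult_ac)
    qed
    \<comment> \<open>\<open>w\<close> solves the linear equation with source \<beta> u^2, and
      \<open>r\<close> the one with source m^2 by \<open>ou_duhamel_resolvent\<close>. Hence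
      \<open>v\<close> solves it with source \<beta> q, where q = u^2 - \<theta>^2 m^2.\<close>
    define v where "v y t = 1 * w y t + (- \<beta> * \<theta>\<^sup>2) * r y t" for y t
    have vm: "(\<lambda>(y, r). v y r) \<in> borel_measurable borel" unfolding v_def by (rule case_prod_borel_arith(1)[OF wm rm])
    have vb: "\<bar>v y t\<bar> \<le> \<theta>\<^sup>2 * c2 + \<beta> * \<theta>\<^sup>2 * R" if "t \<in> {0..T}" for y t
    proof -
      have "\<bar>v y t\<bar> \<le> \<bar>w y t\<bar> + \<bar>\<beta> * \<theta>\<^sup>2 * r y t\<bar>" unfolding v_def by (simp add: abs_triangle_ineq4)
      also have "\<dots> \<le> \<theta>\<^sup>2 * c2 + \<beta> * \<theta>\<^sup>2 * R" using w1[OF that] R[OF that] abpos by (intro add_mono) (auto simp: abs_mult mult_left_mono)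
      finally show ?thesis .
    qed
    define q where "q y t = 1 * (u y t)\<^sup>2 + (- \<theta>\<^sup>2) * (m y t)\<^sup>2" for y t
    have qm: "(\<lambda>(y, r). q y r) \<in> borel_measurable borel" unfolding q_def by (rule case_prod_borel_arith(1)[OF u2m m2m])
    have qb: "\<bar>q y t\<bar> \<le> \<theta> ^ 3 * (c2 * (c1 + c0))" if "t \<in> {0..T}" for y t
    proof -
      \<comment> \<open>The difference of squares exhibits the factor \<open>w\<close>, already of
        order \<theta>^2; the other factor is of order \<theta>.\<close>
      have "q y t = - w y t * (u y t + \<theta> * m y t)" by (simp add: q_def w_def power2_eq_square algebra_simps)
      then have "\<bar>q y t\<bar> = \<bar>w y t\<bar> * \<bar>u y t + \<theta> * m y t\<bar>" by (simp add: abs_mult)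
      also have "\<dots> \<le> (\<theta>\<^sup>2 * c2) * (\<theta> * c1 + \<theta> * c0)"
      proof (intro mult_mono w1[OF that])
        have "\<bar>\<theta> * m y t\<bar> \<le> \<theta> * c0" using mb[OF that] \<theta> by (simp add: abs_mult mult_left_mono)
        then show "\<bar>u y t + \<theta> * m y t\<bar> \<le> \<theta> * c1 + \<theta> * c0" using u1[OF that, of y] by linarith
      qed (use nn in auto)
      also have "\<dots> = \<theta> ^ 3 * (c2 * (c1 + c0))" by (simp add: power2_eq_square power3_eq_cube algebra_simps)
      finally show ?thesis .
    qed
    have veq: "v y t = \<alpha> * ou_duhamel \<sigma> \<mu> 0 v y t + \<beta> * ou_duhamel \<sigma> \<mu> 0 q y t" if t: "t \<in> {0..T}" for y t
    proof -
      have "ou_duhamel \<sigma> \<mu> 0 v y t = 1 * ou_duhamel \<sigma> \<mu> 0 w y t + (- \<beta> * \<theta>\<^sup>2) * ou_duhamel \<sigma> \<mu> 0 r y t"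
        unfolding v_def by (rule ou_duhamel_lincomb[OF pos wm wb rm R]) (use t in auto)
      moreover have "ou_duhamel \<sigma> \<mu> 0 q y t = 1 * ou_duhamel \<sigma> \<mu> 0 (\<lambda>y r. (u y r)\<^sup>2) y t + (- \<theta>\<^sup>2) * ou_duhamel \<sigma> \<mu> 0 (\<lambda>y r. (m y r)\<^sup>2) y t"
        unfolding q_def by (rule ou_duhamel_lincomb[OF pos u2m u2b m2m m2b]) (use t in auto)
      moreover have "r y t = \<alpha> * ou_duhamel \<sigma> \<mu> 0 r y t + ou_duhamel \<sigma> \<mu> 0 (\<lambda>y r. (m y r)\<^sup>2) y t"
        unfolding r_def' by (rule ou_duhamel_resolvent[OF pos m2m m2b abpos(1)]) (use t in auto)
      moreover have "1 * a + (- \<beta> * \<theta>\<^sup>2) * b = \<alpha> * (1 * p + (- \<beta> * \<theta>\<^sup>2) * p') + \<beta> * (1 * s + (- \<theta>\<^sup>2) * s')"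
        if "a = \<alpha> * p + \<beta> * s" "b = \<alpha> * p' + s'" for a b p p' s s' :: real
        unfolding that by (simp add: algebra_simps)
      ultimately show ?thesis unfolding v_def[of y t] using weq[OF t, of y] by metis
    qed
    have TT: "T \<in> {0..T}" using T by simp
    have "\<bar>v x T\<bar> \<le> 2 * (\<beta> * (\<theta> ^ 3 * (c2 * (c1 + c0)) * T)) * exp (2 * \<alpha> * T)"
    proof (rule ou_gronwall[OF pos vm vb abpos(1) _ _ TT])
      show "0 \<le> \<beta> * (\<theta> ^ 3 * (c2 * (c1 + c0)) * T)" using abpos T nn \<theta> by simp
      fix y t assume t: "t \<in> {0..T}"
      have "\<bar>ou_duhamel \<sigma> \<mu> 0 v y t\<bar> \<le> ou_duhamel \<sigma> \<mu> 0 (\<lambda>y r. \<bar>v y r\<bar>) y t"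
        by (rule ou_duhamel_abs[OF pos vm vb]) (use t in auto)
      then have 1: "\<alpha> * \<bar>ou_duhamel \<sigma> \<mu> 0 v y t\<bar> \<le> \<alpha> * ou_duhamel \<sigma> \<mu> 0 (\<lambda>y r. \<bar>v y r\<bar>) y t" using abpos by simp
      have "\<bar>ou_duhamel \<sigma> \<mu> 0 q y t\<bar> \<le> \<theta> ^ 3 * (c2 * (c1 + c0)) * t"
        by (rule ou_duhamel_const_bound[OF pos qm qb]) (use t in auto)
      also have "\<dots> \<le> \<theta> ^ 3 * (c2 * (c1 + c0)) * T" using t nn \<theta> by (intro mult_left_mono) auto
      finally have 2: "\<beta> * \<bar>ou_duhamel \<sigma> \<mu> 0 q y t\<bar> \<le> \<beta> * (\<theta> ^ 3 * (c2 * (c1 + c0)) * T)" using abpos by simp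
      have "\<bar>v y t\<bar> \<le> \<alpha> * \<bar>ou_duhamel \<sigma> \<mu> 0 v y t\<bar> + \<beta> * \<bar>ou_duhamel \<sigma> \<mu> 0 q y t\<bar>"
        unfolding veq[OF t, of y] using abpos by (intro order_trans[OF abs_triangle_ineq]) (simp add: abs_mult)
      then show "\<bar>v y t\<bar> \<le> \<beta> * (\<theta> ^ 3 * (c2 * (c1 + c0)) * T) + \<alpha> * ou_duhamel \<sigma> \<mu> 0 (\<lambda>y r. \<bar>v y r\<bar>) y t" using 1 2 by linarith
    qed auto
    also have "\<dots> = c3 * \<theta> ^ 3" by (simp add: c3_def E_def mult_ac)
    finally have "\<bar>v x T\<bar> \<le> c3 * \<theta> ^ 3" .
    moreover have "u x T - (\<theta> * mean_flow f x T - \<beta> * \<theta>\<^sup>2 * covariance_flow f x T) = - v x T"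
      by (simp add: v_def w_def m_def r_def)
    ultimately show "\<bar>u x T - (\<theta> * mean_flow f x T - \<beta> * \<theta>\<^sup>2 * covariance_flow f x T)\<bar> \<le> c3 * \<theta> ^ 3"
      by (simp only: abs_minus_cancel)
  qed
qed

text \<open>The solution of the logistic equation U' = \<alpha> U - \<beta> U^2 with U(0) = l: the
  log-Laplace exponent of the total mass.\<close>

definition mass_exponent :: "real \<Rightarrow> real \<Rightarrow> real" where
  "mass_exponent l t = l * exp (\<alpha> * t) / (1 + \<beta> / \<alpha> * l * (exp (\<alpha> * t) - 1))"

lemma mass_exponent_derivative:
  assumes "l \<ge> 0" "t \<ge> 0"
  shows "(mass_exponent l has_real_derivative (\<alpha> * mass_exponent l t - \<beta> * (mass_exponent l t)\<^sup>2)) (at t)"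
    and "0 \<le> mass_exponent l t" and "0 < 1 + \<beta> / \<alpha> * l * (exp (\<alpha> * t) - 1)"
proof -
  define D where "D = 1 + \<beta> / \<alpha> * l * (exp (\<alpha> * t) - 1)"
  have "0 \<le> \<beta> / \<alpha> * l * (exp (\<alpha> * t) - 1)" using assms abpos by (intro mult_nonneg_nonneg) auto
  then have D: "D > 0" by (simp add: D_def)
  then show "0 < 1 + \<beta> / \<alpha> * l * (exp (\<alpha> * t) - 1)" by (simp add: D_def)
  show "0 \<le> mass_exponent l t" using D assms by (simp add: mass_exponent_def D_def)
  have "(mass_exponent l has_real_derivative (l * (exp (\<alpha> * t) * \<alpha>) * D - l * exp (\<alpha> * t) * (\<beta> / \<alpha> * l * (exp (\<alpha> * t) * \<alpha>))) / (D * D)) (at t)"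
    unfolding mass_exponent_def D_def using D by (auto intro!: derivative_eq_intros simp: D_def)
  also have "(l * (exp (\<alpha> * t) * \<alpha>) * D - l * exp (\<alpha> * t) * (\<beta> / \<alpha> * l * (exp (\<alpha> * t) * \<alpha>))) / (D * D)
     = \<alpha> * mass_exponent l t - \<beta> * (mass_exponent l t)\<^sup>2"
    using D abpos unfolding mass_exponent_def D_def[symmetric] by (simp add: divide_simps power2_eq_square)
  finally show "(mass_exponent l has_real_derivative (\<alpha> * mass_exponent l t - \<beta> * (mass_exponent l t)\<^sup>2)) (at t)" .
qed

text \<open>The kernel supplies a solution without a formula; for constant data it is identified
  here. The difference \<open>d\<close> from the logistic curve satisfies a Gronwall inequality with
  C = 0, since u^2 - U^2 = (u + U) d with a bounded factor u + U.\<close>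

lemma log_laplace_const_unique:
  fixes u :: "real^'n \<Rightarrow> real \<Rightarrow> real"
  assumes l: "l \<ge> 0" and u: "log_laplace_solution \<sigma> \<mu> \<alpha> \<beta> (\<lambda>_. l) u" and T: "T \<ge> 0"
  shows "u x T = mass_exponent l T"
proof -
  define U where "U = mass_exponent l"
  have Ucont: "continuous_on {0..t} U" for t
    unfolding U_def using mass_exponent_derivative(1)[OF l]
    by (intro continuous_at_imp_continuous_on ballI) (auto intro: DERIV_isCont)
  obtain BU where BU: "\<And>r. r \<in> {0..T} \<Longrightarrow> \<bar>U r\<bar> \<le> BU"
    using compact_imp_bounded[OF compact_continuous_image[OF Ucont[of T] compact_Icc]] by (auto simp: bounded_iff simp del: atLeastAtMost_iff)
  have BU0: "BU \<ge> 0" using BU[of 0] T by auto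
  have um: "(\<lambda>(y, r). u y r) \<in> borel_measurable borel" and u0: "\<And>y r. r \<ge> 0 \<Longrightarrow> 0 \<le> u y r"
    using u by (auto simp: log_laplace_solution_def)
  obtain B where B: "\<And>y r. r \<in> {0..T} \<Longrightarrow> u y r \<le> B" by (rule log_laplace_solution_bounded[OF u T]) blast
  have ub: "\<bar>u y r\<bar> \<le> B" if "r \<in> {0..T}" for y r using B[OF that] u0[of r y] that by auto
  have B0: "B \<ge> 0" using ub[of 0 0] T by auto
  have Um: "(\<lambda>(y, r). U r) \<in> borel_measurable (borel :: ((real^'n) \<times> real) measure)"
  proof -
    have "(\<lambda>p. U (snd p)) \<in> borel_measurable ((borel :: (real^'n) measure) \<Otimes>\<^sub>M borel)" unfolding U_def mass_exponent_def by measurable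
    then show ?thesis by (simp add: borel_prod case_prod_unfold)
  qed
  have U2m: "(\<lambda>(y, r). (U r)\<^sup>2) \<in> borel_measurable (borel :: ((real^'n) \<times> real) measure)" by (rule case_prod_borel_arith(3)[OF Um Um])
  have u2m: "(\<lambda>(y, r). (u y r)\<^sup>2) \<in> borel_measurable borel" by (rule case_prod_borel_arith(3)[OF um um])
  have sqb: "\<bar>z\<^sup>2\<bar> \<le> b\<^sup>2" if "\<bar>z\<bar> \<le> b" for z b :: real using power_mono[OF that, of 2] by simp
  \<comment> \<open>The semigroup fixes functions that are constant in space, so the equation for
    \<open>U\<close> is an ordinary one, obtained from the fundamental theorem of calculus in the
    reversed time t - s.\<close>
  have Ueq: "U t = l + \<alpha> * ou_duhamel \<sigma> \<mu> 0 (\<lambda>(y::real^'n) r. U r) x t - \<beta> * ou_duhamel \<sigma> \<mu> 0 (\<lambda>(y::real^'n) r. (U r)\<^sup>2) x t"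
    if t: "t \<in> {0..T}" for t x
  proof -
    have "(\<integral>s\<in>{0..t}. \<alpha> * U (t - s) - \<beta> * (U (t - s))\<^sup>2 \<partial>lborel) = (- U (t - t)) - (- U (t - 0))"
      unfolding set_lebesgue_integral_def
    proof (rule integral_FTC_atLeastAtMost)
      fix s assume s: "0 \<le> s" "s \<le> t"
      have "(U has_real_derivative (\<alpha> * U (t - s) - \<beta> * (U (t - s))\<^sup>2)) (at (t - s))"
        unfolding U_def by (rule mass_exponent_derivative(1)[OF l]) (use s in auto)
      then have "((\<lambda>s. U (t - s)) has_real_derivative (\<alpha> * U (t - s) - \<beta> * (U (t - s))\<^sup>2) * (- 1)) (at s)"
        by (rule DERIV_chain2) (auto intro!: derivative_eq_intros)
      then have "((\<lambda>s. - U (t - s)) has_real_derivative (\<alpha> * U (t - s) - \<beta> * (U (t - s))\<^sup>2)) (at s)"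
        using DERIV_minus by fastforce
      then show "((\<lambda>s. - U (t - s)) has_vector_derivative \<alpha> * U (t - s) - \<beta> * (U (t - s))\<^sup>2) (at s within {0..t})"
        unfolding has_real_derivative_iff_has_vector_derivative [symmetric] by (rule DERIV_subset) auto
    next
      show "continuous_on {0..t} (\<lambda>s. \<alpha> * U (t - s) - \<beta> * (U (t - s))\<^sup>2)"
        by (intro continuous_intros continuous_on_compose2[OF Ucont[of t]]) auto
    qed (use t in auto)
    moreover have "U 0 = l" by (simp add: U_def mass_exponent_def)
    ultimately have "U t = l + (\<integral>s\<in>{0..t}. \<alpha> * U (t - s) + (- \<beta>) * (U (t - s))\<^sup>2 \<partial>lborel)" by simp
    also have "(\<integral>s\<in>{0..t}. \<alpha> * U (t - s) + (- \<beta>) * (U (t - s))\<^sup>2 \<partial>lborel) = ou_duhamel \<sigma> \<mu> 0 (\<lambda>(y::real^'n) r. \<alpha> * U r + (- \<beta>) * (U r)\<^sup>2) x t"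
      by (simp add: ou_duhamel_def ou_semigroup_const[OF pos])
    also have "\<dots> = \<alpha> * ou_duhamel \<sigma> \<mu> 0 (\<lambda>(y::real^'n) r. U r) x t + (- \<beta>) * ou_duhamel \<sigma> \<mu> 0 (\<lambda>(y::real^'n) r. (U r)\<^sup>2) x t"
      by (rule ou_duhamel_lincomb[OF pos Um BU U2m sqb[OF BU]]) (use t in auto)
    finally show ?thesis by simp
  qed
  define d where "d y t = 1 * u y t + (-1) * U t" for y :: "real^'n" and t
  have dm: "(\<lambda>(y, r). d y r) \<in> borel_measurable borel" unfolding d_def by (rule case_prod_borel_arith(1)[OF um Um])
  have db: "\<bar>d y t\<bar> \<le> B + BU" if "t \<in> {0..T}" for y t using ub[OF that, of y] BU[OF that] unfolding d_def by linarith
  have em: "(\<lambda>(y, r). 1 * (u y r)\<^sup>2 + (-1) * (U r)\<^sup>2) \<in> borel_measurable borel" by (rule case_prod_borel_arith(1)[OF u2m U2m])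
  have em': "(\<lambda>(y, r). \<bar>d y r\<bar>) \<in> borel_measurable borel"
    using borel_measurable_abs[OF dm] by (simp add: case_prod_unfold)
  have eb: "\<bar>1 * (u y t)\<^sup>2 + (-1) * (U t)\<^sup>2\<bar> \<le> (B + BU) * \<bar>d y t\<bar>" if "t \<in> {0..T}" for y t
  proof -
    have "1 * (u y t)\<^sup>2 + (-1) * (U t)\<^sup>2 = (u y t + U t) * d y t" by (simp add: d_def power2_eq_square algebra_simps)
    moreover have "\<bar>u y t + U t\<bar> \<le> B + BU" using ub[OF that, of y] BU[OF that] by linarith
    ultimately show ?thesis by (simp add: abs_mult mult_right_mono)
  qed
  have eb': "\<bar>1 * (u y t)\<^sup>2 + (-1) * (U t)\<^sup>2\<bar> \<le> (B + BU) * (B + BU)" if "t \<in> {0..T}" for y t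
    using eb[OF that, of y] mult_left_mono[OF db[OF that, of y], of "B + BU"] B0 BU0 by linarith
  have "\<bar>d x T\<bar> \<le> 2 * 0 * exp (2 * (\<alpha> + \<beta> * (B + BU)) * T)"
  proof (rule ou_gronwall[OF pos dm db])
    show "0 < \<alpha> + \<beta> * (B + BU)" using abpos B0 BU0 by (simp add: add_pos_nonneg)
    fix x t assume t: "t \<in> {0..T}"
    let ?A = "ou_duhamel \<sigma> \<mu> 0 (\<lambda>y r. \<bar>d y r\<bar>) x t"
    have ueq: "u x t = l + \<alpha> * ou_duhamel \<sigma> \<mu> 0 u x t - \<beta> * ou_duhamel \<sigma> \<mu> 0 (\<lambda>y r. (u y r)\<^sup>2) x t"
      using log_laplace_duhamel[OF u, of t x] t by (simp add: ou_semigroup_const[OF pos])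
    have 1: "ou_duhamel \<sigma> \<mu> 0 d x t = 1 * ou_duhamel \<sigma> \<mu> 0 u x t + (-1) * ou_duhamel \<sigma> \<mu> 0 (\<lambda>y r. U r) x t"
      unfolding d_def by (rule ou_duhamel_lincomb[OF pos um ub Um BU]) (use t in auto)
    have 2: "ou_duhamel \<sigma> \<mu> 0 (\<lambda>y r. 1 * (u y r)\<^sup>2 + (-1) * (U r)\<^sup>2) x t
       = 1 * ou_duhamel \<sigma> \<mu> 0 (\<lambda>y r. (u y r)\<^sup>2) x t + (-1) * ou_duhamel \<sigma> \<mu> 0 (\<lambda>y r. (U r)\<^sup>2) x t"
      by (rule ou_duhamel_lincomb[OF pos u2m sqb[OF ub] U2m sqb[OF BU]]) (use t in auto)
    have deq: "d x t = \<alpha> * ou_duhamel \<sigma> \<mu> 0 d x t - \<beta> * ou_duhamel \<sigma> \<mu> 0 (\<lambda>y r. 1 * (u y r)\<^sup>2 + (-1) * (U r)\<^sup>2) x t"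
      unfolding 1 2 unfolding d_def ueq Ueq[OF t, of x] by (simp add: algebra_simps)
    have 3: "\<bar>ou_duhamel \<sigma> \<mu> 0 d x t\<bar> \<le> ?A" by (rule ou_duhamel_abs[OF pos dm db]) (use t in auto)
    have "\<bar>ou_duhamel \<sigma> \<mu> 0 (\<lambda>y r. 1 * (u y r)\<^sup>2 + (-1) * (U r)\<^sup>2) x t\<bar> \<le> ou_duhamel \<sigma> \<mu> 0 (\<lambda>y r. \<bar>1 * (u y r)\<^sup>2 + (-1) * (U r)\<^sup>2\<bar>) x t"
      by (rule ou_duhamel_abs[OF pos em eb']) (use t in auto)
    also have "\<dots> \<le> (B + BU) * ?A"
    proof -
      have m4: "(\<lambda>(y, r). \<bar>1 * (u y r)\<^sup>2 + (-1) * (U r)\<^sup>2\<bar>) \<in> borel_measurable borel"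
        using borel_measurable_abs[OF em] by (simp add: case_prod_unfold)
      have "0 \<le> ou_duhamel \<sigma> \<mu> 0 (\<lambda>y r. (B + BU) * \<bar>d y r\<bar> + (-1) * \<bar>1 * (u y r)\<^sup>2 + (-1) * (U r)\<^sup>2\<bar>) x t"
        by (rule ou_duhamel_nonneg[OF pos]) (use eb t in auto)
      also have "\<dots> = (B + BU) * ?A + (-1) * ou_duhamel \<sigma> \<mu> 0 (\<lambda>y r. \<bar>1 * (u y r)\<^sup>2 + (-1) * (U r)\<^sup>2\<bar>) x t"
        by (rule ou_duhamel_lincomb[OF pos em' _ m4, where B="B + BU" and B'="(B + BU) * (B + BU)"]) (use db eb' t in auto)
      finally show ?thesis by simp
    qed
    finally have 4: "\<bar>ou_duhamel \<sigma> \<mu> 0 (\<lambda>y r. 1 * (u y r)\<^sup>2 + (-1) * (U r)\<^sup>2) x t\<bar> \<le> (B + BU) * ?A" .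
    have "\<bar>d x t\<bar> \<le> \<alpha> * \<bar>ou_duhamel \<sigma> \<mu> 0 d x t\<bar> + \<beta> * \<bar>ou_duhamel \<sigma> \<mu> 0 (\<lambda>y r. 1 * (u y r)\<^sup>2 + (-1) * (U r)\<^sup>2) x t\<bar>"
      unfolding deq using abpos by (intro order_trans[OF abs_triangle_ineq4]) (simp add: abs_mult)
    also have "\<dots> \<le> \<alpha> * ?A + \<beta> * ((B + BU) * ?A)" using 3 4 abpos by (intro add_mono mult_left_mono) auto
    finally show "\<bar>d x t\<bar> \<le> 0 + (\<alpha> + \<beta> * (B + BU)) * ?A" by (simp add: algebra_simps)
  qed (use T in auto)
  then show ?thesis by (simp add: d_def U_def)
qed

end

section \<open>Second moments of the superprocess\<close>

text \<open>Put y = 2 a(\<theta>) - a(2 \<theta>). The numerator is the square of 1 - exp (-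
  a(\<theta>)) plus exp (- 2 a(\<theta>)) times exp y - 1. The linear terms cancel in y and leave 2
  \<rho> \<theta>^2, so the two parts contribute m^2 and 2 \<rho>.\<close>

lemma second_difference_exp_limit:
  fixes a :: "real \<Rightarrow> real"
  assumes a: "\<And>\<theta>. \<theta> \<ge> 0 \<Longrightarrow> \<bar>a \<theta> - (\<theta> * m - \<rho> * \<theta>\<^sup>2)\<bar> \<le> c * \<theta> ^ 3"
    and \<theta>: "\<And>n. \<theta> n > 0" "\<theta> \<longlonglongrightarrow> 0"
  shows "(\<lambda>n. (1 - 2 * exp (- a (\<theta> n)) + exp (- a (2 * \<theta> n))) / (\<theta> n)\<^sup>2) \<longlonglongrightarrow> m\<^sup>2 + 2 * \<rho>"
proof -
  have 1: "(\<lambda>n. a (\<theta> n) / \<theta> n) \<longlonglongrightarrow> m"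
  proof -
    have "(\<lambda>n. a (\<theta> n) / \<theta> n - (m - \<rho> * \<theta> n)) \<longlonglongrightarrow> 0"
    proof (rule tendsto_0_le[where K=1])
      show "(\<lambda>n. c * (\<theta> n)\<^sup>2) \<longlonglongrightarrow> 0" using tendsto_mult[OF tendsto_const[of c] tendsto_power[OF \<theta>(2), of 2]] by simp
      show "\<forall>\<^sub>F n in sequentially. norm (a (\<theta> n) / \<theta> n - (m - \<rho> * \<theta> n)) \<le> norm (c * (\<theta> n)\<^sup>2) * 1"
      proof (intro always_eventually allI)
        fix n
        have t: "\<theta> n > 0" by (rule \<theta>)
        have "a (\<theta> n) / \<theta> n - (m - \<rho> * \<theta> n) = (a (\<theta> n) - (\<theta> n * m - \<rho> * (\<theta> n)\<^sup>2)) / \<theta> n"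
          using t by (simp add: field_simps power2_eq_square)
        then have "norm (a (\<theta> n) / \<theta> n - (m - \<rho> * \<theta> n)) \<le> (c * (\<theta> n) ^ 3) / \<theta> n"
          using a[of "\<theta> n"] t by (simp add: divide_right_mono)
        also have "\<dots> = c * (\<theta> n)\<^sup>2" using t by (simp add: power2_eq_square power3_eq_cube)
        finally show "norm (a (\<theta> n) / \<theta> n - (m - \<rho> * \<theta> n)) \<le> norm (c * (\<theta> n)\<^sup>2) * 1" by simp
      qed
    qed
    moreover have "(\<lambda>n. m - \<rho> * \<theta> n) \<longlonglongrightarrow> m - \<rho> * 0" by (intro tendsto_intros \<theta>)
    ultimately have "(\<lambda>n. (a (\<theta> n) / \<theta> n - (m - \<rho> * \<theta> n)) + (m - \<rho> * \<theta> n)) \<longlonglongrightarrow> 0 + (m - \<rho> * 0)"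
      by (rule tendsto_add)
    then show ?thesis by simp
  qed
  have a0: "(\<lambda>n. a (\<theta> n)) \<longlonglongrightarrow> 0"
  proof -
    have "(\<lambda>n. a (\<theta> n) / \<theta> n * \<theta> n) \<longlonglongrightarrow> m * 0" by (intro tendsto_mult 1 \<theta>)
    then show ?thesis using \<theta>(1) less_imp_neq[OF \<theta>(1)] by (simp add: less_imp_neq[THEN not_sym])
  qed
  have 2: "(\<lambda>n. (1 - exp (- a (\<theta> n))) / \<theta> n) \<longlonglongrightarrow> m"
  proof -
    have "(\<lambda>n. (1 - exp (- a (\<theta> n)) - a (\<theta> n)) / \<theta> n) \<longlonglongrightarrow> 0"
    proof (rule tendsto_0_le[where K=1])
      have "(\<lambda>n. a (\<theta> n) / \<theta> n * a (\<theta> n) * (1 + exp (- a (\<theta> n)))) \<longlonglongrightarrow> m * 0 * (1 + exp (- 0))"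
        by (intro tendsto_intros 1 a0)
      then show "(\<lambda>n. a (\<theta> n) / \<theta> n * a (\<theta> n) * (1 + exp (- a (\<theta> n)))) \<longlonglongrightarrow> 0" by simp
      show "\<forall>\<^sub>F n in sequentially. norm ((1 - exp (- a (\<theta> n)) - a (\<theta> n)) / \<theta> n) \<le> norm (a (\<theta> n) / \<theta> n * a (\<theta> n) * (1 + exp (- a (\<theta> n)))) * 1"
      proof (intro always_eventually allI)
        fix n
        have t: "\<theta> n > 0" by (rule \<theta>)
        have "\<bar>1 - exp (- a (\<theta> n)) - a (\<theta> n)\<bar> \<le> (a (\<theta> n))\<^sup>2 * (1 + exp (- a (\<theta> n)))"
          using exp_second_order_bound[of "- a (\<theta> n)"] by (simp add: abs_minus_commute)
        then have "\<bar>1 - exp (- a (\<theta> n)) - a (\<theta> n)\<bar> / \<theta> n \<le> (a (\<theta> n))\<^sup>2 * (1 + exp (- a (\<theta> n))) / \<theta> n"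
          using t by (simp add: divide_right_mono)
        also have "\<dots> = a (\<theta> n) / \<theta> n * a (\<theta> n) * (1 + exp (- a (\<theta> n)))" by (simp add: power2_eq_square)
        finally show "norm ((1 - exp (- a (\<theta> n)) - a (\<theta> n)) / \<theta> n) \<le> norm (a (\<theta> n) / \<theta> n * a (\<theta> n) * (1 + exp (- a (\<theta> n)))) * 1"
          using t by (simp add: abs_divide)
      qed
    qed
    from tendsto_add[OF this 1] show ?thesis by (simp add: add_divide_distrib[symmetric])
  qed
  define y where "y n = 2 * a (\<theta> n) - a (2 * \<theta> n)" for n
  have 3: "(\<lambda>n. y n / (\<theta> n)\<^sup>2) \<longlonglongrightarrow> 2 * \<rho>"
  proof -
    have "(\<lambda>n. y n / (\<theta> n)\<^sup>2 - 2 * \<rho>) \<longlonglongrightarrow> 0"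
    proof (rule tendsto_0_le[where K=1])
      \<comment> \<open>10 = 2 + 8: the error at \<theta> counts twice, the one at 2 \<theta>
        carries 2^3.\<close>
      show "(\<lambda>n. 10 * c * \<theta> n) \<longlonglongrightarrow> 0" using tendsto_mult[OF tendsto_const[of "10 * c"] \<theta>(2)] by simp
      show "\<forall>\<^sub>F n in sequentially. norm (y n / (\<theta> n)\<^sup>2 - 2 * \<rho>) \<le> norm (10 * c * \<theta> n) * 1"
      proof (intro always_eventually allI)
        fix n
        have t: "\<theta> n > 0" by (rule \<theta>)
        let ?x = "\<theta> n * m - \<rho> * (\<theta> n)\<^sup>2" let ?x2 = "2 * \<theta> n * m - \<rho> * (2 * \<theta> n)\<^sup>2"
        have e: "y n - 2 * \<rho> * (\<theta> n)\<^sup>2 = 2 * (a (\<theta> n) - ?x) - (a (2 * \<theta> n) - ?x2)"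
          by (simp add: y_def power2_eq_square algebra_simps)
        have "\<bar>a (2 * \<theta> n) - ?x2\<bar> \<le> c * (2 * \<theta> n) ^ 3" using a[of "2 * \<theta> n"] t by simp
        also have "\<dots> = 8 * (c * \<theta> n ^ 3)" by (simp add: power3_eq_cube)
        finally have "\<bar>a (2 * \<theta> n) - ?x2\<bar> \<le> 8 * (c * \<theta> n ^ 3)" .
        moreover have "\<bar>2 * p - q\<bar> \<le> 10 * K" if "\<bar>p\<bar> \<le> K" "\<bar>q\<bar> \<le> 8 * K" for p q K :: real using that by linarith
        ultimately have "\<bar>y n - 2 * \<rho> * (\<theta> n)\<^sup>2\<bar> \<le> 10 * (c * \<theta> n ^ 3)"
          using a[OF less_imp_le[OF t]] unfolding e by blast
        then have "\<bar>y n - 2 * \<rho> * (\<theta> n)\<^sup>2\<bar> / (\<theta> n)\<^sup>2 \<le> 10 * (c * \<theta> n ^ 3) / (\<theta> n)\<^sup>2"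
          using t by (simp add: divide_right_mono)
        also have "\<dots> = 10 * c * \<theta> n" using t by (simp add: power2_eq_square power3_eq_cube)
        also have "\<bar>y n - 2 * \<rho> * (\<theta> n)\<^sup>2\<bar> / (\<theta> n)\<^sup>2 = \<bar>y n / (\<theta> n)\<^sup>2 - 2 * \<rho>\<bar>"
        proof -
          have "y n / (\<theta> n)\<^sup>2 - 2 * \<rho> = (y n - 2 * \<rho> * (\<theta> n)\<^sup>2) / (\<theta> n)\<^sup>2"
            using t by (simp add: diff_divide_distrib)
          then show ?thesis by (simp only: abs_divide abs_power2)
        qed
        finally show "norm (y n / (\<theta> n)\<^sup>2 - 2 * \<rho>) \<le> norm (10 * c * \<theta> n) * 1" by simp
      qed
    qed
    from tendsto_add[OF this tendsto_const[of "2 * \<rho>"]] show ?thesis by simp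
  qed
  have y0: "y \<longlonglongrightarrow> 0"
  proof -
    have "(\<lambda>n. y n / (\<theta> n)\<^sup>2 * (\<theta> n)\<^sup>2) \<longlonglongrightarrow> 2 * \<rho> * 0\<^sup>2" by (intro tendsto_intros 3 \<theta>)
    then show ?thesis using \<theta>(1) by (simp add: less_imp_neq[THEN not_sym])
  qed
  have 4: "(\<lambda>n. (exp (y n) - 1) / (\<theta> n)\<^sup>2) \<longlonglongrightarrow> 2 * \<rho>"
  proof -
    have "(\<lambda>n. (exp (y n) - 1 - y n) / (\<theta> n)\<^sup>2) \<longlonglongrightarrow> 0"
    proof (rule tendsto_0_le[where K=1])
      have "(\<lambda>n. y n / (\<theta> n)\<^sup>2 * y n * (1 + exp (y n))) \<longlonglongrightarrow> 2 * \<rho> * 0 * (1 + exp 0)"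
        by (intro tendsto_intros 3 y0)
      then show "(\<lambda>n. y n / (\<theta> n)\<^sup>2 * y n * (1 + exp (y n))) \<longlonglongrightarrow> 0" by simp
      show "\<forall>\<^sub>F n in sequentially. norm ((exp (y n) - 1 - y n) / (\<theta> n)\<^sup>2) \<le> norm (y n / (\<theta> n)\<^sup>2 * y n * (1 + exp (y n))) * 1"
      proof (intro always_eventually allI)
        fix n
        have t: "\<theta> n > 0" by (rule \<theta>)
        have "\<bar>exp (y n) - 1 - y n\<bar> / (\<theta> n)\<^sup>2 \<le> (y n)\<^sup>2 * (1 + exp (y n)) / (\<theta> n)\<^sup>2"
          using exp_second_order_bound[of "y n"] by (simp add: divide_right_mono)
        also have "\<dots> = y n / (\<theta> n)\<^sup>2 * y n * (1 + exp (y n))" by (simp add: power2_eq_square)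
        finally show "norm ((exp (y n) - 1 - y n) / (\<theta> n)\<^sup>2) \<le> norm (y n / (\<theta> n)\<^sup>2 * y n * (1 + exp (y n))) * 1"
          by (simp add: abs_divide)
      qed
    qed
    from tendsto_add[OF this 3] show ?thesis by (simp add: add_divide_distrib[symmetric])
  qed
  have "(\<lambda>n. ((1 - exp (- a (\<theta> n))) / \<theta> n)\<^sup>2 + (exp (- a (\<theta> n)))\<^sup>2 * ((exp (y n) - 1) / (\<theta> n)\<^sup>2)) \<longlonglongrightarrow> m\<^sup>2 + (exp (- 0))\<^sup>2 * (2 * \<rho>)"
    by (intro tendsto_intros 2 4 a0)
  moreover have "((1 - exp (- a (\<theta> n))) / \<theta> n)\<^sup>2 + (exp (- a (\<theta> n)))\<^sup>2 * ((exp (y n) - 1) / (\<theta> n)\<^sup>2)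
     = (1 - 2 * exp (- a (\<theta> n)) + exp (- a (2 * \<theta> n))) / (\<theta> n)\<^sup>2" for n
  proof -
    have "(exp (- a (\<theta> n)))\<^sup>2 * exp (y n) = exp (- a (2 * \<theta> n))"
      by (simp add: y_def exp_double[symmetric] mult_exp_exp)
    then show ?thesis
      by (simp add: power_divide add_divide_distrib[symmetric] power2_diff algebra_simps)
  qed
  ultimately show ?thesis by simp
qed

text \<open>The second difference of the Laplace transform, divided by \<theta>^2, is the integral
  of the square of (1 - exp (- \<theta> Y)) / \<theta>, which tends to Y^2 and stays below it.
  Fatou's lemma first shows that Y^2 is integrable; then Y^2 is the majorant for dominated
  convergence.\<close>

lemma second_moment_from_laplace:
  fixes Y :: "'a \<Rightarrow> real"
  assumes "prob_space M" and [measurable]: "Y \<in> borel_measurable M" and Y: "\<And>x. x \<in> space M \<Longrightarrow> 0 \<le> Y x"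
    and L: "\<And>\<theta>. \<theta> \<ge> 0 \<Longrightarrow> (\<integral>x. exp (- (\<theta> * Y x)) \<partial>M) = exp (- a \<theta>)"
    and a: "\<And>\<theta>. \<theta> \<ge> 0 \<Longrightarrow> \<bar>a \<theta> - (\<theta> * m - \<rho> * \<theta>\<^sup>2)\<bar> \<le> c * \<theta> ^ 3"
  shows "integrable M (\<lambda>x. (Y x)\<^sup>2)" and "(\<integral>x. (Y x)\<^sup>2 \<partial>M) = m\<^sup>2 + 2 * \<rho>"
proof -
  interpret prob_space M by fact
  define \<theta> where "\<theta> n = inverse (real (Suc n))" for n
  have \<theta>: "\<theta> n > 0" for n by (simp add: \<theta>_def)
  have \<theta>0: "\<theta> \<longlonglongrightarrow> 0" unfolding \<theta>_def by (rule LIMSEQ_inverse_real_of_nat)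
  define g where "g n x = ((1 - exp (- (\<theta> n * Y x))) / \<theta> n)\<^sup>2" for n x
  have [measurable]: "g n \<in> borel_measurable M" for n unfolding g_def by measurable
  have ib: "integrable M (\<lambda>x. exp (- (b * Y x)))" if "b \<ge> 0" for b
    by (rule integrable_const_bound[where B=1]) (use Y that in auto)
  have ge: "g n x = (1 - 2 * exp (- (\<theta> n * Y x)) + exp (- ((2 * \<theta> n) * Y x))) / (\<theta> n)\<^sup>2" for n x
    by (simp add: g_def power_divide power2_diff exp_double[symmetric] mult_ac)
  have gi: "integrable M (g n)" for n
    unfolding ge using ib[of "\<theta> n"] ib[of "2 * \<theta> n"] \<theta>[of n] by simp
  have gI: "(\<integral>x. g n x \<partial>M) = (1 - 2 * exp (- a (\<theta> n)) + exp (- a (2 * \<theta> n))) / (\<theta> n)\<^sup>2" for n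
    unfolding ge using ib[of "\<theta> n"] ib[of "2 * \<theta> n"] \<theta>[of n] L[of "\<theta> n"] L[of "2 * \<theta> n"] prob_space by simp
  have lim: "(\<lambda>n. \<integral>x. g n x \<partial>M) \<longlonglongrightarrow> m\<^sup>2 + 2 * \<rho>"
    unfolding gI by (rule second_difference_exp_limit[OF a \<theta> \<theta>0])
  have gl: "(\<lambda>n. g n x) \<longlonglongrightarrow> (Y x)\<^sup>2" for x
  proof -
    have "((\<lambda>h. exp (- (h * Y x))) has_real_derivative - Y x) (at 0)" by (auto intro!: derivative_eq_intros)
    then have "((\<lambda>h. (exp (- (h * Y x)) - 1) / h) \<longlongrightarrow> - Y x) (at 0)" by (simp add: DERIV_def)
    moreover have "filterlim \<theta> (at 0) sequentially" using \<theta>0 \<theta> by (auto simp: filterlim_at intro!: always_eventually less_imp_neq[THEN not_sym])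
    ultimately have "(\<lambda>n. (exp (- (\<theta> n * Y x)) - 1) / \<theta> n) \<longlonglongrightarrow> - Y x" by (rule filterlim_compose)
    from tendsto_power[OF tendsto_minus[OF this], of 2] show ?thesis by (simp add: g_def minus_divide_left)
  qed
  have gb: "g n x \<le> (Y x)\<^sup>2" if "x \<in> space M" for n x
  proof -
    have "1 - exp (- (\<theta> n * Y x)) \<le> \<theta> n * Y x" using exp_ge_add_one_self[of "- (\<theta> n * Y x)"] by simp
    then have "(1 - exp (- (\<theta> n * Y x))) / \<theta> n \<le> Y x" using \<theta>[of n] by (simp add: field_simps)
    moreover have "0 \<le> (1 - exp (- (\<theta> n * Y x))) / \<theta> n" using \<theta>[of n] Y[OF that] by simp
    ultimately show ?thesis unfolding g_def by (rule power_mono)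
  qed
  have "(\<integral>\<^sup>+x. ennreal ((Y x)\<^sup>2) \<partial>M) = (\<integral>\<^sup>+x. liminf (\<lambda>n. ennreal (g n x)) \<partial>M)"
  proof (intro nn_integral_cong)
    fix x
    have "(\<lambda>n. ennreal (g n x)) \<longlonglongrightarrow> ennreal ((Y x)\<^sup>2)" using gl by (intro tendsto_ennrealI)
    then show "ennreal ((Y x)\<^sup>2) = liminf (\<lambda>n. ennreal (g n x))" by (simp add: lim_imp_Liminf)
  qed
  also have "\<dots> \<le> liminf (\<lambda>n. \<integral>\<^sup>+x. ennreal (g n x) \<partial>M)" by (rule nn_integral_liminf) measurable
  also have "(\<lambda>n. \<integral>\<^sup>+x. ennreal (g n x) \<partial>M) = (\<lambda>n. ennreal (\<integral>x. g n x \<partial>M))"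
    by (intro ext nn_integral_eq_integral gi) (simp add: g_def)
  also have "liminf \<dots> = ennreal (m\<^sup>2 + 2 * \<rho>)"
    by (intro lim_imp_Liminf tendsto_ennrealI lim) simp
  also have "\<dots> < \<infinity>" by simp
  finally show int: "integrable M (\<lambda>x. (Y x)\<^sup>2)" by (intro integrableI_nonneg) auto
  have "(\<lambda>n. \<integral>x. g n x \<partial>M) \<longlonglongrightarrow> (\<integral>x. (Y x)\<^sup>2 \<partial>M)"
    by (rule integral_dominated_convergence[OF _ _ int]) (use gl gb in \<open>auto simp: g_def\<close>)
  with lim show "(\<integral>x. (Y x)\<^sup>2 \<partial>M) = m\<^sup>2 + 2 * \<rho>" by (intro LIMSEQ_unique)
qed

section \<open>Moments under the transition kernel\<close>

locale ou_branching =
  fixes \<sigma> \<mu> \<alpha> \<beta> :: real and Q :: "real \<Rightarrow> (real^'n) measure \<Rightarrow> (real^'n) measure measure"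
  assumes pos: "\<mu> > 0" "\<sigma> > 0" and abpos: "\<alpha> > 0" "\<beta> > 0"
    and kernel: "ou_superprocess_kernel \<sigma> \<mu> \<alpha> \<beta> Q"
begin

abbreviation "FM \<equiv> finite_measure_algebra (borel :: (real^'n) measure)"

lemma kernel_measurable [measurable]: "t \<ge> 0 \<Longrightarrow> Q t \<in> FM \<rightarrow>\<^sub>M prob_algebra FM"
  using kernel by (auto simp: ou_superprocess_kernel_def)

lemma kernel_prob_space:
  assumes "t \<ge> 0" "\<eta> \<in> space FM"
  shows "prob_space (Q t \<eta>)" and "sets (Q t \<eta>) = sets FM"
  using measurable_space[OF kernel_measurable[OF assms(1)] assms(2)] by (auto simp: space_prob_algebra)

lemma kernel_space: "t \<ge> 0 \<Longrightarrow> \<eta> \<in> space FM \<Longrightarrow> space (Q t \<eta>) = space FM"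
  using kernel_prob_space(2) by (rule sets_eq_imp_space_eq)

lemma FM_D: "\<xi> \<in> space FM \<Longrightarrow> finite_measure \<xi>" "\<xi> \<in> space FM \<Longrightarrow> sets \<xi> = sets borel" "\<xi> \<in> space FM \<Longrightarrow> space \<xi> = UNIV"
  by (auto simp: space_finite_measure_algebra dest: sets_eq_imp_space_eq)

lemma FM_bounded_integrable:
  fixes f :: "real^'n \<Rightarrow> real"
  assumes "\<xi> \<in> space FM" "f \<in> borel_measurable borel" "\<And>x. \<bar>f x\<bar> \<le> b"
  shows "integrable \<xi> f"
  by (rule finite_measure.integrable_const_bound[OF FM_D(1)[OF assms(1)], where B=b])
     (use assms in \<open>auto simp: measurable_cong_sets[OF FM_D(2)[OF assms(1)] refl]\<close>)

lemma kernel_laplace: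
  fixes f :: "real^'n \<Rightarrow> real"
  assumes f: "f \<in> borel_measurable borel" "\<And>x. 0 \<le> f x" "\<And>x. f x \<le> b"
  obtains u where "log_laplace_solution \<sigma> \<mu> \<alpha> \<beta> f u"
    and "\<And>t \<eta>. t \<ge> 0 \<Longrightarrow> \<eta> \<in> space FM \<Longrightarrow> (\<integral>\<xi>. exp (- (\<integral>x. f x \<partial>\<xi>)) \<partial>Q t \<eta>) = exp (- (\<integral>x. u x t \<partial>\<eta>))"
proof -
  have "bounded (range f)" using f(2,3) by (auto simp: bounded_iff intro!: exI[of _ b])
  then obtain u where u: "log_laplace_solution \<sigma> \<mu> \<alpha> \<beta> f u"
    and e: "\<And>t \<eta>. t \<ge> 0 \<Longrightarrow> \<eta> \<in> space FM \<Longrightarrow> - ln (\<integral>\<xi>. exp (- (\<integral>x. f x \<partial>\<xi>)) \<partial>Q t \<eta>) = (\<integral>x. u x t \<partial>\<eta>)"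
    using kernel[unfolded ou_superprocess_kernel_def, THEN conjunct2, rule_format, of f] f(1,2) by blast
  show ?thesis
  proof (rule that[OF u])
    fix t \<eta> assume t: "t \<ge> (0 :: real)" and \<eta>: "\<eta> \<in> space FM"
    interpret prob_space "Q t \<eta>" using t \<eta> by (rule kernel_prob_space)
    have [measurable_cong]: "sets (Q t \<eta>) = sets FM" by (rule kernel_prob_space[OF t \<eta>])
    have [measurable]: "f \<in> borel_measurable borel" by (rule f)
    let ?I = "\<lambda>\<xi>. exp (- (\<integral>x. f x \<partial>\<xi>))"
    have i: "integrable (Q t \<eta>) ?I"
      by (rule integrable_const_bound[where B=1]) (auto simp: f)
    \<comment> \<open>The kernel is specified through \<open>ln\<close>, which determines its
      argument only among positive reals; so positivity of the Laplace functional must come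
      first.\<close>
    have "(\<integral>\<xi>. ?I \<xi> \<partial>Q t \<eta>) \<noteq> 0"
    proof
      assume "(\<integral>\<xi>. ?I \<xi> \<partial>Q t \<eta>) = 0"
      then have "AE \<xi> in Q t \<eta>. ?I \<xi> = 0" using i by (subst (asm) integral_nonneg_eq_0_iff_AE) auto
      then show False by simp
    qed
    moreover have "(\<integral>\<xi>. ?I \<xi> \<partial>Q t \<eta>) \<ge> 0" by (intro integral_nonneg_AE) simp
    ultimately have p: "(\<integral>\<xi>. ?I \<xi> \<partial>Q t \<eta>) > 0" by (metis less_eq_real_def)
    from e[OF t \<eta>] have "ln (\<integral>\<xi>. ?I \<xi> \<partial>Q t \<eta>) = - (\<integral>x. u x t \<partial>\<eta>)" by simp
    with p show "(\<integral>\<xi>. ?I \<xi> \<partial>Q t \<eta>) = exp (- (\<integral>x. u x t \<partial>\<eta>))" by (metis exp_ln)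
  qed
qed

lemma kernel_mass_laplace:
  assumes "l \<ge> 0" "t \<ge> 0" "\<eta> \<in> space FM"
  shows "(\<integral>\<xi>. exp (- (l * total_mass \<xi>)) \<partial>Q t \<eta>) = exp (- (total_mass \<eta> * mass_exponent \<alpha> \<beta> l t))"
proof -
  obtain u where u: "log_laplace_solution \<sigma> \<mu> \<alpha> \<beta> (\<lambda>_. l) u"
    and e: "\<And>t \<eta>. t \<ge> 0 \<Longrightarrow> \<eta> \<in> space FM \<Longrightarrow> (\<integral>\<xi>. exp (- (\<integral>x. l \<partial>\<xi>)) \<partial>Q t \<eta>) = exp (- (\<integral>x. u x t \<partial>\<eta>))"
    by (rule kernel_laplace[of "\<lambda>_. l" l]) (use assms in auto)
  have "u x t = mass_exponent \<alpha> \<beta> l t" for x by (rule log_laplace_const_unique[OF pos abpos assms(1) u assms(2)])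
  with e[OF assms(2,3)] show ?thesis by (simp add: mult.commute)
qed

lemma mean_flow_section:
  fixes f :: "real^'n \<Rightarrow> real"
  assumes "f \<in> borel_measurable borel" "\<And>y. \<bar>f y\<bar> \<le> b"
  shows "(\<lambda>x. mean_flow \<sigma> \<mu> \<alpha> f x t) \<in> borel_measurable borel" "\<bar>mean_flow \<sigma> \<mu> \<alpha> f x t\<bar> \<le> b * exp (\<alpha> * t)"
  using ou_slice_measurable[OF pos measurable_mean_flow[OF pos abpos assms(1)]] mean_flow_abs_le[OF pos abpos assms]
  by auto

lemma mean_flow_square:
  fixes f :: "real^'n \<Rightarrow> real"
  assumes "f \<in> borel_measurable borel" "\<And>y. \<bar>f y\<bar> \<le> b"
  shows "(\<lambda>(y, r). (mean_flow \<sigma> \<mu> \<alpha> f y r)\<^sup>2) \<in> borel_measurable borel"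
    and "r \<in> {0..t} \<Longrightarrow> \<bar>(mean_flow \<sigma> \<mu> \<alpha> f y r)\<^sup>2\<bar> \<le> (b * exp (\<alpha> * t))\<^sup>2"
proof -
  show "(\<lambda>(y, r). (mean_flow \<sigma> \<mu> \<alpha> f y r)\<^sup>2) \<in> borel_measurable borel"
    using measurable_mean_flow[OF pos abpos assms(1)] by (intro case_prod_borel_arith(3)[OF pos abpos])
  show "\<bar>(mean_flow \<sigma> \<mu> \<alpha> f y r)\<^sup>2\<bar> \<le> (b * exp (\<alpha> * t))\<^sup>2" if "r \<in> {0..t}"
    using power_mono[OF mean_flow_abs_le[OF pos abpos assms, of r t y], of 2] that by simp
qed

lemma covariance_flow_section:
  fixes f :: "real^'n \<Rightarrow> real"
  assumes f: "f \<in> borel_measurable borel" "\<And>y. \<bar>f y\<bar> \<le> b"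
  shows "(\<lambda>x. covariance_flow \<sigma> \<mu> \<alpha> f x t) \<in> borel_measurable borel"
    and "\<exists>B. \<forall>x. \<bar>covariance_flow \<sigma> \<mu> \<alpha> f x t\<bar> \<le> B"
proof -
  note m = mean_flow_square[OF f]
  show "(\<lambda>x. covariance_flow \<sigma> \<mu> \<alpha> f x t) \<in> borel_measurable borel"
    using ou_slice_measurable[OF pos measurable_ou_duhamel[OF pos m(1)]]
    by (simp add: covariance_flow_def[OF pos abpos])
  have "\<bar>covariance_flow \<sigma> \<mu> \<alpha> f x t\<bar> \<le> (\<integral>s\<in>{0..t}. exp (\<alpha> * s) * (b * exp (\<alpha> * t))\<^sup>2 \<partial>lborel)" for x
    unfolding covariance_flow_def[OF pos abpos] by (rule ou_duhamel_abs_le[OF pos m]) auto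
  then show "\<exists>B. \<forall>x. \<bar>covariance_flow \<sigma> \<mu> \<alpha> f x t\<bar> \<le> B" by blast
qed

lemma kernel_second_moment_nonneg:
  fixes f :: "real^'n \<Rightarrow> real"
  assumes f: "f \<in> borel_measurable borel" "\<And>x. 0 \<le> f x" "\<And>x. f x \<le> b" and t: "t \<ge> 0" and \<eta>: "\<eta> \<in> space FM"
  shows "integrable (Q t \<eta>) (\<lambda>\<xi>. (\<integral>x. f x \<partial>\<xi>)\<^sup>2)"
    and "(\<integral>\<xi>. (\<integral>x. f x \<partial>\<xi>)\<^sup>2 \<partial>Q t \<eta>) =
      (\<integral>x. mean_flow \<sigma> \<mu> \<alpha> f x t \<partial>\<eta>)\<^sup>2 + 2 * (\<beta> * (\<integral>x. covariance_flow \<sigma> \<mu> \<alpha> f x t \<partial>\<eta>))"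
proof -
  have [measurable]: "f \<in> borel_measurable borel" by (rule f)
  interpret prob_space "Q t \<eta>" using t \<eta> by (rule kernel_prob_space)
  interpret \<eta>: finite_measure \<eta> using \<eta> by (rule FM_D)
  have [measurable_cong]: "sets (Q t \<eta>) = sets FM" by (rule kernel_prob_space[OF t \<eta>])
  obtain c where c: "\<And>\<theta> u x. \<theta> \<ge> 0 \<Longrightarrow> log_laplace_solution \<sigma> \<mu> \<alpha> \<beta> (\<lambda>x. \<theta> * f x) u \<Longrightarrow>
     \<bar>u x t - (\<theta> * mean_flow \<sigma> \<mu> \<alpha> f x t - \<beta> * \<theta>\<^sup>2 * covariance_flow \<sigma> \<mu> \<alpha> f x t)\<bar> \<le> c * \<theta> ^ 3"
    using log_laplace_expansion[OF pos abpos f t] by blast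
  define sol where "sol \<theta> u \<longleftrightarrow> log_laplace_solution \<sigma> \<mu> \<alpha> \<beta> (\<lambda>x. \<theta> * f x) u \<and>
     (\<integral>\<xi>. exp (- (\<integral>x. \<theta> * f x \<partial>\<xi>)) \<partial>Q t \<eta>) = exp (- (\<integral>x. u x t \<partial>\<eta>))" for \<theta> u
  have "\<exists>u. sol \<theta> u" if "\<theta> \<ge> 0" for \<theta>
  proof -
    have th: "(\<lambda>x. \<theta> * f x) \<in> borel_measurable borel" "\<And>x. 0 \<le> \<theta> * f x" "\<And>x. \<theta> * f x \<le> \<theta> * b"
      using that f by (auto intro: mult_left_mono)
    obtain u where "log_laplace_solution \<sigma> \<mu> \<alpha> \<beta> (\<lambda>x. \<theta> * f x) u"
      and "\<And>t \<eta>. t \<ge> 0 \<Longrightarrow> \<eta> \<in> space FM \<Longrightarrow> (\<integral>\<xi>. exp (- (\<integral>x. \<theta> * f x \<partial>\<xi>)) \<partial>Q t \<eta>) = exp (- (\<integral>x. u x t \<partial>\<eta>))"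
      by (rule kernel_laplace[OF th]) blast
    then show ?thesis using t \<eta> unfolding sol_def by blast
  qed
  \<comment> \<open>A solution is chosen for each \<theta> separately, without any regularity in
    \<theta>; the uniform constant \<open>c\<close> ties them together.\<close>
  then obtain U where U: "\<And>\<theta>. \<theta> \<ge> 0 \<Longrightarrow> sol \<theta> (U \<theta>)" by metis
  define a where "a \<theta> = (\<integral>x. U \<theta> x t \<partial>\<eta>)" for \<theta>
  define mb where "mb = (\<integral>x. mean_flow \<sigma> \<mu> \<alpha> f x t \<partial>\<eta>)"
  define rb where "rb = (\<integral>x. covariance_flow \<sigma> \<mu> \<alpha> f x t \<partial>\<eta>)"
  have fb: "\<And>y. \<bar>f y\<bar> \<le> b" using f by auto
  have im: "integrable \<eta> (\<lambda>x. mean_flow \<sigma> \<mu> \<alpha> f x t)"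
    by (rule FM_bounded_integrable[OF \<eta> mean_flow_section[OF f(1) fb]])
  have ir: "integrable \<eta> (\<lambda>x. covariance_flow \<sigma> \<mu> \<alpha> f x t)"
    using covariance_flow_section[OF f(1) fb, of t] FM_bounded_integrable[OF \<eta>] by blast
  have L: "(\<integral>\<xi>. exp (- (\<theta> * (\<integral>x. f x \<partial>\<xi>))) \<partial>Q t \<eta>) = exp (- a \<theta>)" if "\<theta> \<ge> 0" for \<theta>
    using U[OF that] by (simp add: sol_def a_def)
  have A: "\<bar>a \<theta> - (\<theta> * mb - (\<beta> * rb) * \<theta>\<^sup>2)\<bar> \<le> (c * total_mass \<eta>) * \<theta> ^ 3" if \<theta>: "\<theta> \<ge> 0" for \<theta>
  proof -
    have s: "log_laplace_solution \<sigma> \<mu> \<alpha> \<beta> (\<lambda>x. \<theta> * f x) (U \<theta>)" using U[OF \<theta>] by (simp add: sol_def)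
    obtain B where "\<And>x. \<bar>U \<theta> x t\<bar> \<le> B"
    proof -
      obtain B where "\<And>x r. r \<in> {0..t} \<Longrightarrow> U \<theta> x r \<le> B" by (rule log_laplace_solution_bounded[OF s t]) blast
      then have "\<bar>U \<theta> x t\<bar> \<le> B" for x using s t by (auto simp: log_laplace_solution_def)
      then show ?thesis by (rule that)
    qed
    moreover have "(\<lambda>x. U \<theta> x t) \<in> borel_measurable borel"
      by (rule ou_slice_measurable[OF pos]) (use s in \<open>simp add: log_laplace_solution_def\<close>)
    ultimately have iu: "integrable \<eta> (\<lambda>x. U \<theta> x t)" by (intro FM_bounded_integrable[OF \<eta>])
    let ?d = "\<lambda>x. U \<theta> x t - (\<theta> * mean_flow \<sigma> \<mu> \<alpha> f x t - \<beta> * \<theta>\<^sup>2 * covariance_flow \<sigma> \<mu> \<alpha> f x t)"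
    have "a \<theta> - (\<theta> * mb - (\<beta> * rb) * \<theta>\<^sup>2) = (\<integral>x. ?d x \<partial>\<eta>)"
      unfolding a_def mb_def rb_def using iu im ir by (simp add: mult_ac)
    then have "\<bar>a \<theta> - (\<theta> * mb - (\<beta> * rb) * \<theta>\<^sup>2)\<bar> = \<bar>\<integral>x. ?d x \<partial>\<eta>\<bar>" by (rule arg_cong)
    also have "\<dots> \<le> (\<integral>x. \<bar>?d x\<bar> \<partial>\<eta>)" by (rule integral_abs_bound)
    also have "\<dots> \<le> (\<integral>x. c * \<theta> ^ 3 \<partial>\<eta>)" using iu im ir c[OF \<theta> s] by (intro integral_mono) auto
    finally show ?thesis by (simp add: mult_ac)
  qed
  note R = second_moment_from_laplace[OF prob_space_axioms _ _ L A]
  show "integrable (Q t \<eta>) (\<lambda>\<xi>. (\<integral>x. f x \<partial>\<xi>)\<^sup>2)" by (rule R) (auto simp: f)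
  show "(\<integral>\<xi>. (\<integral>x. f x \<partial>\<xi>)\<^sup>2 \<partial>Q t \<eta>) = (\<integral>x. mean_flow \<sigma> \<mu> \<alpha> f x t \<partial>\<eta>)\<^sup>2 + 2 * (\<beta> * (\<integral>x. covariance_flow \<sigma> \<mu> \<alpha> f x t \<partial>\<eta>))"
    unfolding mb_def[symmetric] rb_def[symmetric] by (rule R) (auto simp: f)
qed

end

context ou_branching
begin

text \<open>Laplace functionals are given for nonnegative functions only. With p and q the positive
  and negative parts, the identity (p - q)^2 = 2 p^2 + 2 q^2 - (p + q)^2 reduces the claim to p, q
  and \<bar>f\<bar>, because every term of the formula is a quadratic form in f.\<close>

lemma kernel_second_moment:
  fixes f :: "real^'n \<Rightarrow> real"
  assumes f: "f \<in> borel_measurable borel" "\<And>x. \<bar>f x\<bar> \<le> b" and t: "t \<ge> 0" and \<eta>: "\<eta> \<in> space FM"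
  shows "integrable (Q t \<eta>) (\<lambda>\<xi>. (\<integral>x. f x \<partial>\<xi>)\<^sup>2)"
    and "(\<integral>\<xi>. (\<integral>x. f x \<partial>\<xi>)\<^sup>2 \<partial>Q t \<eta>) =
      (\<integral>x. mean_flow \<sigma> \<mu> \<alpha> f x t \<partial>\<eta>)\<^sup>2 + 2 * (\<beta> * (\<integral>x. covariance_flow \<sigma> \<mu> \<alpha> f x t \<partial>\<eta>))"
proof -
  define p where "p x = max (f x) 0" for x
  define q where "q x = max (- f x) 0" for x
  define s where "s x = \<bar>f x\<bar>" for x
  let ?M = "mean_flow \<sigma> \<mu> \<alpha>"
  let ?V = "covariance_flow \<sigma> \<mu> \<alpha>"
  have [measurable]: "f \<in> borel_measurable borel" by (rule f)
  have pm: "p \<in> borel_measurable borel" "\<And>x. 0 \<le> p x" "\<And>x. p x \<le> b" "\<And>x. \<bar>p x\<bar> \<le> b"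
    unfolding p_def using f(2) by (auto simp: max_def abs_le_iff) (smt (verit) f(2))+
  have qm: "q \<in> borel_measurable borel" "\<And>x. 0 \<le> q x" "\<And>x. q x \<le> b" "\<And>x. \<bar>q x\<bar> \<le> b"
    unfolding q_def using f(2) by (auto simp: max_def abs_le_iff) (smt (verit) f(2))+
  have sm: "s \<in> borel_measurable borel" "\<And>x. 0 \<le> s x" "\<And>x. s x \<le> b" "\<And>x. \<bar>s x\<bar> \<le> b"
    unfolding s_def using f(2) by auto
  have fe: "f = (\<lambda>x. 1 * p x + (-1) * q x)" and se: "s = (\<lambda>x. 1 * p x + 1 * q x)"
    by (auto simp: p_def q_def s_def fun_eq_iff)
  have sq: "z1\<^sup>2 = 2 * p1\<^sup>2 + 2 * q1\<^sup>2 - s1\<^sup>2" if "z1 = p1 - q1" "s1 = p1 + q1" for z1 p1 q1 s1 :: real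
    unfolding that by (simp add: power2_eq_square algebra_simps)
  have I: "(\<integral>x. f x \<partial>\<xi>) = (\<integral>x. p x \<partial>\<xi>) - (\<integral>x. q x \<partial>\<xi>)" "(\<integral>x. s x \<partial>\<xi>) = (\<integral>x. p x \<partial>\<xi>) + (\<integral>x. q x \<partial>\<xi>)" if "\<xi> \<in> space FM" for \<xi>
    using FM_bounded_integrable[OF that pm(1,4)] FM_bounded_integrable[OF that qm(1,4)]
    by (simp_all add: fe se)
  have I2: "(\<integral>x. f x \<partial>\<xi>)\<^sup>2 = 2 * (\<integral>x. p x \<partial>\<xi>)\<^sup>2 + 2 * (\<integral>x. q x \<partial>\<xi>)\<^sup>2 - (\<integral>x. s x \<partial>\<xi>)\<^sup>2" if "\<xi> \<in> space FM" for \<xi>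
    by (rule sq[OF I[OF that]])
  note mp = kernel_second_moment_nonneg[OF pm(1-3) t \<eta>]
  note mq = kernel_second_moment_nonneg[OF qm(1-3) t \<eta>]
  note ms = kernel_second_moment_nonneg[OF sm(1-3) t \<eta>]
  have "integrable (Q t \<eta>) (\<lambda>\<xi>. 2 * (\<integral>x. p x \<partial>\<xi>)\<^sup>2 + 2 * (\<integral>x. q x \<partial>\<xi>)\<^sup>2 - (\<integral>x. s x \<partial>\<xi>)\<^sup>2)"
    using mp(1) mq(1) ms(1) by simp
  then show "integrable (Q t \<eta>) (\<lambda>\<xi>. (\<integral>x. f x \<partial>\<xi>)\<^sup>2)"
    using kernel_space[OF t \<eta>] I2 by (subst Bochner_Integration.integrable_cong[OF refl]) auto
  have "(\<integral>\<xi>. (\<integral>x. f x \<partial>\<xi>)\<^sup>2 \<partial>Q t \<eta>) = (\<integral>\<xi>. 2 * (\<integral>x. p x \<partial>\<xi>)\<^sup>2 + 2 * (\<integral>x. q x \<partial>\<xi>)\<^sup>2 - (\<integral>x. s x \<partial>\<xi>)\<^sup>2 \<partial>Q t \<eta>)"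
    using kernel_space[OF t \<eta>] I2 by (intro Bochner_Integration.integral_cong) auto
  also have "\<dots> = 2 * (\<integral>\<xi>. (\<integral>x. p x \<partial>\<xi>)\<^sup>2 \<partial>Q t \<eta>) + 2 * (\<integral>\<xi>. (\<integral>x. q x \<partial>\<xi>)\<^sup>2 \<partial>Q t \<eta>) - (\<integral>\<xi>. (\<integral>x. s x \<partial>\<xi>)\<^sup>2 \<partial>Q t \<eta>)"
    using mp(1) mq(1) ms(1) by simp
  finally have main: "(\<integral>\<xi>. (\<integral>x. f x \<partial>\<xi>)\<^sup>2 \<partial>Q t \<eta>) = \<dots>" .
  have Pf: "?M f x r = ?M p x r - ?M q x r" for x r
    using ou_semigroup_lincomb[OF pos pm(1,4) qm(1,4), of r 1 "-1" x] unfolding fe[symmetric]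
    by (simp add: mean_flow_def[OF pos abpos] ring_distribs)
  have Ps: "?M s x r = ?M p x r + ?M q x r" for x r
    using ou_semigroup_lincomb[OF pos pm(1,4) qm(1,4), of r 1 1 x] unfolding se[symmetric]
    by (simp add: mean_flow_def[OF pos abpos] ring_distribs)
  have mi: "integrable \<eta> (\<lambda>x. ?M p x t)" "integrable \<eta> (\<lambda>x. ?M q x t)"
    by (rule FM_bounded_integrable[OF \<eta> mean_flow_section[OF pm(1,4)]])
       (rule FM_bounded_integrable[OF \<eta> mean_flow_section[OF qm(1,4)]])
  have mbar: "(\<integral>x. ?M f x t \<partial>\<eta>)\<^sup>2 = 2 * (\<integral>x. ?M p x t \<partial>\<eta>)\<^sup>2 + 2 * (\<integral>x. ?M q x t \<partial>\<eta>)\<^sup>2 - (\<integral>x. ?M s x t \<partial>\<eta>)\<^sup>2"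
    by (rule sq) (use mi in \<open>simp_all add: Pf Ps\<close>)
  note Sp = mean_flow_square[OF pm(1,4)] and Sq = mean_flow_square[OF qm(1,4)] and Ss = mean_flow_square[OF sm(1,4)]
  have V: "?V f x t = 2 * ?V p x t + 2 * ?V q x t - ?V s x t" for x
  proof -
    have e1: "ou_duhamel \<sigma> \<mu> \<alpha> (\<lambda>y r. 2 * (?M p y r)\<^sup>2 + 2 * (?M q y r)\<^sup>2) x t
       = 2 * ou_duhamel \<sigma> \<mu> \<alpha> (\<lambda>y r. (?M p y r)\<^sup>2) x t + 2 * ou_duhamel \<sigma> \<mu> \<alpha> (\<lambda>y r. (?M q y r)\<^sup>2) x t"
      by (rule ou_duhamel_lincomb[OF pos Sp Sq])
    have m1: "(\<lambda>(y, r). 2 * (?M p y r)\<^sup>2 + 2 * (?M q y r)\<^sup>2) \<in> borel_measurable borel"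
      by (rule case_prod_borel_arith(1)[OF pos abpos Sp(1) Sq(1)])
    have b1: "\<bar>2 * (?M p y r)\<^sup>2 + 2 * (?M q y r)\<^sup>2\<bar> \<le> 4 * (b * exp (\<alpha> * t))\<^sup>2" if "r \<in> {0..t}" for y r
      using Sp(2)[OF that, of y] Sq(2)[OF that, of y] by simp
    have "ou_duhamel \<sigma> \<mu> \<alpha> (\<lambda>y r. 1 * (2 * (?M p y r)\<^sup>2 + 2 * (?M q y r)\<^sup>2) + (-1) * (?M s y r)\<^sup>2) x t
       = 1 * ou_duhamel \<sigma> \<mu> \<alpha> (\<lambda>y r. 2 * (?M p y r)\<^sup>2 + 2 * (?M q y r)\<^sup>2) x t + (-1) * ou_duhamel \<sigma> \<mu> \<alpha> (\<lambda>y r. (?M s y r)\<^sup>2) x t"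
      by (rule ou_duhamel_lincomb[OF pos m1 b1 Ss])
    moreover have "(\<lambda>y r. (?M f y r)\<^sup>2) = (\<lambda>y r. 1 * (2 * (?M p y r)\<^sup>2 + 2 * (?M q y r)\<^sup>2) + (-1) * (?M s y r)\<^sup>2)"
      using sq[OF Pf Ps] by (simp add: fun_eq_iff)
    ultimately show ?thesis using e1 by (simp add: covariance_flow_def[OF pos abpos])
  qed
  have vi: "integrable \<eta> (\<lambda>x. ?V g x t)" if "g \<in> borel_measurable borel" "\<And>y. \<bar>g y\<bar> \<le> b" for g
    using covariance_flow_section[OF that, of t] FM_bounded_integrable[OF \<eta>] by blast
  have vb: "(\<integral>x. ?V f x t \<partial>\<eta>) = 2 * (\<integral>x. ?V p x t \<partial>\<eta>) + 2 * (\<integral>x. ?V q x t \<partial>\<eta>) - (\<integral>x. ?V s x t \<partial>\<eta>)"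
    unfolding V using vi[OF pm(1,4)] vi[OF qm(1,4)] vi[OF sm(1,4)] by simp
  show "(\<integral>\<xi>. (\<integral>x. f x \<partial>\<xi>)\<^sup>2 \<partial>Q t \<eta>) = (\<integral>x. ?M f x t \<partial>\<eta>)\<^sup>2 + 2 * (\<beta> * (\<integral>x. ?V f x t \<partial>\<eta>))"
    unfolding main mp(2) mq(2) ms(2) mbar vb by (simp add: algebra_simps)
qed

text \<open>Growth of second moments for a function that decays at rate \<rho> under the semigroup.
  The first term is the squared mean. The second is the branching integral: its exponent \<alpha> s
  + 2 (\<alpha> - \<rho>) (t - s) is at most the larger rate times t, and the interval has length
  t.\<close>

definition moment_growth :: "real \<Rightarrow> real \<Rightarrow> real" where
  "moment_growth \<rho> t = exp (2 * (\<alpha> - \<rho>) * t) + 2 * \<beta> * t * exp (max \<alpha> (2 * (\<alpha> - \<rho>)) * t)"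

text \<open>The estimate depends on \<open>f\<close> through its decay constants only, hence is
  uniform over truncations of an unbounded function. The weight with 2 b comes from squaring the
  mean flow inside the branching integral.\<close>

lemma kernel_second_moment_bound:
  fixes f :: "real^'n \<Rightarrow> real"
  assumes f: "f \<in> borel_measurable borel" "\<And>x. \<bar>f x\<bar> \<le> b0" and t: "t \<ge> 0" and \<eta>: "\<eta> \<in> space FM"
    and P: "\<And>u x. u \<in> {0..t} \<Longrightarrow> \<bar>ou_semigroup \<sigma> \<mu> u f x\<bar> \<le> D * exp (- \<rho> * u) * exp (b * norm x)"
    and b: "b \<ge> 0" and \<eta>b: "\<And>c. integrable \<eta> (\<lambda>x. exp (c * norm x))"
  shows "(\<integral>\<xi>. (\<integral>x. f x \<partial>\<xi>)\<^sup>2 \<partial>Q t \<eta>) \<le>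
    D\<^sup>2 * ((\<integral>x. exp (b * norm x) \<partial>\<eta>)\<^sup>2 + ou_exp_moment \<sigma> \<mu> TYPE('n) (2 * b) * (\<integral>x. exp (2 * b * norm x) \<partial>\<eta>)) * moment_growth \<rho> t"
proof -
  let ?M = "mean_flow \<sigma> \<mu> \<alpha>"
  let ?V = "covariance_flow \<sigma> \<mu> \<alpha>"
  let ?E = "ou_exp_moment \<sigma> \<mu> TYPE('n) (2 * b)"
  define A1 where "A1 = (\<integral>x. exp (b * norm x) \<partial>\<eta>)"
  define A2 where "A2 = (\<integral>x. exp (2 * b * norm x) \<partial>\<eta>)"
  define \<kappa> where "\<kappa> = max \<alpha> (2 * (\<alpha> - \<rho>))"
  have A: "A1 \<ge> 0" "A2 \<ge> 0" unfolding A1_def A2_def by (auto intro!: integral_nonneg_AE)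
  have E: "?E \<ge> 0" using ou_exp_moment_ge_1[where 'n='n, OF pos, of "2 * b"] b by simp
  have D: "D \<ge> 0" using P[of 0 0] t by simp
  have M: "\<bar>?M f x r\<bar> \<le> D * exp ((\<alpha> - \<rho>) * r) * exp (b * norm x)" if "r \<in> {0..t}" for x r
  proof -
    have "\<bar>?M f x r\<bar> = exp (\<alpha> * r) * \<bar>ou_semigroup \<sigma> \<mu> r f x\<bar>" by (simp add: mean_flow_def[OF pos abpos] abs_mult)
    also have "\<dots> \<le> exp (\<alpha> * r) * (D * exp (- \<rho> * r) * exp (b * norm x))" using P[OF that] by (intro mult_left_mono) auto
    also have "\<dots> = D * exp ((\<alpha> - \<rho>) * r) * exp (b * norm x)" by (simp add: left_diff_distrib exp_diff exp_minus divide_inverse)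
    finally show ?thesis .
  qed
  have M2: "\<bar>(?M f x r)\<^sup>2\<bar> \<le> D\<^sup>2 * exp (2 * (\<alpha> - \<rho>) * r) * exp (2 * b * norm x)" if "r \<in> {0..t}" for x r
  proof -
    have "(D * exp ((\<alpha> - \<rho>) * r) * exp (b * norm x))\<^sup>2 = D\<^sup>2 * exp (2 * (\<alpha> - \<rho>) * r) * exp (2 * b * norm x)"
      by (simp only: power_mult_distrib exp_double[symmetric] mult.assoc)
    then show ?thesis using power_mono[OF M[OF that], of x 2] by (simp only: power2_abs abs_power2 abs_ge_zero simp_thms)
  qed
  have tt: "t \<in> {0..t}" using t by simp
  have "\<bar>\<integral>x. ?M f x t \<partial>\<eta>\<bar> \<le> (\<integral>x. \<bar>?M f x t\<bar> \<partial>\<eta>)" by (rule integral_abs_bound)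
  also have "\<dots> \<le> (\<integral>x. D * exp ((\<alpha> - \<rho>) * t) * exp (b * norm x) \<partial>\<eta>)"
    using FM_bounded_integrable[OF \<eta> mean_flow_section[OF f]] \<eta>b M[OF tt] by (intro integral_mono) auto
  also have "\<dots> = D * exp ((\<alpha> - \<rho>) * t) * A1" by (simp add: A1_def)
  finally have "\<bar>\<integral>x. ?M f x t \<partial>\<eta>\<bar>\<^sup>2 \<le> (D * exp ((\<alpha> - \<rho>) * t) * A1)\<^sup>2" by (intro power_mono) auto
  then have 1: "(\<integral>x. ?M f x t \<partial>\<eta>)\<^sup>2 \<le> D\<^sup>2 * A1\<^sup>2 * exp (2 * (\<alpha> - \<rho>) * t)"
    by (simp add: power_mult_distrib exp_double[symmetric] mult_ac)
  note Sf = mean_flow_square[OF f]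
  have V: "?V f x t \<le> (exp (\<kappa> * t) * (D\<^sup>2 * ?E * exp (2 * b * norm x))) * t" for x
  proof -
    have "?V f x t \<le> (\<integral>s\<in>{0..t}. exp (\<kappa> * t) * (D\<^sup>2 * ?E * exp (2 * b * norm x)) \<partial>lborel)"
      unfolding covariance_flow_def[OF pos abpos] ou_duhamel_def
    proof (rule set_integral_mono)
      show "set_integrable lborel {0..t} (\<lambda>s. exp (\<alpha> * s) * ou_semigroup \<sigma> \<mu> s (\<lambda>y. (?M f y (t - s))\<^sup>2) x)"
        by (rule ou_duhamel_integrable[OF pos Sf])
      show "set_integrable lborel {0..t} (\<lambda>s. exp (\<kappa> * t) * (D\<^sup>2 * ?E * exp (2 * b * norm x)))"
        by (rule borel_integrable_atLeastAtMost') (intro continuous_intros)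
      fix s assume s: "s \<in> {0..t}"
      have "\<bar>ou_semigroup \<sigma> \<mu> s (\<lambda>y. (?M f y (t - s))\<^sup>2) x\<bar> \<le> (D\<^sup>2 * exp (2 * (\<alpha> - \<rho>) * (t - s))) * ?E * exp (2 * b * norm x)"
        by (rule ou_semigroup_exp_bound(2)[OF pos _ _ ou_slice_measurable[OF pos Sf(1)]]) (use M2 s b in auto)
      then have "exp (\<alpha> * s) * ou_semigroup \<sigma> \<mu> s (\<lambda>y. (?M f y (t - s))\<^sup>2) x \<le> exp (\<alpha> * s) * ((D\<^sup>2 * exp (2 * (\<alpha> - \<rho>) * (t - s))) * ?E * exp (2 * b * norm x))"
        by (intro mult_left_mono) auto
      also have "\<dots> = exp (\<alpha> * s + 2 * (\<alpha> - \<rho>) * (t - s)) * (D\<^sup>2 * ?E * exp (2 * b * norm x))"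
        by (simp add: exp_add)
      also have "\<dots> \<le> exp (\<kappa> * t) * (D\<^sup>2 * ?E * exp (2 * b * norm x))"
      proof (rule mult_right_mono)
        have "\<alpha> * s + 2 * (\<alpha> - \<rho>) * (t - s) \<le> \<kappa> * s + \<kappa> * (t - s)"
          unfolding \<kappa>_def using s by (intro add_mono mult_right_mono) auto
        also have "\<dots> = \<kappa> * t" by (simp add: algebra_simps)
        finally show "exp (\<alpha> * s + 2 * (\<alpha> - \<rho>) * (t - s)) \<le> exp (\<kappa> * t)" by simp
      qed (use E in auto)
      finally show "exp (\<alpha> * s) * ou_semigroup \<sigma> \<mu> s (\<lambda>y. (?M f y (t - s))\<^sup>2) x \<le> exp (\<kappa> * t) * (D\<^sup>2 * ?E * exp (2 * b * norm x))" .
    qed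
    also have "\<dots> = (exp (\<kappa> * t) * (D\<^sup>2 * ?E * exp (2 * b * norm x))) * t"
      by (rule set_integral_const_Icc[OF pos t])
    finally show ?thesis .
  qed
  have "integrable \<eta> (\<lambda>x. ?V f x t)"
    using covariance_flow_section[OF f, of t] FM_bounded_integrable[OF \<eta>] by blast
  then have "(\<integral>x. ?V f x t \<partial>\<eta>) \<le> (\<integral>x. (exp (\<kappa> * t) * (D\<^sup>2 * ?E * exp (2 * b * norm x))) * t \<partial>\<eta>)"
    using \<eta>b[of "2 * b"] V by (intro integral_mono) auto
  also have "\<dots> = D\<^sup>2 * ?E * A2 * (t * exp (\<kappa> * t))" by (simp add: A2_def mult_ac)
  finally have "2 * (\<beta> * (\<integral>x. ?V f x t \<partial>\<eta>)) \<le> 2 * (\<beta> * (D\<^sup>2 * ?E * A2 * (t * exp (\<kappa> * t))))" using abpos by simp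
  with 1 have "(\<integral>\<xi>. (\<integral>x. f x \<partial>\<xi>)\<^sup>2 \<partial>Q t \<eta>) \<le> D\<^sup>2 * A1\<^sup>2 * exp (2 * (\<alpha> - \<rho>) * t) + D\<^sup>2 * (?E * A2) * (2 * \<beta> * t * exp (\<kappa> * t))"
    unfolding kernel_second_moment(2)[OF f t \<eta>] by (simp add: mult_ac)
  also have "\<dots> \<le> D\<^sup>2 * (A1\<^sup>2 + ?E * A2) * exp (2 * (\<alpha> - \<rho>) * t) + D\<^sup>2 * (A1\<^sup>2 + ?E * A2) * (2 * \<beta> * t * exp (\<kappa> * t))"
    using A E abpos t by (intro add_mono mult_right_mono mult_left_mono) auto
  also have "\<dots> = D\<^sup>2 * (A1\<^sup>2 + ?E * A2) * moment_growth \<rho> t"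
    unfolding moment_growth_def \<kappa>_def by (simp only: distrib_left)
  finally show ?thesis by (simp only: A1_def A2_def)
qed

text \<open>Truncated exponentials have second moments bounded uniformly in n, by
  \<open>kernel_second_moment_bound\<close> with \<rho> = 0. The inequality z \<le> 1 + z^2 passes
  to first moments, and monotone convergence removes the truncation.\<close>

lemma kernel_exp_integrable:
  assumes t: "t \<ge> 0" and \<eta>: "\<eta> \<in> space FM" and a: "a \<ge> 0" and \<eta>b: "\<And>c. integrable \<eta> (\<lambda>x. exp (c * norm x))"
  shows "AE \<xi> in Q t \<eta>. integrable \<xi> (\<lambda>x. exp (a * norm x))"
proof -
  interpret prob_space "Q t \<eta>" using t \<eta> by (rule kernel_prob_space)
  have [measurable_cong]: "sets (Q t \<eta>) = sets FM" by (rule kernel_prob_space[OF t \<eta>])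
  define h where "h n x = exp (a * norm x) * indicator {x. norm x \<le> real n} x" for n and x :: "real^'n"
  have [measurable]: "h n \<in> borel_measurable borel" for n unfolding h_def by measurable
  have h0: "0 \<le> h n x" "h n x \<le> 1 * exp (a * norm x)" for n x by (auto simp: h_def indicator_def)
  have hb: "\<bar>h n x\<bar> \<le> exp (a * real n)" for n x
    using a by (auto simp: h_def indicator_def intro!: mult_left_mono)
  define K where "K = (ou_exp_moment \<sigma> \<mu> TYPE('n) a)\<^sup>2 * ((\<integral>x. exp (a * norm x) \<partial>\<eta>)\<^sup>2 + ou_exp_moment \<sigma> \<mu> TYPE('n) (2 * a) * (\<integral>x. exp (2 * a * norm x) \<partial>\<eta>)) * moment_growth 0 t"
  have le: "(\<integral>\<xi>. (\<integral>x. h n x \<partial>\<xi>)\<^sup>2 \<partial>Q t \<eta>) \<le> K" for n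
    unfolding K_def
  proof (rule kernel_second_moment_bound[OF _ hb t \<eta> _ a \<eta>b])
    fix u and x :: "real^'n" assume u: "u \<in> {0..t}"
    have "\<bar>ou_semigroup \<sigma> \<mu> u (h n) x\<bar> \<le> 1 * ou_exp_moment \<sigma> \<mu> TYPE('n) a * exp (a * norm x)"
      by (rule ou_semigroup_exp_bound(2)[OF pos _ a]) (use u h0 in auto)
    then show "\<bar>ou_semigroup \<sigma> \<mu> u (h n) x\<bar> \<le> ou_exp_moment \<sigma> \<mu> TYPE('n) a * exp (- 0 * u) * exp (a * norm x)" by simp
  qed measurable
  have "(\<integral>\<^sup>+\<xi>. (\<integral>\<^sup>+x. ennreal (h n x) \<partial>\<xi>) \<partial>Q t \<eta>) \<le> ennreal (1 + K)" for n
  proof -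
    have "(\<integral>\<^sup>+\<xi>. (\<integral>\<^sup>+x. ennreal (h n x) \<partial>\<xi>) \<partial>Q t \<eta>) \<le> (\<integral>\<^sup>+\<xi>. ennreal (1 + (\<integral>x. h n x \<partial>\<xi>)\<^sup>2) \<partial>Q t \<eta>)"
    proof (intro nn_integral_mono)
      fix \<xi> assume "\<xi> \<in> space (Q t \<eta>)"
      then have \<xi>: "\<xi> \<in> space FM" by (simp add: kernel_space[OF t \<eta>])
      have "(\<integral>\<^sup>+x. ennreal (h n x) \<partial>\<xi>) = ennreal (\<integral>x. h n x \<partial>\<xi>)"
        by (rule nn_integral_eq_integral[OF FM_bounded_integrable[OF \<xi> _ hb]]) (auto simp: h0)
      also have "\<dots> \<le> ennreal (1 + (\<integral>x. h n x \<partial>\<xi>)\<^sup>2)"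
      proof (rule ennreal_leI)
        have "z \<le> 1 + z\<^sup>2" for z :: real using zero_le_power2[of "z - 1/2"] by (simp add: power2_eq_square algebra_simps)
        then show "(\<integral>x. h n x \<partial>\<xi>) \<le> 1 + (\<integral>x. h n x \<partial>\<xi>)\<^sup>2" .
      qed
      finally show "(\<integral>\<^sup>+x. ennreal (h n x) \<partial>\<xi>) \<le> ennreal (1 + (\<integral>x. h n x \<partial>\<xi>)\<^sup>2)" .
    qed
    also have "\<dots> = ennreal (\<integral>\<xi>. 1 + (\<integral>x. h n x \<partial>\<xi>)\<^sup>2 \<partial>Q t \<eta>)"
      by (rule nn_integral_eq_integral) (use kernel_second_moment(1)[OF _ hb t \<eta>] in auto)
    also have "(\<integral>\<xi>. 1 + (\<integral>x. h n x \<partial>\<xi>)\<^sup>2 \<partial>Q t \<eta>) = 1 + (\<integral>\<xi>. (\<integral>x. h n x \<partial>\<xi>)\<^sup>2 \<partial>Q t \<eta>)"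
      using kernel_second_moment(1)[OF _ hb t \<eta>] prob_space by simp
    also have "ennreal \<dots> \<le> ennreal (1 + K)" using le by (intro ennreal_leI) auto
    finally show ?thesis .
  qed
  then have "(SUP n. \<integral>\<^sup>+\<xi>. (\<integral>\<^sup>+x. ennreal (h n x) \<partial>\<xi>) \<partial>Q t \<eta>) \<le> ennreal (1 + K)" by (intro SUP_least)
  moreover have inc: "incseq (\<lambda>n x. ennreal (h n x))"
    by (auto simp: incseq_def le_fun_def h_def indicator_def intro!: ennreal_leI)
  have "(\<integral>\<^sup>+\<xi>. (\<integral>\<^sup>+x. ennreal (exp (a * norm x)) \<partial>\<xi>) \<partial>Q t \<eta>) = (SUP n. \<integral>\<^sup>+\<xi>. (\<integral>\<^sup>+x. ennreal (h n x) \<partial>\<xi>) \<partial>Q t \<eta>)"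
  proof -
    have sup: "(SUP n. ennreal (h n x)) = ennreal (exp (a * norm x))" for x
    proof (rule antisym)
      show "(SUP n. ennreal (h n x)) \<le> ennreal (exp (a * norm x))" using h0 by (intro SUP_least ennreal_leI) auto
      obtain n where "norm x \<le> real n" using real_arch_simple by blast
      then have "h n x = exp (a * norm x)" by (simp add: h_def)
      then show "ennreal (exp (a * norm x)) \<le> (SUP n. ennreal (h n x))" by (metis SUP_upper UNIV_I)
    qed
    have "(\<integral>\<^sup>+\<xi>. (\<integral>\<^sup>+x. ennreal (exp (a * norm x)) \<partial>\<xi>) \<partial>Q t \<eta>) = (\<integral>\<^sup>+\<xi>. (SUP n. \<integral>\<^sup>+x. ennreal (h n x) \<partial>\<xi>) \<partial>Q t \<eta>)"
    proof (intro nn_integral_cong)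
      fix \<xi> assume "\<xi> \<in> space (Q t \<eta>)"
      then have "\<xi> \<in> space FM" by (simp add: kernel_space[OF t \<eta>])
      then have [measurable_cong]: "sets \<xi> = sets borel" by (rule FM_D)
      show "(\<integral>\<^sup>+x. ennreal (exp (a * norm x)) \<partial>\<xi>) = (SUP n. \<integral>\<^sup>+x. ennreal (h n x) \<partial>\<xi>)"
        unfolding sup[symmetric] by (rule nn_integral_monotone_convergence_SUP[OF inc]) measurable
    qed
    also have "\<dots> = (SUP n. \<integral>\<^sup>+\<xi>. (\<integral>\<^sup>+x. ennreal (h n x) \<partial>\<xi>) \<partial>Q t \<eta>)"
    proof (rule nn_integral_monotone_convergence_SUP)
      show "incseq (\<lambda>n \<xi>. \<integral>\<^sup>+x. ennreal (h n x) \<partial>\<xi>)"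
        using inc by (auto simp: incseq_def le_fun_def intro!: nn_integral_mono)
    qed measurable
    finally show ?thesis .
  qed
  ultimately have "(\<integral>\<^sup>+\<xi>. (\<integral>\<^sup>+x. ennreal (exp (a * norm x)) \<partial>\<xi>) \<partial>Q t \<eta>) \<le> ennreal (1 + K)" by simp
  then have "(\<integral>\<^sup>+\<xi>. (\<integral>\<^sup>+x. ennreal (exp (a * norm x)) \<partial>\<xi>) \<partial>Q t \<eta>) \<noteq> \<infinity>" by (auto simp: top_unique)
  then have "AE \<xi> in Q t \<eta>. (\<integral>\<^sup>+x. ennreal (exp (a * norm x)) \<partial>\<xi>) \<noteq> \<infinity>"
    by (intro nn_integral_PInf_AE) auto
  then show ?thesis
  proof (rule AE_mp, intro AE_I2 impI)
    fix \<xi> assume "\<xi> \<in> space (Q t \<eta>)" and fin: "(\<integral>\<^sup>+x. ennreal (exp (a * norm x)) \<partial>\<xi>) \<noteq> \<infinity>"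
    then have "\<xi> \<in> space FM" by (simp add: kernel_space[OF t \<eta>])
    then have [measurable_cong]: "sets \<xi> = sets borel" by (rule FM_D)
    show "integrable \<xi> (\<lambda>x. exp (a * norm x))"
      using fin by (intro integrableI_nonneg) (auto simp: top.not_eq_extremum)
  qed
qed

text \<open>Truncation at radius n may destroy the cancellations behind the decay of
  \<open>g\<close>. But the semigroup applied to the removed tail is of order exp (- n), so for n
  \<ge> \<rho> t the truncated function still decays like exp (- \<rho> u) for all u up to t, with
  the enlarged constant \<open>D'\<close>. Fatou's lemma then lets n tend to infinity at fixed
  t.\<close>

lemma kernel_decay_second_moment:
  fixes g :: "real^'n \<Rightarrow> real"
  assumes g [measurable]: "g \<in> borel_measurable borel" and gb: "\<And>y. \<bar>g y\<bar> \<le> C * exp (a * norm y)" and a: "a \<ge> 0"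
    and P: "\<And>u x. u \<ge> 0 \<Longrightarrow> \<bar>ou_semigroup \<sigma> \<mu> u g x\<bar> \<le> D * exp (- \<rho> * u) * exp ((a + 2) * norm x)" and \<rho>: "\<rho> \<ge> 0"
    and \<eta>: "\<eta> \<in> space FM" and \<eta>b: "\<And>c. integrable \<eta> (\<lambda>x. exp (c * norm x))"
  shows "\<exists>K\<ge>0. \<forall>t\<ge>0. (\<integral>\<^sup>+\<xi>. ennreal ((\<integral>x. g x \<partial>\<xi>)\<^sup>2) \<partial>Q t \<eta>) \<le> ennreal (K * moment_growth \<rho> t)"
proof -
  let ?E = "ou_exp_moment \<sigma> \<mu> TYPE('n)"
  have C: "C \<ge> 0" using gb[of 0] by simp
  have D: "D \<ge> 0" using P[of 0 0] by simp
  have E: "?E b \<ge> 0" if "b \<ge> 0" for b using ou_exp_moment_ge_1[where 'n='n, OF pos that] by simp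
  define D' where "D' = D + C * ?E (a + 1)"
  have D': "D' \<ge> 0" using D C E[of "a + 1"] a by (simp add: D'_def)
  define K where "K = D'\<^sup>2 * ((\<integral>x. exp ((a + 2) * norm x) \<partial>\<eta>)\<^sup>2 + ?E (2 * (a + 2)) * (\<integral>x. exp (2 * (a + 2) * norm x) \<partial>\<eta>))"
  show ?thesis
  proof (intro exI conjI allI impI)
    show "K \<ge> 0" unfolding K_def using E[of "2 * (a + 2)"] a
      by (intro mult_nonneg_nonneg add_nonneg_nonneg integral_nonneg_AE) auto
    fix t :: real assume t: "t \<ge> 0"
    interpret prob_space "Q t \<eta>" using t \<eta> by (rule kernel_prob_space)
    have [measurable_cong]: "sets (Q t \<eta>) = sets FM" by (rule kernel_prob_space[OF t \<eta>])
    define h where "h n x = g x * indicator {x. norm x \<le> real n} x" for n x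
    have [measurable]: "h n \<in> borel_measurable borel" for n unfolding h_def by measurable
    have hb: "\<bar>h n x\<bar> \<le> C * exp (a * real n)" for n x
    proof (cases "norm x \<le> real n")
      case True
      then have "C * exp (a * norm x) \<le> C * exp (a * real n)" using C a by (intro mult_left_mono) (auto intro: mult_left_mono)
      then show ?thesis using gb[of x] True by (simp add: h_def)
    qed (use C in \<open>simp add: h_def\<close>)
    have hle: "\<bar>h n x\<bar> \<le> C * exp (a * norm x)" for n x using gb[of x] C by (auto simp: h_def indicator_def)
    have le: "(\<integral>\<xi>. (\<integral>x. h n x \<partial>\<xi>)\<^sup>2 \<partial>Q t \<eta>) \<le> K * moment_growth \<rho> t" if n: "\<rho> * t \<le> real n" for n
      unfolding K_def
    proof (rule kernel_second_moment_bound[OF _ hb t \<eta> _ _ \<eta>b])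
      fix u and x :: "real^'n" assume u: "u \<in> {0..t}"
      define d where "d y = g y - h n y" for y
      have [measurable]: "d \<in> borel_measurable borel" unfolding d_def by measurable
      \<comment> \<open>On the removed part \<open>norm y\<close> exceeds n, so one more unit in the
        exponent pays for \<open>exp (- real n)\<close>.\<close>
      have db: "\<bar>d y\<bar> \<le> (C * exp (- real n)) * exp ((a + 1) * norm y)" for y
      proof (cases "norm y \<le> real n")
        case False
        have "C * exp (a * norm y) \<le> C * exp (- real n + (a + 1) * norm y)"
          using C False by (intro mult_left_mono) (auto simp: distrib_right)
        then show ?thesis using gb[of y] False by (simp add: d_def h_def mult_exp_exp mult.assoc)
      qed (use C in \<open>simp add: d_def h_def\<close>)
      have u0: "u \<ge> 0" using u by simp
      have a1: "a + 1 \<ge> 0" using a by simp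
      have "ou_semigroup \<sigma> \<mu> u (h n) x = ou_semigroup \<sigma> \<mu> u g x - ou_semigroup \<sigma> \<mu> u d x"
        using ou_semigroup_exp_bound(1)[OF pos u0 a g gb, of x] ou_semigroup_exp_bound(1)[OF pos u0 a1 _ db, of x]
        by (subst (1 2 3) ou_semigroup_def) (simp add: d_def flip: Bochner_Integration.integral_diff)
      moreover have "\<bar>ou_semigroup \<sigma> \<mu> u d x\<bar> \<le> (C * exp (- real n)) * ?E (a + 1) * exp ((a + 1) * norm x)"
        by (rule ou_semigroup_exp_bound(2)[OF pos u0 a1 _ db]) measurable
      moreover have "(C * exp (- real n)) * ?E (a + 1) * exp ((a + 1) * norm x) \<le> (C * exp (- \<rho> * u)) * ?E (a + 1) * exp ((a + 2) * norm x)"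
      proof -
        have "\<rho> * u \<le> \<rho> * t" using u \<rho> by (intro mult_left_mono) auto
        then have "exp (- real n) \<le> exp (- \<rho> * u)" using n by simp
        moreover have "exp ((a + 1) * norm x) \<le> exp ((a + 2) * norm x)" by (simp add: mult_right_mono)
        ultimately show ?thesis using C E[OF a1] by (intro mult_mono) auto
      qed
      moreover note P[OF u0, of x]
      ultimately have "\<bar>ou_semigroup \<sigma> \<mu> u (h n) x\<bar> \<le> D * exp (- \<rho> * u) * exp ((a + 2) * norm x) + (C * exp (- \<rho> * u)) * ?E (a + 1) * exp ((a + 2) * norm x)"
        by linarith
      also have "\<dots> = D' * exp (- \<rho> * u) * exp ((a + 2) * norm x)" by (simp add: D'_def algebra_simps)
      finally show "\<bar>ou_semigroup \<sigma> \<mu> u (h n) x\<bar> \<le> D' * exp (- \<rho> * u) * exp ((a + 2) * norm x)" .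
    qed (use a in auto)
    have lim: "AE \<xi> in Q t \<eta>. (\<lambda>n. \<integral>x. h n x \<partial>\<xi>) \<longlonglongrightarrow> (\<integral>x. g x \<partial>\<xi>)"
      using kernel_exp_integrable[OF t \<eta> a \<eta>b]
    proof (rule AE_mp, intro AE_I2 impI)
      fix \<xi> assume "\<xi> \<in> space (Q t \<eta>)" and int: "integrable \<xi> (\<lambda>x. exp (a * norm x))"
      then have "\<xi> \<in> space FM" by (simp add: kernel_space[OF t \<eta>])
      then have [measurable_cong]: "sets \<xi> = sets borel" by (rule FM_D)
      show "(\<lambda>n. \<integral>x. h n x \<partial>\<xi>) \<longlonglongrightarrow> (\<integral>x. g x \<partial>\<xi>)"
      proof (rule integral_dominated_convergence)
        show "integrable \<xi> (\<lambda>x. C * exp (a * norm x))" using int by simp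
        show "AE x in \<xi>. (\<lambda>n. h n x) \<longlonglongrightarrow> g x"
        proof (intro always_eventually allI)
          fix x :: "real^'n"
          obtain N where N: "norm x \<le> real N" using real_arch_simple by blast
          have "\<forall>\<^sub>F n in sequentially. h n x = g x"
            using eventually_ge_at_top[of N] by eventually_elim (use N in \<open>auto simp: h_def\<close>)
          then show "(\<lambda>n. h n x) \<longlonglongrightarrow> g x" by (rule tendsto_eventually)
        qed
      qed (use hle in auto)
    qed
    have "(\<integral>\<^sup>+\<xi>. ennreal ((\<integral>x. g x \<partial>\<xi>)\<^sup>2) \<partial>Q t \<eta>) \<le> (\<integral>\<^sup>+\<xi>. liminf (\<lambda>n. ennreal ((\<integral>x. h n x \<partial>\<xi>)\<^sup>2)) \<partial>Q t \<eta>)"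
    proof (rule nn_integral_mono_AE, rule AE_mp[OF lim], intro AE_I2 impI)
      fix \<xi> :: "(real^'n) measure" assume "(\<lambda>n. \<integral>x. h n x \<partial>\<xi>) \<longlonglongrightarrow> (\<integral>x. g x \<partial>\<xi>)"
      then have "(\<lambda>n. ennreal ((\<integral>x. h n x \<partial>\<xi>)\<^sup>2)) \<longlonglongrightarrow> ennreal ((\<integral>x. g x \<partial>\<xi>)\<^sup>2)"
        by (intro tendsto_ennrealI tendsto_power)
      from lim_imp_Liminf[OF sequentially_bot this]
      show "ennreal ((\<integral>x. g x \<partial>\<xi>)\<^sup>2) \<le> liminf (\<lambda>n. ennreal ((\<integral>x. h n x \<partial>\<xi>)\<^sup>2))"
        by (simp only: order_refl)
    qed
    also have "\<dots> \<le> liminf (\<lambda>n. \<integral>\<^sup>+\<xi>. ennreal ((\<integral>x. h n x \<partial>\<xi>)\<^sup>2) \<partial>Q t \<eta>)"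
      by (rule nn_integral_liminf) measurable
    also have "\<dots> \<le> liminf (\<lambda>n::nat. ennreal (K * moment_growth \<rho> t))"
    proof (rule Liminf_mono)
      obtain N where N: "\<rho> * t \<le> real N" using real_arch_simple by blast
      show "\<forall>\<^sub>F n in sequentially. (\<integral>\<^sup>+\<xi>. ennreal ((\<integral>x. h n x \<partial>\<xi>)\<^sup>2) \<partial>Q t \<eta>) \<le> ennreal (K * moment_growth \<rho> t)"
        using eventually_ge_at_top[of N]
      proof eventually_elim
        case (elim n)
        have "(\<integral>\<^sup>+\<xi>. ennreal ((\<integral>x. h n x \<partial>\<xi>)\<^sup>2) \<partial>Q t \<eta>) = ennreal (\<integral>\<xi>. (\<integral>x. h n x \<partial>\<xi>)\<^sup>2 \<partial>Q t \<eta>)"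
          by (rule nn_integral_eq_integral[OF kernel_second_moment(1)[OF _ hb t \<eta>]]) auto
        also have "\<dots> \<le> ennreal (K * moment_growth \<rho> t)" using N elim by (intro ennreal_leI le) auto
        finally show ?case .
      qed
    qed
    also have "\<dots> = ennreal (K * moment_growth \<rho> t)" by (simp add: Liminf_const)
    finally show "(\<integral>\<^sup>+\<xi>. ennreal ((\<integral>x. g x \<partial>\<xi>)\<^sup>2) \<partial>Q t \<eta>) \<le> ennreal (K * moment_growth \<rho> t)" .
  qed
qed

end

section \<open>Two-time laws\<close>

text \<open>Both measures are finite and agree on rectangles, an intersection-stable generator that
  contains the whole space.\<close>

lemma distr_pair_eq_bind_kernel:
  assumes "prob_space M" and [measurable]: "X \<in> M \<rightarrow>\<^sub>M S" "Y \<in> M \<rightarrow>\<^sub>M T" and K [measurable]: "K \<in> S \<rightarrow>\<^sub>M prob_algebra T"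
    and eq: "\<And>A B. A \<in> sets S \<Longrightarrow> B \<in> sets T \<Longrightarrow>
      emeasure M (X -` A \<inter> Y -` B \<inter> space M) = (\<integral>\<^sup>+\<omega>. indicator A (X \<omega>) * emeasure (K (X \<omega>)) B \<partial>M)"
  shows "distr M (S \<Otimes>\<^sub>M T) (\<lambda>\<omega>. (X \<omega>, Y \<omega>)) = distr M S X \<bind> (\<lambda>x. distr (K x) (S \<Otimes>\<^sub>M T) (Pair x))"
proof -
  interpret prob_space M by fact
  have Km [measurable]: "(\<lambda>x. distr (K x) (S \<Otimes>\<^sub>M T) (Pair x)) \<in> S \<rightarrow>\<^sub>M prob_algebra (S \<Otimes>\<^sub>M T)"
    by (rule measurable_distr_prob_space2[where M=T]) measurable
  have dX: "distr M S X \<in> space (prob_algebra S)" by (simp add: space_prob_algebra prob_space_distr)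
  let ?L = "distr M (S \<Otimes>\<^sub>M T) (\<lambda>\<omega>. (X \<omega>, Y \<omega>))"
  let ?R = "distr M S X \<bind> (\<lambda>x. distr (K x) (S \<Otimes>\<^sub>M T) (Pair x))"
  have sR: "sets ?R = sets (S \<Otimes>\<^sub>M T)" by (rule sets_bind'[OF dX Km])
  let ?E = "{a \<times> b | a b. a \<in> sets S \<and> b \<in> sets T}"
  show ?thesis
  proof (rule measure_eqI_generator_eq[OF Int_stable_pair_measure_generator[of S T], where \<Omega>="space S \<times> space T" and A="\<lambda>_. space S \<times> space T"])
    show "?E \<subseteq> Pow (space S \<times> space T)"
      using sets.space_closed[of S] sets.space_closed[of T] by auto
    show "sets ?L = sigma_sets (space S \<times> space T) ?E" by (simp add: sets_pair_measure)
    show "sets ?R = sigma_sets (space S \<times> space T) ?E" unfolding sR by (simp add: sets_pair_measure)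
    show "range (\<lambda>_::nat. space S \<times> space T) \<subseteq> ?E" by auto
    show "(\<Union>i::nat. space S \<times> space T) = space S \<times> space T" by simp
    have "prob_space ?L" by (rule prob_space_distr) measurable
    then interpret L: prob_space ?L .
    show "emeasure ?L (space S \<times> space T) \<noteq> \<infinity>" by simp
    fix C assume "C \<in> ?E"
    then obtain A B where C: "C = A \<times> B" and [measurable]: "A \<in> sets S" "B \<in> sets T" by auto
    have "emeasure ?L C = emeasure M ((\<lambda>\<omega>. (X \<omega>, Y \<omega>)) -` C \<inter> space M)"
      unfolding C by (rule emeasure_distr) measurable
    also have "(\<lambda>\<omega>. (X \<omega>, Y \<omega>)) -` C \<inter> space M = X -` A \<inter> Y -` B \<inter> space M" unfolding C by auto
    also have "emeasure M \<dots> = (\<integral>\<^sup>+\<omega>. indicator A (X \<omega>) * emeasure (K (X \<omega>)) B \<partial>M)" by (rule eq) measurable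
    also have "\<dots> = (\<integral>\<^sup>+\<omega>. emeasure (distr (K (X \<omega>)) (S \<Otimes>\<^sub>M T) (Pair (X \<omega>))) C \<partial>M)"
    proof (intro nn_integral_cong)
      fix \<omega> assume "\<omega> \<in> space M"
      then have x: "X \<omega> \<in> space S" by (rule measurable_space[OF assms(2)])
      have sK: "sets (K (X \<omega>)) = sets T" using measurable_space[OF K x] by (simp add: space_prob_algebra)
      have "emeasure (distr (K (X \<omega>)) (S \<Otimes>\<^sub>M T) (Pair (X \<omega>))) C = emeasure (K (X \<omega>)) (Pair (X \<omega>) -` C \<inter> space (K (X \<omega>)))"
        unfolding C using x by (intro emeasure_distr) (simp_all add: measurable_cong_sets[OF sK refl])
      also have "Pair (X \<omega>) -` C \<inter> space (K (X \<omega>)) = (if X \<omega> \<in> A then B else {})"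
        using sets.sets_into_space[of B T] sets_eq_imp_space_eq[OF sK] by (auto simp: C)
      finally show "indicator A (X \<omega>) * emeasure (K (X \<omega>)) B = emeasure (distr (K (X \<omega>)) (S \<Otimes>\<^sub>M T) (Pair (X \<omega>))) C"
        by (simp add: indicator_def)
    qed
    also have "\<dots> = (\<integral>\<^sup>+x. emeasure (distr (K x) (S \<Otimes>\<^sub>M T) (Pair x)) C \<partial>distr M S X)"
    proof (rule nn_integral_distr[symmetric])
      have "(\<lambda>x. emeasure (distr (K x) (S \<Otimes>\<^sub>M T) (Pair x)) C) \<in> borel_measurable S"
        using measurable_prob_algebraD[OF Km] unfolding C by (rule measurable_emeasure_kernel) measurable
      then show "(\<lambda>x. emeasure (distr (K x) (S \<Otimes>\<^sub>M T) (Pair x)) C) \<in> borel_measurable (distr M S X)" by simp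
    qed measurable
    also have "\<dots> = emeasure ?R C"
      unfolding C by (rule emeasure_bind_prob_algebra[OF dX Km, symmetric]) measurable
    finally show "emeasure ?L C = emeasure ?R C" .
  qed
qed

lemma nn_integral_pair_kernel:
  assumes "prob_space M" and X [measurable]: "X \<in> M \<rightarrow>\<^sub>M S" and Y [measurable]: "Y \<in> M \<rightarrow>\<^sub>M T" and K [measurable]: "K \<in> S \<rightarrow>\<^sub>M prob_algebra T"
    and eq: "\<And>A B. A \<in> sets S \<Longrightarrow> B \<in> sets T \<Longrightarrow>
      emeasure M (X -` A \<inter> Y -` B \<inter> space M) = (\<integral>\<^sup>+\<omega>. indicator A (X \<omega>) * emeasure (K (X \<omega>)) B \<partial>M)"
    and h [measurable]: "(\<lambda>(x, y). h x y) \<in> borel_measurable (S \<Otimes>\<^sub>M T)"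
  shows "(\<integral>\<^sup>+\<omega>. h (X \<omega>) (Y \<omega>) \<partial>M) = (\<integral>\<^sup>+\<omega>. (\<integral>\<^sup>+y. h (X \<omega>) y \<partial>K (X \<omega>)) \<partial>M)"
proof -
  have Km [measurable]: "(\<lambda>x. distr (K x) (S \<Otimes>\<^sub>M T) (Pair x)) \<in> S \<rightarrow>\<^sub>M prob_algebra (S \<Otimes>\<^sub>M T)"
    by (rule measurable_distr_prob_space2[where M=T]) measurable
  have "(\<integral>\<^sup>+\<omega>. h (X \<omega>) (Y \<omega>) \<partial>M) = (\<integral>\<^sup>+p. (case p of (x, y) \<Rightarrow> h x y) \<partial>distr M (S \<Otimes>\<^sub>M T) (\<lambda>\<omega>. (X \<omega>, Y \<omega>)))"
    by (subst nn_integral_distr) auto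
  also have "\<dots> = (\<integral>\<^sup>+x. (\<integral>\<^sup>+p. (case p of (x, y) \<Rightarrow> h x y) \<partial>distr (K x) (S \<Otimes>\<^sub>M T) (Pair x)) \<partial>distr M S X)"
  proof -
    have "distr M (S \<Otimes>\<^sub>M T) (\<lambda>\<omega>. (X \<omega>, Y \<omega>)) = distr M S X \<bind> (\<lambda>x. distr (K x) (S \<Otimes>\<^sub>M T) (Pair x))"
      by (rule distr_pair_eq_bind_kernel[OF assms(1-5)])
    then show ?thesis
      by (simp only:) (rule nn_integral_bind[OF h], simp add: measurable_prob_algebraD[OF Km])
  qed
  also have "\<dots> = (\<integral>\<^sup>+\<omega>. (\<integral>\<^sup>+p. (case p of (x, y) \<Rightarrow> h x y) \<partial>distr (K (X \<omega>)) (S \<Otimes>\<^sub>M T) (Pair (X \<omega>))) \<partial>M)"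
  proof (rule nn_integral_distr[OF X])
    show "(\<lambda>x. \<integral>\<^sup>+p. (case p of (x, y) \<Rightarrow> h x y) \<partial>distr (K x) (S \<Otimes>\<^sub>M T) (Pair x)) \<in> borel_measurable (distr M S X)"
      using measurable_compose[OF measurable_prob_algebraD[OF Km] nn_integral_measurable_subprob_algebra[OF h]] by simp
  qed
  also have "\<dots> = (\<integral>\<^sup>+\<omega>. (\<integral>\<^sup>+y. h (X \<omega>) y \<partial>K (X \<omega>)) \<partial>M)"
  proof (intro nn_integral_cong)
    fix \<omega> assume "\<omega> \<in> space M"
    then have x: "X \<omega> \<in> space S" by (rule measurable_space[OF X])
    have sK: "sets (K (X \<omega>)) = sets T" using measurable_space[OF K x] by (simp add: space_prob_algebra)
    show "(\<integral>\<^sup>+p. (case p of (x, y) \<Rightarrow> h x y) \<partial>distr (K (X \<omega>)) (S \<Otimes>\<^sub>M T) (Pair (X \<omega>))) = (\<integral>\<^sup>+y. h (X \<omega>) y \<partial>K (X \<omega>))"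
      using x by (subst nn_integral_distr) (simp_all add: measurable_cong_sets[OF sK refl])
  qed
  finally show ?thesis .
qed

locale ou_branching_process = ou_branching \<sigma> \<mu> \<alpha> \<beta> Q + prob_space M
  for \<sigma> \<mu> \<alpha> \<beta> :: real and Q :: "real \<Rightarrow> (real^'n) measure \<Rightarrow> (real^'n) measure measure" and M :: "'w measure" +
  fixes X :: "real \<Rightarrow> 'w \<Rightarrow> (real^'n) measure" and \<nu> :: "(real^'n) measure"
  assumes markov: "markov_process M FM Q X"
    and start: "AE \<omega> in M. X 0 \<omega> = \<nu>"
    and nu: "\<nu> \<in> compactly_supported_measures"
begin

lemma X_measurable [measurable]: "t \<ge> 0 \<Longrightarrow> X t \<in> M \<rightarrow>\<^sub>M FM"
  using markov by (auto simp: markov_process_def)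

lemma X_space: "t \<ge> 0 \<Longrightarrow> \<omega> \<in> space M \<Longrightarrow> X t \<omega> \<in> space FM"
  using X_measurable by (rule measurable_space)

lemma nu_FM: "\<nu> \<in> space FM"
  using nu by (simp add: compactly_supported_measures_def)

text \<open>Compact support bounds the weight almost everywhere. All exponential moments of the
  process at later times start from here.\<close>

lemma nu_exp_integrable: "integrable \<nu> (\<lambda>x. exp (c * norm x))"
proof -
  obtain K where K: "compact K" "emeasure \<nu> (- K) = 0" using nu by (auto simp: compactly_supported_measures_def)
  interpret finite_measure \<nu> using nu_FM by (rule FM_D)
  have [measurable_cong]: "sets \<nu> = sets borel" using nu_FM by (rule FM_D)
  obtain R where R: "\<And>x. x \<in> K \<Longrightarrow> norm x \<le> R" using compact_imp_bounded[OF K(1)] by (auto simp: bounded_iff)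
  have "- K \<in> sets \<nu>"
    using K(1) by (simp add: borel_closed compact_imp_closed borel_comp FM_D(2)[OF nu_FM])
  then have "AE x in \<nu>. x \<in> K"
    by (intro AE_I[where N="- K"]) (use K in auto)
  then have "AE x in \<nu>. norm (exp (c * norm x)) \<le> exp (\<bar>c\<bar> * R)"
  proof (rule AE_mp, intro AE_I2 impI)
    fix x assume "x \<in> K"
    then have "norm x \<le> R" by (rule R)
    then have "c * norm x \<le> \<bar>c\<bar> * R" by (meson abs_ge_self abs_ge_zero mult_mono norm_ge_zero)
    then show "norm (exp (c * norm x)) \<le> exp (\<bar>c\<bar> * R)" by simp
  qed
  then show ?thesis by (intro integrable_const_bound) auto
qed

lemma subalgebra_natural_filtration: "subalgebra M (natural_filtration M FM X s)"
  unfolding subalgebra_def natural_filtration_def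
proof
  let ?G = "\<Union>s\<in>{0..s}. {X s -` A \<inter> space M | A. A \<in> sets FM}"
  have G: "?G \<subseteq> sets M"
  proof
    fix C assume "C \<in> ?G"
    then obtain r A where "r \<in> {0..s}" "A \<in> sets FM" "C = X r -` A \<inter> space M" by blast
    then show "C \<in> sets M" using measurable_sets[OF X_measurable, of r A] by auto
  qed
  then have G': "?G \<subseteq> Pow (space M)" using sets.space_closed[of M] by (rule order_trans)
  then show "space (sigma (space M) ?G) = space M" by (rule space_measure_of)
  show "sets (sigma (space M) ?G) \<subseteq> sets M" unfolding sets_measure_of[OF G'] by (rule sets.sigma_sets_subset[OF G])
qed

text \<open>The event that \<open>X s\<close> lies in \<open>A\<close> belongs to the natural
  filtration at s, so the conditional probability in the Markov property can be integrated over it.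
  The result is the rectangle hypothesis of \<open>nn_integral_pair_kernel\<close>.\<close>

lemma two_time_rectangles:
  assumes s: "s \<ge> 0" and t: "t \<ge> 0" and [measurable]: "A \<in> sets FM" "B \<in> sets FM"
  shows "emeasure M (X s -` A \<inter> X (s + t) -` B \<inter> space M) = (\<integral>\<^sup>+\<omega>. indicator A (X s \<omega>) * emeasure (Q t (X s \<omega>)) B \<partial>M)"
proof -
  let ?F = "natural_filtration M FM X s"
  interpret F: finite_measure_subalgebra M ?F
    by unfold_locales (rule subalgebra_natural_filtration)
  have st: "s + t \<ge> 0" using s t by simp
  note [measurable] = X_measurable[OF s] X_measurable[OF st]
  define A' where "A' = X s -` A \<inter> space M"
  define B' where "B' = X (s + t) -` B \<inter> space M"
  have [measurable]: "A' \<in> sets M" "B' \<in> sets M" unfolding A'_def B'_def by measurable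
  have AF: "A' \<in> sets ?F"
  proof -
    let ?G = "\<Union>s\<in>{0..s}. {X s -` A \<inter> space M | A. A \<in> sets FM}"
    have G': "?G \<subseteq> Pow (space M)" by auto
    have "A' \<in> ?G" unfolding A'_def
    proof (rule UN_I)
      show "s \<in> {0..s}" using s by simp
      show "X s -` A \<inter> space M \<in> {X s -` A \<inter> space M | A. A \<in> sets FM}" using assms(3) by blast
    qed
    then show ?thesis unfolding natural_filtration_def sets_measure_of[OF G'] by (rule sigma_sets.Basic)
  qed
  have m [measurable]: "(\<lambda>\<omega>. measure (Q t (X s \<omega>)) B) \<in> borel_measurable M"
    using measurable_compose[OF X_measurable[OF s] measurable_compose[OF kernel_measurable[OF t] measurable_measure_prob_algebra[OF assms(4)]]] .
  have "(\<integral>\<omega>. indicat_real A' \<omega> * indicat_real B' \<omega> \<partial>M) = (\<integral>\<omega>\<in>A'. indicat_real B' \<omega> \<partial>M)" by (simp add: set_lebesgue_integral_def)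
  also have "\<dots> = (\<integral>\<omega>\<in>A'. real_cond_exp M ?F (indicat_real B') \<omega> \<partial>M)"
    by (rule F.real_cond_exp_intA[OF _ AF]) (auto intro!: integrable_real_indicator simp: emeasure_eq_measure)
  also have "\<dots> = (\<integral>\<omega>\<in>A'. measure (Q t (X s \<omega>)) B \<partial>M)"
    unfolding set_lebesgue_integral_def
  proof (rule integral_cong_AE)
    have "AE \<omega> in M. real_cond_exp M ?F (indicator B') \<omega> = measure (Q t (X s \<omega>)) B"
      using markov s t assms(4) by (simp add: markov_process_def B'_def)
    then show "AE \<omega> in M. indicator A' \<omega> *\<^sub>R real_cond_exp M ?F (indicator B') \<omega> = indicator A' \<omega> *\<^sub>R measure (Q t (X s \<omega>)) B"
      by eventually_elim simp
  qed measurable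
  finally have eq: "(\<integral>\<omega>. indicat_real A' \<omega> * indicat_real B' \<omega> \<partial>M) = (\<integral>\<omega>. indicat_real A' \<omega> * measure (Q t (X s \<omega>)) B \<partial>M)"
    by (simp add: set_lebesgue_integral_def)
  have ps: "prob_space (Q t (X s \<omega>))" if "\<omega> \<in> space M" for \<omega> by (rule kernel_prob_space[OF t X_space[OF s that]])
  have "emeasure M (A' \<inter> B') = ennreal (\<integral>\<omega>. indicator A' \<omega> * indicator B' \<omega> \<partial>M)"
    by (simp add: indicator_inter_arith[symmetric] emeasure_eq_measure)
  also have "\<dots> = (\<integral>\<^sup>+\<omega>. ennreal (indicator A' \<omega> * measure (Q t (X s \<omega>)) B) \<partial>M)"
    unfolding eq
  proof (rule nn_integral_eq_integral[symmetric])
    show "integrable M (\<lambda>\<omega>. indicator A' \<omega> * measure (Q t (X s \<omega>)) B)"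
      by (rule integrable_const_bound[where B=1]) (use ps in \<open>auto simp: indicator_def intro!: AE_I2 prob_space.prob_le_1\<close>)
  qed simp
  also have "\<dots> = (\<integral>\<^sup>+\<omega>. indicator A (X s \<omega>) * emeasure (Q t (X s \<omega>)) B \<partial>M)"
  proof (intro nn_integral_cong)
    fix \<omega> assume w: "\<omega> \<in> space M"
    interpret Q: prob_space "Q t (X s \<omega>)" using w by (rule ps)
    show "ennreal (indicator A' \<omega> * measure (Q t (X s \<omega>)) B) = indicator A (X s \<omega>) * emeasure (Q t (X s \<omega>)) B"
      using w by (auto simp: A'_def indicator_def Q.emeasure_eq_measure)
  qed
  also have "A' \<inter> B' = X s -` A \<inter> X (s + t) -` B \<inter> space M" by (auto simp: A'_def B'_def)
  finally show ?thesis .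
qed

lemma nn_integral_two_time:
  assumes s: "s \<ge> 0" and t: "t \<ge> 0" and h: "(\<lambda>(x, y). h x y) \<in> borel_measurable (FM \<Otimes>\<^sub>M FM)"
  shows "(\<integral>\<^sup>+\<omega>. h (X s \<omega>) (X (s + t) \<omega>) \<partial>M) = (\<integral>\<^sup>+\<omega>. (\<integral>\<^sup>+\<xi>. h (X s \<omega>) \<xi> \<partial>Q t (X s \<omega>)) \<partial>M)"
  using s t
  by (intro nn_integral_pair_kernel[OF prob_space_axioms _ _ kernel_measurable[OF t] two_time_rectangles[OF s t] h]) auto

text \<open>The Markov property at time 0, where the process sits at \<nu> almost surely:
  \<open>X t\<close> has law \<open>Q t \<nu>\<close>, and kernel estimates transfer to the
  process.\<close>

lemma nn_integral_one_time:
  assumes t: "t \<ge> 0" and h [measurable]: "h \<in> borel_measurable FM"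
  shows "(\<integral>\<^sup>+\<omega>. h (X t \<omega>) \<partial>M) = (\<integral>\<^sup>+\<xi>. h \<xi> \<partial>Q t \<nu>)"
proof -
  have "(\<integral>\<^sup>+\<omega>. h (X t \<omega>) \<partial>M) = (\<integral>\<^sup>+\<omega>. (\<integral>\<^sup>+\<xi>. h \<xi> \<partial>Q t (X 0 \<omega>)) \<partial>M)"
    using nn_integral_two_time[of 0 t "\<lambda>_. h"] t by simp
  also have "\<dots> = (\<integral>\<^sup>+\<omega>. (\<integral>\<^sup>+\<xi>. h \<xi> \<partial>Q t \<nu>) \<partial>M)"
    using start by (intro nn_integral_cong_AE) auto
  finally show ?thesis by (simp add: emeasure_space_1)
qed

lemma AE_one_time:
  assumes t: "t \<ge> 0" and [measurable]: "Measurable.pred FM P" and "AE \<xi> in Q t \<nu>. P \<xi>"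
  shows "AE \<omega> in M. P (X t \<omega>)"
proof -
  note [measurable] = X_measurable[OF t]
  have [measurable_cong]: "sets (Q t \<nu>) = sets FM" by (rule kernel_prob_space[OF t nu_FM])
  have "(\<integral>\<^sup>+\<omega>. indicator {\<xi>\<in>space FM. \<not> P \<xi>} (X t \<omega>) \<partial>M) = (\<integral>\<^sup>+\<xi>. indicator {\<xi>\<in>space FM. \<not> P \<xi>} \<xi> \<partial>Q t \<nu>)"
    by (rule nn_integral_one_time[OF t]) measurable
  also have "\<dots> = 0"
    using assms(3) by (subst nn_integral_0_iff_AE) (auto simp: indicator_def)
  finally have "AE \<omega> in M. indicator {\<xi>\<in>space FM. \<not> P \<xi>} (X t \<omega>) = (0 :: ennreal)"
    by (subst (asm) nn_integral_0_iff_AE) measurable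
  then show ?thesis using X_space[OF t] by (auto simp: indicator_def elim!: AE_mp intro!: AE_I2)
qed

lemma AE_exp_integrable:
  assumes t: "t \<ge> 0" and a: "a \<ge> 0"
  shows "AE \<omega> in M. integrable (X t \<omega>) (\<lambda>x. exp (a * norm x))"
proof -
  have "AE \<omega> in M. (\<integral>\<^sup>+x. ennreal (exp (a * norm x)) \<partial>X t \<omega>) < \<infinity>"
  proof (rule AE_one_time[OF t])
    show "AE \<xi> in Q t \<nu>. (\<integral>\<^sup>+x. ennreal (exp (a * norm x)) \<partial>\<xi>) < \<infinity>"
      using kernel_exp_integrable[OF t nu_FM a nu_exp_integrable]
      by eventually_elim (simp add: integrable_iff_bounded)
  qed measurable
  then show ?thesis
  proof (rule AE_mp, intro AE_I2 impI)
    fix \<omega> assume "\<omega> \<in> space M" and fin: "(\<integral>\<^sup>+x. ennreal (exp (a * norm x)) \<partial>X t \<omega>) < \<infinity>"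
    then have [measurable_cong]: "sets (X t \<omega>) = sets borel" by (intro FM_D X_space[OF t])
    show "integrable (X t \<omega>) (\<lambda>x. exp (a * norm x))" using fin by (intro integrableI_nonneg) auto
  qed
qed

text \<open>The Laplace parameter may be a function of \<open>X s\<close>, in view of the later
  choice proportional to the inverse square root of the mass at time s.\<close>

lemma two_time_mass_laplace:
  assumes s: "s \<ge> 0" and t: "t \<ge> 0" and [measurable]: "p \<in> borel_measurable FM" "l \<in> borel_measurable FM"
    and p: "\<And>\<xi>. \<xi> \<in> space FM \<Longrightarrow> 0 \<le> p \<xi> \<and> p \<xi> \<le> b" and l: "\<And>\<xi>. \<xi> \<in> space FM \<Longrightarrow> 0 \<le> l \<xi>"
  shows "(\<integral>\<omega>. p (X s \<omega>) * exp (- (l (X s \<omega>) * total_mass (X (s + t) \<omega>))) \<partial>M)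
       = (\<integral>\<omega>. p (X s \<omega>) * exp (- (total_mass (X s \<omega>) * mass_exponent \<alpha> \<beta> (l (X s \<omega>)) t)) \<partial>M)"
proof -
  have st: "s + t \<ge> 0" using s t by simp
  note [measurable] = X_measurable[OF s] X_measurable[OF st]
  define h where "h x y = p x * exp (- (l x * total_mass y))" for x y :: "(real^'n) measure"
  have [measurable]: "(\<lambda>(x, y). h x y) \<in> borel_measurable (FM \<Otimes>\<^sub>M FM)" unfolding h_def by measurable
  have [measurable]: "(\<lambda>\<omega>. mass_exponent \<alpha> \<beta> (l (X s \<omega>)) t) \<in> borel_measurable M"
    unfolding mass_exponent_def[OF pos abpos] by measurable
  have "(\<integral>\<^sup>+\<omega>. ennreal (h (X s \<omega>) (X (s + t) \<omega>)) \<partial>M) = (\<integral>\<^sup>+\<omega>. (\<integral>\<^sup>+\<xi>. ennreal (h (X s \<omega>) \<xi>) \<partial>Q t (X s \<omega>)) \<partial>M)"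
    by (rule nn_integral_two_time[OF s t]) measurable
  also have "\<dots> = (\<integral>\<^sup>+\<omega>. ennreal (p (X s \<omega>) * exp (- (total_mass (X s \<omega>) * mass_exponent \<alpha> \<beta> (l (X s \<omega>)) t))) \<partial>M)"
  proof (intro nn_integral_cong)
    fix \<omega> assume "\<omega> \<in> space M"
    then have \<eta>: "X s \<omega> \<in> space FM" by (rule X_space[OF s])
    interpret Q: prob_space "Q t (X s \<omega>)" by (rule kernel_prob_space[OF t \<eta>])
    have [measurable_cong]: "sets (Q t (X s \<omega>)) = sets FM" by (rule kernel_prob_space[OF t \<eta>])
    have "(\<integral>\<^sup>+\<xi>. ennreal (h (X s \<omega>) \<xi>) \<partial>Q t (X s \<omega>)) = ennreal (\<integral>\<xi>. h (X s \<omega>) \<xi> \<partial>Q t (X s \<omega>))"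
    proof (rule nn_integral_eq_integral)
      show "integrable (Q t (X s \<omega>)) (h (X s \<omega>))"
        unfolding h_def using l[OF \<eta>] by (intro integrable_mult_right Q.integrable_const_bound[where B=1]) auto
    qed (use p[OF \<eta>] in \<open>auto simp: h_def\<close>)
    also have "(\<integral>\<xi>. h (X s \<omega>) \<xi> \<partial>Q t (X s \<omega>)) = p (X s \<omega>) * exp (- (total_mass (X s \<omega>) * mass_exponent \<alpha> \<beta> (l (X s \<omega>)) t))"
      unfolding h_def using kernel_mass_laplace[OF l[OF \<eta>] t \<eta>] by simp
    finally show "(\<integral>\<^sup>+\<xi>. ennreal (h (X s \<omega>) \<xi>) \<partial>Q t (X s \<omega>)) = ennreal (p (X s \<omega>) * exp (- (total_mass (X s \<omega>) * mass_exponent \<alpha> \<beta> (l (X s \<omega>)) t)))" .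
  qed
  finally have eq: "(\<integral>\<^sup>+\<omega>. ennreal (h (X s \<omega>) (X (s + t) \<omega>)) \<partial>M) = \<dots>" .
  have "(\<integral>\<omega>. h (X s \<omega>) (X (s + t) \<omega>) \<partial>M) = enn2real (\<integral>\<^sup>+\<omega>. ennreal (h (X s \<omega>) (X (s + t) \<omega>)) \<partial>M)"
    by (rule integral_eq_nn_integral) (use p X_space[OF s] in \<open>auto simp: h_def intro!: AE_I2\<close>)
  also have "\<dots> = (\<integral>\<omega>. p (X s \<omega>) * exp (- (total_mass (X s \<omega>) * mass_exponent \<alpha> \<beta> (l (X s \<omega>)) t)) \<partial>M)"
    unfolding eq by (rule integral_eq_nn_integral[symmetric]) (use p X_space[OF s] in \<open>auto intro!: AE_I2\<close>)
  finally show ?thesis by (simp add: h_def)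
qed

end

section \<open>Extinction\<close>

lemma exp_neg_tendsto_0:
  assumes "c > 0"
  shows "((\<lambda>t::real. exp (- c * t)) \<longlongrightarrow> 0) at_top"
proof -
  have "filterlim (\<lambda>t. c * t) at_top at_top"
    by (rule filterlim_tendsto_pos_mult_at_top[OF tendsto_const assms filterlim_ident])
  then show ?thesis by (auto intro!: filterlim_compose[OF exp_at_bot] simp: filterlim_uminus_at_top)
qed

locale ou_branching_limit = ou_branching_process \<sigma> \<mu> \<alpha> \<beta> Q M X \<nu>
  for \<sigma> \<mu> \<alpha> \<beta> :: real and Q :: "real \<Rightarrow> (real^'n) measure \<Rightarrow> (real^'n) measure measure"
    and M :: "'w measure" and X :: "real \<Rightarrow> 'w \<Rightarrow> (real^'n) measure" and \<nu> :: "(real^'n) measure" +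
  fixes V_inf :: "'w \<Rightarrow> real"
  assumes V_inf_measurable [measurable]: "V_inf \<in> borel_measurable M"
    and V_inf_limit: "AE \<omega> in M. ((\<lambda>t. exp (- \<alpha> * t) * total_mass (X t \<omega>)) \<longlongrightarrow> V_inf \<omega>) at_top"
    and mass_right_continuous: "\<And>\<omega> t. \<omega> \<in> space M \<Longrightarrow> t \<ge> 0 \<Longrightarrow>
      ((\<lambda>s. total_mass (X s \<omega>)) \<longlongrightarrow> total_mass (X t \<omega>)) (at_right t)"
begin

abbreviation "\<kappa> \<equiv> \<beta> / \<alpha>"

lemma kappa_pos: "\<kappa> > 0" using abpos by simp

lemma measurable_mass [measurable]: "t \<ge> 0 \<Longrightarrow> (\<lambda>\<omega>. total_mass (X t \<omega>)) \<in> borel_measurable M"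
  using measurable_compose[OF X_measurable measurable_total_mass] .

lemma start_mass: "AE \<omega> in M. total_mass (X 0 \<omega>) = total_mass \<nu>"
  using start by eventually_elim simp

lemma V_inf_nonneg: "AE \<omega> in M. V_inf \<omega> \<ge> 0"
  using V_inf_limit
proof eventually_elim
  case (elim \<omega>)
  show ?case by (rule tendsto_lowerbound[OF elim]) auto
qed

text \<open>The two-time identity at s and s + n with parameter
  \<open>exp (- \<alpha> * real n) * l\<close>. On the left the scaled mass tends to exp (\<alpha>
  s) \<open>V_inf\<close>; on the right \<open>mass_exponent\<close> tends to l / (1 + \<kappa> l).
  Both integrands are dominated by the bound of \<open>p\<close>.\<close>

lemma mass_laplace_terminal:
  assumes s: "s \<ge> 0" and [measurable]: "p \<in> borel_measurable FM" "l \<in> borel_measurable FM"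
    and p: "\<And>\<xi>. \<xi> \<in> space FM \<Longrightarrow> 0 \<le> p \<xi> \<and> p \<xi> \<le> b" and l: "\<And>\<xi>. \<xi> \<in> space FM \<Longrightarrow> 0 \<le> l \<xi>"
  shows "(\<integral>\<omega>. p (X s \<omega>) * exp (- (l (X s \<omega>) * exp (\<alpha> * s) * V_inf \<omega>)) \<partial>M)
       = (\<integral>\<omega>. p (X s \<omega>) * exp (- (total_mass (X s \<omega>) * (l (X s \<omega>) / (1 + \<kappa> * l (X s \<omega>))))) \<partial>M)"
proof (rule LIMSEQ_unique)
  note [measurable] = X_measurable[OF s]
  define ln where "ln n \<xi> = exp (- \<alpha> * real n) * l \<xi>" for n \<xi>
  have [measurable]: "ln n \<in> borel_measurable FM" for n unfolding ln_def by measurable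
  have ln0: "\<xi> \<in> space FM \<Longrightarrow> 0 \<le> ln n \<xi>" for n \<xi> using l by (simp add: ln_def)
  define a where "a n = (\<integral>\<omega>. p (X s \<omega>) * exp (- (ln n (X s \<omega>) * total_mass (X (s + real n) \<omega>))) \<partial>M)" for n
  have aeq: "a n = (\<integral>\<omega>. p (X s \<omega>) * exp (- (total_mass (X s \<omega>) * mass_exponent \<alpha> \<beta> (ln n (X s \<omega>)) (real n))) \<partial>M)" for n
    unfolding a_def by (rule two_time_mass_laplace[OF s _ _ _ p ln0]) auto
  have meas [measurable]: "(\<lambda>\<omega>. total_mass (X (s + real n) \<omega>)) \<in> borel_measurable M" for n using s by simp
  have pb: "norm (p (X s \<omega>) * exp (- y)) \<le> b" if "\<omega> \<in> space M" "y \<ge> 0" for \<omega> y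
  proof -
    have "0 \<le> p (X s \<omega>)" "p (X s \<omega>) \<le> b" using p X_space[OF s that(1)] by auto
    then have "p (X s \<omega>) * exp (- y) \<le> b * 1" using that(2) by (intro mult_mono) auto
    then show ?thesis using \<open>0 \<le> p (X s \<omega>)\<close> by simp
  qed
  show "a \<longlonglongrightarrow> (\<integral>\<omega>. p (X s \<omega>) * exp (- (l (X s \<omega>) * exp (\<alpha> * s) * V_inf \<omega>)) \<partial>M)"
    unfolding a_def
  proof (rule integral_dominated_convergence[where w="\<lambda>_. b"])
    show "AE \<omega> in M. (\<lambda>n. p (X s \<omega>) * exp (- (ln n (X s \<omega>) * total_mass (X (s + real n) \<omega>)))) \<longlonglongrightarrow> p (X s \<omega>) * exp (- (l (X s \<omega>) * exp (\<alpha> * s) * V_inf \<omega>))"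
      using V_inf_limit
    proof eventually_elim
      case (elim \<omega>)
      have f: "filterlim (\<lambda>n. s + real n) at_top sequentially"
        by (rule filterlim_tendsto_add_at_top[OF tendsto_const filterlim_real_sequentially])
      have e: "ln n (X s \<omega>) * total_mass (X (s + real n) \<omega>) = l (X s \<omega>) * exp (\<alpha> * s) * (exp (- \<alpha> * (s + real n)) * total_mass (X (s + real n) \<omega>))" for n
      proof -
        have h: "exp (\<alpha> * s) * exp (- \<alpha> * (s + real n)) = exp (- \<alpha> * real n)" by (simp add: mult_exp_exp algebra_simps)
        show ?thesis unfolding ln_def h[symmetric] by (simp only: mult_ac)
      qed
      show ?case unfolding e by (intro tendsto_intros filterlim_compose[OF elim f])
    qed
    show "AE \<omega> in M. norm (p (X s \<omega>) * exp (- (ln n (X s \<omega>) * total_mass (X (s + real n) \<omega>)))) \<le> b" for n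
      using ln0 X_space[OF s] by (intro AE_I2 pb) auto
  qed auto
  show "a \<longlonglongrightarrow> (\<integral>\<omega>. p (X s \<omega>) * exp (- (total_mass (X s \<omega>) * (l (X s \<omega>) / (1 + \<kappa> * l (X s \<omega>))))) \<partial>M)"
    unfolding aeq
  proof (rule integral_dominated_convergence[where w="\<lambda>_. b"])
    show "AE \<omega> in M. (\<lambda>n. p (X s \<omega>) * exp (- (total_mass (X s \<omega>) * mass_exponent \<alpha> \<beta> (ln n (X s \<omega>)) (real n))))
        \<longlonglongrightarrow> p (X s \<omega>) * exp (- (total_mass (X s \<omega>) * (l (X s \<omega>) / (1 + \<kappa> * l (X s \<omega>)))))"
    proof (intro AE_I2)
      fix \<omega> assume "\<omega> \<in> space M"
      then have l0: "0 \<le> l (X s \<omega>)" using l X_space[OF s] by auto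
      have e: "mass_exponent \<alpha> \<beta> (ln n (X s \<omega>)) (real n) = l (X s \<omega>) / (1 + \<kappa> * (l (X s \<omega>) * (1 - exp (- \<alpha> * real n))))" for n
      proof -
        have "exp (- \<alpha> * real n) * exp (\<alpha> * real n) = 1" by (simp add: mult_exp_exp)
        then have "ln n (X s \<omega>) * exp (\<alpha> * real n) = l (X s \<omega>)" "ln n (X s \<omega>) * (exp (\<alpha> * real n) - 1) = l (X s \<omega>) * (1 - exp (- \<alpha> * real n))"
          by (simp_all add: ln_def right_diff_distrib left_diff_distrib mult.commute mult.left_commute)
        then show ?thesis unfolding mass_exponent_def[OF pos abpos] by (simp only: mult.assoc)
      qed
      have "(\<lambda>n. exp (- \<alpha> * real n)) \<longlonglongrightarrow> 0"
        by (rule filterlim_compose[OF exp_neg_tendsto_0[OF abpos(1)] filterlim_real_sequentially])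
      then have lim: "(\<lambda>n. p (X s \<omega>) * exp (- (total_mass (X s \<omega>) * (l (X s \<omega>) / (1 + \<kappa> * (l (X s \<omega>) * (1 - exp (- \<alpha> * real n)))))))) \<longlonglongrightarrow>
          p (X s \<omega>) * exp (- (total_mass (X s \<omega>) * (l (X s \<omega>) / (1 + \<kappa> * (l (X s \<omega>) * (1 - 0))))))"
      proof (intro tendsto_intros)
        have "0 \<le> \<kappa> * (l (X s \<omega>) * (1 - 0))" using kappa_pos l0 by (intro mult_nonneg_nonneg) auto
        then show "1 + \<kappa> * (l (X s \<omega>) * (1 - 0)) \<noteq> 0" by linarith
      qed
      show "(\<lambda>n. p (X s \<omega>) * exp (- (total_mass (X s \<omega>) * mass_exponent \<alpha> \<beta> (ln n (X s \<omega>)) (real n))))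
        \<longlonglongrightarrow> p (X s \<omega>) * exp (- (total_mass (X s \<omega>) * (l (X s \<omega>) / (1 + \<kappa> * l (X s \<omega>)))))"
        unfolding e using lim by simp
    qed
    show "AE \<omega> in M. norm (p (X s \<omega>) * exp (- (total_mass (X s \<omega>) * mass_exponent \<alpha> \<beta> (ln n (X s \<omega>)) (real n)))) \<le> b" for n
      using mass_exponent_derivative(2)[OF pos abpos] ln0 X_space[OF s] by (intro AE_I2 pb) auto
  qed (auto simp: mass_exponent_def[OF pos abpos])
qed

text \<open>exp (- n Y) decreases to the indicator of Y = 0.\<close>

lemma prob_zero_from_laplace:
  assumes [measurable]: "Y \<in> borel_measurable M" and Y: "AE \<omega> in M. 0 \<le> Y \<omega>"
    and L: "\<And>n. (\<integral>\<omega>. exp (- (real n * Y \<omega>)) \<partial>M) = a n" and a: "a \<longlonglongrightarrow> c"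
  shows "prob {\<omega>\<in>space M. Y \<omega> = 0} = c"
proof (rule LIMSEQ_unique[OF _ a])
  have "(\<lambda>n. \<integral>\<omega>. exp (- (real n * Y \<omega>)) \<partial>M) \<longlonglongrightarrow> (\<integral>\<omega>. indicator {\<omega>\<in>space M. Y \<omega> = 0} \<omega> \<partial>M)"
  proof (rule integral_dominated_convergence[where w="\<lambda>_. 1"])
    show "AE \<omega> in M. (\<lambda>n. exp (- (real n * Y \<omega>))) \<longlonglongrightarrow> indicator {\<omega>\<in>space M. Y \<omega> = 0} \<omega>"
      using Y
    proof (rule AE_mp, intro AE_I2 impI)
      fix \<omega> assume w: "\<omega> \<in> space M" and Y: "0 \<le> Y \<omega>"
      show "(\<lambda>n. exp (- (real n * Y \<omega>))) \<longlonglongrightarrow> indicator {\<omega>\<in>space M. Y \<omega> = 0} \<omega>"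
      proof (cases "Y \<omega> = 0")
        case False
        then have "filterlim (\<lambda>n. Y \<omega> * real n) at_top sequentially"
          using Y by (intro filterlim_tendsto_pos_mult_at_top[OF tendsto_const] filterlim_real_sequentially) auto
        then have "(\<lambda>n. exp (- (Y \<omega> * real n))) \<longlonglongrightarrow> 0"
          by (auto intro!: filterlim_compose[OF exp_at_bot] simp: filterlim_uminus_at_top)
        then show ?thesis using False by (simp add: mult.commute)
      qed (use w in simp)
    qed
    show "AE \<omega> in M. norm (exp (- (real n * Y \<omega>))) \<le> 1" for n using Y by eventually_elim simp
  qed auto
  then show "a \<longlonglongrightarrow> prob {\<omega>\<in>space M. Y \<omega> = 0}" by (simp add: L)
qed

lemma prob_V_inf_zero: "prob {\<omega>\<in>space M. V_inf \<omega> = 0} = exp (- (total_mass \<nu> / \<kappa>))"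
proof (rule prob_zero_from_laplace[OF V_inf_measurable V_inf_nonneg])
  note [measurable] = X_measurable[of 0, simplified]
  fix n
  have "(\<integral>\<omega>. 1 * exp (- (real n * exp (\<alpha> * 0) * V_inf \<omega>)) \<partial>M) = (\<integral>\<omega>. 1 * exp (- (total_mass (X 0 \<omega>) * (real n / (1 + \<kappa> * real n)))) \<partial>M)"
    by (rule mass_laplace_terminal[of 0 "\<lambda>_. 1" "\<lambda>_. real n" 1]) auto
  also have "\<dots> = (\<integral>\<omega>. exp (- (total_mass \<nu> * (real n / (1 + \<kappa> * real n)))) \<partial>M)"
    using start_mass by (intro integral_cong_AE) (auto elim!: AE_mp intro!: AE_I2)
  finally show "(\<integral>\<omega>. exp (- (real n * V_inf \<omega>)) \<partial>M) = exp (- (total_mass \<nu> * (real n / (1 + \<kappa> * real n))))"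
    by (simp add: prob_space)
next
  have "(\<lambda>n. real n / (1 + \<kappa> * real n)) \<longlonglongrightarrow> 1 / \<kappa>"
  proof -
    have "(\<lambda>n. 1 / (1 / real n + \<kappa>)) \<longlonglongrightarrow> 1 / (0 + \<kappa>)"
      using kappa_pos by (intro tendsto_intros lim_1_over_n) auto
    moreover have "\<forall>\<^sub>F n in sequentially. 1 / (1 / real n + \<kappa>) = real n / (1 + \<kappa> * real n)"
      using eventually_gt_at_top[of 0]
    proof eventually_elim
      case (elim n)
      have "1 / real n + \<kappa> = (1 + \<kappa> * real n) / real n" using elim by (simp add: add_divide_distrib)
      then show ?case by simp
    qed
    ultimately show ?thesis by (simp add: tendsto_cong)
  qed
  from tendsto_exp[OF tendsto_minus[OF tendsto_mult[OF tendsto_const[of "total_mass \<nu>"] this]]]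
  show "(\<lambda>n. exp (- (total_mass \<nu> * (real n / (1 + \<kappa> * real n))))) \<longlonglongrightarrow> exp (- (total_mass \<nu> / \<kappa>))" by simp
qed

text \<open>As the Laplace parameter tends to infinity, \<open>mass_exponent\<close> has a finite
  limit, an effect of the quadratic branching term; so the mass vanishes at each positive time with
  positive probability.\<close>

lemma prob_mass_zero:
  assumes t: "t > 0"
  shows "prob {\<omega>\<in>space M. total_mass (X t \<omega>) = 0} = exp (- (total_mass \<nu> * (exp (\<alpha> * t) / (\<kappa> * (exp (\<alpha> * t) - 1)))))"
proof (rule prob_zero_from_laplace)
  have t0: "t \<ge> 0" using t by simp
  note [measurable] = X_measurable[OF t0]  X_measurable[of 0, simplified]
  show "(\<lambda>\<omega>. total_mass (X t \<omega>)) \<in> borel_measurable M" by measurable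
  show "AE \<omega> in M. 0 \<le> total_mass (X t \<omega>)" by simp
  fix n
  have "(\<integral>\<omega>. 1 * exp (- (real n * total_mass (X (0 + t) \<omega>))) \<partial>M) = (\<integral>\<omega>. 1 * exp (- (total_mass (X 0 \<omega>) * mass_exponent \<alpha> \<beta> (real n) t)) \<partial>M)"
    by (rule two_time_mass_laplace[of 0 t "\<lambda>_. 1" "\<lambda>_. real n" 1]) (use t0 in auto)
  also have "\<dots> = (\<integral>\<omega>. exp (- (total_mass \<nu> * mass_exponent \<alpha> \<beta> (real n) t)) \<partial>M)"
    using start_mass by (intro integral_cong_AE) (auto elim!: AE_mp intro!: AE_I2)
  finally show "(\<integral>\<omega>. exp (- (real n * total_mass (X t \<omega>))) \<partial>M) = exp (- (total_mass \<nu> * mass_exponent \<alpha> \<beta> (real n) t))"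
    by (simp add: prob_space)
next
  define E where "E = exp (\<alpha> * t)"
  have E: "E > 1" using abpos t by (simp add: E_def)
  have k: "\<kappa> * (E - 1) > 0" using kappa_pos E by (intro mult_pos_pos) auto
  have "(\<lambda>n. mass_exponent \<alpha> \<beta> (real n) t) \<longlonglongrightarrow> E / (\<kappa> * (E - 1))"
  proof -
    have "(\<lambda>n. E / (1 / real n + \<kappa> * (E - 1))) \<longlonglongrightarrow> E / (0 + \<kappa> * (E - 1))"
      using k by (intro tendsto_divide tendsto_add tendsto_const lim_1_over_n) (metis add_0 less_irrefl)
    moreover have "\<forall>\<^sub>F n in sequentially. E / (1 / real n + \<kappa> * (E - 1)) = mass_exponent \<alpha> \<beta> (real n) t"
      using eventually_gt_at_top[of 0]
    proof eventually_elim
      case (elim n)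
      have "1 / real n + \<kappa> * (E - 1) = (1 + \<kappa> * real n * (E - 1)) / real n"
        using elim by (simp only: add_divide_distrib) (simp add: mult_ac)
      then show ?case by (simp add: mass_exponent_def[OF pos abpos] E_def mult.commute)
    qed
    ultimately show ?thesis by (simp add: tendsto_cong)
  qed
  from tendsto_exp[OF tendsto_minus[OF tendsto_mult[OF tendsto_const[of "total_mass \<nu>"] this]]]
  show "(\<lambda>n. exp (- (total_mass \<nu> * mass_exponent \<alpha> \<beta> (real n) t))) \<longlonglongrightarrow> exp (- (total_mass \<nu> * (exp (\<alpha> * t) / (\<kappa> * (exp (\<alpha> * t) - 1)))))"
    by (simp add: E_def)
qed

text \<open>Both probabilities are explicit; the exponent at time t is 1 / (\<kappa> (1 - exp (-
  \<alpha> t))) per unit of initial mass and tends to 1 / \<kappa>.\<close>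

lemma prob_mass_zero_limit:
  "((\<lambda>t. prob {\<omega>\<in>space M. total_mass (X t \<omega>) = 0}) \<longlongrightarrow> prob {\<omega>\<in>space M. V_inf \<omega> = 0}) at_top"
proof -
  have e0: "((\<lambda>t. exp (- \<alpha> * t)) \<longlongrightarrow> 0) at_top"
    by (rule exp_neg_tendsto_0[OF abpos(1)])
  have "((\<lambda>t. exp (- (total_mass \<nu> * (1 / (\<kappa> * (1 - exp (- \<alpha> * t))))))) \<longlongrightarrow> exp (- (total_mass \<nu> * (1 / (\<kappa> * (1 - 0)))))) at_top"
    using kappa_pos abpos by (intro tendsto_intros e0) auto
  moreover have "\<forall>\<^sub>F t in at_top. exp (- (total_mass \<nu> * (1 / (\<kappa> * (1 - exp (- \<alpha> * t)))))) = prob {\<omega>\<in>space M. total_mass (X t \<omega>) = 0}"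
    using eventually_gt_at_top[of 0]
  proof eventually_elim
    case (elim t)
    have "exp (\<alpha> * t) / (\<kappa> * (exp (\<alpha> * t) - 1)) = 1 / (\<kappa> * (1 - exp (- \<alpha> * t)))"
    proof -
      have "exp (\<alpha> * t) - 1 = exp (\<alpha> * t) * (1 - exp (- \<alpha> * t))" by (simp add: right_diff_distrib mult_exp_exp)
      then show ?thesis by simp
    qed
    then show ?case by (simp add: prob_mass_zero[OF elim])
  qed
  ultimately show ?thesis by (simp add: prob_V_inf_zero tendsto_cong)
qed

text \<open>Right continuity carries a strict inequality to a rational time shortly after, which
  reduces statements about all times to countably many.\<close>

lemma mass_exceeds_at_rational:
  assumes "\<omega> \<in> space M" "t \<ge> 0" "total_mass (X t \<omega>) > c"
  obtains q :: rat where "t < of_rat q" "total_mass (X (of_rat q) \<omega>) > c"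
proof -
  have "\<forall>\<^sub>F s in at_right t. total_mass (X s \<omega>) > c"
    using order_tendstoD(1)[OF mass_right_continuous[OF assms(1,2)] assms(3)] .
  then obtain b where b: "b > t" "\<And>y. t < y \<Longrightarrow> y < b \<Longrightarrow> total_mass (X y \<omega>) > c"
    unfolding eventually_at_right_field by blast
  obtain q where "t < of_rat q" "of_rat q < b" using of_rat_dense[OF b(1)] by blast
  with b that show ?thesis by blast
qed

lemma extinction_iff:
  assumes w: "\<omega> \<in> space M"
  shows "((\<lambda>t. total_mass (X t \<omega>)) \<longlongrightarrow> 0) at_top \<longleftrightarrow>
    (\<forall>k::nat. \<exists>N::nat. \<forall>q::rat. real N \<le> of_rat q \<longrightarrow> total_mass (X (of_rat q) \<omega>) \<le> inverse (real (Suc k)))"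
    (is "?L \<longleftrightarrow> ?R")
proof
  assume ?L
  show ?R
  proof
    fix k
    have "\<forall>\<^sub>F t in at_top. total_mass (X t \<omega>) < inverse (real (Suc k))"
      using order_tendstoD(2)[OF \<open>?L\<close>, of "inverse (real (Suc k))"] by simp
    then obtain T where T: "\<And>t. t \<ge> T \<Longrightarrow> total_mass (X t \<omega>) < inverse (real (Suc k))"
      by (auto simp: eventually_at_top_linorder)
    obtain N where "T \<le> real N" using real_arch_simple by blast
    then show "\<exists>N::nat. \<forall>q::rat. real N \<le> of_rat q \<longrightarrow> total_mass (X (of_rat q) \<omega>) \<le> inverse (real (Suc k))"
      using T by (meson less_imp_le order_trans)
  qed
next
  assume R: ?R
  show ?L
  proof (rule order_tendstoI)
    fix a :: real assume "0 < a"
    then obtain k where k: "inverse (real (Suc k)) < a" using reals_Archimedean by blast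
    obtain N :: nat where N: "\<And>q::rat. real N \<le> of_rat q \<Longrightarrow> total_mass (X (of_rat q) \<omega>) \<le> inverse (real (Suc k))"
      using R by blast
    show "\<forall>\<^sub>F t in at_top. total_mass (X t \<omega>) < a"
      using eventually_ge_at_top[of "real N"]
    proof eventually_elim
      case (elim t)
      have "\<not> total_mass (X t \<omega>) > inverse (real (Suc k))"
      proof
        assume gt: "total_mass (X t \<omega>) > inverse (real (Suc k))"
        obtain q where "t < of_rat q" "total_mass (X (of_rat q) \<omega>) > inverse (real (Suc k))"
          by (rule mass_exceeds_at_rational[OF w _ gt]) (use elim in auto)
        with N[of q] elim show False by auto
      qed
      with k show ?case by linarith
    qed
  qed (auto intro!: always_eventually intro: less_le_trans)
qed

lemma non_extinction_sets [measurable]: "non_extinction M X \<in> sets M"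
proof -
  have "{\<omega>\<in>space M. ((\<lambda>t. total_mass (X t \<omega>)) \<longlongrightarrow> 0) at_top} =
    {\<omega>\<in>space M. \<forall>k::nat. \<exists>N::nat. \<forall>q::rat. real N \<le> of_rat q \<longrightarrow> total_mass (X (of_rat q) \<omega>) \<le> inverse (real (Suc k))}"
    using extinction_iff by blast
  also have "\<dots> \<in> sets M"
  proof -
    have "{\<omega>\<in>space M. real N \<le> of_rat q \<longrightarrow> total_mass (X (of_rat q) \<omega>) \<le> inverse (real (Suc k))} \<in> sets M" for N k :: nat and q :: rat
    proof (cases "real N \<le> of_rat q")
      case True
      then have "0 \<le> (of_rat q :: real)" by (rule order_trans[rotated]) simp
      note [measurable] = measurable_mass[OF this]
      show ?thesis by measurable
    qed simp
    then show ?thesis by (intro sets.sets_Collect_countable_All sets.sets_Collect_countable_Ex)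
  qed
  finally show ?thesis unfolding non_extinction_def by measurable
qed

text \<open>With the indicator of zero mass at t as weight and l = 1, the two-time identity says
  that exp of minus the later mass integrates to the full probability of that event; so the later
  mass is 0 there almost surely. This covers all rational times at once, and right continuity covers
  the others.\<close>

lemma mass_zero_absorbing:
  assumes t: "t \<ge> 0"
  shows "AE \<omega> in M. total_mass (X t \<omega>) = 0 \<longrightarrow> \<omega> \<notin> non_extinction M X"
proof -
  have "AE \<omega> in M. total_mass (X t \<omega>) = 0 \<longrightarrow> t \<le> of_rat q \<longrightarrow> total_mass (X (of_rat q) \<omega>) = 0" for q :: rat
  proof (cases "t \<le> of_rat q")
    case True
    define s where "s = of_rat q - t"
    have s: "s \<ge> 0" "t + s = of_rat q" using True by (auto simp: s_def)
    have q: "t + s \<ge> 0" using t s(1) by (rule add_nonneg_nonneg)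
    note [measurable] = X_measurable[OF t] X_measurable[OF q]
    define p where "p \<xi> = (if total_mass \<xi> = 0 then 1 else 0 :: real)" for \<xi> :: "(real^'n) measure"
    have [measurable]: "p \<in> borel_measurable FM" unfolding p_def by measurable
    have pb: "0 \<le> p \<xi>" "p \<xi> \<le> 1" for \<xi> by (auto simp: p_def)
    have "(\<integral>\<omega>. p (X t \<omega>) * exp (- (1 * total_mass (X (t + s) \<omega>))) \<partial>M) = (\<integral>\<omega>. p (X t \<omega>) * exp (- (total_mass (X t \<omega>) * mass_exponent \<alpha> \<beta> 1 s)) \<partial>M)"
      by (rule two_time_mass_laplace[OF t s(1), where b=1]) (auto simp: pb)
    also have "\<dots> = (\<integral>\<omega>. p (X t \<omega>) \<partial>M)"
      by (intro Bochner_Integration.integral_cong) (auto simp: p_def)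
    finally have eq: "(\<integral>\<omega>. p (X t \<omega>) * exp (- (1 * total_mass (X (t + s) \<omega>))) \<partial>M) = (\<integral>\<omega>. p (X t \<omega>) \<partial>M)" .
    have i1: "integrable M (\<lambda>\<omega>. p (X t \<omega>))" by (rule integrable_const_bound[where B=1]) (auto simp: pb)
    have i2: "integrable M (\<lambda>\<omega>. p (X t \<omega>) * exp (- (1 * total_mass (X (t + s) \<omega>))))"
      by (rule integrable_const_bound[where B=1]) (auto simp: p_def)
    let ?D = "\<lambda>\<omega>. p (X t \<omega>) - p (X t \<omega>) * exp (- (1 * total_mass (X (t + s) \<omega>)))"
    have "(\<integral>\<omega>. ?D \<omega> \<partial>M) = 0" using i1 i2 eq by simp
    moreover have "0 \<le> ?D \<omega>" for \<omega> by (simp add: p_def)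
    ultimately have "AE \<omega> in M. ?D \<omega> = 0"
      using i1 i2 by (subst (asm) integral_nonneg_eq_0_iff_AE) auto
    then show ?thesis
    proof eventually_elim
      case (elim \<omega>)
      show ?case using elim s(2) by (auto simp: p_def)
    qed
  qed simp
  then have "AE \<omega> in M. \<forall>q::rat. total_mass (X t \<omega>) = 0 \<longrightarrow> t \<le> of_rat q \<longrightarrow> total_mass (X (of_rat q) \<omega>) = 0"
    unfolding AE_all_countable by blast
  then show ?thesis
  proof (rule AE_mp, intro AE_I2 impI)
    fix \<omega> assume w: "\<omega> \<in> space M" and Z: "total_mass (X t \<omega>) = 0"
      and q: "\<forall>q::rat. total_mass (X t \<omega>) = 0 \<longrightarrow> t \<le> of_rat q \<longrightarrow> total_mass (X (of_rat q) \<omega>) = 0"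
    have "total_mass (X u \<omega>) = 0" if u: "u \<ge> t" for u
    proof (rule ccontr)
      assume "total_mass (X u \<omega>) \<noteq> 0"
      then have gt: "total_mass (X u \<omega>) > 0" by (simp add: less_le)
      obtain r where "u < of_rat r" "total_mass (X (of_rat r) \<omega>) > 0"
        by (rule mass_exceeds_at_rational[OF w _ gt]) (use u t in auto)
      with q Z u show False by auto
    qed
    then have "((\<lambda>t. total_mass (X t \<omega>)) \<longlongrightarrow> 0) at_top"
      by (intro tendsto_eventually) (auto simp: eventually_at_top_linorder)
    with w show "\<omega> \<notin> non_extinction M X" by (simp add: non_extinction_def)
  qed
qed

lemma extinction_V_inf_zero: "AE \<omega> in M. \<omega> \<notin> non_extinction M X \<longrightarrow> V_inf \<omega> = 0"
  using V_inf_limit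
proof (rule AE_mp, intro AE_I2 impI)
  fix \<omega> assume w: "\<omega> \<in> space M" and V: "((\<lambda>t. exp (- \<alpha> * t) * total_mass (X t \<omega>)) \<longlongrightarrow> V_inf \<omega>) at_top"
    and "\<omega> \<notin> non_extinction M X"
  then have Z: "((\<lambda>t. total_mass (X t \<omega>)) \<longlongrightarrow> 0) at_top" by (simp add: non_extinction_def)
  have e0: "((\<lambda>t. exp (- \<alpha> * t)) \<longlongrightarrow> 0) at_top"
    by (rule exp_neg_tendsto_0[OF abpos(1)])
  from tendsto_mult[OF e0 Z] have "((\<lambda>t. exp (- \<alpha> * t) * total_mass (X t \<omega>)) \<longlongrightarrow> 0) at_top" by simp
  from tendsto_unique[OF _ V this] show "V_inf \<omega> = 0" by simp
qed

text \<open>\<open>|X\<^sub>t| = 0\<close> implies extinction, which implies \<open>V\<^sub>\<infinity> = 0\<close>, and the probability of the first event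
  tends to that of the last one, so that all three agree in the limit.\<close>

lemma prob_extinction: "prob (space M - non_extinction M X) = prob {\<omega>\<in>space M. V_inf \<omega> = 0}"
proof (rule antisym)
  show "prob (space M - non_extinction M X) \<le> prob {\<omega>\<in>space M. V_inf \<omega> = 0}"
    using extinction_V_inf_zero by (intro finite_measure_mono_AE) auto
  show "prob {\<omega>\<in>space M. V_inf \<omega> = 0} \<le> prob (space M - non_extinction M X)"
  proof (rule tendsto_upperbound[OF prob_mass_zero_limit])
    show "\<forall>\<^sub>F t in at_top. prob {\<omega>\<in>space M. total_mass (X t \<omega>) = 0} \<le> prob (space M - non_extinction M X)"
      using eventually_ge_at_top[of 0]
    proof eventually_elim
      case (elim t)
      show ?case using mass_zero_absorbing[OF elim] by (intro finite_measure_mono_AE) auto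
    qed
  qed simp
qed

text \<open>Extinction is almost surely contained in the event \<open>V_inf = 0\<close> and has the
  same probability, so the difference of the two events is null.\<close>

lemma V_inf_positive: "AE \<omega> in M. \<omega> \<in> non_extinction M X \<longrightarrow> V_inf \<omega> > 0"
proof -
  have "prob ({\<omega>\<in>space M. V_inf \<omega> = 0} - (space M - non_extinction M X)) = 0"
  proof -
    have "prob {\<omega>\<in>space M. V_inf \<omega> = 0} = prob ({\<omega>\<in>space M. V_inf \<omega> = 0} \<inter> (space M - non_extinction M X)) + prob ({\<omega>\<in>space M. V_inf \<omega> = 0} - (space M - non_extinction M X))"
      by (subst finite_measure_Union[symmetric]) (auto intro!: arg_cong[where f=prob])
    moreover have "prob ({\<omega>\<in>space M. V_inf \<omega> = 0} \<inter> (space M - non_extinction M X)) = prob (space M - non_extinction M X)"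
      using extinction_V_inf_zero by (intro finite_measure_eq_AE) auto
    ultimately show ?thesis using prob_extinction by simp
  qed
  then have "AE \<omega> in M. \<omega> \<notin> {\<omega>\<in>space M. V_inf \<omega> = 0} - (space M - non_extinction M X)"
    by (subst (asm) prob_eq_0) auto
  with V_inf_nonneg show ?thesis
    by (rule AE_mp[OF AE_conjI]) (auto intro!: AE_I2)
qed

text \<open>Survival up to t is a function of \<open>X t\<close> and becomes indistinguishable from
  non-extinction. By absorption the difference of the indicators has one sign almost surely, so its
  L1 norm is a difference of probabilities.\<close>

lemma survival_indicator_limit:
  "((\<lambda>t. \<integral>\<omega>. \<bar>indicat_real {\<omega>\<in>space M. total_mass (X t \<omega>) > 0} \<omega> - indicat_real (non_extinction M X) \<omega>\<bar> \<partial>M) \<longlongrightarrow> 0) at_top"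
proof -
  let ?E = "space M - non_extinction M X"
  have "((\<lambda>t. prob ?E - prob {\<omega>\<in>space M. total_mass (X t \<omega>) = 0}) \<longlongrightarrow> prob ?E - prob ?E) at_top"
    unfolding prob_extinction by (intro tendsto_intros prob_mass_zero_limit)
  moreover have "\<forall>\<^sub>F t in at_top. prob ?E - prob {\<omega>\<in>space M. total_mass (X t \<omega>) = 0} =
     (\<integral>\<omega>. \<bar>indicat_real {\<omega>\<in>space M. total_mass (X t \<omega>) > 0} \<omega> - indicat_real (non_extinction M X) \<omega>\<bar> \<partial>M)"
    using eventually_ge_at_top[of 0]
  proof eventually_elim
    case (elim t)
    note [measurable] = measurable_mass[OF elim]
    have "(\<integral>\<omega>. \<bar>indicat_real {\<omega>\<in>space M. total_mass (X t \<omega>) > 0} \<omega> - indicat_real (non_extinction M X) \<omega>\<bar> \<partial>M)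
       = (\<integral>\<omega>. indicat_real ?E \<omega> - indicat_real {\<omega>\<in>space M. total_mass (X t \<omega>) = 0} \<omega> \<partial>M)"
    proof (rule integral_cong_AE)
      show "AE \<omega> in M. \<bar>indicat_real {\<omega>\<in>space M. total_mass (X t \<omega>) > 0} \<omega> - indicat_real (non_extinction M X) \<omega>\<bar>
        = (indicat_real ?E \<omega> - indicat_real {\<omega>\<in>space M. total_mass (X t \<omega>) = 0} \<omega> :: real)"
        using mass_zero_absorbing[OF elim] by (rule AE_mp) (auto intro!: AE_I2 simp: indicator_def less_le)
    qed measurable
    also have "\<dots> = prob ?E - prob {\<omega>\<in>space M. total_mass (X t \<omega>) = 0}"
      by (subst Bochner_Integration.integral_diff) (auto simp: emeasure_eq_measure)
    finally show ?case by simp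
  qed
  ultimately show ?thesis by (simp add: tendsto_cong)
qed

end

section \<open>Analytic continuation of Laplace transforms\<close>

text \<open>Cauchy's estimate on discs of radius r / 4 around the points of the half-size ball
  bounds the derivative there by 4 C / r.\<close>

lemma holomorphic_bounded_difference:
  assumes "f holomorphic_on ball z r" "r > 0" and C: "\<And>w. w \<in> ball z r \<Longrightarrow> norm (f w) \<le> C"
    and "norm (w - z) < r / 2"
  shows "norm (f w - f z) \<le> 4 * C / r * norm (w - z)"
proof -
  have D: "norm (deriv f y) \<le> 4 * C / r" if y: "y \<in> ball z (r / 2)" for y
  proof -
    have sub: "cball y (r / 4) \<subseteq> ball z r" "ball y (r / 4) \<subseteq> ball z r"
      using y assms(2) by (auto simp: cball_subset_ball_iff ball_subset_ball_iff dist_commute)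
    have "norm ((deriv ^^ 1) f y) \<le> fact 1 * C / (r / 4) ^ 1"
    proof (rule Cauchy_inequality)
      show "f holomorphic_on ball y (r / 4)" using assms(1) sub by (blast intro: holomorphic_on_subset)
      show "continuous_on (cball y (r / 4)) f"
        using holomorphic_on_imp_continuous_on[OF assms(1)] sub by (blast intro: continuous_on_subset)
      show "0 < r / 4" using assms(2) by simp
      fix x assume "norm (y - x) = r / 4"
      then have "x \<in> cball y (r / 4)" by (simp add: dist_norm)
      then show "norm (f x) \<le> C" using sub C by blast
    qed
    then show ?thesis by (simp add: mult.commute)
  qed
  show ?thesis
  proof (rule field_differentiable_bound[where S="ball z (r / 2)" and f'="deriv f"])
    fix y assume y: "y \<in> ball z (r / 2)"
    have "y \<in> ball z r" using y assms(2) by auto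
    then have "(f has_field_derivative deriv f y) (at y)"
      using holomorphic_derivI[OF assms(1) open_ball] by blast
    then show "(f has_field_derivative deriv f y) (at y within ball z (r / 2))" by (rule has_field_derivative_at_within)
  qed (use D assms in \<open>auto simp: dist_norm norm_minus_commute\<close>)
qed

text \<open>Differentiation under the integral: by \<open>holomorphic_bounded_difference\<close> the
  uniform bound alone gives a constant majorant for the difference quotients. The pointwise
  derivative is measurable as a limit of quotients along one fixed sequence.\<close>

lemma holomorphic_integral:
  fixes f :: "complex \<Rightarrow> 'a \<Rightarrow> complex"
  assumes "finite_measure M" and S: "open S"
    and hol: "\<And>\<omega>. \<omega> \<in> space M \<Longrightarrow> (\<lambda>z. f z \<omega>) holomorphic_on S"
    and meas [measurable]: "\<And>z. f z \<in> borel_measurable M"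
    and C: "\<And>z \<omega>. z \<in> S \<Longrightarrow> \<omega> \<in> space M \<Longrightarrow> norm (f z \<omega>) \<le> C"
  shows "(\<lambda>z. \<integral>\<omega>. f z \<omega> \<partial>M) holomorphic_on S"
  unfolding holomorphic_on_def field_differentiable_def
proof
  interpret finite_measure M by fact
  fix z assume z: "z \<in> S"
  obtain r where r: "r > 0" "ball z r \<subseteq> S" using S z by (auto simp: open_contains_ball)
  have i: "integrable M (f w)" if "w \<in> S" for w
    by (rule integrable_const_bound[where B=C]) (use C that in auto)
  define d where "d \<omega> = deriv (\<lambda>w. f w \<omega>) z" for \<omega>
  have der: "((\<lambda>w. (f w \<omega> - f z \<omega>) / (w - z)) \<longlongrightarrow> d \<omega>) (at z)" if "\<omega> \<in> space M" for \<omega>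
    using holomorphic_derivI[OF hol[OF that] S z] unfolding d_def has_field_derivative_iff by simp
  have seq: "(\<lambda>n. (f (W n) \<omega> - f z \<omega>) / (W n - z)) \<longlonglongrightarrow> d \<omega>"
    if "\<omega> \<in> space M" "\<And>n. W n \<noteq> z" "W \<longlonglongrightarrow> z" for W \<omega>
    by (rule filterlim_compose[OF der[OF that(1)]]) (use that in \<open>auto simp: filterlim_at\<close>)
  have dm [measurable]: "d \<in> borel_measurable M"
  proof (rule borel_measurable_LIMSEQ_metric)
    let ?W = "\<lambda>n. z + of_real (inverse (real (Suc n)))"
    show "(\<lambda>\<omega>. (f (?W n) \<omega> - f z \<omega>) / (?W n - z)) \<in> borel_measurable M" for n by measurable
    fix \<omega> assume "\<omega> \<in> space M"
    then show "(\<lambda>n. (f (?W n) \<omega> - f z \<omega>) / (?W n - z)) \<longlonglongrightarrow> d \<omega>"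
    proof (rule seq)
      have "?W \<longlonglongrightarrow> z + of_real 0" by (intro tendsto_intros LIMSEQ_inverse_real_of_nat)
      then show "?W \<longlonglongrightarrow> z" by simp
      fix n
      have "of_real (inverse (real (Suc n))) \<noteq> (0 :: complex)" by (simp only: of_real_eq_0_iff) simp
      then show "?W n \<noteq> z" by (metis add_cancel_left_right)
    qed
  qed
  have "((\<lambda>w. ((\<integral>\<omega>. f w \<omega> \<partial>M) - (\<integral>\<omega>. f z \<omega> \<partial>M)) / (w - z)) \<longlongrightarrow> (\<integral>\<omega>. d \<omega> \<partial>M)) (at z)"
    unfolding tendsto_at_iff_sequentially comp_def
  proof (intro allI impI)
    fix W :: "nat \<Rightarrow> complex" assume W: "\<forall>n. W n \<in> UNIV - {z}" "W \<longlonglongrightarrow> z"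
    then have Wz: "W n \<noteq> z" for n by auto
    have "\<forall>\<^sub>F n in sequentially. dist (W n) z < r / 2" using tendstoD[OF W(2), of "r / 2"] r by simp
    then obtain N where N: "\<And>n. n \<ge> N \<Longrightarrow> dist (W n) z < r / 2" by (auto simp: eventually_sequentially)
    \<comment> \<open>Discarding an initial segment puts every point within r / 2 of z, where the
      majorant is valid.\<close>
    define W' where "W' n = W (n + N)" for n
    have W': "W' n \<noteq> z" "norm (W' n - z) < r / 2" for n
      unfolding W'_def using Wz N[of "n + N"] by (auto simp: dist_norm)
    have W'S: "W' n \<in> S" for n
    proof -
      have "W' n \<in> ball z r" using W'(2)[of n] r by (simp add: dist_norm norm_minus_commute)
      then show ?thesis using r by auto
    qed
    have lim': "W' \<longlonglongrightarrow> z" unfolding W'_def using W(2) by (rule LIMSEQ_ignore_initial_segment)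
    have "(\<lambda>n. \<integral>\<omega>. (f (W' n) \<omega> - f z \<omega>) / (W' n - z) \<partial>M) \<longlonglongrightarrow> (\<integral>\<omega>. d \<omega> \<partial>M)"
    proof (rule integral_dominated_convergence[where w="\<lambda>_. 4 * C / r"])
      show "AE \<omega> in M. (\<lambda>n. (f (W' n) \<omega> - f z \<omega>) / (W' n - z)) \<longlonglongrightarrow> d \<omega>"
        by (intro AE_I2 seq W' lim')
      show "AE \<omega> in M. norm ((f (W' n) \<omega> - f z \<omega>) / (W' n - z)) \<le> 4 * C / r" for n
      proof (intro AE_I2)
        fix \<omega> assume w: "\<omega> \<in> space M"
        have "norm (f (W' n) \<omega> - f z \<omega>) \<le> 4 * C / r * norm (W' n - z)"
          by (rule holomorphic_bounded_difference[of "\<lambda>w. f w \<omega>", OF holomorphic_on_subset[OF hol[OF w] r(2)] r(1)])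
             (use C w r W' in auto)
        then show "norm ((f (W' n) \<omega> - f z \<omega>) / (W' n - z)) \<le> 4 * C / r"
          using W'(1)[of n] by (simp add: norm_divide divide_le_eq)
      qed
    qed auto
    moreover have "(\<integral>\<omega>. (f (W' n) \<omega> - f z \<omega>) / (W' n - z) \<partial>M) = ((\<integral>\<omega>. f (W' n) \<omega> \<partial>M) - (\<integral>\<omega>. f z \<omega> \<partial>M)) / (W' n - z)" for n
      using i[OF W'S] i[OF z] by simp
    ultimately have "(\<lambda>n. ((\<integral>\<omega>. f (W' n) \<omega> \<partial>M) - (\<integral>\<omega>. f z \<omega> \<partial>M)) / (W' n - z)) \<longlonglongrightarrow> (\<integral>\<omega>. d \<omega> \<partial>M)"
      by (simp only:)
    then have "(\<lambda>n. ((\<integral>\<omega>. f (W (n + N)) \<omega> \<partial>M) - (\<integral>\<omega>. f z \<omega> \<partial>M)) / (W (n + N) - z)) \<longlonglongrightarrow> (\<integral>\<omega>. d \<omega> \<partial>M)"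
      by (simp only: W'_def)
    then show "(\<lambda>n. ((\<integral>\<omega>. f (W n) \<omega> \<partial>M) - (\<integral>\<omega>. f z \<omega> \<partial>M)) / (W n - z)) \<longlonglongrightarrow> (\<integral>\<omega>. d \<omega> \<partial>M)"
      by (rule LIMSEQ_offset)
  qed
  then have "((\<lambda>z. \<integral>\<omega>. f z \<omega> \<partial>M) has_field_derivative (\<integral>\<omega>. d \<omega> \<partial>M)) (at z)"
    unfolding has_field_derivative_iff .
  then show "\<exists>f'. ((\<lambda>z. \<integral>\<omega>. f z \<omega> \<partial>M) has_field_derivative f') (at z within S)"
    using has_field_derivative_at_within by blast
qed

text \<open>This Moebius map preserves the right half plane and has no pole there; hence the
  exponentials on the right-hand side of the Laplace identity have modulus at most one.\<close>

lemma Re_moebius_nonneg: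
  fixes z :: complex
  assumes "Re z \<ge> 0" "a \<ge> 0" "c \<ge> 0"
  shows "Re (of_real a * z / (1 + of_real c * z)) \<ge> 0" and "1 + of_real c * z \<noteq> 0"
proof -
  have "Re (1 + of_real c * z) > 0" using assms by (simp add: add_pos_nonneg)
  then show "1 + of_real c * z \<noteq> 0" by (metis less_irrefl zero_complex.sel(1))
  have "Re (of_real a * z / (1 + of_real c * z)) = (a * Re z * (1 + c * Re z) + a * c * (Im z)\<^sup>2) / ((1 + c * Re z)\<^sup>2 + (c * Im z)\<^sup>2)"
    by (simp add: Re_divide power2_eq_square mult_ac)
  also have "\<dots> \<ge> 0" using assms by (intro divide_nonneg_nonneg add_nonneg_nonneg mult_nonneg_nonneg) auto
  finally show "Re (of_real a * z / (1 + of_real c * z)) \<ge> 0" .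
qed

text \<open>Both sides are bounded and holomorphic in the open right half plane and continuous up to
  its boundary, so it suffices that they agree on the positive real axis.\<close>

lemma laplace_identity_half_plane:
  fixes p T a c :: "'a \<Rightarrow> real" and z :: complex
  assumes "finite_measure M" and [measurable]: "p \<in> borel_measurable M" "T \<in> borel_measurable M" "a \<in> borel_measurable M" "c \<in> borel_measurable M"
    and p: "\<And>\<omega>. \<omega> \<in> space M \<Longrightarrow> \<bar>p \<omega>\<bar> \<le> b"
    and nn: "\<And>\<omega>. \<omega> \<in> space M \<Longrightarrow> 0 \<le> T \<omega> \<and> 0 \<le> a \<omega> \<and> 0 \<le> c \<omega>"
    and eq: "\<And>l. l > 0 \<Longrightarrow> (\<integral>\<omega>. p \<omega> * exp (- (l * T \<omega>)) \<partial>M) = (\<integral>\<omega>. p \<omega> * exp (- (a \<omega> * l / (1 + c \<omega> * l))) \<partial>M)"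
    and z: "Re z \<ge> 0"
  shows "(\<integral>\<omega>. of_real (p \<omega>) * exp (- (z * of_real (T \<omega>))) \<partial>M) = (\<integral>\<omega>. of_real (p \<omega>) * exp (- (of_real (a \<omega>) * z / (1 + of_real (c \<omega>) * z))) \<partial>M)"
proof -
  interpret finite_measure M by fact
  define F where "F z \<omega> = of_real (p \<omega>) * exp (- (z * of_real (T \<omega>)))" for z :: complex and \<omega>
  define G where "G z \<omega> = of_real (p \<omega>) * exp (- (of_real (a \<omega>) * z / (1 + of_real (c \<omega>) * z)))" for z :: complex and \<omega>
  have [measurable]: "F z \<in> borel_measurable M" "G z \<in> borel_measurable M" for z unfolding F_def G_def by measurable
  have Fb: "norm (F z \<omega>) \<le> b" if "Re z \<ge> 0" "\<omega> \<in> space M" for z \<omega>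
  proof -
    have "norm (F z \<omega>) = \<bar>p \<omega>\<bar> * exp (- (Re z * T \<omega>))" by (simp add: F_def norm_mult)
    also have "\<dots> \<le> b * 1" using p[OF that(2)] nn[OF that(2)] that(1) by (intro mult_mono) auto
    finally show ?thesis by simp
  qed
  have Gb: "norm (G z \<omega>) \<le> b" if "Re z \<ge> 0" "\<omega> \<in> space M" for z \<omega>
  proof -
    have "norm (G z \<omega>) = \<bar>p \<omega>\<bar> * exp (- Re (of_real (a \<omega>) * z / (1 + of_real (c \<omega>) * z)))" by (simp only: G_def norm_mult norm_of_real norm_exp_eq_Re uminus_complex.sel)
    also have "\<dots> \<le> b * 1" using p[OF that(2)] nn[OF that(2)] Re_moebius_nonneg(1)[of z "a \<omega>" "c \<omega>"] that(1) by (intro mult_mono) auto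
    finally show ?thesis by simp
  qed
  define H where "H z = (\<integral>\<omega>. F z \<omega> \<partial>M) - (\<integral>\<omega>. G z \<omega> \<partial>M)" for z
  let ?S = "{z :: complex. 0 < Re z}"
  have S: "open ?S" "connected ?S" by (auto simp: open_halfspace_Re_gt intro!: convex_connected convex_halfspace_Re_gt)
  have hol: "H holomorphic_on ?S"
    unfolding H_def
  proof (intro holomorphic_on_diff holomorphic_integral[where C=b] finite_measure_axioms S)
    fix \<omega> assume w: "\<omega> \<in> space M"
    show "(\<lambda>z. F z \<omega>) holomorphic_on ?S" unfolding F_def by (intro holomorphic_intros)
    show "(\<lambda>z. G z \<omega>) holomorphic_on ?S"
      unfolding G_def using Re_moebius_nonneg(2)[of _ 0 "c \<omega>"] nn[OF w] by (intro holomorphic_intros) auto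
  qed (use Fb Gb in auto)
  have zero: "H (of_real l) = 0" if l: "l > 0" for l
  proof -
    have "(\<integral>\<omega>. F (of_real l) \<omega> \<partial>M) = (\<integral>\<omega>. of_real (p \<omega> * exp (- (l * T \<omega>))) \<partial>M)"
      by (intro Bochner_Integration.integral_cong) (auto simp: F_def exp_of_real[symmetric])
    also have "\<dots> = of_real (\<integral>\<omega>. p \<omega> * exp (- (l * T \<omega>)) \<partial>M)" by (rule integral_complex_of_real)
    also have "\<dots> = of_real (\<integral>\<omega>. p \<omega> * exp (- (a \<omega> * l / (1 + c \<omega> * l))) \<partial>M)" by (simp only: eq[OF l])
    also have "\<dots> = (\<integral>\<omega>. of_real (p \<omega> * exp (- (a \<omega> * l / (1 + c \<omega> * l)))) \<partial>M)" by (rule integral_complex_of_real[symmetric])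
    also have "\<dots> = (\<integral>\<omega>. G (of_real l) \<omega> \<partial>M)"
      by (intro Bochner_Integration.integral_cong) (auto simp: G_def exp_of_real[symmetric])
    finally show ?thesis by (simp add: H_def)
  qed
  have pos: "H w = 0" if w: "w \<in> ?S" for w
  proof (rule analytic_continuation[OF hol S _ _ _ _ w])
    show "of_real ` {0<..} \<subseteq> ?S" by auto
    show "(1 :: complex) \<in> ?S" by simp
    show "1 islimpt (of_real ` {0<..} :: complex set)"
      unfolding islimpt_sequential
    proof (intro exI conjI allI)
      let ?W = "\<lambda>n. of_real (1 + inverse (real (Suc n))) :: complex"
      show "?W n \<in> of_real ` {0<..} - {1}" for n
      proof -
        have "1 + inverse (real (Suc n)) > 0" "1 + inverse (real (Suc n)) \<noteq> 1" by (auto intro: add_pos_pos)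
        then show ?thesis by (metis DiffI greaterThan_iff image_eqI of_real_eq_1_iff singletonD)
      qed
      have "?W \<longlonglongrightarrow> of_real (1 + 0)" by (intro tendsto_intros LIMSEQ_inverse_real_of_nat)
      then show "?W \<longlonglongrightarrow> 1" by simp
    qed
  qed (use zero in auto)
  define W where "W n = z + of_real (inverse (real (Suc n)))" for n
  have Wp: "Re (W n) > 0" for n using z by (simp add: W_def add_nonneg_pos)
  have Wl: "W \<longlonglongrightarrow> z"
  proof -
    have "W \<longlonglongrightarrow> z + of_real 0" unfolding W_def by (intro tendsto_intros LIMSEQ_inverse_real_of_nat)
    then show ?thesis by simp
  qed
  have FL: "(\<lambda>n. \<integral>\<omega>. F (W n) \<omega> \<partial>M) \<longlonglongrightarrow> (\<integral>\<omega>. F z \<omega> \<partial>M)"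
  proof (rule integral_dominated_convergence[where w="\<lambda>_. b"])
    show "AE \<omega> in M. (\<lambda>n. F (W n) \<omega>) \<longlonglongrightarrow> F z \<omega>"
      unfolding F_def by (intro AE_I2 tendsto_intros Wl)
    show "AE \<omega> in M. norm (F (W n) \<omega>) \<le> b" for n using Fb Wp[of n] by (intro AE_I2) auto
  qed auto
  have GL: "(\<lambda>n. \<integral>\<omega>. G (W n) \<omega> \<partial>M) \<longlonglongrightarrow> (\<integral>\<omega>. G z \<omega> \<partial>M)"
  proof (rule integral_dominated_convergence[where w="\<lambda>_. b"])
    show "AE \<omega> in M. (\<lambda>n. G (W n) \<omega>) \<longlonglongrightarrow> G z \<omega>"
      unfolding G_def using Re_moebius_nonneg(2)[OF z, of 0] nn by (intro AE_I2 tendsto_intros Wl) auto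
    show "AE \<omega> in M. norm (G (W n) \<omega>) \<le> b" for n using Gb Wp[of n] by (intro AE_I2) auto
  qed auto
  have "(\<integral>\<omega>. F (W n) \<omega> \<partial>M) = (\<integral>\<omega>. G (W n) \<omega> \<partial>M)" for n
    using pos[of "W n"] Wp[of n] by (simp add: H_def)
  with FL have "(\<lambda>n. \<integral>\<omega>. G (W n) \<omega> \<partial>M) \<longlonglongrightarrow> (\<integral>\<omega>. F z \<omega> \<partial>M)" by (simp only:)
  from LIMSEQ_unique[OF this GL] have "(\<integral>\<omega>. F z \<omega> \<partial>M) = (\<integral>\<omega>. G z \<omega> \<partial>M)" .
  then show ?thesis by (simp add: F_def G_def)
qed

section \<open>Weak convergence from products of test functions\<close>

text \<open>The middle coordinate is separated from the outer two because it will be the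
  fluctuation, the asymptotically independent component. For a product of polynomials the list
  consists of all pairwise products.\<close>

lemma polynomial_as_sum_of_products:
  fixes h :: "real \<times> real \<times> real \<Rightarrow> real"
  assumes "real_polynomial_function h"
  shows "\<exists>ps :: ((real \<times> real \<Rightarrow> real) \<times> (real \<Rightarrow> real)) list.
    (\<forall>(p, q)\<in>set ps. continuous_on UNIV p \<and> continuous_on UNIV q) \<and>
    (\<forall>v a b. h (v, a, b) = (\<Sum>(p, q)\<leftarrow>ps. p (v, b) * q a))"
  using assms
proof induction
  case (linear f)
  then have l: "f (v, a, b) = f (v, 0, b) + f (0, a, 0)" for v a b
    using linear_add[OF bounded_linear.linear[OF linear], of "(v, 0, b)" "(0, a, 0)"] by simp
  have c: "continuous_on UNIV f" using linear by (rule linear_continuous_on)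
  let ?ps = "[(\<lambda>x. f (fst x, 0, snd x), \<lambda>_. 1), (\<lambda>_. 1, \<lambda>a. f (0, a, 0))]"
  have 1: "\<forall>(p, q)\<in>set ?ps. continuous_on UNIV p \<and> continuous_on UNIV q"
    by (auto intro!: continuous_intros continuous_on_compose2[OF c])
  have 2: "f (v, a, b) = (\<Sum>(p, q)\<leftarrow>?ps. p (v, b) * q a)" for v a b
    using l[of v a b] by simp
  show ?case using 1 2 by blast
next
  case (const c)
  show ?case by (rule exI[of _ "[(\<lambda>_. c, \<lambda>_. 1)]"]) (auto intro!: continuous_intros)
next
  case (add f g)
  then obtain ps qs where "(\<forall>(p, q)\<in>set ps. continuous_on UNIV p \<and> continuous_on UNIV q) \<and>
    (\<forall>v a b. f (v, a, b) = (\<Sum>(p, q)\<leftarrow>ps. p (v, b) * q a))" "(\<forall>(p, q)\<in>set qs. continuous_on UNIV p \<and> continuous_on UNIV q) \<and>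
    (\<forall>v a b. g (v, a, b) = (\<Sum>(p, q)\<leftarrow>qs. p (v, b) * q a))" by blast
  then show ?case by (intro exI[of _ "ps @ qs"]) auto
next
  case (mult f g)
  then obtain ps qs where ps: "\<forall>(p, q)\<in>set ps. continuous_on UNIV p \<and> continuous_on UNIV q"
    "\<And>v a b. f (v, a, b) = (\<Sum>(p, q)\<leftarrow>ps. p (v, b) * q a)" and qs: "\<forall>(p, q)\<in>set qs. continuous_on UNIV p \<and> continuous_on UNIV q"
    "\<And>v a b. g (v, a, b) = (\<Sum>(p, q)\<leftarrow>qs. p (v, b) * q a)" by blast
  have prod: "(\<Sum>(p, q)\<leftarrow>[(\<lambda>x. fst u x * fst w x, \<lambda>x. snd u x * snd w x). u \<leftarrow> ps, w \<leftarrow> qs]. p (v, b) * q a)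
    = (\<Sum>(p, q)\<leftarrow>ps. p (v, b) * q a) * (\<Sum>(p, q)\<leftarrow>qs. p (v, b) * q a)"
    for v a b and ps qs :: "((real \<times> real \<Rightarrow> real) \<times> (real \<Rightarrow> real)) list"
  proof (induction ps)
    case (Cons u ps)
    have "(\<Sum>(p, q)\<leftarrow>map (\<lambda>w. (\<lambda>x. fst u x * fst w x, \<lambda>x. snd u x * snd w x)) qs. p (v, b) * q a)
      = fst u (v, b) * snd u a * (\<Sum>(p, q)\<leftarrow>qs. p (v, b) * q a)"
      by (induction qs) (auto simp: algebra_simps)
    then show ?case using Cons by (simp add: case_prod_unfold distrib_right)
  qed simp
  show ?case
    by (rule exI[of _ "[(\<lambda>x. fst u x * fst w x, \<lambda>x. snd u x * snd w x). u \<leftarrow> ps, w \<leftarrow> qs]"])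
       (use ps qs prod in \<open>auto simp: case_prod_unfold intro!: continuous_intros\<close>)
qed

text \<open>A continuous plateau of height one on [-R, R]; multiplication by it turns polynomials
  into bounded continuous test functions.\<close>

definition cutoff :: "real \<Rightarrow> real \<Rightarrow> real" where
  "cutoff R x = max 0 (min 1 (R + 1 - \<bar>x\<bar>))"

lemma cutoff_properties:
  "0 \<le> cutoff R x" "cutoff R x \<le> 1" "\<bar>x\<bar> \<le> R \<Longrightarrow> cutoff R x = 1" "\<bar>x\<bar> > R + 1 \<Longrightarrow> cutoff R x = 0"
  "continuous_on UNIV (cutoff R)"
  unfolding cutoff_def by (auto intro!: continuous_intros)

lemma continuous_cutoff_bounded:
  fixes f g :: "'a::heine_borel \<Rightarrow> real"
  assumes "continuous_on UNIV f" "compact K" and g: "\<And>x. \<bar>g x\<bar> \<le> 1" "\<And>x. x \<notin> K \<Longrightarrow> g x = 0"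
  shows "bounded (range (\<lambda>x. g x * f x))"
proof -
  have "bounded (f ` K)"
    by (intro compact_imp_bounded compact_continuous_image continuous_on_subset[OF assms(1)] assms(2)) auto
  then obtain B where B: "\<And>x. x \<in> K \<Longrightarrow> \<bar>f x\<bar> \<le> B" by (auto simp: bounded_iff)
  have "\<bar>g x * f x\<bar> \<le> \<bar>B\<bar>" for x
  proof (cases "x \<in> K")
    case True
    have "\<bar>g x\<bar> * \<bar>f x\<bar> \<le> 1 * \<bar>B\<bar>" using g(1)[of x] B[OF True] by (intro mult_mono) auto
    then show ?thesis by (simp add: abs_mult)
  qed (simp add: g)
  then show ?thesis by (auto simp: bounded_iff intro!: exI[of _ "\<bar>B\<bar>"])
qed

text \<open>Tightness comes from \<open>H\<close> itself: the cut-off \<open>X R\<close> is a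
  product test function, so its integrals converge to a value close to one. On the box carrying the
  cut-off, \<open>g\<close> is approximated by a polynomial (Stone-Weierstrass), and a polynomial
  times the cut-off is a finite sum of products.\<close>

lemma weak_convergence_from_products:
  fixes v a b :: "nat \<Rightarrow> 'a \<Rightarrow> real" and v' a' b' :: "'b \<Rightarrow> real" and g :: "real \<times> real \<times> real \<Rightarrow> real"
  assumes "prob_space P" "prob_space N"
    and [measurable]: "\<And>n. v n \<in> borel_measurable P" "\<And>n. a n \<in> borel_measurable P" "\<And>n. b n \<in> borel_measurable P"
    and [measurable]: "v' \<in> borel_measurable N" "a' \<in> borel_measurable N" "b' \<in> borel_measurable N"
    and H: "\<And>(p :: real \<times> real \<Rightarrow> real) (q :: real \<Rightarrow> real). continuous_on UNIV p \<Longrightarrow> bounded (range p) \<Longrightarrow> continuous_on UNIV q \<Longrightarrow> bounded (range q) \<Longrightarrow>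
       (\<lambda>n. \<integral>\<omega>. p (v n \<omega>, b n \<omega>) * q (a n \<omega>) \<partial>P) \<longlonglongrightarrow> (\<integral>\<omega>. p (v' \<omega>, b' \<omega>) * q (a' \<omega>) \<partial>N)"
    and g: "continuous_on UNIV g" "bounded (range g)"
  shows "(\<lambda>n. \<integral>\<omega>. g (v n \<omega>, a n \<omega>, b n \<omega>) \<partial>P) \<longlonglongrightarrow> (\<integral>\<omega>. g (v' \<omega>, a' \<omega>, b' \<omega>) \<partial>N)"
proof -
  interpret P: prob_space P by fact
  interpret N: prob_space N by fact
  define Y where "Y n \<omega> = (v n \<omega>, a n \<omega>, b n \<omega>)" for n \<omega>
  define Y' where "Y' \<omega> = (v' \<omega>, a' \<omega>, b' \<omega>)" for \<omega>
  have Ym [measurable]: "Y n \<in> borel_measurable P" "Y' \<in> borel_measurable N" for n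
    unfolding Y_def Y'_def by measurable
  have cm: "(\<lambda>\<omega>. f (Y n \<omega>)) \<in> borel_measurable P" "(\<lambda>\<omega>. f (Y' \<omega>)) \<in> borel_measurable N"
    if "continuous_on UNIV f" for f :: "real \<times> real \<times> real \<Rightarrow> real" and n
    using borel_measurable_continuous_onI[OF that] Ym by (auto intro: measurable_compose)
  obtain K where K: "\<And>y. \<bar>g y\<bar> \<le> K" using g(2) by (auto simp: bounded_iff)
  have K0: "K \<ge> 0" using K[of undefined] by simp
  define X where "X R y = cutoff R (fst y) * cutoff R (fst (snd y)) * cutoff R (snd (snd y))" for R and y :: "real \<times> real \<times> real"
  have X01: "0 \<le> X R y" "X R y \<le> 1" for R y
    unfolding X_def by (auto intro!: mult_nonneg_nonneg mult_le_one cutoff_properties)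
  have Xc: "continuous_on UNIV (X R)" for R
    unfolding X_def by (auto intro!: continuous_intros continuous_on_compose2[OF cutoff_properties(5)])
  define XX where "XX R x = cutoff R (fst x) * cutoff R (snd x)" for R and x :: "real \<times> real"
  have XX01: "\<bar>XX R x\<bar> \<le> 1" for R x
    unfolding XX_def using cutoff_properties(1,2) by (simp add: abs_mult mult_le_one)
  have XXc: "continuous_on UNIV (XX R)" for R
    unfolding XX_def by (auto intro!: continuous_intros continuous_on_compose2[OF cutoff_properties(5)])
  have XXb: "bounded (range (\<lambda>x. XX R x * p x))" if "continuous_on UNIV p" for R p
  proof (rule continuous_cutoff_bounded[OF that _ XX01])
    show "compact ({-(R+1)..R+1} \<times> {-(R+1)..R+1})" by (intro compact_Times) auto
    fix x assume "x \<notin> {-(R+1)..R+1} \<times> {-(R+1)..R+1}"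
    then have "\<bar>fst x\<bar> > R + 1 \<or> \<bar>snd x\<bar> > R + 1" by (cases x) auto
    then show "XX R x = 0" using cutoff_properties(4)[of R] by (auto simp: XX_def)
  qed
  have Cb: "bounded (range (\<lambda>x. cutoff R x * q x))" if "continuous_on UNIV q" for R and q :: "real \<Rightarrow> real"
  proof (rule continuous_cutoff_bounded[OF that])
    show "compact {-(R+1)..R+1}" by simp
    show "\<bar>cutoff R x\<bar> \<le> 1" for x using cutoff_properties(1,2)[of R x] by simp
    fix x assume "x \<notin> {-(R+1)..R+1}"
    then have "\<bar>x\<bar> > R + 1" by auto
    then show "cutoff R x = 0" by (rule cutoff_properties)
  qed
  have prodlim: "(\<lambda>n. \<integral>\<omega>. (\<Sum>(p, q)\<leftarrow>ps. (XX R (v n \<omega>, b n \<omega>) * p (v n \<omega>, b n \<omega>)) * (cutoff R (a n \<omega>) * q (a n \<omega>))) \<partial>P)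
      \<longlonglongrightarrow> (\<integral>\<omega>. (\<Sum>(p, q)\<leftarrow>ps. (XX R (v' \<omega>, b' \<omega>) * p (v' \<omega>, b' \<omega>)) * (cutoff R (a' \<omega>) * q (a' \<omega>))) \<partial>N)
     \<and> (\<forall>n. integrable P (\<lambda>\<omega>. (\<Sum>(p, q)\<leftarrow>ps. (XX R (v n \<omega>, b n \<omega>) * p (v n \<omega>, b n \<omega>)) * (cutoff R (a n \<omega>) * q (a n \<omega>)))))
     \<and> integrable N (\<lambda>\<omega>. (\<Sum>(p, q)\<leftarrow>ps. (XX R (v' \<omega>, b' \<omega>) * p (v' \<omega>, b' \<omega>)) * (cutoff R (a' \<omega>) * q (a' \<omega>))))"
    if "\<forall>(p, q)\<in>set ps. continuous_on UNIV p \<and> continuous_on UNIV q" for ps R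
    using that
  proof (induction ps)
    case (Cons u ps)
    obtain p q where u: "u = (p, q)" by (cases u)
    have p: "continuous_on UNIV p" and q: "continuous_on UNIV q" using Cons.prems by (auto simp: u)
    have pc: "continuous_on UNIV (\<lambda>x. XX R x * p x)" and qc: "continuous_on UNIV (\<lambda>x. cutoff R x * q x)"
      by (auto intro!: continuous_intros p q XXc cutoff_properties)
    note l = H[OF pc XXb[OF p] qc Cb[OF q]]
    obtain Bp where Bp: "\<And>x. \<bar>XX R x * p x\<bar> \<le> Bp" using XXb[OF p, of R] by (auto simp: bounded_iff)
    obtain Bq where Bq: "\<And>x. \<bar>cutoff R x * q x\<bar> \<le> Bq" using Cb[OF q, of R] by (auto simp: bounded_iff)
    have Bpq: "\<bar>(XX R x * p x) * (cutoff R y * q y)\<bar> \<le> Bp * Bq" for x y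
      unfolding abs_mult[of "XX R x * p x"] using Bp[of x] Bq[of y] by (intro mult_mono) auto
    have c3: "continuous_on UNIV (\<lambda>y::real \<times> real \<times> real. (XX R (fst y, snd (snd y)) * p (fst y, snd (snd y))) * (cutoff R (fst (snd y)) * q (fst (snd y))))"
      by (auto intro!: continuous_intros continuous_on_compose2[OF pc] continuous_on_compose2[OF qc] continuous_on_compose2[OF p] continuous_on_compose2[OF q] continuous_on_compose2[OF XXc] continuous_on_compose2[OF cutoff_properties(5)])
    have i1: "integrable P (\<lambda>\<omega>. (XX R (v n \<omega>, b n \<omega>) * p (v n \<omega>, b n \<omega>)) * (cutoff R (a n \<omega>) * q (a n \<omega>)))" for n
      by (rule P.integrable_const_bound[where B="Bp * Bq"]) (use Bpq cm(1)[OF c3, of n] in \<open>auto simp: Y_def\<close>)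
    have i2: "integrable N (\<lambda>\<omega>. (XX R (v' \<omega>, b' \<omega>) * p (v' \<omega>, b' \<omega>)) * (cutoff R (a' \<omega>) * q (a' \<omega>)))"
      by (rule N.integrable_const_bound[where B="Bp * Bq"]) (use Bpq cm(2)[OF c3] in \<open>auto simp: Y'_def\<close>)
    from Cons have IH: "(\<lambda>n. \<integral>\<omega>. (\<Sum>(p, q)\<leftarrow>ps. (XX R (v n \<omega>, b n \<omega>) * p (v n \<omega>, b n \<omega>)) * (cutoff R (a n \<omega>) * q (a n \<omega>))) \<partial>P)
      \<longlonglongrightarrow> (\<integral>\<omega>. (\<Sum>(p, q)\<leftarrow>ps. (XX R (v' \<omega>, b' \<omega>) * p (v' \<omega>, b' \<omega>)) * (cutoff R (a' \<omega>) * q (a' \<omega>))) \<partial>N)"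
     "\<And>n. integrable P (\<lambda>\<omega>. (\<Sum>(p, q)\<leftarrow>ps. (XX R (v n \<omega>, b n \<omega>) * p (v n \<omega>, b n \<omega>)) * (cutoff R (a n \<omega>) * q (a n \<omega>))))"
     "integrable N (\<lambda>\<omega>. (\<Sum>(p, q)\<leftarrow>ps. (XX R (v' \<omega>, b' \<omega>) * p (v' \<omega>, b' \<omega>)) * (cutoff R (a' \<omega>) * q (a' \<omega>))))" by auto
    show ?case
      unfolding list.map sum_list.Cons u prod.case
      using tendsto_add[OF l IH(1)] i1 i2 IH(2,3)
      by (simp only: Bochner_Integration.integral_add Bochner_Integration.integrable_add simp_thms)
  qed simp
  show ?thesis
    unfolding Y_def[symmetric] Y'_def[symmetric]
  proof (rule LIMSEQ_I)
    fix r :: real assume r: "r > 0"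
    \<comment> \<open>Two comparison errors (K + 1) \<epsilon> and a convergence error \<epsilon>
      add up to (2 K + 3) \<epsilon> = r.\<close>
    define \<epsilon> where "\<epsilon> = r / (2 * K + 3)"
    have eps: "\<epsilon> > 0" using r K0 by (simp add: \<epsilon>_def)
    have "(\<lambda>k. \<integral>\<omega>. X (real k) (Y' \<omega>) \<partial>N) \<longlonglongrightarrow> (\<integral>\<omega>. 1 \<partial>N)"
    proof (rule integral_dominated_convergence[where w="\<lambda>_. 1"])
      show "AE \<omega> in N. (\<lambda>k. X (real k) (Y' \<omega>)) \<longlonglongrightarrow> 1"
      proof (intro AE_I2 tendsto_eventually)
        fix \<omega>
        obtain m :: nat where m: "max \<bar>v' \<omega>\<bar> (max \<bar>a' \<omega>\<bar> \<bar>b' \<omega>\<bar>) \<le> real m" using real_arch_simple by blast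
        show "\<forall>\<^sub>F k in sequentially. X (real k) (Y' \<omega>) = 1"
          using eventually_ge_at_top[of m]
        proof eventually_elim
          case (elim k)
          then have "real m \<le> real k" by simp
          with m show ?case by (simp add: X_def Y'_def cutoff_properties(3))
        qed
      qed
    qed (use X01 cm(2)[OF Xc] in auto)
    then have "\<forall>\<^sub>F k in sequentially. (\<integral>\<omega>. X (real k) (Y' \<omega>) \<partial>N) > 1 - \<epsilon>"
      using eps by (intro order_tendstoD(1)) (auto simp: N.prob_space)
    then obtain k where k: "(\<integral>\<omega>. X (real k) (Y' \<omega>) \<partial>N) > 1 - \<epsilon>" by (auto simp: eventually_sequentially)
    define R where "R = real k"
    have NX: "(\<integral>\<omega>. X R (Y' \<omega>) \<partial>N) > 1 - \<epsilon>" using k by (simp add: R_def)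
    have XXcut: "X R (x, y, z) = XX R (x, z) * cutoff R y" for x y z by (simp add: X_def XX_def)
    have "(\<lambda>n. \<integral>\<omega>. XX R (v n \<omega>, b n \<omega>) * cutoff R (a n \<omega>) \<partial>P) \<longlonglongrightarrow> (\<integral>\<omega>. XX R (v' \<omega>, b' \<omega>) * cutoff R (a' \<omega>) \<partial>N)"
      by (rule H[OF XXc _ cutoff_properties(5)]) (use XXb[of "\<lambda>_. 1" R] Cb[of "\<lambda>_. 1" R] in auto)
    then have "(\<lambda>n. \<integral>\<omega>. X R (Y n \<omega>) \<partial>P) \<longlonglongrightarrow> (\<integral>\<omega>. X R (Y' \<omega>) \<partial>N)" by (simp add: XXcut Y_def Y'_def)
    from order_tendstoD(1)[OF this NX] have PX: "\<forall>\<^sub>F n in sequentially. (\<integral>\<omega>. X R (Y n \<omega>) \<partial>P) > 1 - \<epsilon>" .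
    let ?B = "{-(R+1)..R+1} \<times> {-(R+1)..R+1} \<times> {-(R+1)..R+1} :: (real \<times> real \<times> real) set"
    have "compact ?B" by (intro compact_Times) auto
    then obtain h where h: "real_polynomial_function h" and gh: "\<And>y. y \<in> ?B \<Longrightarrow> \<bar>g y - h y\<bar> < \<epsilon>"
      using Stone_Weierstrass_real_polynomial_function[of ?B g \<epsilon>] continuous_on_subset[OF g(1)] eps by auto
    obtain ps where ps: "\<forall>(p, q)\<in>set ps. continuous_on UNIV p \<and> continuous_on UNIV q"
      and hps: "\<And>v a b. h (v, a, b) = (\<Sum>(p, q)\<leftarrow>ps. p (v, b) * q a)"
      using polynomial_as_sum_of_products[OF h] by blast
    have Xh: "X R (x, y, z) * h (x, y, z) = (\<Sum>(p, q)\<leftarrow>ps. (XX R (x, z) * p (x, z)) * (cutoff R y * q y))" for x y z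
      unfolding hps XXcut sum_list_const_mult[symmetric] by (simp add: case_prod_unfold mult_ac)
    have hl: "(\<lambda>n. \<integral>\<omega>. X R (Y n \<omega>) * h (Y n \<omega>) \<partial>P) \<longlonglongrightarrow> (\<integral>\<omega>. X R (Y' \<omega>) * h (Y' \<omega>) \<partial>N)"
      and hi: "\<And>n. integrable P (\<lambda>\<omega>. X R (Y n \<omega>) * h (Y n \<omega>))" "integrable N (\<lambda>\<omega>. X R (Y' \<omega>) * h (Y' \<omega>))"
      using prodlim[OF ps, of R] unfolding Y_def Y'_def Xh by auto
    \<comment> \<open>Inside the box the error is the bound \<open>K\<close> on the part that the
      cut-off loses, plus the polynomial error; outside the box the cut-off vanishes.\<close>
    have pw: "\<bar>g y - X R y * h y\<bar> \<le> K * (1 - X R y) + \<epsilon>" for y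
    proof (cases "y \<in> ?B")
      case True
      have "g y - X R y * h y = g y * (1 - X R y) + X R y * (g y - h y)" by (simp add: algebra_simps)
      also have "\<bar>\<dots>\<bar> \<le> \<bar>g y\<bar> * (1 - X R y) + X R y * \<bar>g y - h y\<bar>"
        using X01[of R y] by (intro order_trans[OF abs_triangle_ineq]) (simp add: abs_mult)
      also have "\<dots> \<le> K * (1 - X R y) + 1 * \<epsilon>"
        using X01[of R y] K[of y] gh[OF True] by (intro add_mono mult_mono) auto
      finally show ?thesis by simp
    next
      case False
      then have "\<bar>fst y\<bar> > R + 1 \<or> \<bar>fst (snd y)\<bar> > R + 1 \<or> \<bar>snd (snd y)\<bar> > R + 1" by (cases y) auto
      then have "X R y = 0" using cutoff_properties(4)[of R] by (auto simp: X_def)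
      then show ?thesis using K[of y] eps by simp
    qed
    have est: "\<bar>(\<integral>\<omega>. g (W \<omega>) \<partial>L) - (\<integral>\<omega>. X R (W \<omega>) * h (W \<omega>) \<partial>L)\<bar> \<le> (K + 1) * \<epsilon>"
      if "prob_space L" "(\<lambda>\<omega>. g (W \<omega>)) \<in> borel_measurable L" "(\<lambda>\<omega>. X R (W \<omega>)) \<in> borel_measurable L"
        "integrable L (\<lambda>\<omega>. X R (W \<omega>) * h (W \<omega>))" "(\<integral>\<omega>. X R (W \<omega>) \<partial>L) > 1 - \<epsilon>" for W and L :: "'c measure"
    proof -
      interpret L: prob_space L by fact
      have ig: "integrable L (\<lambda>\<omega>. g (W \<omega>))" by (rule L.integrable_const_bound[where B=K]) (use K that in auto)
      have iX: "integrable L (\<lambda>\<omega>. X R (W \<omega>))" by (rule L.integrable_const_bound[where B=1]) (use X01 that in auto)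
      have "\<bar>(\<integral>\<omega>. g (W \<omega>) \<partial>L) - (\<integral>\<omega>. X R (W \<omega>) * h (W \<omega>) \<partial>L)\<bar> = \<bar>\<integral>\<omega>. g (W \<omega>) - X R (W \<omega>) * h (W \<omega>) \<partial>L\<bar>"
        using ig that(4) by simp
      also have "\<dots> \<le> (\<integral>\<omega>. \<bar>g (W \<omega>) - X R (W \<omega>) * h (W \<omega>)\<bar> \<partial>L)" by (rule integral_abs_bound)
      also have "\<dots> \<le> (\<integral>\<omega>. K * (1 - X R (W \<omega>)) + \<epsilon> \<partial>L)"
        using ig that(4) iX pw by (intro integral_mono) auto
      also have "\<dots> = K * (1 - (\<integral>\<omega>. X R (W \<omega>) \<partial>L)) + \<epsilon>" using iX by (simp add: L.prob_space)
      also have "\<dots> \<le> K * \<epsilon> + \<epsilon>" using that(5) K0 by (intro add_right_mono mult_left_mono) auto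
      finally show ?thesis by (simp add: distrib_right)
    qed
    have eN: "\<bar>(\<integral>\<omega>. g (Y' \<omega>) \<partial>N) - (\<integral>\<omega>. X R (Y' \<omega>) * h (Y' \<omega>) \<partial>N)\<bar> \<le> (K + 1) * \<epsilon>"
      by (rule est[OF assms(2) cm(2)[OF g(1)] cm(2)[OF Xc] hi(2) NX])
    have "\<forall>\<^sub>F n in sequentially. \<bar>(\<integral>\<omega>. X R (Y n \<omega>) * h (Y n \<omega>) \<partial>P) - (\<integral>\<omega>. X R (Y' \<omega>) * h (Y' \<omega>) \<partial>N)\<bar> < \<epsilon>"
      using tendstoD[OF hl eps] by (simp add: dist_real_def)
    with PX have "\<forall>\<^sub>F n in sequentially. norm ((\<integral>\<omega>. g (Y n \<omega>) \<partial>P) - (\<integral>\<omega>. g (Y' \<omega>) \<partial>N)) < r"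
    proof eventually_elim
      case (elim n)
      have "\<bar>(\<integral>\<omega>. g (Y n \<omega>) \<partial>P) - (\<integral>\<omega>. X R (Y n \<omega>) * h (Y n \<omega>) \<partial>P)\<bar> \<le> (K + 1) * \<epsilon>"
        by (rule est[OF assms(1) cm(1)[OF g(1)] cm(1)[OF Xc] hi(1) elim(1)])
      with eN elim(2) have "\<bar>(\<integral>\<omega>. g (Y n \<omega>) \<partial>P) - (\<integral>\<omega>. g (Y' \<omega>) \<partial>N)\<bar> < (K + 1) * \<epsilon> + \<epsilon> + (K + 1) * \<epsilon>" by linarith
      also have "\<dots> = (2 * K + 3) * \<epsilon>" by (simp add: algebra_simps)
      also have "\<dots> = r" using K0 by (simp add: \<epsilon>_def)
      finally show ?case by simp
    qed
    then show "\<exists>no. \<forall>n\<ge>no. norm ((\<integral>\<omega>. g (Y n \<omega>) \<partial>P) - (\<integral>\<omega>. g (Y' \<omega>) \<partial>N)) < r"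
      by (simp add: eventually_sequentially)
  qed
qed

section \<open>Fluctuations of the total mass\<close>

lemma norm_exp_neg_le_1: "Re w \<ge> 0 \<Longrightarrow> norm (exp (- w)) \<le> 1"
  by (simp add: norm_exp_eq_Re)

text \<open>The characteristic function at \<theta> of the fluctuation given mass \<open>z\<close>.
  At z = 0 division by zero yields 0 and the value is 1, in accordance with a fluctuation equal to 0
  there.\<close>

definition fluctuation_char :: "real \<Rightarrow> real \<Rightarrow> real \<Rightarrow> complex" where
  "fluctuation_char k \<theta> z = iexp (\<theta> * sqrt z) * exp (- (of_real (sqrt z) * (\<i> * of_real \<theta>) / (1 + of_real (k / sqrt z) * (\<i> * of_real \<theta>))))"

lemma norm_fluctuation_char_le_1: "k \<ge> 0 \<Longrightarrow> z \<ge> 0 \<Longrightarrow> norm (fluctuation_char k \<theta> z) \<le> 1"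
  using Re_moebius_nonneg(1)[of "\<i> * of_real \<theta>" "sqrt z" "k / sqrt z"]
  by (simp only: fluctuation_char_def norm_mult norm_exp_eq_Re) simp

text \<open>Over the common denominator the two imaginary terms of order \<open>sqrt z\<close>
  cancel and leave - k \<theta>^2 divided by that denominator, which tends to 1.\<close>

lemma fluctuation_char_limit:
  assumes "k \<ge> 0"
  shows "(fluctuation_char k \<theta> \<longlongrightarrow> of_real (exp (- k * \<theta>\<^sup>2))) at_top"
proof -
  have e: "fluctuation_char k \<theta> z = exp (- of_real (k * \<theta>\<^sup>2) / (1 + of_real (k / sqrt z) * (\<i> * of_real \<theta>)))" if z: "z > 0" for z
  proof -
    define s where "s = complex_of_real (sqrt z)"
    define D where "D = 1 + of_real (k / sqrt z) * (\<i> * complex_of_real \<theta>)"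
    have s: "s \<noteq> 0" using z by (simp add: s_def)
    have D: "D \<noteq> 0" unfolding D_def using Re_moebius_nonneg(2)[of "\<i> * of_real \<theta>" 0 "k / sqrt z"] assms z by simp
    have "s * (\<i> * of_real \<theta>) * D - s * (\<i> * of_real \<theta>) = - of_real (k * \<theta>\<^sup>2)"
      using s by (simp add: D_def s_def algebra_simps power2_eq_square)
    then have "s * (\<i> * of_real \<theta>) - s * (\<i> * of_real \<theta>) / D = - of_real (k * \<theta>\<^sup>2) / D"
      using D by (metis diff_divide_distrib nonzero_mult_div_cancel_right)
    then show ?thesis
      unfolding fluctuation_char_def D_def[symmetric] s_def[symmetric]
      by (simp add: mult_exp_exp s_def mult_ac)
  qed
  have "((\<lambda>z. 1 / sqrt z) \<longlongrightarrow> 0) at_top"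
    by (intro tendsto_divide_0[OF tendsto_const] filterlim_at_top_imp_at_infinity sqrt_at_top)
  then have "((\<lambda>z. k * (1 / sqrt z)) \<longlongrightarrow> k * 0) at_top" by (intro tendsto_intros)
  then have k0: "((\<lambda>z. k / sqrt z) \<longlongrightarrow> 0) at_top" by simp
  have "((\<lambda>z. exp (- of_real (k * \<theta>\<^sup>2) / (1 + of_real (k / sqrt z) * (\<i> * of_real \<theta>)))) \<longlongrightarrow> exp (- of_real (k * \<theta>\<^sup>2) / (1 + of_real 0 * (\<i> * of_real \<theta>)))) at_top"
    by (intro tendsto_intros k0) auto
  moreover have "\<forall>\<^sub>F z in at_top. exp (- of_real (k * \<theta>\<^sup>2) / (1 + of_real (k / sqrt z) * (\<i> * of_real \<theta>))) = fluctuation_char k \<theta> z"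
    using eventually_gt_at_top[of 0] by eventually_elim (simp add: e)
  ultimately show ?thesis by (auto simp: exp_of_real[symmetric] intro: Lim_transform_eventually)
qed

context ou_branching_limit
begin

definition fluctuation :: "real \<Rightarrow> 'w \<Rightarrow> real" where
  "fluctuation t \<omega> = (total_mass (X t \<omega>) - exp (\<alpha> * t) * V_inf \<omega>) / sqrt (total_mass (X t \<omega>))"

lemma measurable_fluctuation [measurable]: "t \<ge> 0 \<Longrightarrow> fluctuation t \<in> borel_measurable M"
  unfolding fluctuation_def by measurable

text \<open>\<open>mass_laplace_terminal\<close> works with nonnegative weights, whereas real and
  imaginary parts of a characteristic function bring in signed ones. The identity is linear in the
  weight, so it is applied to p + b and to a constant.\<close>

lemma mass_laplace_terminal_signed:
  assumes s: "s \<ge> 0" and [measurable]: "p \<in> borel_measurable FM" "l \<in> borel_measurable FM"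
    and p: "\<And>\<xi>. \<xi> \<in> space FM \<Longrightarrow> \<bar>p \<xi>\<bar> \<le> b" and l: "\<And>\<xi>. \<xi> \<in> space FM \<Longrightarrow> 0 \<le> l \<xi>"
  shows "(\<integral>\<omega>. p (X s \<omega>) * exp (- (l (X s \<omega>) * exp (\<alpha> * s) * V_inf \<omega>)) \<partial>M)
       = (\<integral>\<omega>. p (X s \<omega>) * exp (- (total_mass (X s \<omega>) * (l (X s \<omega>) / (1 + \<kappa> * l (X s \<omega>))))) \<partial>M)"
proof -
  note [measurable] = X_measurable[OF s]
  let ?F = "\<lambda>\<omega>. exp (- (l (X s \<omega>) * exp (\<alpha> * s) * V_inf \<omega>))"
  let ?G = "\<lambda>\<omega>. exp (- (total_mass (X s \<omega>) * (l (X s \<omega>) / (1 + \<kappa> * l (X s \<omega>)))))"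
  have F1: "AE \<omega> in M. ?F \<omega> \<le> 1"
    using V_inf_nonneg AE_space by eventually_elim (use l X_space[OF s] in auto)
  have G1: "AE \<omega> in M. ?G \<omega> \<le> 1"
    using AE_space
  proof eventually_elim
    case (elim \<omega>)
    have "0 \<le> l (X s \<omega>)" by (rule l[OF X_space[OF s elim]])
    then have "0 \<le> total_mass (X s \<omega>) * (l (X s \<omega>) / (1 + \<kappa> * l (X s \<omega>)))"
      using abpos by (intro mult_nonneg_nonneg divide_nonneg_nonneg add_nonneg_nonneg) auto
    then show ?case by simp
  qed
  have i: "integrable M (\<lambda>\<omega>. q (X s \<omega>) * H \<omega>)" if [measurable]: "q \<in> borel_measurable FM" "H \<in> borel_measurable M"
    and "\<And>\<xi>. \<xi> \<in> space FM \<Longrightarrow> \<bar>q \<xi>\<bar> \<le> c" "AE \<omega> in M. H \<omega> \<le> 1" "\<And>\<omega>. 0 \<le> H \<omega>" for q H and c :: real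
  proof (rule integrable_const_bound[where B=c])
    show "AE \<omega> in M. norm (q (X s \<omega>) * H \<omega>) \<le> c"
      using that(4) AE_space
    proof eventually_elim
      case (elim \<omega>)
      have "\<bar>q (X s \<omega>)\<bar> * H \<omega> \<le> c * 1" using that(3)[OF X_space[OF s elim(2)]] that(5) elim by (intro mult_mono) auto
      then show ?case using that(5)[of \<omega>] by (simp add: abs_mult)
    qed
  qed measurable
  have one: "(\<integral>\<omega>. (p (X s \<omega>) + b) * ?F \<omega> \<partial>M) = (\<integral>\<omega>. (p (X s \<omega>) + b) * ?G \<omega> \<partial>M)"
    by (rule mass_laplace_terminal[OF s, of "\<lambda>\<xi>. p \<xi> + b" l "2 * b"]) (use p l in \<open>force simp: abs_le_iff\<close>)+
  \<comment> \<open>The absolute value provides a nonnegative weight whatever the sign of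
    \<open>b\<close>; the factor is then cancelled.\<close>
  have two: "(\<integral>\<omega>. \<bar>b\<bar> * ?F \<omega> \<partial>M) = (\<integral>\<omega>. \<bar>b\<bar> * ?G \<omega> \<partial>M)"
    by (rule mass_laplace_terminal[OF s, of "\<lambda>\<xi>. \<bar>b\<bar>" l "\<bar>b\<bar>"]) (use l in auto)
  then have two: "(\<integral>\<omega>. b * ?F \<omega> \<partial>M) = (\<integral>\<omega>. b * ?G \<omega> \<partial>M)" by (cases "b = 0") auto
  have "(\<integral>\<omega>. p (X s \<omega>) * ?F \<omega> \<partial>M) + (\<integral>\<omega>. b * ?F \<omega> \<partial>M) = (\<integral>\<omega>. p (X s \<omega>) * ?G \<omega> \<partial>M) + (\<integral>\<omega>. b * ?G \<omega> \<partial>M)"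
    using one i[of p ?F b] i[of p ?G b] i[of "\<lambda>_. b" ?F "\<bar>b\<bar>"] i[of "\<lambda>_. b" ?G "\<bar>b\<bar>"] p F1 G1
    by (simp add: distrib_right)
  with two show ?thesis by linarith
qed

text \<open>The Laplace parameter l over the square root of the mass brings the identity into the
  form continued by \<open>laplace_identity_half_plane\<close>.
  \<open>max 0 (V_inf \<omega>)\<close> equals \<open>V_inf\<close> almost everywhere and is
  nonnegative at every point, as that lemma demands.\<close>

lemma char_fluctuation_real:
  fixes z :: complex
  assumes s: "s \<ge> 0" and [measurable]: "p \<in> borel_measurable FM" and p: "\<And>\<xi>. \<xi> \<in> space FM \<Longrightarrow> \<bar>p \<xi>\<bar> \<le> b"
    and z: "Re z \<ge> 0"
  shows "(\<integral>\<omega>. of_real (p (X s \<omega>)) * exp (- (z * of_real (exp (\<alpha> * s) * max 0 (V_inf \<omega>) / sqrt (total_mass (X s \<omega>))))) \<partial>M)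
    = (\<integral>\<omega>. of_real (p (X s \<omega>)) * exp (- (of_real (sqrt (total_mass (X s \<omega>))) * z / (1 + of_real (\<kappa> / sqrt (total_mass (X s \<omega>))) * z))) \<partial>M)"
proof (rule laplace_identity_half_plane[OF finite_measure_axioms _ _ _ _ _ _ _ z])
  note [measurable] = X_measurable[OF s]
  let ?Z = "\<lambda>\<omega>. total_mass (X s \<omega>)"
  show "\<bar>p (X s \<omega>)\<bar> \<le> b" if "\<omega> \<in> space M" for \<omega> using p[OF X_space[OF s that]] .
  show "0 \<le> exp (\<alpha> * s) * max 0 (V_inf \<omega>) / sqrt (?Z \<omega>) \<and> 0 \<le> sqrt (?Z \<omega>) \<and> 0 \<le> \<kappa> / sqrt (?Z \<omega>)" for \<omega>
    using abpos by (auto intro!: mult_nonneg_nonneg divide_nonneg_nonneg)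
  fix l :: real assume l: "l > 0"
  have "(\<integral>\<omega>. p (X s \<omega>) * exp (- (l * (exp (\<alpha> * s) * max 0 (V_inf \<omega>) / sqrt (?Z \<omega>)))) \<partial>M)
     = (\<integral>\<omega>. p (X s \<omega>) * exp (- ((l / sqrt (?Z \<omega>)) * exp (\<alpha> * s) * V_inf \<omega>)) \<partial>M)"
  proof (rule integral_cong_AE)
    show "AE \<omega> in M. p (X s \<omega>) * exp (- (l * (exp (\<alpha> * s) * max 0 (V_inf \<omega>) / sqrt (?Z \<omega>)))) = p (X s \<omega>) * exp (- ((l / sqrt (?Z \<omega>)) * exp (\<alpha> * s) * V_inf \<omega>))"
      using V_inf_nonneg by eventually_elim simp
  qed measurable
  also have "\<dots> = (\<integral>\<omega>. p (X s \<omega>) * exp (- (?Z \<omega> * ((l / sqrt (?Z \<omega>)) / (1 + \<kappa> * (l / sqrt (?Z \<omega>)))))) \<partial>M)"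
    by (rule mass_laplace_terminal_signed[OF s, where p=p and b=b and l="\<lambda>\<xi>. l / sqrt (total_mass \<xi>)"]) (use l p in auto)
  also have "\<dots> = (\<integral>\<omega>. p (X s \<omega>) * exp (- (sqrt (?Z \<omega>) * l / (1 + \<kappa> / sqrt (?Z \<omega>) * l))) \<partial>M)"
  proof (intro Bochner_Integration.integral_cong refl)
    fix \<omega>
    \<comment> \<open>True for zero mass as well, where both sides are 0.\<close>
    have "?Z \<omega> * (l / sqrt (?Z \<omega>)) = sqrt (?Z \<omega>) * l"
    proof -
      have "?Z \<omega> * (l / sqrt (?Z \<omega>)) = l * (?Z \<omega> / sqrt (?Z \<omega>))" by simp
      also have "?Z \<omega> / sqrt (?Z \<omega>) = sqrt (?Z \<omega>)" by (rule real_div_sqrt) simp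
      finally show ?thesis by (simp only: mult.commute)
    qed
    then have "?Z \<omega> * ((l / sqrt (?Z \<omega>)) / (1 + \<kappa> * (l / sqrt (?Z \<omega>)))) = sqrt (?Z \<omega>) * l / (1 + \<kappa> / sqrt (?Z \<omega>) * l)"
      by (simp only: times_divide_eq_right times_divide_eq_left)
    then show "p (X s \<omega>) * exp (- (?Z \<omega> * ((l / sqrt (?Z \<omega>)) / (1 + \<kappa> * (l / sqrt (?Z \<omega>)))))) = p (X s \<omega>) * exp (- (sqrt (?Z \<omega>) * l / (1 + \<kappa> / sqrt (?Z \<omega>) * l)))"
      by (simp only:)
  qed
  finally show "(\<integral>\<omega>. p (X s \<omega>) * exp (- (l * (exp (\<alpha> * s) * max 0 (V_inf \<omega>) / sqrt (?Z \<omega>)))) \<partial>M)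
     = (\<integral>\<omega>. p (X s \<omega>) * exp (- (sqrt (?Z \<omega>) * l / (1 + \<kappa> / sqrt (?Z \<omega>) * l))) \<partial>M)" .
qed (use X_measurable[OF s] in measurable)

text \<open>The fluctuation is the square root of the mass minus a multiple of \<open>V_inf\<close>.
  The phase of the first part is a function of \<open>X s\<close>: its cosine and sine are absorbed
  into the real weight. The second part is the half-plane identity at z = i \<theta>.\<close>

lemma char_fluctuation:
  assumes s: "s \<ge> 0" and [measurable]: "p \<in> borel_measurable FM" and p: "\<And>\<xi>. \<xi> \<in> space FM \<Longrightarrow> \<bar>p \<xi>\<bar> \<le> b"
  shows "(\<integral>\<omega>. of_real (p (X s \<omega>)) * iexp (\<theta> * fluctuation s \<omega>) \<partial>M)
    = (\<integral>\<omega>. of_real (p (X s \<omega>)) * fluctuation_char \<kappa> \<theta> (total_mass (X s \<omega>)) \<partial>M)"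
proof -
  note [measurable] = X_measurable[OF s]
  let ?Z = "\<lambda>\<omega>. total_mass (X s \<omega>)"
  let ?z = "\<i> * complex_of_real \<theta>"
  let ?F = "\<lambda>\<omega>. exp (- (?z * of_real (exp (\<alpha> * s) * max 0 (V_inf \<omega>) / sqrt (?Z \<omega>))))"
  let ?G = "\<lambda>\<omega>. exp (- (of_real (sqrt (?Z \<omega>)) * ?z / (1 + of_real (\<kappa> / sqrt (?Z \<omega>)) * ?z)))"
  have Fn: "norm (?F \<omega>) \<le> 1" for \<omega> by (simp add: norm_exp_eq_Re)
  have Gn: "norm (?G \<omega>) \<le> 1" for \<omega>
    by (rule norm_exp_neg_le_1[OF Re_moebius_nonneg(1)]) (use abpos in auto)
  define p1 where "p1 \<xi> = p \<xi> * cos (\<theta> * sqrt (total_mass \<xi>))" for \<xi>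
  define p2 where "p2 \<xi> = p \<xi> * sin (\<theta> * sqrt (total_mass \<xi>))" for \<xi>
  have [measurable]: "p1 \<in> borel_measurable FM" "p2 \<in> borel_measurable FM" unfolding p1_def p2_def by measurable
  have c: "\<bar>x * y\<bar> \<le> b" if "\<bar>x\<bar> \<le> b" "\<bar>y\<bar> \<le> 1" for x y :: real
    using mult_mono[of "\<bar>x\<bar>" b "\<bar>y\<bar>" 1] that by (simp add: abs_mult)
  have p1b: "\<xi> \<in> space FM \<Longrightarrow> \<bar>p1 \<xi>\<bar> \<le> b" and p2b: "\<xi> \<in> space FM \<Longrightarrow> \<bar>p2 \<xi>\<bar> \<le> b" for \<xi>
    unfolding p1_def p2_def using c[OF p] by auto
  have z: "Re ?z \<ge> 0" by simp
  have e1: "(\<integral>\<omega>. of_real (p1 (X s \<omega>)) * ?F \<omega> \<partial>M) = (\<integral>\<omega>. of_real (p1 (X s \<omega>)) * ?G \<omega> \<partial>M)"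
    by (rule char_fluctuation_real[OF s _ p1b z]) auto
  have e2: "(\<integral>\<omega>. of_real (p2 (X s \<omega>)) * ?F \<omega> \<partial>M) = (\<integral>\<omega>. of_real (p2 (X s \<omega>)) * ?G \<omega> \<partial>M)"
    by (rule char_fluctuation_real[OF s _ p2b z]) auto
  have i: "integrable M (\<lambda>\<omega>. of_real (q (X s \<omega>)) * H \<omega>)"
    if [measurable]: "q \<in> borel_measurable FM" "H \<in> borel_measurable M" and "\<And>\<xi>. \<xi> \<in> space FM \<Longrightarrow> \<bar>q \<xi>\<bar> \<le> b" "\<And>\<omega>. norm (H \<omega>) \<le> 1" for q and H :: "'w \<Rightarrow> complex"
  proof (rule integrable_const_bound[where B=b])
    show "AE \<omega> in M. norm (of_real (q (X s \<omega>)) * H \<omega>) \<le> b"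
    proof (intro AE_I2)
      fix \<omega> assume "\<omega> \<in> space M"
      then have "\<bar>q (X s \<omega>)\<bar> \<le> b" by (intro that(3) X_space[OF s])
      then have "\<bar>q (X s \<omega>)\<bar> * norm (H \<omega>) \<le> b * 1" using that(4)[of \<omega>] by (intro mult_mono) auto
      then show "norm (of_real (q (X s \<omega>)) * H \<omega>) \<le> b" by (simp add: norm_mult)
    qed
  qed measurable
  have split: "of_real (p1 \<xi>) * y + \<i> * (of_real (p2 \<xi>) * y) = of_real (p \<xi>) * (iexp (\<theta> * sqrt (total_mass \<xi>)) * y)" for \<xi> y
  proof -
    have "iexp (\<theta> * sqrt (total_mass \<xi>)) = of_real (cos (\<theta> * sqrt (total_mass \<xi>))) + \<i> * of_real (sin (\<theta> * sqrt (total_mass \<xi>)))"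
      by (simp only: exp_Euler cos_of_real sin_of_real)
    then show ?thesis by (simp only: p1_def p2_def of_real_mult ring_distribs mult_ac)
  qed
  have comb: "(\<integral>\<omega>. of_real (p (X s \<omega>)) * (iexp (\<theta> * sqrt (?Z \<omega>)) * H \<omega>) \<partial>M) = (\<integral>\<omega>. of_real (p1 (X s \<omega>)) * H \<omega> \<partial>M) + \<i> * (\<integral>\<omega>. of_real (p2 (X s \<omega>)) * H \<omega> \<partial>M)"
    if "H \<in> borel_measurable M" "\<And>\<omega>. norm (H \<omega>) \<le> 1" for H :: "'w \<Rightarrow> complex"
    using i[of p1 H] i[of p2 H] that p1b p2b unfolding split[symmetric] by simp
  have "(\<integral>\<omega>. of_real (p (X s \<omega>)) * iexp (\<theta> * fluctuation s \<omega>) \<partial>M) = (\<integral>\<omega>. of_real (p (X s \<omega>)) * (iexp (\<theta> * sqrt (?Z \<omega>)) * ?F \<omega>) \<partial>M)"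
  proof (rule integral_cong_AE)
    show "AE \<omega> in M. of_real (p (X s \<omega>)) * iexp (\<theta> * fluctuation s \<omega>) = of_real (p (X s \<omega>)) * (iexp (\<theta> * sqrt (?Z \<omega>)) * ?F \<omega>)"
      using V_inf_nonneg
    proof eventually_elim
      case (elim \<omega>)
      have "fluctuation s \<omega> = sqrt (?Z \<omega>) - exp (\<alpha> * s) * max 0 (V_inf \<omega>) / sqrt (?Z \<omega>)"
        using elim by (simp add: fluctuation_def diff_divide_distrib real_div_sqrt)
      moreover have "iexp (\<theta> * (x - y)) = iexp (\<theta> * x) * exp (- (?z * of_real y))" for x y
        by (simp add: mult_exp_exp algebra_simps)
      ultimately show ?case by (simp only:)
    qed
  qed (use measurable_fluctuation[OF s] in measurable)
  also have "\<dots> = (\<integral>\<omega>. of_real (p1 (X s \<omega>)) * ?F \<omega> \<partial>M) + \<i> * (\<integral>\<omega>. of_real (p2 (X s \<omega>)) * ?F \<omega> \<partial>M)"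
    by (rule comb) (use Fn in auto)
  also have "\<dots> = (\<integral>\<omega>. of_real (p1 (X s \<omega>)) * ?G \<omega> \<partial>M) + \<i> * (\<integral>\<omega>. of_real (p2 (X s \<omega>)) * ?G \<omega> \<partial>M)"
    by (simp only: e1 e2)
  also have "\<dots> = (\<integral>\<omega>. of_real (p (X s \<omega>)) * (iexp (\<theta> * sqrt (?Z \<omega>)) * ?G \<omega>) \<partial>M)"
    by (rule comb[symmetric]) (use Gn in auto)
  finally show ?thesis by (simp add: fluctuation_char_def)
qed

text \<open>The weight \<open>p\<close> times the survival indicator, normalised, is the density of
  a tilted probability measure \<open>dn n\<close>. Under these measures the characteristic
  functions of the fluctuation converge to that of \<open>N0\<close>, and Levy's continuity theorem
  applies. Positivity of \<open>p\<close> keeps the normalising constants and their limit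
  positive.\<close>

lemma fluctuation_product_limit_pos:
  fixes t :: "nat \<Rightarrow> real" and Bf :: "nat \<Rightarrow> (real^'n) measure \<Rightarrow> real" and p :: "real \<times> real \<Rightarrow> real" and q :: "real \<Rightarrow> real"
  assumes t0: "\<And>n. t n \<ge> 0" and t: "filterlim t at_top sequentially"
    and Bf [measurable]: "\<And>n. Bf n \<in> borel_measurable FM" and Bl [measurable]: "Bl \<in> borel_measurable M"
    and Bl_lim: "AE \<omega> in M. (\<lambda>n. Bf n (X (t n) \<omega>)) \<longlonglongrightarrow> Bl \<omega>"
    and p: "continuous_on UNIV p" "\<And>x. 0 < p x" "\<And>x. p x \<le> K" and q: "continuous_on UNIV q" "\<And>x. \<bar>q x\<bar> \<le> Kq"
    and N0: "real_distribution N0" "\<And>\<theta>. char N0 \<theta> = of_real (exp (- \<kappa> * \<theta>\<^sup>2))"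
    and surv: "prob (non_extinction M X) > 0"
  shows "(\<lambda>n. \<integral>\<omega>. indicator (non_extinction M X) \<omega> * (p (exp (- \<alpha> * t n) * total_mass (X (t n) \<omega>), Bf n (X (t n) \<omega>)) * q (fluctuation (t n) \<omega>)) \<partial>M)
     \<longlonglongrightarrow> (\<integral>\<omega>. indicator (non_extinction M X) \<omega> * p (V_inf \<omega>, Bl \<omega>) \<partial>M) * (\<integral>x. q x \<partial>N0)"
proof -
  let ?E = "non_extinction M X"
  have Xm [measurable]: "X (t n) \<in> M \<rightarrow>\<^sub>M FM" for n by (rule X_measurable[OF t0])
  have fm [measurable]: "fluctuation (t n) \<in> borel_measurable M" for n by (rule measurable_fluctuation[OF t0])
  have [measurable]: "p \<in> borel_measurable borel" "q \<in> borel_measurable borel" using p(1) q(1) by (auto intro: borel_measurable_continuous_onI)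
  have [measurable]: "p \<in> borel_measurable (borel \<Otimes>\<^sub>M borel)" by (simp add: borel_prod)
  define \<pi> where "\<pi> n \<xi> = p (exp (- \<alpha> * t n) * total_mass \<xi>, Bf n \<xi>)" for n \<xi>
  have pm [measurable]: "\<pi> n \<in> borel_measurable FM" for n unfolding \<pi>_def by measurable
  have K: "K > 0" using p(2,3)[of undefined] by linarith
  have pb: "0 < \<pi> n \<xi>" "\<pi> n \<xi> \<le> K" for n \<xi> using p by (auto simp: \<pi>_def)
  \<comment> \<open>The indicator of positive mass, unlike that of non-extinction, is a function of
    \<open>X (t n)\<close>, as \<open>char_fluctuation\<close> requires.\<close>
  define pn where "pn n \<xi> = (if total_mass \<xi> > 0 then \<pi> n \<xi> else 0)" for n \<xi>
  have pnm [measurable]: "pn n \<in> borel_measurable FM" for n unfolding pn_def by measurable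
  have pnb: "0 \<le> pn n \<xi>" "pn n \<xi> \<le> K" "\<bar>pn n \<xi>\<bar> \<le> K" for n \<xi> using pb[of n \<xi>] K by (auto simp: pn_def)
  have ind: "(\<lambda>n. \<integral>\<omega>. \<bar>indicat_real {\<omega>\<in>space M. total_mass (X (t n) \<omega>) > 0} \<omega> - indicat_real ?E \<omega>\<bar> \<partial>M) \<longlonglongrightarrow> 0"
    by (rule filterlim_compose[OF survival_indicator_limit t])
  define D where "D n \<omega> = \<bar>indicat_real {\<omega>\<in>space M. total_mass (X (t n) \<omega>) > 0} \<omega> - indicat_real ?E \<omega>\<bar>" for n \<omega>
  have Dm [measurable]: "D n \<in> borel_measurable M" for n unfolding D_def by measurable
  have D0: "0 \<le> D n \<omega>" "D n \<omega> \<le> 1" for n \<omega> by (auto simp: D_def indicator_def)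
  have Di: "integrable M (D n)" for n by (rule integrable_const_bound[where B=1]) (use D0 in auto)
  \<comment> \<open>Exchanging the survival indicator for that of non-extinction costs at most K L
    times their L1 distance. The type of \<open>H\<close> is left general: the statement serves
    complex characteristic functions and the real test function \<open>q\<close>.\<close>
  have swap: "(\<lambda>n. (\<integral>\<omega>. of_real (pn n (X (t n) \<omega>)) * H n \<omega> \<partial>M) - (\<integral>\<omega>. of_real (indicat_real ?E \<omega> * \<pi> n (X (t n) \<omega>)) * H n \<omega> \<partial>M)) \<longlonglongrightarrow> 0"
    if [measurable]: "\<And>n. H n \<in> borel_measurable M" and H: "\<And>n \<omega>. norm (H n \<omega>) \<le> L"
    for H :: "nat \<Rightarrow> 'w \<Rightarrow> 'c :: {real_normed_field, banach, second_countable_topology}" and L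
  proof (rule tendsto_0_le[where K=1])
    have L: "L \<ge> 0" using H[of 0 undefined] norm_ge_zero order_trans by blast
    show "(\<lambda>n. K * L * (\<integral>\<omega>. D n \<omega> \<partial>M)) \<longlonglongrightarrow> 0"
      using tendsto_mult[OF tendsto_const[of "K * L"] ind] by (simp add: D_def)
    have b1: "norm (of_real x * H n \<omega>) \<le> K * L" if "\<bar>x\<bar> \<le> K" for x n \<omega>
      using mult_mono[of "\<bar>x\<bar>" K "norm (H n \<omega>)" L] that H[of n \<omega>] K by (simp add: norm_mult)
    have ib: "\<bar>indicat_real ?E \<omega> * \<pi> n \<xi>\<bar> \<le> K" for n \<xi> \<omega> using pb[of n \<xi>] K by (auto simp: indicator_def)
    show "\<forall>\<^sub>F n in sequentially. norm ((\<integral>\<omega>. of_real (pn n (X (t n) \<omega>)) * H n \<omega> \<partial>M) - (\<integral>\<omega>. of_real (indicat_real ?E \<omega> * \<pi> n (X (t n) \<omega>)) * H n \<omega> \<partial>M)) \<le> norm (K * L * (\<integral>\<omega>. D n \<omega> \<partial>M)) * 1"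
    proof (intro always_eventually allI)
      fix n
      have i1: "integrable M (\<lambda>\<omega>. of_real (pn n (X (t n) \<omega>)) * H n \<omega>)"
        by (rule integrable_const_bound[where B="K * L"]) (use b1[OF pnb(3)] in auto)
      have i2: "integrable M (\<lambda>\<omega>. of_real (indicat_real ?E \<omega> * \<pi> n (X (t n) \<omega>)) * H n \<omega>)"
        by (rule integrable_const_bound[where B="K * L"]) (use b1[OF ib] in auto)
      have "norm ((\<integral>\<omega>. of_real (pn n (X (t n) \<omega>)) * H n \<omega> \<partial>M) - (\<integral>\<omega>. of_real (indicat_real ?E \<omega> * \<pi> n (X (t n) \<omega>)) * H n \<omega> \<partial>M))
        = norm (\<integral>\<omega>. of_real (pn n (X (t n) \<omega>)) * H n \<omega> - of_real (indicat_real ?E \<omega> * \<pi> n (X (t n) \<omega>)) * H n \<omega> \<partial>M)"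
        using i1 i2 by simp
      also have "\<dots> \<le> (\<integral>\<omega>. norm (of_real (pn n (X (t n) \<omega>)) * H n \<omega> - of_real (indicat_real ?E \<omega> * \<pi> n (X (t n) \<omega>)) * H n \<omega>) \<partial>M)"
        by (rule integral_norm_bound)
      also have "\<dots> \<le> (\<integral>\<omega>. (K * L) * D n \<omega> \<partial>M)"
      proof (rule integral_mono)
        show "integrable M (\<lambda>\<omega>. norm (of_real (pn n (X (t n) \<omega>)) * H n \<omega> - of_real (indicat_real ?E \<omega> * \<pi> n (X (t n) \<omega>)) * H n \<omega>))"
          using i1 i2 by (intro integrable_norm Bochner_Integration.integrable_diff)
        show "integrable M (\<lambda>\<omega>. (K * L) * D n \<omega>)" using Di by simp
        fix \<omega> assume w: "\<omega> \<in> space M"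
        let ?S = "indicat_real {\<omega>\<in>space M. total_mass (X (t n) \<omega>) > 0} \<omega>"
        have "pn n (X (t n) \<omega>) = ?S * \<pi> n (X (t n) \<omega>)" using w by (simp add: pn_def indicator_def)
        then have "of_real (pn n (X (t n) \<omega>)) * H n \<omega> - of_real (indicat_real ?E \<omega> * \<pi> n (X (t n) \<omega>)) * H n \<omega> = of_real ((?S - indicat_real ?E \<omega>) * \<pi> n (X (t n) \<omega>)) * H n \<omega>"
          by (simp add: left_diff_distrib)
        then have "norm (of_real (pn n (X (t n) \<omega>)) * H n \<omega> - of_real (indicat_real ?E \<omega> * \<pi> n (X (t n) \<omega>)) * H n \<omega>) = D n \<omega> * (\<pi> n (X (t n) \<omega>) * norm (H n \<omega>))"
          using pb(1)[of n "X (t n) \<omega>"] by (simp add: norm_mult D_def abs_mult del: of_real_mult of_real_diff)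
        also have "\<dots> \<le> D n \<omega> * (K * L)" using pb[of n "X (t n) \<omega>"] H[of n \<omega>] D0 by (intro mult_left_mono mult_mono) auto
        finally show "norm (of_real (pn n (X (t n) \<omega>)) * H n \<omega> - of_real (indicat_real ?E \<omega> * \<pi> n (X (t n) \<omega>)) * H n \<omega>) \<le> (K * L) * D n \<omega>" by (simp add: mult.commute)
      qed
      finally show "norm ((\<integral>\<omega>. of_real (pn n (X (t n) \<omega>)) * H n \<omega> \<partial>M) - (\<integral>\<omega>. of_real (indicat_real ?E \<omega> * \<pi> n (X (t n) \<omega>)) * H n \<omega> \<partial>M)) \<le> norm (K * L * (\<integral>\<omega>. D n \<omega> \<partial>M)) * 1"
        using K L D0 by (simp add: integral_nonneg_AE)
    qed
  qed
  define c where "c = (\<integral>\<omega>. indicat_real ?E \<omega> * p (V_inf \<omega>, Bl \<omega>) \<partial>M)"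
  have ci: "integrable M (\<lambda>\<omega>. indicat_real ?E \<omega> * p (V_inf \<omega>, Bl \<omega>))"
    by (rule integrable_const_bound[where B=K]) (use p K in \<open>auto simp: indicator_def less_imp_le\<close>)
  have \<pi>lim: "AE \<omega> in M. (\<lambda>n. \<pi> n (X (t n) \<omega>)) \<longlonglongrightarrow> p (V_inf \<omega>, Bl \<omega>)"
    using V_inf_limit Bl_lim
  proof eventually_elim
    case (elim \<omega>)
    have "(\<lambda>n. (exp (- \<alpha> * t n) * total_mass (X (t n) \<omega>), Bf n (X (t n) \<omega>))) \<longlonglongrightarrow> (V_inf \<omega>, Bl \<omega>)"
      by (intro tendsto_Pair filterlim_compose[OF elim(1) t] elim(2))
    then show ?case unfolding \<pi>_def by (rule continuous_on_tendsto_compose[OF p(1)]) auto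
  qed
  have Zinf: "AE \<omega> in M. \<omega> \<in> ?E \<longrightarrow> filterlim (\<lambda>n. total_mass (X (t n) \<omega>)) at_top sequentially"
    using V_inf_limit V_inf_positive
  proof eventually_elim
    case (elim \<omega>)
    show ?case
    proof
      assume "\<omega> \<in> ?E"
      then have V: "V_inf \<omega> > 0" using elim by simp
      have "filterlim (\<lambda>n. \<alpha> * t n) at_top sequentially" by (rule filterlim_tendsto_pos_mult_at_top[OF tendsto_const abpos(1) t])
      then have E: "filterlim (\<lambda>n. exp (\<alpha> * t n)) at_top sequentially" by (rule filterlim_compose[OF exp_at_top])
      have "filterlim (\<lambda>n. (exp (- \<alpha> * t n) * total_mass (X (t n) \<omega>)) * exp (\<alpha> * t n)) at_top sequentially"
        by (rule filterlim_tendsto_pos_mult_at_top[OF filterlim_compose[OF elim(1) t] V E])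
      moreover have "(exp (- \<alpha> * t n) * total_mass (X (t n) \<omega>)) * exp (\<alpha> * t n) = total_mass (X (t n) \<omega>)" for n
      proof -
        have "exp (- \<alpha> * t n) * exp (\<alpha> * t n) = 1" by (simp add: mult_exp_exp)
        then show ?thesis by (simp add: mult.assoc mult.left_commute)
      qed
      ultimately show "filterlim (\<lambda>n. total_mass (X (t n) \<omega>)) at_top sequentially" by (simp only:)
    qed
  qed
  have charlim: "(\<lambda>n. \<integral>\<omega>. of_real (pn n (X (t n) \<omega>)) * iexp (\<theta> * fluctuation (t n) \<omega>) \<partial>M) \<longlonglongrightarrow> of_real c * of_real (exp (- \<kappa> * \<theta>\<^sup>2))" for \<theta>
  proof -
    define H where "H n \<omega> = fluctuation_char \<kappa> \<theta> (total_mass (X (t n) \<omega>))" for n \<omega>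
    have Hm [measurable]: "H n \<in> borel_measurable M" for n unfolding H_def fluctuation_char_def by measurable
    have H1: "norm (H n \<omega>) \<le> 1" for n \<omega> unfolding H_def using kappa_pos by (intro norm_fluctuation_char_le_1) auto
    have "(\<lambda>n. \<integral>\<omega>. of_real (indicat_real ?E \<omega> * \<pi> n (X (t n) \<omega>)) * H n \<omega> \<partial>M) \<longlonglongrightarrow> (\<integral>\<omega>. of_real (indicat_real ?E \<omega> * p (V_inf \<omega>, Bl \<omega>)) * of_real (exp (- \<kappa> * \<theta>\<^sup>2)) \<partial>M)"
    proof (rule integral_dominated_convergence[where w="\<lambda>_. K"])
      show "AE \<omega> in M. (\<lambda>n. of_real (indicat_real ?E \<omega> * \<pi> n (X (t n) \<omega>)) * H n \<omega>) \<longlonglongrightarrow> of_real (indicat_real ?E \<omega> * p (V_inf \<omega>, Bl \<omega>)) * of_real (exp (- \<kappa> * \<theta>\<^sup>2))"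
        using \<pi>lim Zinf
      proof eventually_elim
        case (elim \<omega>)
        show ?case
        proof (cases "\<omega> \<in> ?E")
          case True
          then have "(\<lambda>n. H n \<omega>) \<longlonglongrightarrow> of_real (exp (- \<kappa> * \<theta>\<^sup>2))"
            unfolding H_def using elim(2) kappa_pos by (intro filterlim_compose[OF fluctuation_char_limit]) auto
          then show ?thesis by (intro tendsto_mult tendsto_of_real tendsto_const elim(1))
        qed simp
      qed
      show "AE \<omega> in M. norm (of_real (indicat_real ?E \<omega> * \<pi> n (X (t n) \<omega>)) * H n \<omega>) \<le> K" for n
      proof (intro AE_I2)
        fix \<omega>
        have "\<bar>indicat_real ?E \<omega> * \<pi> n (X (t n) \<omega>)\<bar> * norm (H n \<omega>) \<le> K * 1"
          using pb[of n "X (t n) \<omega>"] H1[of n \<omega>] K by (intro mult_mono) (auto simp: indicator_def)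
        then show "norm (of_real (indicat_real ?E \<omega> * \<pi> n (X (t n) \<omega>)) * H n \<omega>) \<le> K" by (simp add: norm_mult del: of_real_mult)
      qed
    qed auto
    also have "(\<integral>\<omega>. of_real (indicat_real ?E \<omega> * p (V_inf \<omega>, Bl \<omega>)) * of_real (exp (- \<kappa> * \<theta>\<^sup>2)) \<partial>M) = complex_of_real c * of_real (exp (- \<kappa> * \<theta>\<^sup>2))"
      unfolding c_def by (simp only: integral_mult_left_zero integral_complex_of_real)
    finally have "(\<lambda>n. \<integral>\<omega>. of_real (indicat_real ?E \<omega> * \<pi> n (X (t n) \<omega>)) * H n \<omega> \<partial>M) \<longlonglongrightarrow> complex_of_real c * of_real (exp (- \<kappa> * \<theta>\<^sup>2))" .
    moreover have "(\<lambda>n. (\<integral>\<omega>. of_real (pn n (X (t n) \<omega>)) * H n \<omega> \<partial>M) - (\<integral>\<omega>. of_real (indicat_real ?E \<omega> * \<pi> n (X (t n) \<omega>)) * H n \<omega> \<partial>M)) \<longlonglongrightarrow> 0"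
      by (rule swap[OF Hm H1])
    note tendsto_add[OF this calculation]
    then
    have "(\<lambda>n. \<integral>\<omega>. of_real (pn n (X (t n) \<omega>)) * H n \<omega> \<partial>M) \<longlonglongrightarrow> complex_of_real c * of_real (exp (- \<kappa> * \<theta>\<^sup>2))" by (simp only: diff_add_cancel add_0_left)
    then show ?thesis unfolding H_def char_fluctuation[OF t0 pnm pnb(3)] .
  qed
  define cn where "cn n = (\<integral>\<omega>. pn n (X (t n) \<omega>) \<partial>M)" for n
  have pni: "integrable M (\<lambda>\<omega>. pn n (X (t n) \<omega>))" for n by (rule integrable_const_bound[where B=K]) (use pnb in auto)
  \<comment> \<open>The normalising constants are the integrals in \<open>charlim\<close> at
    \<theta> = 0.\<close>
  have cnlim: "cn \<longlonglongrightarrow> c"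
  proof -
    have "(\<lambda>n. complex_of_real (cn n)) \<longlonglongrightarrow> of_real c"
      using charlim[of 0] by (simp add: cn_def)
    then show ?thesis by (simp only: tendsto_of_real_iff)
  qed
  \<comment> \<open>A vanishing constant would force zero mass at time t n, hence extinction, almost
    surely, against \<open>surv\<close>.\<close>
  have cnpos: "cn n > 0" for n
  proof -
    have "cn n \<noteq> 0"
    proof
      assume "cn n = 0"
      then have "AE \<omega> in M. pn n (X (t n) \<omega>) = 0"
        unfolding cn_def using pnb pni by (subst (asm) integral_nonneg_eq_0_iff_AE) auto
      then have "AE \<omega> in M. \<omega> \<notin> ?E"
        using mass_zero_absorbing[OF t0[of n]]
      proof eventually_elim
        case (elim \<omega>)
        then have "\<not> total_mass (X (t n) \<omega>) > 0" using pb(1)[of n "X (t n) \<omega>"] by (auto simp: pn_def split: if_splits)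
        then have "total_mass (X (t n) \<omega>) = 0" by (simp add: less_le)
        with elim show ?case by simp
      qed
      then have "prob ?E = 0" by (subst prob_eq_0) auto
      with surv show False by simp
    qed
    moreover have "cn n \<ge> 0" unfolding cn_def using pnb by (intro integral_nonneg_AE) auto
    ultimately show ?thesis by simp
  qed
  have cpos: "c > 0"
  proof -
    have "c \<noteq> 0"
    proof
      assume "c = 0"
      then have "AE \<omega> in M. indicat_real ?E \<omega> * p (V_inf \<omega>, Bl \<omega>) = 0"
        unfolding c_def using ci p(2) by (subst (asm) integral_nonneg_eq_0_iff_AE) (auto simp: less_imp_le)
      then have "AE \<omega> in M. \<omega> \<notin> ?E"
        by eventually_elim (use p(2) in \<open>auto simp: indicator_def less_le split: if_splits\<close>)
      then have "prob ?E = 0" by (subst prob_eq_0) auto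
      with surv show False by simp
    qed
    moreover have "c \<ge> 0" unfolding c_def using p(2) by (intro integral_nonneg_AE) (auto simp: less_imp_le)
    ultimately show ?thesis by simp
  qed
  define dn where "dn n = density M (\<lambda>\<omega>. ennreal (pn n (X (t n) \<omega>) / cn n))" for n
  define mn where "mn n = distr (dn n) borel (fluctuation (t n))" for n
  have dnp: "prob_space (dn n)" for n
  proof
    have "(\<integral>\<^sup>+\<omega>. ennreal (pn n (X (t n) \<omega>) / cn n) \<partial>M) = ennreal (\<integral>\<omega>. pn n (X (t n) \<omega>) / cn n \<partial>M)"
      using pni pnb cnpos[of n] by (intro nn_integral_eq_integral) (auto intro!: AE_I2 divide_nonneg_pos)
    also have "(\<integral>\<omega>. pn n (X (t n) \<omega>) / cn n \<partial>M) = 1" using cnpos[of n] by (simp add: cn_def[symmetric])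
    finally have "(\<integral>\<^sup>+\<omega>. ennreal (pn n (X (t n) \<omega>) / cn n) \<partial>M) = 1" by simp
    then show "emeasure (dn n) (space (dn n)) = 1"
      unfolding dn_def by (subst emeasure_density) (auto intro: nn_integral_cong simp: indicator_def cong: nn_integral_cong)
  qed
  have mnI: "(\<integral>x. f x \<partial>mn n) = (\<integral>\<omega>. of_real (pn n (X (t n) \<omega>)) * f (fluctuation (t n) \<omega>) \<partial>M) / of_real (cn n)"
    if f [measurable]: "f \<in> borel_measurable borel" for f :: "real \<Rightarrow> 'c :: {real_normed_field, banach, second_countable_topology}" and n
  proof -
    have "(\<integral>x. f x \<partial>mn n) = (\<integral>\<omega>. f (fluctuation (t n) \<omega>) \<partial>dn n)"
      unfolding mn_def by (rule integral_distr) (auto simp: dn_def)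
    also have "\<dots> = (\<integral>\<omega>. (pn n (X (t n) \<omega>) / cn n) *\<^sub>R f (fluctuation (t n) \<omega>) \<partial>M)"
      unfolding dn_def using pnb cnpos[of n] by (intro integral_density) (auto intro!: AE_I2 divide_nonneg_pos)
    also have "\<dots> = (\<integral>\<omega>. (of_real (pn n (X (t n) \<omega>)) * f (fluctuation (t n) \<omega>)) / of_real (cn n) \<partial>M)"
      by (simp add: scaleR_conv_of_real)
    finally show ?thesis by simp
  qed
  have mnr: "real_distribution (mn n)" for n
    unfolding mn_def by (rule prob_space.real_distribution_distr[OF dnp]) (simp add: dn_def)
  have "weak_conv_m mn N0"
  proof (rule levy_continuity[OF mnr N0(1)])
    fix \<theta>
    have "char (mn n) \<theta> = (\<integral>\<omega>. of_real (pn n (X (t n) \<omega>)) * iexp (\<theta> * fluctuation (t n) \<omega>) \<partial>M) / of_real (cn n)" for n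
      unfolding char_def by (subst mnI) auto
    moreover have "(\<lambda>n. (\<integral>\<omega>. of_real (pn n (X (t n) \<omega>)) * iexp (\<theta> * fluctuation (t n) \<omega>) \<partial>M) / of_real (cn n)) \<longlonglongrightarrow> of_real c * of_real (exp (- \<kappa> * \<theta>\<^sup>2)) / of_real c"
      using cpos by (intro tendsto_intros charlim cnlim) auto
    ultimately show "(\<lambda>n. char (mn n) \<theta>) \<longlonglongrightarrow> char N0 \<theta>" using cpos by (simp add: N0(2))
  qed
  then have "(\<lambda>n. \<integral>x. q x \<partial>mn n) \<longlonglongrightarrow> (\<integral>x. q x \<partial>N0)"
    using q by (intro weak_conv_imp_integral_bdd_continuous_conv[OF mnr N0(1), where B=Kq]) (auto simp: continuous_on_eq_continuous_at)
  from tendsto_mult[OF this cnlim]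
  have "(\<lambda>n. (\<integral>\<omega>. of_real (pn n (X (t n) \<omega>)) * q (fluctuation (t n) \<omega>) \<partial>M)) \<longlonglongrightarrow> (\<integral>x. q x \<partial>N0) * c"
    using cnpos by (subst (asm) mnI) (auto simp: less_imp_neq[THEN not_sym])
  moreover have "(\<lambda>n. (\<integral>\<omega>. of_real (pn n (X (t n) \<omega>)) * q (fluctuation (t n) \<omega>) \<partial>M) - (\<integral>\<omega>. of_real (indicat_real ?E \<omega> * \<pi> n (X (t n) \<omega>)) * q (fluctuation (t n) \<omega>) \<partial>M)) \<longlonglongrightarrow> 0"
    by (rule swap[of "\<lambda>n \<omega>. q (fluctuation (t n) \<omega>)" Kq]) (use q in auto)
  ultimately have "(\<lambda>n. \<integral>\<omega>. of_real (indicat_real ?E \<omega> * \<pi> n (X (t n) \<omega>)) * q (fluctuation (t n) \<omega>) \<partial>M) \<longlonglongrightarrow> (\<integral>x. q x \<partial>N0) * c - 0"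
    using tendsto_diff by fastforce
  then show ?thesis by (simp add: \<pi>_def c_def mult_ac)
qed

end

section \<open>The centred functional\<close>

lemma power_le_fact_exp: "x ^ n \<le> fact n * exp x" if "x \<ge> 0" for x :: real
proof -
  have "(\<Sum>k\<in>{n}. inverse (fact k) *\<^sub>R x ^ k) \<le> (\<Sum>k. inverse (fact k) *\<^sub>R x ^ k)"
    using that by (intro sum_le_suminf summable_exp_generic) auto
  then have "inverse (fact n) * x ^ n \<le> exp x" by (simp add: exp_def)
  then show ?thesis by (simp add: field_simps)
qed

text \<open>The power series of exp dominates each power of the norm, and continuity handles a ball.
  The rate is written \<open>1 * norm x\<close> to match the weights \<open>exp (a * norm x)\<close>
  of the semigroup estimates.\<close>

lemma poly_growth_exp_bound:
  assumes f: "f \<in> poly_growth_functions"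
  shows "\<exists>C. \<forall>x. \<bar>f x\<bar> \<le> C * exp (1 * norm x)"
proof -
  obtain n where c: "continuous_on UNIV f" and n: "((\<lambda>x. \<bar>f x\<bar> / norm x ^ n) \<longlongrightarrow> 0) at_infinity"
    using f by (auto simp: poly_growth_functions_def)
  have "\<forall>\<^sub>F x in at_infinity. \<bar>f x\<bar> / norm x ^ n < 1" using n by (rule order_tendstoD) simp
  then obtain b where b: "\<And>x. norm x \<ge> b \<Longrightarrow> \<bar>f x\<bar> / norm x ^ n < 1" by (auto simp: eventually_at_infinity)
  have "compact (f ` cball 0 (max b 1))"
    by (intro compact_continuous_image continuous_on_subset[OF c]) auto
  then obtain K where K: "\<And>x. norm x \<le> max b 1 \<Longrightarrow> \<bar>f x\<bar> \<le> K"
    by (force dest!: compact_imp_bounded simp: bounded_iff)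
  have K0: "K \<ge> 0" using order_trans[OF abs_ge_zero K[of 0]] by simp
  have "\<bar>f x\<bar> \<le> (K + fact n) * exp (1 * norm x)" for x
  proof (cases "norm x \<le> max b 1")
    case True
    then have "\<bar>f x\<bar> \<le> K * 1" using K by simp
    also have "\<dots> \<le> (K + fact n) * exp (norm x)" using K0 by (intro mult_mono) auto
    finally show ?thesis by simp
  next
    case False
    then have "norm x > 0" "norm x \<ge> b" by auto
    then have p: "norm x ^ n > 0" and "norm x \<ge> b" by (auto intro: zero_less_power)
    from b[OF this(2)] p have "\<bar>f x\<bar> \<le> norm x ^ n" by (simp add: field_simps)
    also have "\<dots> \<le> fact n * exp (norm x)" by (rule power_le_fact_exp) simp
    also have "\<dots> \<le> (K + fact n) * exp (norm x)" using K0 by (intro mult_right_mono) auto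
    finally show ?thesis by simp
  qed
  then show ?thesis by blast
qed

lemma gradient_ou_density: "gradient (ou_density \<sigma> \<mu>) x = - (2 * (\<mu> / \<sigma>\<^sup>2) * ou_density \<sigma> \<mu> x) *\<^sub>R x" for x :: "real^'n"
proof -
  have "((\<lambda>x::real^'n. ou_density \<sigma> \<mu> x) has_derivative (\<lambda>h. - (2 * (\<mu> / \<sigma>\<^sup>2) * ou_density \<sigma> \<mu> x) * (x \<bullet> h))) (at x)"
    unfolding ou_density_def power2_norm_eq_inner
    by (rule has_derivative_eq_rhs, (rule derivative_intros)+) (auto simp: inner_commute algebra_simps)
  then have "frechet_derivative (ou_density \<sigma> \<mu>) (at x) = (\<lambda>h. - (2 * (\<mu> / \<sigma>\<^sup>2) * ou_density \<sigma> \<mu> x) * (x \<bullet> h))"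
    by (rule frechet_derivative_at[symmetric])
  then show ?thesis by (simp add: gradient_def vec_eq_iff inner_axis)
qed

text \<open>The gradient of the Gaussian density is a multiple of x times the density, so the weak
  mean gradient is a first moment of \<open>f\<close>.\<close>

lemma ou_mean_gradient_eq:
  fixes f :: "real^'n \<Rightarrow> real"
  assumes pos: "\<mu> > 0" "\<sigma> > 0" and [measurable]: "f \<in> borel_measurable borel" and f: "\<And>y. \<bar>f y\<bar> \<le> C * exp (1 * norm y)"
  shows "ou_mean_gradient \<sigma> \<mu> f \<bullet> v = 2 * (\<mu> / \<sigma>\<^sup>2) * (\<integral>y. f y * (y \<bullet> v) \<partial>ou_measure \<sigma> \<mu>)"
proof -
  let ?G = "ou_measure \<sigma> \<mu> :: (real^'n) measure"
  have C: "C \<ge> 0" using f[of 0] by simp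
  have "integrable ?G (\<lambda>y. C * exp (2 * norm y))" by (intro integrable_mult_right integrable_ou_exp_norm pos)
  then have i: "integrable ?G (\<lambda>y. f y *\<^sub>R y)"
  proof (rule Bochner_Integration.integrable_bound)
    have "norm (f y *\<^sub>R y) \<le> norm (C * exp (2 * norm y))" for y :: "real^'n"
    proof -
      have "norm y \<le> exp (norm y)" using exp_ge_add_one_self[of "norm y"] by linarith
      then have "\<bar>f y\<bar> * norm y \<le> (C * exp (1 * norm y)) * exp (norm y)" using C by (intro mult_mono f) auto
      also have "\<dots> = C * exp (2 * norm y)" by (simp add: mult_exp_exp)
      finally show ?thesis using C by (simp add: abs_mult)
    qed
    then show "AE y in ?G. norm (f y *\<^sub>R y) \<le> norm (C * exp (2 * norm y))" by simp
  qed simp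
  have "ou_mean_gradient \<sigma> \<mu> f = - (\<integral>y. (- (2 * (\<mu> / \<sigma>\<^sup>2))) *\<^sub>R (ou_density \<sigma> \<mu> y *\<^sub>R (f y *\<^sub>R y)) \<partial>lborel)"
    unfolding ou_mean_gradient_def gradient_ou_density
    by (intro arg_cong[where f=uminus] Bochner_Integration.integral_cong) (auto simp: algebra_simps)
  also have "\<dots> = (2 * (\<mu> / \<sigma>\<^sup>2)) *\<^sub>R (\<integral>y. f y *\<^sub>R y \<partial>?G)"
  proof -
    have "(\<integral>y. f y *\<^sub>R y \<partial>?G) = (\<integral>y. ou_density \<sigma> \<mu> y *\<^sub>R (f y *\<^sub>R y) \<partial>lborel)"
      unfolding ou_measure_def by (rule integral_density) auto
    then show ?thesis by (simp only: integral_scaleR_right scaleR_minus_left minus_minus integral_minus)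
  qed
  finally have "ou_mean_gradient \<sigma> \<mu> f \<bullet> v = 2 * (\<mu> / \<sigma>\<^sup>2) * ((\<integral>y. f y *\<^sub>R y \<partial>?G) \<bullet> v)" by simp
  also have "(\<integral>y. f y *\<^sub>R y \<partial>?G) \<bullet> v = (\<integral>y. f y * (y \<bullet> v) \<partial>?G)"
    using integral_inner_left[of v ?G "\<lambda>y. f y *\<^sub>R y"] i by simp
  finally show ?thesis .
qed

text \<open>Each coordinate has variance \<sigma>^2 / (2 \<mu>), the inverse of the factor in
  \<open>ou_mean_gradient_eq\<close>. Subtracting the mean and
  \<open>ou_mean_gradient \<sigma> \<mu> f \<bullet> x\<close> is therefore the orthogonal
  projection off the affine functions.\<close>

lemma hermite_remainder:
  fixes f :: "real^'n \<Rightarrow> real"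
  assumes pos: "\<mu> > 0" "\<sigma> > 0" and [measurable]: "f \<in> borel_measurable borel" and f: "\<And>y. \<bar>f y\<bar> \<le> C * exp (1 * norm y)"
  defines "g \<equiv> \<lambda>x. f x - (\<integral>y. f y \<partial>ou_measure \<sigma> \<mu>) - ou_mean_gradient \<sigma> \<mu> f \<bullet> x"
  shows "\<exists>C'. \<forall>y. \<bar>g y\<bar> \<le> C' * exp (1 * norm y)"
    and "(\<integral>y. g y \<partial>ou_measure \<sigma> \<mu>) = 0" and "(\<integral>y. g y * (v \<bullet> y) \<partial>ou_measure \<sigma> \<mu>) = 0"
proof -
  let ?G = "ou_measure \<sigma> \<mu> :: (real^'n) measure"
  interpret G: prob_space ?G using pos by (rule prob_space_ou_measure)
  define m where "m = (\<integral>y. f y \<partial>?G)"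
  define c where "c = ou_mean_gradient \<sigma> \<mu> f"
  have C: "C \<ge> 0" using f[of 0] by simp
  have lin: "\<And>v. linear (\<lambda>y::real^'n. v \<bullet> y)" by (rule bounded_linear.linear[OF bounded_linear_inner_right])
  note il = ou_measure_linear[OF pos lin]
  have le: "norm y \<le> exp (norm y)" for y :: "real^'n" using exp_ge_add_one_self[of "norm y"] by linarith
  have "\<bar>g y\<bar> \<le> (C + \<bar>m\<bar> + norm c) * exp (1 * norm y)" for y
  proof -
    have "\<bar>c \<bullet> y\<bar> \<le> norm c * norm y" by (rule Cauchy_Schwarz_ineq2)
    also have "\<dots> \<le> norm c * exp (norm y)" by (intro mult_left_mono le) auto
    finally have "\<bar>c \<bullet> y\<bar> \<le> norm c * exp (norm y)" .
    moreover have "\<bar>m\<bar> * 1 \<le> \<bar>m\<bar> * exp (norm y)" by (intro mult_left_mono) auto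
    ultimately show ?thesis using f[of y] by (simp add: g_def m_def c_def distrib_right)
  qed
  then show "\<exists>C'. \<forall>y. \<bar>g y\<bar> \<le> C' * exp (1 * norm y)" by blast
  have fi: "integrable ?G f" by (rule ou_exp_bound[OF pos _ f]) simp
  show "(\<integral>y. g y \<partial>?G) = 0"
    using fi il[of c] G.prob_space by (simp add: g_def m_def c_def)
  have fvi: "integrable ?G (\<lambda>y. f y * (v \<bullet> y))"
  proof (rule ou_exp_bound(1)[OF pos])
    fix y :: "real^'n"
    have "\<bar>f y * (v \<bullet> y)\<bar> \<le> (C * exp (1 * norm y)) * (exp (norm v) * exp (norm y))"
      unfolding abs_mult using C by (intro mult_mono f inner_le_exp) auto
    also have "\<dots> = (C * exp (norm v)) * exp (2 * norm y)" by (simp add: mult_exp_exp)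
    finally show "\<bar>f y * (v \<bullet> y)\<bar> \<le> (C * exp (norm v)) * exp (2 * norm y)" .
  qed simp
  have linD: "linear (\<lambda>y::real^'n. (c \<bullet> y) *\<^sub>R v)" by (auto intro!: linearI simp: inner_add_right algebra_simps)
  note q = ou_measure_quadratic[OF pos linD]
  have "(\<Sum>i\<in>UNIV. ((c \<bullet> axis i 1) *\<^sub>R v) $ i) = c \<bullet> v" by (simp add: inner_axis inner_vec_def[of c v])
  then have q2: "(\<integral>y. (c \<bullet> y) * (v \<bullet> y) \<partial>?G) = \<sigma>\<^sup>2 / (2 * \<mu>) * (c \<bullet> v)" and q1: "integrable ?G (\<lambda>y. (c \<bullet> y) * (v \<bullet> y))"
    using q by (simp_all add: inner_commute)
  have "(\<integral>y. g y * (v \<bullet> y) \<partial>?G) = (\<integral>y. f y * (v \<bullet> y) - m * (v \<bullet> y) - (c \<bullet> y) * (v \<bullet> y) \<partial>?G)"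
    by (simp add: g_def m_def c_def algebra_simps)
  also have "\<dots> = (\<integral>y. f y * (v \<bullet> y) \<partial>?G) - \<sigma>\<^sup>2 / (2 * \<mu>) * (c \<bullet> v)"
    using fvi q1 il[of v] q2 by simp
  also have "\<sigma>\<^sup>2 / (2 * \<mu>) * (c \<bullet> v) = (\<integral>y. f y * (v \<bullet> y) \<partial>?G)"
    unfolding c_def ou_mean_gradient_eq[OF pos assms(3) f] using pos by (simp add: inner_commute)
  finally show "(\<integral>y. g y * (v \<bullet> y) \<partial>?G) = 0" by simp
qed

text \<open>If the limit failed, there would be times t n \<ge> n at which F stays outside a
  neighbourhood of L, and no subsequence of these could converge to L.\<close>

lemma tendsto_at_top_subseqI:
  fixes F :: "real \<Rightarrow> 'a::topological_space"
  assumes "\<And>t :: nat \<Rightarrow> real. (\<And>n. t n \<ge> 0) \<Longrightarrow> filterlim t at_top sequentially \<Longrightarrow> \<exists>r. strict_mono r \<and> (\<lambda>n. F (t (r n))) \<longlonglongrightarrow> L"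
  shows "(F \<longlongrightarrow> L) at_top"
proof (rule ccontr)
  assume "\<not> (F \<longlongrightarrow> L) at_top"
  then obtain S where S: "open S" "L \<in> S" "\<not> eventually (\<lambda>x. F x \<in> S) at_top" by (auto simp: tendsto_def)
  have "\<exists>x. x \<ge> real n \<and> F x \<notin> S" for n using S(3) by (auto simp: eventually_at_top_linorder)
  then obtain t where t: "\<And>n. t n \<ge> real n" "\<And>n. F (t n) \<notin> S" by metis
  have "filterlim t at_top sequentially"
    by (rule filterlim_at_top_mono[OF filterlim_real_sequentially]) (use t in auto)
  moreover have "t n \<ge> 0" for n using t(1)[of n] by simp
  ultimately obtain r where "(\<lambda>n. F (t (r n))) \<longlonglongrightarrow> L" using assms by blast
  then have "\<forall>\<^sub>F n in sequentially. F (t (r n)) \<in> S" using S by (auto simp: tendsto_def)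
  then show False using t(2) by simp
qed

text \<open>Along the subsequence the indicators of the deviation events tend to 0 almost surely,
  hence so do their integrals.\<close>

lemma tendsto_in_probability_subseqI:
  fixes Y :: "real \<Rightarrow> 'w \<Rightarrow> 'a::{metric_space, second_countable_topology}"
  assumes "finite_measure M"
    and Y: "\<And>t. t \<ge> 0 \<Longrightarrow> Y t \<in> borel_measurable M" and [measurable]: "Z \<in> borel_measurable M"
    and sub: "\<And>t :: nat \<Rightarrow> real. (\<And>n. t n \<ge> 0) \<Longrightarrow> filterlim t at_top sequentially \<Longrightarrow>
      \<exists>r. strict_mono r \<and> (AE \<omega> in M. (\<lambda>n. Y (t (r n)) \<omega>) \<longlonglongrightarrow> Z \<omega>)"
  shows "tendsto_in_probability M Y Z at_top"
  unfolding tendsto_in_probability_def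
proof (intro allI impI)
  interpret finite_measure M by fact
  fix \<epsilon> :: real assume \<epsilon>: "\<epsilon> > 0"
  show "((\<lambda>t. measure M {\<omega>\<in>space M. dist (Y t \<omega>) (Z \<omega>) > \<epsilon>}) \<longlongrightarrow> 0) at_top"
  proof (rule tendsto_at_top_subseqI)
    fix t :: "nat \<Rightarrow> real" assume t: "\<And>n. t n \<ge> 0" "filterlim t at_top sequentially"
    obtain r where r: "strict_mono r" "AE \<omega> in M. (\<lambda>n. Y (t (r n)) \<omega>) \<longlonglongrightarrow> Z \<omega>" using sub[OF t] by blast
    have [measurable]: "Y (t n) \<in> borel_measurable M" for n by (rule Y[OF t(1)])
    define S where "S n = {\<omega>\<in>space M. dist (Y (t (r n)) \<omega>) (Z \<omega>) > \<epsilon>}" for n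
    have [measurable]: "S n \<in> sets M" for n unfolding S_def by measurable
    have "(\<lambda>n. \<integral>\<omega>. indicat_real (S n) \<omega> \<partial>M) \<longlonglongrightarrow> (\<integral>\<omega>. 0 \<partial>M)"
    proof (rule integral_dominated_convergence[where w="\<lambda>_. 1"])
      show "AE \<omega> in M. (\<lambda>n. indicat_real (S n) \<omega>) \<longlonglongrightarrow> 0"
        using r(2)
      proof eventually_elim
        case (elim \<omega>)
        have "\<forall>\<^sub>F n in sequentially. dist (Y (t (r n)) \<omega>) (Z \<omega>) < \<epsilon>" using elim \<epsilon> by (rule tendstoD)
        then show ?case by (intro tendsto_eventually) (auto elim!: eventually_mono simp: S_def indicator_def)
      qed
    qed (auto simp: indicator_def)
    then have "(\<lambda>n. measure M (S n)) \<longlonglongrightarrow> 0" by simp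
    then show "\<exists>r. strict_mono r \<and> (\<lambda>n. measure M {\<omega>\<in>space M. dist (Y (t (r n)) \<omega>) (Z \<omega>) > \<epsilon>}) \<longlonglongrightarrow> 0"
      using r(1) unfolding S_def by blast
  qed
qed

lemma integral_uniform_measure:
  fixes f :: "'a \<Rightarrow> real"
  assumes "finite_measure M" "E \<in> sets M" and [measurable]: "f \<in> borel_measurable M" and E: "measure M E > 0"
  shows "(\<integral>x. f x \<partial>uniform_measure M E) = (\<integral>x. indicator E x * f x \<partial>M) / measure M E"
proof -
  interpret finite_measure M by fact
  note [measurable] = assms(2)
  have "uniform_measure M E = density M (\<lambda>x. ennreal (indicator E x / measure M E))"
    unfolding uniform_measure_def
  proof (rule density_cong)
    show "AE x in M. indicator E x / emeasure M E = ennreal (indicator E x / measure M E)"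
      using E by (auto simp: emeasure_eq_measure indicator_def divide_ennreal[symmetric] simp del: divide_ennreal)
  qed auto
  then have "(\<integral>x. f x \<partial>uniform_measure M E) = (\<integral>x. (indicator E x / measure M E) *\<^sub>R f x \<partial>M)"
    by (simp add: integral_density)
  then show ?thesis by simp
qed

context ou_branching_process
begin

text \<open>After normalisation the squared mean decays like exp (- 2 \<mu> t) and the branching
  term like t exp (- \<delta> t). Here \<delta> is positive because 2 (\<alpha> - \<mu>) exceeds
  both \<alpha>, which is the condition on \<alpha>, and 2 (\<alpha> - 2 \<mu>). The nonnegative
  integral on the left yields integrability of the square along with its bound.\<close>

lemma remainder_second_moment:
  assumes \<alpha>: "\<alpha> > 2 * \<mu>" and [measurable]: "g \<in> borel_measurable borel" and g: "\<And>y. \<bar>g y\<bar> \<le> C * exp (1 * norm y)"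
    and g0: "(\<integral>y. g y \<partial>ou_measure \<sigma> \<mu>) = 0" and g1: "\<And>x. (\<integral>y. g y * (x \<bullet> y) \<partial>ou_measure \<sigma> \<mu>) = 0"
  shows "\<exists>h. (h \<longlongrightarrow> 0) at_top \<and> (\<forall>t\<ge>0. 0 \<le> h t \<and>
    (\<integral>\<^sup>+\<omega>. ennreal ((exp (- (\<alpha> - \<mu>) * t) * (\<integral>x. g x \<partial>X t \<omega>))\<^sup>2) \<partial>M) \<le> ennreal (h t))"
proof -
  obtain D where D: "\<And>u x. u \<ge> 0 \<Longrightarrow> \<bar>ou_semigroup \<sigma> \<mu> u g x\<bar> \<le> D * exp (- 2 * \<mu> * u) * exp ((1 + 2) * norm x)"
    using ou_semigroup_decay[OF pos _ _ g g0 g1] by auto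
  have "\<exists>K\<ge>0. \<forall>t\<ge>0. (\<integral>\<^sup>+\<xi>. ennreal ((\<integral>x. g x \<partial>\<xi>)\<^sup>2) \<partial>Q t \<nu>) \<le> ennreal (K * moment_growth (2 * \<mu>) t)"
  proof (rule kernel_decay_second_moment[OF _ g])
    show "\<bar>ou_semigroup \<sigma> \<mu> u g x\<bar> \<le> D * exp (- (2 * \<mu>) * u) * exp ((1 + 2) * norm x)" if "u \<ge> 0" for u x
      using D[OF that] by simp
  qed (use pos nu_FM nu_exp_integrable in auto)
  then obtain K where K: "K \<ge> 0" "\<And>t. t \<ge> 0 \<Longrightarrow> (\<integral>\<^sup>+\<xi>. ennreal ((\<integral>x. g x \<partial>\<xi>)\<^sup>2) \<partial>Q t \<nu>) \<le> ennreal (K * moment_growth (2 * \<mu>) t)"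
    by blast
  define \<delta> where "\<delta> = 2 * (\<alpha> - \<mu>) - max \<alpha> (2 * (\<alpha> - 2 * \<mu>))"
  have \<delta>: "\<delta> > 0" using \<alpha> pos by (auto simp: \<delta>_def max_def)
  define h where "h t = K * (exp (- (2 * \<mu>) * t) + 2 * \<beta> * (t * exp (- \<delta> * t)))" for t
  have heq: "exp (- 2 * (\<alpha> - \<mu>) * t) * (K * moment_growth (2 * \<mu>) t) = h t" for t
  proof -
    have "exp (- 2 * (\<alpha> - \<mu>) * t) * exp (2 * (\<alpha> - 2 * \<mu>) * t) = exp (- (2 * \<mu>) * t)"
      by (simp add: mult_exp_exp algebra_simps)
    moreover have "exp (- 2 * (\<alpha> - \<mu>) * t) * exp (max \<alpha> (2 * (\<alpha> - 2 * \<mu>)) * t) = exp (- \<delta> * t)"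
      by (simp add: mult_exp_exp \<delta>_def left_diff_distrib add.commute)
    ultimately show ?thesis by (simp add: h_def moment_growth_def distrib_left mult.left_commute)
  qed
  have "((\<lambda>t. t * exp (- \<delta> * t)) \<longlongrightarrow> 0) at_top"
  proof -
    have "filterlim (\<lambda>t. \<delta> * t) at_top at_top"
      by (rule filterlim_tendsto_pos_mult_at_top[OF tendsto_const \<delta> filterlim_ident])
    from filterlim_compose[OF tendsto_power_div_exp_0[of 1] this]
    have "((\<lambda>t. (\<delta> * t) / exp (\<delta> * t) / \<delta>) \<longlongrightarrow> 0 / \<delta>) at_top" using \<delta> by (intro tendsto_divide tendsto_const) auto
    moreover have "(\<delta> * t) / exp (\<delta> * t) / \<delta> = t * exp (- \<delta> * t)" for t using \<delta> by (simp add: exp_minus divide_inverse)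
    ultimately show ?thesis by simp
  qed
  then have "(h \<longlongrightarrow> K * (0 + 2 * \<beta> * 0)) at_top"
    unfolding h_def using pos by (intro tendsto_intros exp_neg_tendsto_0) auto
  then have "(h \<longlongrightarrow> 0) at_top" by simp
  moreover have "0 \<le> h t \<and> (\<integral>\<^sup>+\<omega>. ennreal ((exp (- (\<alpha> - \<mu>) * t) * (\<integral>x. g x \<partial>X t \<omega>))\<^sup>2) \<partial>M) \<le> ennreal (h t)" if t: "t \<ge> 0" for t
  proof
    show "0 \<le> h t" using K(1) t abpos by (simp add: h_def)
    have e: "(exp (- (\<alpha> - \<mu>) * t) * r)\<^sup>2 = exp (- 2 * (\<alpha> - \<mu>) * t) * r\<^sup>2" for r
      by (simp add: power_mult_distrib exp_double[symmetric] mult.assoc)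
    have "(\<integral>\<^sup>+\<omega>. ennreal ((exp (- (\<alpha> - \<mu>) * t) * (\<integral>x. g x \<partial>X t \<omega>))\<^sup>2) \<partial>M)
        = (\<integral>\<^sup>+\<xi>. ennreal ((exp (- (\<alpha> - \<mu>) * t) * (\<integral>x. g x \<partial>\<xi>))\<^sup>2) \<partial>Q t \<nu>)"
      by (rule nn_integral_one_time[OF t]) simp
    also have "\<dots> = (\<integral>\<^sup>+\<xi>. ennreal (exp (- 2 * (\<alpha> - \<mu>) * t)) * ennreal ((\<integral>x. g x \<partial>\<xi>)\<^sup>2) \<partial>Q t \<nu>)"
      unfolding e by (simp add: ennreal_mult)
    also have "\<dots> = ennreal (exp (- 2 * (\<alpha> - \<mu>) * t)) * (\<integral>\<^sup>+\<xi>. ennreal ((\<integral>x. g x \<partial>\<xi>)\<^sup>2) \<partial>Q t \<nu>)"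
    proof (rule nn_integral_cmult)
      have sQ: "sets (Q t \<nu>) = sets FM" using measurable_space[OF kernel_measurable[OF t] nu_FM] by (simp add: space_prob_algebra)
      show "(\<lambda>\<xi>. ennreal ((\<integral>x. g x \<partial>\<xi>)\<^sup>2)) \<in> borel_measurable (Q t \<nu>)"
        unfolding measurable_cong_sets[OF sQ refl] by measurable
    qed
    also have "\<dots> \<le> ennreal (exp (- 2 * (\<alpha> - \<mu>) * t)) * ennreal (K * moment_growth (2 * \<mu>) t)"
      by (intro mult_left_mono K(2) t) auto
    also have "\<dots> = ennreal (h t)" by (subst ennreal_mult'[symmetric]) (auto simp: heq[symmetric])
    finally show "(\<integral>\<^sup>+\<omega>. ennreal ((exp (- (\<alpha> - \<mu>) * t) * (\<integral>x. g x \<partial>X t \<omega>))\<^sup>2) \<partial>M) \<le> ennreal (h t)" .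
  qed
  ultimately show ?thesis by blast
qed

definition centred_functional :: "(real^'n \<Rightarrow> real) \<Rightarrow> real \<Rightarrow> (real^'n) measure \<Rightarrow> real" where
  "centred_functional f t \<xi> = ((\<integral>x. f x \<partial>\<xi>) - total_mass \<xi> * (\<integral>x. f x \<partial>ou_measure \<sigma> \<mu>)) / exp ((\<alpha> - \<mu>) * t)"

lemma measurable_centred_functional [measurable]:
  assumes [measurable]: "f \<in> borel_measurable borel"
  shows "centred_functional f t \<in> borel_measurable FM"
  unfolding centred_functional_def by measurable

text \<open>Up to the remainder \<open>R\<close> the functional is the inner product of
  \<open>c\<close> with the martingale H. The remainder tends to 0 in L2, hence almost surely along
  a subsequence.\<close>

lemma centred_functional_subseq:
  assumes \<alpha>: "\<alpha> > 2 * \<mu>" and fm [measurable]: "f \<in> borel_measurable borel" and f: "\<And>y. \<bar>f y\<bar> \<le> C * exp (1 * norm y)"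
    and H: "AE \<omega> in M. ((\<lambda>t. exp (- (\<alpha> - \<mu>) * t) *\<^sub>R (\<integral>x. x \<partial>X t \<omega>)) \<longlongrightarrow> H_inf \<omega>) at_top"
    and t0: "\<And>n. t n \<ge> 0" and t: "filterlim t at_top sequentially"
  shows "\<exists>r. strict_mono r \<and>
    (AE \<omega> in M. (\<lambda>n. centred_functional f (t (r n)) (X (t (r n)) \<omega>)) \<longlonglongrightarrow> ou_mean_gradient \<sigma> \<mu> f \<bullet> H_inf \<omega>)"
proof -
  define c where "c = ou_mean_gradient \<sigma> \<mu> f"
  define m where "m = (\<integral>x. f x \<partial>ou_measure \<sigma> \<mu>)"
  define g where "g x = f x - m - c \<bullet> x" for x
  note gp = hermite_remainder[OF pos fm f, folded c_def m_def, folded g_def]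
  have [measurable]: "g \<in> borel_measurable borel" unfolding g_def by measurable
  note Xm [measurable] = X_measurable[OF t0]
  define R where "R n \<omega> = exp (- (\<alpha> - \<mu>) * t n) * (\<integral>x. g x \<partial>X (t n) \<omega>)" for n \<omega>
  have [measurable]: "R n \<in> borel_measurable M" for n unfolding R_def by measurable
  obtain C' where "\<And>y. \<bar>g y\<bar> \<le> C' * exp (1 * norm y)" using gp(1) by blast
  from remainder_second_moment[OF \<alpha> _ this gp(2,3)] obtain h where h: "(h \<longlongrightarrow> 0) at_top"
    "\<And>t. t \<ge> 0 \<Longrightarrow> 0 \<le> h t" "\<And>n. (\<integral>\<^sup>+\<omega>. ennreal ((R n \<omega>)\<^sup>2) \<partial>M) \<le> ennreal (h (t n))"
    unfolding R_def using t0 by auto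
  have Ri: "integrable M (\<lambda>\<omega>. (R n \<omega>)\<^sup>2)" for n
    using h(3)[of n] by (intro integrableI_nonneg) (auto simp: le_less_trans)
  have Rle: "(\<integral>\<omega>. norm ((R n \<omega>)\<^sup>2) \<partial>M) \<le> h (t n)" for n
  proof -
    have "ennreal (\<integral>\<omega>. (R n \<omega>)\<^sup>2 \<partial>M) \<le> ennreal (h (t n))"
      using h(3)[of n] by (subst (asm) nn_integral_eq_integral[OF Ri]) auto
    then show ?thesis using h(2)[OF t0[of n]] by simp
  qed
  have "(\<lambda>n. \<integral>\<omega>. norm ((R n \<omega>)\<^sup>2) \<partial>M) \<longlonglongrightarrow> 0"
    by (rule tendsto_sandwich[OF _ _ tendsto_const filterlim_compose[OF h(1) t]]) (use Rle in auto)
  from tendsto_L1_AE_subseq[OF Ri this] obtain r where r: "strict_mono r" "AE \<omega> in M. (\<lambda>n. (R (r n) \<omega>)\<^sup>2) \<longlonglongrightarrow> 0" by blast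
  \<comment> \<open>An almost sure identity: splitting the integral of \<open>g\<close> requires
    \<open>f\<close> and x to be integrable with respect to \<open>X (t n) \<omega>\<close>, which
    the exponential moment guarantees outside a null set.\<close>
  have eq: "AE \<omega> in M. centred_functional f (t n) (X (t n) \<omega>) = c \<bullet> (exp (- (\<alpha> - \<mu>) * t n) *\<^sub>R (\<integral>x. x \<partial>X (t n) \<omega>)) + R n \<omega>" for n
    using AE_exp_integrable[OF t0[of n], of 1, simplified] AE_space
  proof eventually_elim
    case (elim \<omega>)
    let ?\<xi> = "X (t n) \<omega>"
    have x: "?\<xi> \<in> space FM" by (rule X_space[OF t0 elim(2)])
    interpret finite_measure ?\<xi> by (rule FM_D(1)[OF x])
    have [measurable_cong]: "sets ?\<xi> = sets borel" by (rule FM_D(2)[OF x])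
    have C: "C \<ge> 0" using f[of 0] by simp
    have fi: "integrable ?\<xi> f"
      by (rule Bochner_Integration.integrable_bound[OF integrable_mult_right[OF elim(1), of C]]) (use f C in \<open>auto simp: abs_mult\<close>)
    have xi: "integrable ?\<xi> (\<lambda>x. x)"
    proof (rule Bochner_Integration.integrable_bound[OF elim(1)])
      have "norm y \<le> exp (norm y)" for y :: "real^'n" using exp_ge_add_one_self[of "norm y"] by linarith
      then show "AE y in ?\<xi>. norm y \<le> norm (exp (norm y))" by simp
    qed simp
    have "(\<integral>x. g x \<partial>?\<xi>) = (\<integral>x. f x \<partial>?\<xi>) - total_mass ?\<xi> * m - c \<bullet> (\<integral>x. x \<partial>?\<xi>)"
      unfolding g_def using fi xi by (simp add: integral_inner_right)
    then have "c \<bullet> (exp (- (\<alpha> - \<mu>) * t n) *\<^sub>R (\<integral>x. x \<partial>?\<xi>)) + R n \<omega> = exp (- (\<alpha> - \<mu>) * t n) * ((\<integral>x. f x \<partial>?\<xi>) - total_mass ?\<xi> * m)"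
      unfolding R_def by (simp only:) (simp add: algebra_simps)
    also have "\<dots> = centred_functional f (t n) ?\<xi>"
      unfolding centred_functional_def m_def minus_mult_left[symmetric] exp_minus by (simp add: divide_inverse mult.commute)
    finally show ?case by simp
  qed
  have "AE \<omega> in M. \<forall>n. centred_functional f (t n) (X (t n) \<omega>) = c \<bullet> (exp (- (\<alpha> - \<mu>) * t n) *\<^sub>R (\<integral>x. x \<partial>X (t n) \<omega>)) + R n \<omega>"
    by (intro AE_all_countable[THEN iffD2] allI eq)
  with r(2) H have "AE \<omega> in M. (\<lambda>n. centred_functional f (t (r n)) (X (t (r n)) \<omega>)) \<longlonglongrightarrow> c \<bullet> H_inf \<omega>"
  proof eventually_elim
    case (elim \<omega>)
    have R0: "(\<lambda>n. R (r n) \<omega>) \<longlonglongrightarrow> 0"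
      using tendsto_real_sqrt[OF elim(1)] unfolding real_sqrt_abs real_sqrt_zero by (rule tendsto_rabs_zero_cancel)
    have tr: "filterlim (\<lambda>n. t (r n)) at_top sequentially"
      by (rule filterlim_compose[OF t filterlim_subseq[OF r(1)]])
    have "(\<lambda>n. c \<bullet> (exp (- (\<alpha> - \<mu>) * t (r n)) *\<^sub>R (\<integral>x. x \<partial>X (t (r n)) \<omega>)) + R (r n) \<omega>) \<longlonglongrightarrow> c \<bullet> H_inf \<omega> + 0"
      by (intro tendsto_add tendsto_inner tendsto_const R0 filterlim_compose[OF elim(2) tr])
    then show ?case using elim(3) by simp
  qed
  with r(1) show ?thesis unfolding c_def by blast
qed

end

section \<open>Joint convergence\<close>

text \<open>Composition with \<open>p\<close> and \<open>q\<close> makes both variables real-valued,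
  where independence in the sense of \<open>indep_var\<close> gives the product formula. Preimages
  of Borel sets under p and q reduce the events to those of the hypothesis.\<close>

lemma (in prob_space) indep_rv_expectation_mult:
  fixes p :: "'b \<Rightarrow> real" and q :: "'c \<Rightarrow> real"
  assumes XY: "indep_rv S X T Y" and p [measurable]: "p \<in> borel_measurable S" and q [measurable]: "q \<in> borel_measurable T"
    and pb: "\<And>x. \<bar>p x\<bar> \<le> K" and qb: "\<And>x. \<bar>q x\<bar> \<le> L"
  shows "expectation (\<lambda>\<omega>. p (X \<omega>) * q (Y \<omega>)) = expectation (\<lambda>\<omega>. p (X \<omega>)) * expectation (\<lambda>\<omega>. q (Y \<omega>))"
proof -
  have X [measurable]: "random_variable S X" and Y [measurable]: "random_variable T Y"
    and i: "indep_set {X -` A \<inter> space M | A. A \<in> sets S} {Y -` B \<inter> space M | B. B \<in> sets T}"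
    using XY by (auto simp: indep_rv_def)
  have stable: "Int_stable {f -` A \<inter> space M | A. A \<in> sets borel}" for f :: "'a \<Rightarrow> real"
    unfolding Int_stable_def
  proof clarify
    fix A B :: "real set" assume "A \<in> sets borel" "B \<in> sets borel"
    then show "\<exists>C. (f -` A \<inter> space M) \<inter> (f -` B \<inter> space M) = f -` C \<inter> space M \<and> C \<in> sets borel"
      by (intro exI[of _ "A \<inter> B"]) auto
  qed
  have "indep_set {(\<lambda>\<omega>. p (X \<omega>)) -` A \<inter> space M | A. A \<in> sets borel} {(\<lambda>\<omega>. q (Y \<omega>)) -` B \<inter> space M | B. B \<in> sets borel}"
  proof (rule indep_setI)
    fix a b assume "a \<in> {(\<lambda>\<omega>. p (X \<omega>)) -` A \<inter> space M | A. A \<in> sets borel}" "b \<in> {(\<lambda>\<omega>. q (Y \<omega>)) -` B \<inter> space M | B. B \<in> sets borel}"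
    then obtain A B where A: "A \<in> sets borel" "a = (\<lambda>\<omega>. p (X \<omega>)) -` A \<inter> space M" and B: "B \<in> sets borel" "b = (\<lambda>\<omega>. q (Y \<omega>)) -` B \<inter> space M"
      by blast
    have "a = X -` (p -` A \<inter> space S) \<inter> space M" using measurable_space[OF X] by (auto simp: A)
    moreover have "b = Y -` (q -` B \<inter> space T) \<inter> space M" using measurable_space[OF Y] by (auto simp: B)
    moreover have "p -` A \<inter> space S \<in> sets S" "q -` B \<inter> space T \<in> sets T" using measurable_sets[OF p A(1)] measurable_sets[OF q B(1)] by auto
    ultimately show "prob (a \<inter> b) = prob a * prob b" by (intro indep_setD[OF i]) blast+
  qed auto
  from indep_set_sigma_sets[OF this stable stable]
  have "indep_var borel (\<lambda>\<omega>. p (X \<omega>)) borel (\<lambda>\<omega>. q (Y \<omega>))" by (simp add: indep_var_eq)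
  moreover have "integrable M (\<lambda>\<omega>. p (X \<omega>))" by (rule integrable_const_bound[where B=K]) (auto simp: pb)
  moreover have "integrable M (\<lambda>\<omega>. q (Y \<omega>))" by (rule integrable_const_bound[where B=L]) (auto simp: qb)
  ultimately show ?thesis by (rule indep_var_lebesgue_integral)
qed

lemma (in prob_space) normal_char:
  assumes G: "distributed M lborel G (normal_density 0 s)" and s: "s > 0"
  shows "real_distribution (distr M borel G)" "char (distr M borel G) \<theta> = of_real (exp (- (s\<^sup>2 / 2) * \<theta>\<^sup>2))"
proof -
  have [measurable]: "G \<in> borel_measurable M" using distributed_measurable[OF G] by simp
  show "real_distribution (distr M borel G)" by (rule real_distribution_distr) simp
  have "distributed M lborel (\<lambda>x. 0 + inverse s * G x) (normal_density (0 + inverse s * 0) (\<bar>inverse s\<bar> * s))"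
    by (rule normal_density_affine[OF G s]) (use s in auto)
  then have d: "distributed M lborel (\<lambda>x. inverse s * G x) std_normal_density" using s by simp
  have "distr M borel (\<lambda>x. inverse s * G x) = distr M lborel (\<lambda>x. inverse s * G x)" by (rule distr_cong) auto
  also have "\<dots> = std_normal_distribution" using d by (simp add: distributed_distr_eq_density)
  finally have e: "distr M borel (\<lambda>x. inverse s * G x) = std_normal_distribution" .
  have "char (distr M borel G) \<theta> = (\<integral>\<omega>. iexp (\<theta> * G \<omega>) \<partial>M)" unfolding char_def by (rule integral_distr) auto
  also have "\<dots> = char (distr M borel (\<lambda>x. inverse s * G x)) (s * \<theta>)"
  proof -
    have "s * \<theta> * (inverse s * x) = \<theta> * x" for x using s by simp
    then show ?thesis unfolding char_def by (subst integral_distr) (simp, simp, simp only:)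
  qed
  also have "\<dots> = of_real (exp (- (s\<^sup>2 / 2) * \<theta>\<^sup>2))"
    unfolding e char_std_normal_distribution by (simp add: power_mult_distrib)
  finally show "char (distr M borel G) \<theta> = of_real (exp (- (s\<^sup>2 / 2) * \<theta>\<^sup>2))" .
qed

context ou_branching_limit
begin

text \<open>Both sides are linear in \<open>p\<close>, and a bounded \<open>p\<close> is the
  difference of the positive function p + K and the positive constant K. Dividing by the probability
  of non-extinction turns integrals over that event into conditional ones.\<close>

lemma fluctuation_product_limit:
  fixes t :: "nat \<Rightarrow> real" and Bf :: "nat \<Rightarrow> (real^'n) measure \<Rightarrow> real" and p :: "real \<times> real \<Rightarrow> real" and q :: "real \<Rightarrow> real"
  assumes t0: "\<And>n. t n \<ge> 0" and t: "filterlim t at_top sequentially"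
    and Bf [measurable]: "\<And>n. Bf n \<in> borel_measurable FM" and Bl [measurable]: "Bl \<in> borel_measurable M"
    and Bl_lim: "AE \<omega> in M. (\<lambda>n. Bf n (X (t n) \<omega>)) \<longlonglongrightarrow> Bl \<omega>"
    and p: "continuous_on UNIV p" "bounded (range p)" and q: "continuous_on UNIV q" "bounded (range q)"
    and N0: "real_distribution N0" "\<And>\<theta>. char N0 \<theta> = of_real (exp (- \<kappa> * \<theta>\<^sup>2))"
    and surv: "prob (non_extinction M X) > 0"
  defines "P \<equiv> uniform_measure M (non_extinction M X)"
  shows "(\<lambda>n. \<integral>\<omega>. p (exp (- \<alpha> * t n) * total_mass (X (t n) \<omega>), Bf n (X (t n) \<omega>)) * q (fluctuation (t n) \<omega>) \<partial>P)
     \<longlonglongrightarrow> (\<integral>\<omega>. p (V_inf \<omega>, Bl \<omega>) \<partial>P) * (\<integral>x. q x \<partial>N0)"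
proof -
  let ?E = "non_extinction M X"
  note [measurable] = X_measurable[OF t0] measurable_fluctuation[OF t0]
  note pq = borel_measurable_continuous_onI[OF p(1)] borel_measurable_continuous_onI[OF q(1)]
  note [measurable] = pq
  obtain Kp where Kp: "\<And>x. \<bar>p x\<bar> \<le> Kp" using p(2) by (auto simp: bounded_iff)
  obtain Kq where Kq: "\<And>x. \<bar>q x\<bar> \<le> Kq" using q(2) by (auto simp: bounded_iff)
  have Kp0: "0 \<le> Kp" using order_trans[OF abs_ge_zero Kp] .
  interpret P: prob_space P unfolding P_def
    using surv by (intro prob_space_uniform_measure) (auto simp: emeasure_eq_measure)
  have sP [measurable_cong]: "sets P = sets M" by (simp add: P_def)
  have int: "(\<integral>\<omega>. f \<omega> \<partial>P) = (\<integral>\<omega>. indicator ?E \<omega> * f \<omega> \<partial>M) / prob ?E" if "f \<in> borel_measurable M" for f :: "'w \<Rightarrow> real"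
    unfolding P_def using that surv by (intro integral_uniform_measure) (auto intro: finite_measure_axioms)
  define v where "v n \<omega> = (exp (- \<alpha> * t n) * total_mass (X (t n) \<omega>), Bf n (X (t n) \<omega>))" for n \<omega>
  have [measurable]: "v n \<in> borel_measurable M" for n unfolding v_def by measurable
  have step: "(\<lambda>n. \<integral>\<omega>. p' (v n \<omega>) * q (fluctuation (t n) \<omega>) \<partial>P) \<longlonglongrightarrow> (\<integral>\<omega>. p' (V_inf \<omega>, Bl \<omega>) \<partial>P) * (\<integral>x. q x \<partial>N0)"
    if p': "continuous_on UNIV p'" "\<And>x. 0 < p' x" "\<And>x. p' x \<le> K" for p' K
  proof -
    have [measurable]: "p' \<in> borel_measurable borel" using p'(1) by (rule borel_measurable_continuous_onI)
    have "(\<lambda>n. (\<integral>\<omega>. indicator ?E \<omega> * (p' (v n \<omega>) * q (fluctuation (t n) \<omega>)) \<partial>M) / prob ?E)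
       \<longlonglongrightarrow> (\<integral>\<omega>. indicator ?E \<omega> * p' (V_inf \<omega>, Bl \<omega>) \<partial>M) * (\<integral>x. q x \<partial>N0) / prob ?E"
      unfolding v_def using surv
      by (intro tendsto_divide tendsto_const fluctuation_product_limit_pos[OF t0 t Bf Bl Bl_lim p' q(1) Kq N0 surv]) auto
    then show ?thesis by (simp add: int)
  qed
  define K where "K = Kp + 1"
  have Kpos: "0 < K" and pK: "0 < p x + K" "p x + K \<le> 2 * K" for x using Kp[of x] Kp0 by (auto simp: K_def)
  have 1: "(\<lambda>n. \<integral>\<omega>. (p (v n \<omega>) + K) * q (fluctuation (t n) \<omega>) \<partial>P) \<longlonglongrightarrow> (\<integral>\<omega>. (p (V_inf \<omega>, Bl \<omega>) + K) \<partial>P) * (\<integral>x. q x \<partial>N0)"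
    by (rule step[of "\<lambda>z. p z + K" "2 * K"]) (intro continuous_intros p(1) pK)+
  have 2: "(\<lambda>n. \<integral>\<omega>. K * q (fluctuation (t n) \<omega>) \<partial>P) \<longlonglongrightarrow> (\<integral>\<omega>. K \<partial>P) * (\<integral>x. q x \<partial>N0)"
    by (rule step[of "\<lambda>_. K" K]) (auto simp: Kpos)
  have i1: "integrable P (\<lambda>\<omega>. p (v n \<omega>) * q (fluctuation (t n) \<omega>))" for n
    by (rule P.integrable_const_bound[where B="Kp * Kq"]) (auto simp: abs_mult intro!: mult_mono Kp Kq Kp0)
  have i2: "integrable P (\<lambda>\<omega>. K * q (fluctuation (t n) \<omega>))" for n
    by (intro integrable_mult_right P.integrable_const_bound[where B="Kq"]) (auto intro!: Kq)
  have i3: "integrable P (\<lambda>\<omega>. p (V_inf \<omega>, Bl \<omega>))"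
    by (rule P.integrable_const_bound[where B=Kp]) (auto intro!: Kp)
  have "(\<lambda>n. (\<integral>\<omega>. (p (v n \<omega>) + K) * q (fluctuation (t n) \<omega>) \<partial>P) - (\<integral>\<omega>. K * q (fluctuation (t n) \<omega>) \<partial>P))
     \<longlonglongrightarrow> (\<integral>\<omega>. (p (V_inf \<omega>, Bl \<omega>) + K) \<partial>P) * (\<integral>x. q x \<partial>N0) - (\<integral>\<omega>. K \<partial>P) * (\<integral>x. q x \<partial>N0)"
    by (rule tendsto_diff[OF 1 2])
  moreover have "(\<integral>\<omega>. (p (v n \<omega>) + K) * q (fluctuation (t n) \<omega>) \<partial>P) - (\<integral>\<omega>. K * q (fluctuation (t n) \<omega>) \<partial>P) = (\<integral>\<omega>. p (v n \<omega>) * q (fluctuation (t n) \<omega>) \<partial>P)" for n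
    using i1[of n] i2[of n] by (simp add: distrib_right)
  moreover have "(\<integral>\<omega>. (p (V_inf \<omega>, Bl \<omega>) + K) \<partial>P) * (\<integral>x. q x \<partial>N0) - (\<integral>\<omega>. K \<partial>P) * (\<integral>x. q x \<partial>N0) = (\<integral>\<omega>. p (V_inf \<omega>, Bl \<omega>) \<partial>P) * (\<integral>x. q x \<partial>N0)"
    using i3 P.prob_space by (simp add: distrib_right)
  ultimately show ?thesis unfolding v_def by simp
qed

lemma joint_distribution_limit:
  fixes N :: "'v measure" and V' :: "'v \<Rightarrow> real" and H' :: "'v \<Rightarrow> real^'n" and G :: "'v \<Rightarrow> real"
  assumes \<alpha>: "\<alpha> > 2 * \<mu>" and fm: "f \<in> borel_measurable borel" and f: "\<And>y. \<bar>f y\<bar> \<le> C * exp (1 * norm y)"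
    and H: "AE \<omega> in M. ((\<lambda>t. exp (- (\<alpha> - \<mu>) * t) *\<^sub>R (\<integral>x. x \<partial>X t \<omega>)) \<longlongrightarrow> H_inf \<omega>) at_top"
    and Hm [measurable]: "H_inf \<in> borel_measurable M"
    and N: "prob_space N" and VH [measurable]: "(\<lambda>\<omega>. (V' \<omega>, H' \<omega>)) \<in> borel_measurable N"
    and law: "distr N borel (\<lambda>\<omega>. (V' \<omega>, H' \<omega>)) = distr (uniform_measure M (non_extinction M X)) borel (\<lambda>\<omega>. (V_inf \<omega>, H_inf \<omega>))"
    and G: "distributed N lborel G (normal_density 0 (sqrt (2 * \<beta> / \<alpha>)))"
    and ind: "prob_space.indep_rv N borel (\<lambda>\<omega>. (V' \<omega>, H' \<omega>)) borel G"
  shows "tendsto_in_distribution (uniform_measure M (non_extinction M X))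
      (\<lambda>t \<omega>. (exp (- \<alpha> * t) * total_mass (X t \<omega>), fluctuation t \<omega>, centred_functional f t (X t \<omega>)))
      N (\<lambda>\<omega>. (V' \<omega>, G \<omega>, ou_mean_gradient \<sigma> \<mu> f \<bullet> H' \<omega>)) at_top"
  unfolding tendsto_in_distribution_def
proof (intro allI impI, elim conjE)
  interpret N: prob_space N by fact
  define P where "P = uniform_measure M (non_extinction M X)"
  define c where "c = ou_mean_gradient \<sigma> \<mu> f"
  have sP [measurable_cong]: "sets P = sets M" by (simp add: P_def)
  have [measurable]: "G \<in> borel_measurable N" using distributed_measurable[OF G] by simp
  note VH' = VH[unfolded borel_prod[symmetric]]
  have [measurable]: "V' \<in> borel_measurable N" "H' \<in> borel_measurable N"
    using measurable_compose[OF VH' measurable_fst] measurable_compose[OF VH' measurable_snd] by simp_all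
  \<comment> \<open>If extinction were certain, conditioning would give the zero measure. Equality
    of laws with variables on the probability space \<open>N\<close> excludes this and so supplies
    \<open>surv\<close>.\<close>
  have PP: "prob_space P"
  proof
    have "emeasure N (space N) = emeasure (distr N borel (\<lambda>\<omega>. (V' \<omega>, H' \<omega>))) UNIV"
      by (simp add: emeasure_distr)
    also have "\<dots> = emeasure P (space P)"
      unfolding law P_def[symmetric] by (simp add: emeasure_distr)
    finally show "emeasure P (space P) = 1" by (simp add: N.emeasure_space_1)
  qed
  have surv: "prob (non_extinction M X) > 0"
  proof (rule ccontr)
    assume "\<not> ?thesis"
    then have "prob (non_extinction M X) = 0" by (simp add: less_le)
    then have "emeasure P (space P) = 0"
      unfolding P_def using sets.sets_into_space[OF non_extinction_sets] by (simp add: emeasure_eq_measure Int_absorb2)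
    then show False using prob_space.emeasure_space_1[OF PP] by simp
  qed
  have s: "sqrt (2 * \<beta> / \<alpha>) > 0" using abpos by simp
  \<comment> \<open>Half the variance 2 \<beta> / \<alpha> is the constant \<kappa> of the limiting
    characteristic function.\<close>
  have "(sqrt (2 * \<beta> / \<alpha>))\<^sup>2 / 2 = \<kappa>" using abpos by simp
  note N0 = N.normal_char[OF G s, unfolded this]
  fix g :: "real \<times> real \<times> real \<Rightarrow> real" assume g: "continuous_on UNIV g" "bounded (range g)"
  show "((\<lambda>t. \<integral>\<omega>. g (exp (- \<alpha> * t) * total_mass (X t \<omega>), fluctuation t \<omega>, centred_functional f t (X t \<omega>)) \<partial>uniform_measure M (non_extinction M X))
     \<longlongrightarrow> (\<integral>\<omega>. g (V' \<omega>, G \<omega>, ou_mean_gradient \<sigma> \<mu> f \<bullet> H' \<omega>) \<partial>N)) at_top"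
    unfolding P_def[symmetric] c_def[symmetric]
  proof (rule tendsto_at_top_subseqI)
    fix t :: "nat \<Rightarrow> real" assume t: "\<And>n. t n \<ge> 0" "filterlim t at_top sequentially"
    from centred_functional_subseq[OF \<alpha> fm f H t] obtain r where r: "strict_mono r"
      "AE \<omega> in M. (\<lambda>n. centred_functional f (t (r n)) (X (t (r n)) \<omega>)) \<longlonglongrightarrow> c \<bullet> H_inf \<omega>"
      unfolding c_def by blast
    have tr: "filterlim (\<lambda>n. t (r n)) at_top sequentially"
      by (rule filterlim_compose[OF t(2) filterlim_subseq[OF r(1)]])
    have tr0: "t (r n) \<ge> 0" for n by (rule t(1))
    note [measurable] = X_measurable[OF tr0] measurable_fluctuation[OF tr0] measurable_centred_functional[OF fm]
    have "(\<lambda>n. \<integral>\<omega>. g (exp (- \<alpha> * t (r n)) * total_mass (X (t (r n)) \<omega>), fluctuation (t (r n)) \<omega>, centred_functional f (t (r n)) (X (t (r n)) \<omega>)) \<partial>P)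
      \<longlonglongrightarrow> (\<integral>\<omega>. g (V' \<omega>, G \<omega>, c \<bullet> H' \<omega>) \<partial>N)"
    proof (rule weak_convergence_from_products[OF PP N _ _ _ _ _ _ _ g])
      fix p :: "real \<times> real \<Rightarrow> real" and q :: "real \<Rightarrow> real"
      assume p: "continuous_on UNIV p" "bounded (range p)" and q: "continuous_on UNIV q" "bounded (range q)"
      note [measurable] = borel_measurable_continuous_onI[OF p(1)] borel_measurable_continuous_onI[OF q(1)]
      obtain Kp where Kp: "\<And>x. \<bar>p x\<bar> \<le> Kp" using p(2) by (auto simp: bounded_iff)
      obtain Kq where Kq: "\<And>x. \<bar>q x\<bar> \<le> Kq" using q(2) by (auto simp: bounded_iff)
      define p' where "p' z = p (fst z, c \<bullet> snd z)" for z
      have "continuous_on UNIV (\<lambda>z. (fst z :: real, c \<bullet> snd z))" by (intro continuous_intros)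
      then have "continuous_on UNIV (\<lambda>z. p (fst z :: real, c \<bullet> snd z))" by (rule continuous_on_compose2[OF p(1)]) simp
      from borel_measurable_continuous_onI[OF this]
      have [measurable]: "p' \<in> borel_measurable borel" unfolding p'_def .
      have p'b: "\<bar>p' z\<bar> \<le> Kp" for z unfolding p'_def by (rule Kp)
      have "(\<lambda>n. \<integral>\<omega>. p (exp (- \<alpha> * t (r n)) * total_mass (X (t (r n)) \<omega>), centred_functional f (t (r n)) (X (t (r n)) \<omega>)) * q (fluctuation (t (r n)) \<omega>) \<partial>P)
        \<longlonglongrightarrow> (\<integral>\<omega>. p (V_inf \<omega>, c \<bullet> H_inf \<omega>) \<partial>P) * (\<integral>x. q x \<partial>distr N borel G)"
        unfolding P_def
        by (rule fluctuation_product_limit[where Bf="\<lambda>n. centred_functional f (t (r n))", OF tr0 tr _ _ r(2) p q N0 surv]) auto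
      also have "(\<integral>\<omega>. p (V_inf \<omega>, c \<bullet> H_inf \<omega>) \<partial>P) = (\<integral>z. p' z \<partial>distr P borel (\<lambda>\<omega>. (V_inf \<omega>, H_inf \<omega>)))"
        by (subst integral_distr) (auto simp: p'_def)
      also have "\<dots> = (\<integral>\<omega>. p' (V' \<omega>, H' \<omega>) \<partial>N)"
        unfolding P_def law[symmetric] by (rule integral_distr) auto
      also have "(\<integral>x. q x \<partial>distr N borel G) = (\<integral>\<omega>. q (G \<omega>) \<partial>N)" by (rule integral_distr) auto
      also have "(\<integral>\<omega>. p' (V' \<omega>, H' \<omega>) \<partial>N) * (\<integral>\<omega>. q (G \<omega>) \<partial>N) = (\<integral>\<omega>. p' (V' \<omega>, H' \<omega>) * q (G \<omega>) \<partial>N)"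
        by (rule N.indep_rv_expectation_mult[OF ind, symmetric, where K=Kp and L=Kq]) (auto intro!: p'b Kq)
      finally show "(\<lambda>n. \<integral>\<omega>. p (exp (- \<alpha> * t (r n)) * total_mass (X (t (r n)) \<omega>), centred_functional f (t (r n)) (X (t (r n)) \<omega>)) * q (fluctuation (t (r n)) \<omega>) \<partial>P)
        \<longlonglongrightarrow> (\<integral>\<omega>. p (V' \<omega>, c \<bullet> H' \<omega>) * q (G \<omega>) \<partial>N)" by (simp add: p'_def)
    qed measurable
    with r(1) show "\<exists>r. strict_mono r \<and> (\<lambda>n. \<integral>\<omega>. g (exp (- \<alpha> * t (r n)) * total_mass (X (t (r n)) \<omega>), fluctuation (t (r n)) \<omega>, centred_functional f (t (r n)) (X (t (r n)) \<omega>)) \<partial>P)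
      \<longlonglongrightarrow> (\<integral>\<omega>. g (V' \<omega>, G \<omega>, c \<bullet> H' \<omega>) \<partial>N)" by blast
  qed
qed

text \<open>\<open>P\<close> stands for \<open>M\<close> as well as for the conditional measure; the
  link between them is that null sets of \<open>M\<close> are null for \<open>P\<close>.\<close>

lemma joint_limit_in_probability:
  assumes \<alpha>: "\<alpha> > 2 * \<mu>" and fm: "f \<in> borel_measurable borel" and f: "\<And>y. \<bar>f y\<bar> \<le> C * exp (1 * norm y)"
    and H: "AE \<omega> in M. ((\<lambda>t. exp (- (\<alpha> - \<mu>) * t) *\<^sub>R (\<integral>x. x \<partial>X t \<omega>)) \<longlongrightarrow> H_inf \<omega>) at_top"
    and Hm [measurable]: "H_inf \<in> borel_measurable M"
    and P: "finite_measure P" "sets P = sets M" "\<And>p. AE \<omega> in M. p \<omega> \<Longrightarrow> AE \<omega> in P. p \<omega>"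
  shows "tendsto_in_probability P (\<lambda>t \<omega>. (exp (- \<alpha> * t) * total_mass (X t \<omega>), centred_functional f t (X t \<omega>)))
    (\<lambda>\<omega>. (V_inf \<omega>, ou_mean_gradient \<sigma> \<mu> f \<bullet> H_inf \<omega>)) at_top"
proof (rule tendsto_in_probability_subseqI[OF P(1)])
  note [measurable] = measurable_centred_functional[OF fm]
  note [measurable_cong] = P(2)
  show "(\<lambda>\<omega>. (exp (- \<alpha> * t) * total_mass (X t \<omega>), centred_functional f t (X t \<omega>))) \<in> borel_measurable P" if "t \<ge> 0" for t
  proof -
    note [measurable] = X_measurable[OF that]
    show ?thesis by measurable
  qed
  show "(\<lambda>\<omega>. (V_inf \<omega>, ou_mean_gradient \<sigma> \<mu> f \<bullet> H_inf \<omega>)) \<in> borel_measurable P" by measurable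
  fix t :: "nat \<Rightarrow> real" assume t: "\<And>n. t n \<ge> 0" "filterlim t at_top sequentially"
  from centred_functional_subseq[OF \<alpha> fm f H t] obtain r where r: "strict_mono r"
    "AE \<omega> in M. (\<lambda>n. centred_functional f (t (r n)) (X (t (r n)) \<omega>)) \<longlonglongrightarrow> ou_mean_gradient \<sigma> \<mu> f \<bullet> H_inf \<omega>"
    by blast
  have tr: "filterlim (\<lambda>n. t (r n)) at_top sequentially"
    by (rule filterlim_compose[OF t(2) filterlim_subseq[OF r(1)]])
  have "AE \<omega> in M. (\<lambda>n. (exp (- \<alpha> * t (r n)) * total_mass (X (t (r n)) \<omega>), centred_functional f (t (r n)) (X (t (r n)) \<omega>)))
      \<longlonglongrightarrow> (V_inf \<omega>, ou_mean_gradient \<sigma> \<mu> f \<bullet> H_inf \<omega>)"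
    using r(2) V_inf_limit
  proof eventually_elim
    case (elim \<omega>)
    show ?case by (intro tendsto_Pair elim(1) filterlim_compose[OF elim(2) tr])
  qed
  with r(1) P(3) show "\<exists>r. strict_mono r \<and> (AE \<omega> in P. (\<lambda>n. (exp (- \<alpha> * t (r n)) * total_mass (X (t (r n)) \<omega>), centred_functional f (t (r n)) (X (t (r n)) \<omega>)))
      \<longlonglongrightarrow> (V_inf \<omega>, ou_mean_gradient \<sigma> \<mu> f \<bullet> H_inf \<omega>))" by blast
qed

end

text \<open>Convergence in distribution concerns only the law of the limit, so it is stated for
  every realisation of the limit variables on some probability space \<open>N\<close>. The
  convergence in probability is given under the original and under the conditional measure.\<close>

theorem theorem6:
  fixes \<sigma> \<mu> \<alpha> \<beta> :: real
    and \<nu> :: "(real^'n) measure"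
    and M :: "'w measure"
    and X :: "real \<Rightarrow> 'w \<Rightarrow> (real^'n) measure"
    and V_inf :: "'w \<Rightarrow> real"
    and H_inf :: "'w \<Rightarrow> real^'n"
    and f :: "real^'n \<Rightarrow> real"
  assumes "\<sigma> > 0" "\<mu> > 0" "\<alpha> > 0" "\<beta> > 0"
    and "\<alpha> > 2 * \<mu>"
    and "\<nu> \<in> compactly_supported_measures"
    and "ou_superprocess \<sigma> \<mu> \<alpha> \<beta> \<nu> M X"
    and "V_inf \<in> borel_measurable M"
    and "AE \<omega> in M. ((\<lambda>t. exp (- \<alpha> * t) * total_mass (X t \<omega>)) \<longlongrightarrow> V_inf \<omega>) at_top"
    and "H_inf \<in> borel_measurable M"
    and "AE \<omega> in M. ((\<lambda>t. exp (- (\<alpha> - \<mu>) * t) *\<^sub>R (\<integral>x. x \<partial>X t \<omega>)) \<longlongrightarrow> H_inf \<omega>) at_top"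
    and "f \<in> poly_growth_functions"
  defines "M_cond \<equiv> uniform_measure M (non_extinction M X)"
    and "V \<equiv> \<lambda>t \<omega>. exp (- \<alpha> * t) * total_mass (X t \<omega>)"
    and "A \<equiv> \<lambda>t \<omega>. (total_mass (X t \<omega>) - exp (\<alpha> * t) * V_inf \<omega>) / sqrt (total_mass (X t \<omega>))"
    and "B \<equiv> \<lambda>t \<omega>. ((\<integral>x. f x \<partial>X t \<omega>) - total_mass (X t \<omega>) * (\<integral>x. f x \<partial>ou_measure \<sigma> \<mu>))
                     / exp ((\<alpha> - \<mu>) * t)"
  shows "(\<forall>(N :: 'v measure) V' H' G.
            prob_space N \<and>
            (\<lambda>\<omega>. (V' \<omega>, H' \<omega>)) \<in> borel_measurable N \<and>
            distr N borel (\<lambda>\<omega>. (V' \<omega>, H' \<omega>)) = distr M_cond borel (\<lambda>\<omega>. (V_inf \<omega>, H_inf \<omega>)) \<and>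
            distributed N lborel G (normal_density 0 (sqrt (2 * \<beta> / \<alpha>))) \<and>
            prob_space.indep_rv N borel (\<lambda>\<omega>. (V' \<omega>, H' \<omega>)) borel G
            \<longrightarrow> tendsto_in_distribution M_cond (\<lambda>t \<omega>. (V t \<omega>, A t \<omega>, B t \<omega>))
                  N (\<lambda>\<omega>. (V' \<omega>, G \<omega>, ou_mean_gradient \<sigma> \<mu> f \<bullet> H' \<omega>)) at_top)
       \<and> tendsto_in_probability M (\<lambda>t \<omega>. (V t \<omega>, B t \<omega>))
            (\<lambda>\<omega>. (V_inf \<omega>, ou_mean_gradient \<sigma> \<mu> f \<bullet> H_inf \<omega>)) at_top
       \<and> tendsto_in_probability M_cond (\<lambda>t \<omega>. (V t \<omega>, B t \<omega>))
            (\<lambda>\<omega>. (V_inf \<omega>, ou_mean_gradient \<sigma> \<mu> f \<bullet> H_inf \<omega>)) at_top"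
proof -
  obtain Q where Q: "ou_superprocess_kernel \<sigma> \<mu> \<alpha> \<beta> Q" "markov_process M (finite_measure_algebra borel) Q X"
    and M: "prob_space M" and start: "AE \<omega> in M. X 0 \<omega> = \<nu>"
    and rc: "\<And>\<omega> g t. \<omega> \<in> space M \<Longrightarrow> continuous_on UNIV g \<Longrightarrow> bounded (range g) \<Longrightarrow> t \<ge> 0 \<Longrightarrow>
      ((\<lambda>s. \<integral>x. (g::real^'n \<Rightarrow> real) x \<partial>X s \<omega>) \<longlongrightarrow> (\<integral>x. g x \<partial>X t \<omega>)) (at_right t)"
    using assms(7) unfolding ou_superprocess_def by blast
  have rc1: "((\<lambda>s. total_mass (X s \<omega>)) \<longlongrightarrow> total_mass (X t \<omega>)) (at_right t)" if "\<omega> \<in> space M" "t \<ge> 0" for \<omega> t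
    using rc[OF that(1), of "\<lambda>_. 1" t] that(2) by simp
  interpret ou_branching_limit \<sigma> \<mu> \<alpha> \<beta> Q M X \<nu> V_inf
    by (intro ou_branching_limit.intro ou_branching_process.intro ou_branching.intro
        ou_branching_process_axioms.intro ou_branching_limit_axioms.intro M Q start assms rc1)
  obtain C where C: "\<And>y. \<bar>f y\<bar> \<le> C * exp (1 * norm y)" using poly_growth_exp_bound[OF assms(12)] by blast
  have fm: "f \<in> borel_measurable borel"
    using assms(12) by (auto simp: poly_growth_functions_def intro: borel_measurable_continuous_onI)
  have A: "A = fluctuation" by (intro ext) (simp add: A_def fluctuation_def)
  have B: "B = (\<lambda>t \<omega>. centred_functional f t (X t \<omega>))" by (intro ext) (simp add: B_def centred_functional_def)
  have P: "finite_measure M_cond" "sets M_cond = sets M" "\<And>p. AE \<omega> in M. p \<omega> \<Longrightarrow> AE \<omega> in M_cond. p \<omega>"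
  proof -
    show "sets M_cond = sets M" by (simp add: M_cond_def)
    show "AE \<omega> in M_cond. p \<omega>" if "AE \<omega> in M. p \<omega>" for p
      unfolding M_cond_def using that by (intro AE_uniform_measureI) auto
    \<comment> \<open>If non-extinction is a null event, the quotient is 0 by convention and the
      conditional measure is zero, which is still finite; no case distinction arises.\<close>
    have "emeasure M_cond (space M_cond) = emeasure M (non_extinction M X) / emeasure M (non_extinction M X)"
      unfolding M_cond_def using sets.sets_into_space[OF non_extinction_sets] by (simp add: Int_absorb2)
    then show "finite_measure M_cond"
      by (intro finite_measureI) (auto simp: emeasure_eq_measure divide_ennreal_def ennreal_mult_eq_top_iff ennreal_inverse_eq_top_iff)
  qed
  note prob = joint_limit_in_probability[OF assms(5) fm C assms(11,10)]
  show ?thesis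
    unfolding V_def A B
    using joint_distribution_limit[OF assms(5) fm C assms(11,10), folded M_cond_def]
      prob[OF finite_measure_axioms refl] prob[OF P]
    by blast
qed

end
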